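(* Let $n\geqslant 3$, $\alpha\in(0,2]$, let $D\subset\mathbb R^n$ be a domain, let $A_1\subset D$ be relatively closed in $D$ with $c_\alpha(A_1)>0$, and let $A_2:=D^c=\mathbb R^n\setminus D$, where $c_\alpha(A_2)>0$ and $A_2$ is not $\alpha$-thin at infinity; write $\mathbf A=(A_1,A_2)$. For an external field $f$ (of the type of Case I or Case II described in the context) and a constraint $\xi\in\mathfrak C(A_1;\mathbb R^n)$, consider the constrained $f$-weighted minimum $\alpha$-Riesz energy problem: does there exist $\lambda_{\mathbf A}^\xi\in\mathcal E_{\alpha,f}^\xi(\mathbf A,\mathbf 1;\mathbb R^n)$ with $$G_{\alpha,f}(\lambda_{\mathbf A}^\xi)=G_{\alpha,f}^{\xi}(\mathbf A,\mathbf 1;\mathbb R^n):=\inf_{\mu\in\mathcal E_{\alpha,f}^\xi(\mathbf A,\mathbf 1;\mathbb R^n)}G_{\alpha,f}(\mu)\,?$$ The condition $\xi(A_1)<\infty$ is actually necessary (and sufficient) for the solvability of this problem. More precisely, suppose that $c_\alpha(A_1)=\infty$ and that Case II holds with $\zeta\geqslant0$, i.e. $f=U_\alpha^{\zeta-\zeta'}$, where $\zeta\geqslant0$ is an extendible Radon measure on $D$ with $E_\alpha(\zeta)<\infty$ and $\zeta'$ is its $\alpha$-Riesz balayage onto $D^c$. Then there exists a constraint $\xi\in\mathfrak C(A_1;\mathbb R^n)$ with $\xi(A_1)=\infty$ such that $$G_{\alpha,f}^{\xi}(\mathbf A,\mathbf 1;\mathbb R^n)=0,$$ and hence $G_{\alpha,f}^{\xi}(\mathbf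 A,\mathbf 1;\mathbb R^n)$ cannot be an actual minimum (the infimum is not attained).
   Context: Measures. For a locally compact space $X$ ($X=\mathbb R^n$ or $X=D$), $\mathfrak M(X)$ is the space of signed Radon measures on $X$, $\mathfrak M^+(X)$ the cone of positive ones; $\mu=\mu^+-\mu^-$ is the Hahn--Jordan decomposition, $|\mu|=\mu^++\mu^-$. A positive Radon measure $\mu$ is carried by $Q\subset X$ if $X\setminus Q$ is $\mu$-negligible. Positive Radon measures $\mu$ on $\mathbb R^n$ are tacitly assumed to have potential $U_\alpha^\mu$ not identically infinite. Riesz kernel. $\kappa_\alpha(x,y)=|x-y|^{\alpha-n}$ on $\mathbb R^n$; $U_\alpha^\mu(x)=\int|x-y|^{\alpha-n}\,d\mu(y)$, $E_\alpha(\mu,\nu)=\iint|x-y|^{\alpha-n}\,d\mu(x)\,d\nu(y)$, $E_\alpha(\mu)=E_\alpha(\mu,\mu)=\|\mu\|_\alpha^2$. $\mathcal E_\alpha(\mathbb R^n)$ is the set of signed Radon measures $\mu$ with $E_\alpha(|\mu|)<\infty$; for a signed measure $\zeta$, $E_\alpha(\zeta)<\infty$ means $E_\alpha(|\zeta|)<\infty$. $\mathcal E_\alpha^+(Q;\mathbb R^n)$ is the set of positive measures in $\mathcal E_\alpha(\mathbb R^n)$ carried by $Q$. Inner capacity: $c_\alpha(Q)=[\inf E_\alpha(\mu)]^{-1}$, the infimum over $\mu\in\mathcal E_\alpha^+(Q;\mathbb R^n)$ with $\mu(Q)=1$ ($\inf\varnothing=+\infty$, $1/(+\infty)=0$, $1/0=+\infty$).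 "n.e. on $Q$" means: for all $x\in Q$ outside a set $N$ with $c_\alpha(N)=0$. A measure $\mu$ is $c_\alpha$-absolutely continuous if $\mu(K)=0$ for every compact $K$ with $c_\alpha(K)=0$. Thinness at infinity. For closed $F\subset\mathbb R^n$, a point $x_0\in F$ is $\alpha$-irregular for $F$ if $\sum_{k\geqslant1}c_\alpha(F_k)\,q^{-k(n-\alpha)}<\infty$, where $q\in(0,1)$ is fixed and $F_k=\{x\in F:\ q^{k+1}<|x-x_0|\leqslant q^k\}$ (Wiener criterion). $F$ is $\alpha$-thin at infinity if either $F$ is compact, or $0$ is an $\alpha$-irregular point of the inverse $\{0\}\cup\{x/|x|^2:\ x\in F\setminus\{0\}\}$ of $F$ with respect to the unit sphere. Extendible measures and balayage. $\nu\in\mathfrak M(D)$ is extendible if $\nu^\pm$ extend by $0$ off $D$ to positive Radon measures on $\mathbb R^n$ satisfying $\int_{|y|>1}|y|^{\alpha-n}\,d\nu^\pm(y)<\infty$; $\nu$ is identified with its extension. Its ($\alpha$-Riesz) balayage $\nu'=\nu^{D^c}$ onto $D^c$ is the unique $c_\alpha$-absolutely continuous signed measure on $\mathbb R^n$ supported by $D^c$ with $U_\alpha^{\nu'}=U_\alpha^{\nu}$ n.e. on $D^c$. External fields. One of the following holds. Case I: $f:\mathbb R^n\to[0,\infty]$ is lower semicontinuous and $f=0$ n.e. on $A_2$. Case II: $f=U_\alpha^{\zeta-\zeta'}$, where $\zeta$ is a signed extendible Radon measure on $D$ with $E_\alpha(\zeta)<\infty$. Constraint and admissible measures. $\mathfrak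 C(A_1;\mathbb R^n)$ is the set of $\xi\in\mathcal E_\alpha^+(A_1;\mathbb R^n)$ with $\xi(A_1)>1$ (possibly $\xi(A_1)=\infty$). $\mathcal E_\alpha(\mathbf A,\mathbf 1;\mathbb R^n)$ is the set of $\mu\in\mathcal E_\alpha(\mathbb R^n)$ such that $\mu^+$ is carried by $A_1$, $\mu^-$ is carried by $A_2$, and $\mu^+(A_1)=\mu^-(A_2)=1$. $\mathcal E_{\alpha,f}^\xi(\mathbf A,\mathbf 1;\mathbb R^n)$ is the set of $\mu\in\mathcal E_\alpha(\mathbf A,\mathbf 1;\mathbb R^n)$ with $\mu^+\leqslant\xi$ for which $f$ is $|\mu|$-integrable. The weighted energy is $G_{\alpha,f}(\mu)=\|\mu\|_\alpha^2+2\int f\,d\mu$. The minimum problem is considered when $\mathcal E_{\alpha,f}^\xi(\mathbf A,\mathbf 1;\mathbb R^n)\ne\varnothing$, i.e. when $G_{\alpha,f}^{\xi}(\mathbf A,\mathbf 1;\mathbb R^n)<\infty$ (this is automatic in Case II). *)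

theory Defs
  imports "HOL-Analysis.Analysis"
begin

text \<open>The space \<open>R^n\<close> is an arbitrary type of class \<open>euclidean_space\<close> with \<open>n = DIM('a)\<close>.\<close>

subsection \<open>Riesz kernel, potentials and energies of positive measures\<close>

text \<open>The diagonal is treated separately because \<open>0 powr a = 0\<close>.\<close>

definition riesz_kernel :: "real \<Rightarrow> 'a::euclidean_space \<Rightarrow> 'a \<Rightarrow> ennreal" where
  "riesz_kernel \<alpha> x y =
     (if x = y then \<infinity> else ennreal (norm (x - y) powr (\<alpha> - real DIM('a))))"

definition potential :: "real \<Rightarrow> 'a::euclidean_space measure \<Rightarrow> 'a \<Rightarrow> ennreal" where
  "potential \<alpha> \<mu> x = (\<integral>\<^sup>+ y. riesz_kernel \<alpha> x y \<partial>\<mu>)"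

definition mutual_energy ::
  "real \<Rightarrow> 'a::euclidean_space measure \<Rightarrow> 'a measure \<Rightarrow> ennreal" where
  "mutual_energy \<alpha> \<mu> \<nu> = (\<integral>\<^sup>+ x. (\<integral>\<^sup>+ y. riesz_kernel \<alpha> x y \<partial>\<nu>) \<partial>\<mu>)"

text \<open>Positive Radon measures on \<open>R^n\<close> are the Borel measures that are finite on compact sets
  (regularity is automatic). The last conjunct is the standing convention that the potential
  is not identically infinite.\<close>

definition radon_measure :: "real \<Rightarrow> 'a::euclidean_space measure \<Rightarrow> bool" where
  "radon_measure \<alpha> \<mu> \<longleftrightarrow>
     sets \<mu> = sets borel \<and>
     (\<forall>K. compact K \<longrightarrow> emeasure \<mu> K < \<infinity>) \<and>
     (\<exists>x. potential \<alpha> \<mu> x < \<infinity>)"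

text \<open>\<open>Q\<close> need not be Borel: \<open>AE\<close> says that the complement of \<open>Q\<close> is contained in a null set.\<close>

definition carried_by :: "'a measure \<Rightarrow> 'a set \<Rightarrow> bool" where
  "carried_by \<mu> Q \<longleftrightarrow> (AE x in \<mu>. x \<in> Q)"

definition finite_energy_pos :: "real \<Rightarrow> 'a::euclidean_space set \<Rightarrow> 'a measure set" where
  "finite_energy_pos \<alpha> Q =
     {\<mu>. radon_measure \<alpha> \<mu> \<and> mutual_energy \<alpha> \<mu> \<mu> < \<infinity> \<and> carried_by \<mu> Q}"

text \<open>In \<open>ennreal\<close> we have \<open>Inf {} = \<infinity>\<close>, \<open>inverse \<infinity> = 0\<close> and \<open>inverse 0 = \<infinity>\<close>. The completion
  gives \<open>\<mu>(Q)\<close> its meaning for a non-Borel set \<open>Q\<close> carrying \<open>\<mu>\<close>.\<close>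

definition inner_cap :: "real \<Rightarrow> 'a::euclidean_space set \<Rightarrow> ennreal" where
  "inner_cap \<alpha> Q =
     inverse (INF \<mu> \<in> {\<mu> \<in> finite_energy_pos \<alpha> Q. emeasure (completion \<mu>) Q = 1}.
                mutual_energy \<alpha> \<mu> \<mu>)"

definition nearly_everywhere_on ::
  "real \<Rightarrow> 'a::euclidean_space set \<Rightarrow> ('a \<Rightarrow> bool) \<Rightarrow> bool" where
  "nearly_everywhere_on \<alpha> Q P \<longleftrightarrow> (\<exists>N. inner_cap \<alpha> N = 0 \<and> (\<forall>x \<in> Q - N. P x))"

subsection \<open>Thinness at infinity\<close>

text \<open>The index \<open>k \<ge> 1\<close> of the Wiener series is written \<open>Suc k\<close>.\<close>

definition irregular_point :: "real \<Rightarrow> real \<Rightarrow> 'a::euclidean_space set \<Rightarrow> 'a \<Rightarrow> bool" where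
  "irregular_point \<alpha> q F x0 \<longleftrightarrow>
     (\<Sum>k. inner_cap \<alpha> {x \<in> F. q ^ (Suc k + 1) < norm (x - x0) \<and> norm (x - x0) \<le> q ^ Suc k} *
           ennreal (q powr (- real (Suc k) * (real DIM('a) - \<alpha>)))) < \<infinity>"

definition inverse_set :: "'a::euclidean_space set \<Rightarrow> 'a set" where
  "inverse_set F = insert 0 ((\<lambda>x. x /\<^sub>R (norm x)\<^sup>2) ` (F - {0}))"

definition thin_at_infinity :: "real \<Rightarrow> real \<Rightarrow> 'a::euclidean_space set \<Rightarrow> bool" where
  "thin_at_infinity \<alpha> q F \<longleftrightarrow> compact F \<or> irregular_point \<alpha> q (inverse_set F) 0"

subsection \<open>Signed measures\<close>

text \<open>A signed Radon measure may have infinite positive and negative mass. It is represented by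
  a pair \<open>(\<mu>\<^sup>+, \<mu>\<^sup>-)\<close> of positive measures. The predicate \<open>signed_radon\<close> requires the
  two parts to be mutually singular, i.e. the pair is the Hahn--Jordan decomposition, so
  that each signed Radon measure has exactly one such representation.\<close>

type_synonym 'a signed = "'a measure \<times> 'a measure"

definition add_measure :: "'a measure \<Rightarrow> 'a measure \<Rightarrow> 'a measure" where
  "add_measure \<mu> \<nu> = measure_of (space \<mu>) (sets \<mu>) (\<lambda>B. emeasure \<mu> B + emeasure \<nu> B)"

lemma sets_add_measure [simp]: "sets (add_measure \<mu> \<nu>) = sets \<mu>"
  by (simp add: add_measure_def)

lemma emeasure_add_measure:
  assumes "sets \<nu> = sets \<mu>" "B \<in> sets \<mu>"
  shows "emeasure (add_measure \<mu> \<nu>) B = emeasure \<mu> B + emeasure \<nu> B"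
proof (rule emeasure_measure_of[OF add_measure_def])
  show "countably_additive (sets (add_measure \<mu> \<nu>)) (\<lambda>B. emeasure \<mu> B + emeasure \<nu> B)"
    using assms(1)
    by (auto simp: countably_additive_def suminf_add[symmetric] suminf_emeasure)
qed (use assms in \<open>auto simp: positive_def sets.space_closed dest: sets.sets_into_space\<close>)

definition total_variation :: "'a signed \<Rightarrow> 'a measure" where
  "total_variation \<mu> = add_measure (fst \<mu>) (snd \<mu>)"

definition signed_radon :: "real \<Rightarrow> 'a::euclidean_space signed \<Rightarrow> bool" where
  "signed_radon \<alpha> \<mu> \<longleftrightarrow>
     radon_measure \<alpha> (fst \<mu>) \<and> radon_measure \<alpha> (snd \<mu>) \<and>
     (\<exists>B \<in> sets borel. emeasure (fst \<mu>) (- B) = 0 \<and> emeasure (snd \<mu>) B = 0)"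

definition nonneg_signed :: "'a signed \<Rightarrow> bool" where
  "nonneg_signed \<mu> \<longleftrightarrow> emeasure (snd \<mu>) (space (snd \<mu>)) = 0"

definition finite_energy :: "real \<Rightarrow> 'a::euclidean_space signed set" where
  "finite_energy \<alpha> =
     {\<mu>. signed_radon \<alpha> \<mu> \<and>
         mutual_energy \<alpha> (total_variation \<mu>) (total_variation \<mu>) < \<infinity>}"

text \<open>The potential of a signed measure is meaningful at \<open>x\<close> unless both parts are infinite there.
  For signed Radon measures the exceptional points form a set of zero capacity; on them
  \<open>signed_potential\<close> takes the conventional value \<open>\<infinity> - \<infinity> = \<infinity>\<close> of \<open>ereal\<close>.\<close>

definition potential_defined :: "real \<Rightarrow> 'a::euclidean_space signed \<Rightarrow> 'a \<Rightarrow> bool" where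
  "potential_defined \<alpha> \<mu> x \<longleftrightarrow> potential \<alpha> (fst \<mu>) x < \<infinity> \<or> potential \<alpha> (snd \<mu>) x < \<infinity>"

definition signed_potential :: "real \<Rightarrow> 'a::euclidean_space signed \<Rightarrow> 'a \<Rightarrow> ereal" where
  "signed_potential \<alpha> \<mu> x =
     enn2ereal (potential \<alpha> (fst \<mu>) x) - enn2ereal (potential \<alpha> (snd \<mu>) x)"

text \<open>\<open>E(\<mu>) = E(\<mu>\<^sup>+,\<mu>\<^sup>+) + E(\<mu>\<^sup>-,\<mu>\<^sup>-) - E(\<mu>\<^sup>+,\<mu>\<^sup>-) - E(\<mu>\<^sup>-,\<mu>\<^sup>+)\<close>; only used for members of
  \<open>finite_energy\<close>, where all four terms are finite.\<close>

definition signed_energy :: "real \<Rightarrow> 'a::euclidean_space signed \<Rightarrow> real" where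
  "signed_energy \<alpha> \<mu> =
     enn2real (mutual_energy \<alpha> (fst \<mu>) (fst \<mu>)) + enn2real (mutual_energy \<alpha> (snd \<mu>) (snd \<mu>))
     - enn2real (mutual_energy \<alpha> (fst \<mu>) (snd \<mu>)) - enn2real (mutual_energy \<alpha> (snd \<mu>) (fst \<mu>))"

text \<open>For \<open>\<mu>\<close> carried by \<open>D\<close> and \<open>\<nu>\<close> carried by the complement of \<open>D\<close>, as below, this pair is
  the Hahn--Jordan decomposition of \<open>\<mu> - \<nu>\<close>.\<close>

definition diff_signed :: "'a signed \<Rightarrow> 'a signed \<Rightarrow> 'a signed" where
  "diff_signed \<mu> \<nu> = (add_measure (fst \<mu>) (snd \<nu>), add_measure (snd \<mu>) (fst \<nu>))"

subsection \<open>Extendible measures and balayage\<close>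

text \<open>An extendible measure on \<open>D\<close> is identified with its extension by \<open>0\<close>, i.e. with a signed Radon
  measure on \<open>R^n\<close> whose two parts are carried by \<open>D\<close>.\<close>

definition extendible :: "real \<Rightarrow> 'a::euclidean_space set \<Rightarrow> 'a signed \<Rightarrow> bool" where
  "extendible \<alpha> D \<nu> \<longleftrightarrow>
     signed_radon \<alpha> \<nu> \<and> carried_by (fst \<nu>) D \<and> carried_by (snd \<nu>) D \<and>
     (\<integral>\<^sup>+ y \<in> {y. 1 < norm y}. ennreal (norm y powr (\<alpha> - real DIM('a))) \<partial>fst \<nu>) < \<infinity> \<and>
     (\<integral>\<^sup>+ y \<in> {y. 1 < norm y}. ennreal (norm y powr (\<alpha> - real DIM('a))) \<partial>snd \<nu>) < \<infinity>"

definition cap_abs_continuous :: "real \<Rightarrow> 'a::euclidean_space signed \<Rightarrow> bool" where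
  "cap_abs_continuous \<alpha> \<mu> \<longleftrightarrow>
     (\<forall>K. compact K \<and> inner_cap \<alpha> K = 0 \<longrightarrow> emeasure (total_variation \<mu>) K = 0)"

text \<open>\<open>balayage \<alpha> D \<nu> \<nu>'\<close>: the defining property of the balayage \<open>\<nu>'\<close> of \<open>\<nu>\<close> onto the complement
  of \<open>D\<close>. As that complement is closed, being supported by it and being carried by it agree.\<close>

definition balayage :: "real \<Rightarrow> 'a::euclidean_space set \<Rightarrow> 'a signed \<Rightarrow> 'a signed \<Rightarrow> bool" where
  "balayage \<alpha> D \<nu> \<nu>' \<longleftrightarrow>
     signed_radon \<alpha> \<nu>' \<and> cap_abs_continuous \<alpha> \<nu>' \<and>
     carried_by (fst \<nu>') (- D) \<and> carried_by (snd \<nu>') (- D) \<and>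
     nearly_everywhere_on \<alpha> (- D)
       (\<lambda>x. potential_defined \<alpha> \<nu>' x \<and> potential_defined \<alpha> \<nu> x \<and>
            signed_potential \<alpha> \<nu>' x = signed_potential \<alpha> \<nu> x)"

subsection \<open>External fields\<close>

definition field_case_I ::
  "real \<Rightarrow> 'a::euclidean_space set \<Rightarrow> ('a \<Rightarrow> ereal) \<Rightarrow> bool" where
  "field_case_I \<alpha> A2 f \<longleftrightarrow>
     (\<forall>x. 0 \<le> f x) \<and> (\<forall>a. open {x. a < f x}) \<and> nearly_everywhere_on \<alpha> A2 (\<lambda>x. f x = 0)"

definition field_case_II ::
  "real \<Rightarrow> 'a::euclidean_space set \<Rightarrow> 'a signed \<Rightarrow> ('a \<Rightarrow> ereal) \<Rightarrow> bool" where
  "field_case_II \<alpha> D \<zeta> f \<longleftrightarrow>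
     extendible \<alpha> D \<zeta> \<and>
     mutual_energy \<alpha> (total_variation \<zeta>) (total_variation \<zeta>) < \<infinity> \<and>
     (\<exists>\<zeta>'. balayage \<alpha> D \<zeta> \<zeta>' \<and> f = signed_potential \<alpha> (diff_signed \<zeta> \<zeta>'))"

subsection \<open>The constrained weighted minimum energy problem\<close>

definition constraints :: "real \<Rightarrow> 'a::euclidean_space set \<Rightarrow> 'a measure set" where
  "constraints \<alpha> A1 = {\<xi> \<in> finite_energy_pos \<alpha> A1. 1 < emeasure \<xi> A1}"

definition condenser_measures ::
  "real \<Rightarrow> 'a::euclidean_space set \<Rightarrow> 'a set \<Rightarrow> 'a signed set" where
  "condenser_measures \<alpha> A1 A2 =
     {\<mu> \<in> finite_energy \<alpha>.
        carried_by (fst \<mu>) A1 \<and> carried_by (snd \<mu>) A2 \<and>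
        emeasure (fst \<mu>) A1 = 1 \<and> emeasure (snd \<mu>) A2 = 1}"

definition field_integrable :: "('a \<Rightarrow> ereal) \<Rightarrow> 'a signed \<Rightarrow> bool" where
  "field_integrable f \<mu> \<longleftrightarrow>
     f \<in> borel_measurable (total_variation \<mu>) \<and>
     (\<integral>\<^sup>+ x. e2ennreal \<bar>f x\<bar> \<partial>total_variation \<mu>) < \<infinity>"

text \<open>Only used for integrable \<open>f\<close>, which is finite almost everywhere, so that \<open>real_of_ereal\<close> does
  not affect the integrals.\<close>

definition field_integral :: "('a \<Rightarrow> ereal) \<Rightarrow> 'a signed \<Rightarrow> real" where
  "field_integral f \<mu> =
     (\<integral>x. real_of_ereal (f x) \<partial>fst \<mu>) - (\<integral>x. real_of_ereal (f x) \<partial>snd \<mu>)"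

definition admissible ::
  "real \<Rightarrow> 'a::euclidean_space set \<Rightarrow> 'a set \<Rightarrow> 'a measure \<Rightarrow> ('a \<Rightarrow> ereal) \<Rightarrow> 'a signed set" where
  "admissible \<alpha> A1 A2 \<xi> f =
     {\<mu> \<in> condenser_measures \<alpha> A1 A2.
        (\<forall>B \<in> sets borel. emeasure (fst \<mu>) B \<le> emeasure \<xi> B) \<and> field_integrable f \<mu>}"

definition weighted_energy ::
  "real \<Rightarrow> ('a::euclidean_space \<Rightarrow> ereal) \<Rightarrow> 'a signed \<Rightarrow> real" where
  "weighted_energy \<alpha> f \<mu> = signed_energy \<alpha> \<mu> + 2 * field_integral f \<mu>"

text \<open>The infimum is taken in \<open>ereal\<close>, so that it is \<open>\<infinity>\<close> when there are no admissible measures.\<close>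

definition min_weighted_energy ::
  "real \<Rightarrow> 'a::euclidean_space set \<Rightarrow> 'a set \<Rightarrow> 'a measure \<Rightarrow> ('a \<Rightarrow> ereal) \<Rightarrow> ereal" where
  "min_weighted_energy \<alpha> A1 A2 \<xi> f =
     (INF \<mu> \<in> admissible \<alpha> A1 A2 \<xi> f. ereal (weighted_energy \<alpha> f \<mu>))"

definition solvable ::
  "real \<Rightarrow> 'a::euclidean_space set \<Rightarrow> 'a set \<Rightarrow> 'a measure \<Rightarrow> ('a \<Rightarrow> ereal) \<Rightarrow> bool" where
  "solvable \<alpha> A1 A2 \<xi> f \<longleftrightarrow>
     (\<exists>\<mu> \<in> admissible \<alpha> A1 A2 \<xi> f.
        ereal (weighted_energy \<alpha> f \<mu>) = min_weighted_energy \<alpha> A1 A2 \<xi> f)"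

end

(*
  Since D is the complement of a closed set A that is not thin at infinity, sweeping a finite measure
  of finite energy from D onto A preserves its total mass.  For fixed sigma on D the energy of
  sigma - nu is smallest when nu is the sweep of sigma, so the constraint nu(A) = 1 costs nothing and
  mass cannot be lost at infinity in the second component.

  If xi has finite mass, the positive parts of admissible measures are densities with values in [0,1]
  with respect to xi.  By convexity some convex combinations of a minimizing sequence of densities
  converge xi-almost everywhere (Mazur); the limit together with its sweep is a minimizer.

  If A1 has infinite capacity, there are unit measures mu_k on A1 with energies at most 4^-k, and xi
  is their sum.  The pairs of mu_k and its sweep have weighted energies tending to 0, a lower bound
  since the field is nonnegative almost everywhere.  Equality would force two probability measures on
  disjoint sets to have the same Gaussian convolutions.

  Positivity of the energy comes from writing the Riesz kernel as a mixture of Gaussian kernels over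
  time.  As alpha <= 2, removing the times up to r from this mixture amounts to convolving the kernel
  with a positive mixture of Gaussians; this gives the domination principle.
*)
theory Submission
  imports Defs "HOL-Probability.Probability"
begin

section \<open>Gaussian kernels\<close>

text \<open>What makes the sweep usable is the domination principle. Minimise over measures on A
  with mass at most one more than that of sigma: the first variation gives U^nu <= U^sigma only
  nu-almost everywhere. Domination spreads this to every point, and comparison of masses then shows
  that the bound on the mass is not active, so mass may be added and equality on A follows.
  Non-thinness acts through measures on A whose potential is at most 1 + eps everywhere and at least
  1 - eps on a large ball: integrating against them turns inequalities between potentials into
  inequalities between masses. The energy of a difference is kept as a time and space integral of
  squared differences of heat evolutions; this form is nonnegative, lower semicontinuous under vague
  convergence, and meaningful before a limit is known to have finite energy. A field of Case II
  combines four potentials that may be infinite together, and the defining equation of zeta' holds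
  only nearly everywhere. So the field is controlled in integrated form, by sweeping the test
  measure rather than by identifying zeta' with a constructed sweep.\<close>

definition gauss :: "real \<Rightarrow> 'a::euclidean_space \<Rightarrow> real" where
  "gauss t x = (2 * pi * t) powr (- (real DIM('a) / 2)) * exp (- (norm x)\<^sup>2 / (2 * t))"

lemma gauss_nonneg [simp]: "0 \<le> gauss t x"
  by (simp add: gauss_def)

lemma gauss_pos: "0 < t \<Longrightarrow> 0 < gauss t x"
  by (simp add: gauss_def)

lemma gauss_minus [simp]: "gauss t (- x) = gauss t x"
  by (simp add: gauss_def)

lemma gauss_commute: "gauss t (x - y) = gauss t (y - x)"
  by (simp add: gauss_def norm_minus_commute)

lemma gauss_le_zero:
  fixes x :: "'a::euclidean_space"
  shows "0 < t \<Longrightarrow> gauss t x \<le> gauss t (0::'a)"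
  by (simp add: gauss_def mult_le_cancel_left1)

lemma gauss_measurable [measurable]:
  assumes [measurable]: "f \<in> borel_measurable M" "g \<in> borel_measurable M"
  shows "(\<lambda>w. gauss (f w) (g w)) \<in> borel_measurable M"
  unfolding gauss_def by measurable

lemma norm_sq_Basis: "(norm (x::'a::euclidean_space))\<^sup>2 = (\<Sum>b\<in>Basis. (x \<bullet> b)\<^sup>2)"
  using euclidean_inner[of x x] unfolding power2_norm_eq_inner by (simp only: power2_eq_square)

text \<open>Splitting into coordinates lets normalisation and the convolution law be inherited from
  the one-dimensional normal density.\<close>

lemma gauss_prod:
  fixes x :: "'a::euclidean_space"
  assumes "0 < t"
  shows "gauss t x = (\<Prod>b\<in>Basis. normal_density 0 (sqrt t) (x \<bullet> b))"
proof -
  have nd: "normal_density 0 (sqrt t) y = (2 * pi * t) powr (- (1/2)) * exp (- y\<^sup>2 / (2 * t))" for y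
    using assms by (simp add: normal_density_def powr_minus_divide powr_half_sqrt)
  have "(\<Prod>b\<in>(Basis::'a set). normal_density 0 (sqrt t) (x \<bullet> b)) =
      (\<Prod>b\<in>(Basis::'a set). (2 * pi * t) powr (- (1/2))) * (\<Prod>b\<in>Basis. exp (- (x \<bullet> b)\<^sup>2 / (2 * t)))"
    unfolding nd by (rule prod.distrib)
  also have "(\<Prod>b\<in>(Basis::'a set). (2 * pi * t) powr (- (1/2))) = (2 * pi * t) powr (- (real DIM('a) / 2))"
    using assms by (simp add: powr_power)
  also have "(\<Prod>b\<in>Basis. exp (- (x \<bullet> b)\<^sup>2 / (2 * t))) = exp (- (norm x)\<^sup>2 / (2 * t))"
    by (simp add: exp_sum[symmetric] norm_sq_Basis sum_negf sum_divide_distrib)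
  finally show ?thesis by (simp add: gauss_def)
qed

lemma nn_integral_gauss:
  assumes "0 < t"
  shows "(\<integral>\<^sup>+x. ennreal (gauss t (x::'a::euclidean_space)) \<partial>lborel) = 1"
proof -
  have "(\<integral>\<^sup>+x. ennreal (normal_density 0 (sqrt t) x) \<partial>lborel) = 1"
    using assms by (subst nn_integral_eq_integral) (auto simp: integral_normal_density)
  then show ?thesis
    using assms by (simp add: gauss_prod prod_ennreal[symmetric] normal_density_nonneg
        nn_integral_lborel_prod[of "\<lambda>b y. ennreal (normal_density 0 (sqrt t) y)"])
qed

lemma nn_integral_lborel_translate:
  fixes f :: "'a::euclidean_space \<Rightarrow> ennreal"
  assumes [measurable]: "f \<in> borel_measurable borel"
  shows "(\<integral>\<^sup>+x. f (a + x) \<partial>lborel) = (\<integral>\<^sup>+x. f x \<partial>lborel)"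
  by (subst (2) lborel_affine[of 1 a]) (simp_all add: nn_integral_density nn_integral_distr)

lemma nn_integral_lborel_reflect:
  fixes f :: "'a::euclidean_space \<Rightarrow> ennreal"
  assumes [measurable]: "f \<in> borel_measurable borel"
  shows "(\<integral>\<^sup>+x. f (a - x) \<partial>lborel) = (\<integral>\<^sup>+x. f x \<partial>lborel)"
  by (subst (2) lborel_affine[of "-1" a]) (simp_all add: nn_integral_density nn_integral_distr)

lemma nn_integral_lborel_scale:
  fixes f :: "'a::euclidean_space \<Rightarrow> ennreal"
  assumes [measurable]: "f \<in> borel_measurable borel" and c: "0 < c"
  shows "(\<integral>\<^sup>+x. f x \<partial>lborel) = ennreal (c ^ DIM('a)) * (\<integral>\<^sup>+x. f (a + c *\<^sub>R x) \<partial>lborel)"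
  using c by (subst lborel_affine[of c a]) (simp_all add: nn_integral_density nn_integral_distr nn_integral_cmult)

text \<open>Semigroup law of the heat kernel: in each coordinate the variances of independent
  centred normals add.\<close>

lemma gauss_conv:
  fixes x y :: "'a::euclidean_space"
  assumes st: "0 < s" "0 < t"
  shows "(\<integral>\<^sup>+z. ennreal (gauss s (x - z)) * ennreal (gauss t (z - y)) \<partial>lborel) = ennreal (gauss (s + t) (x - y))"
proof -
  have one: "(\<integral>\<^sup>+z. ennreal (normal_density 0 (sqrt s) (a - z) * normal_density 0 (sqrt t) z) \<partial>lborel)
      = ennreal (normal_density 0 (sqrt (s + t)) a)" for a
    using fun_cong[OF conv_normal_density_zero_mean[of "sqrt s" "sqrt t"], of a] st by simp
  have "(\<integral>\<^sup>+z. ennreal (gauss s (x - z)) * ennreal (gauss t (z - y)) \<partial>lborel) =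
     (\<integral>\<^sup>+z. ennreal (gauss s ((x - y) - z)) * ennreal (gauss t z) \<partial>lborel)"
    by (subst nn_integral_lborel_translate[of _ "-y", symmetric]) (simp_all add: algebra_simps)
  also have "\<dots> = (\<integral>\<^sup>+z. (\<Prod>b\<in>Basis. ennreal (normal_density 0 (sqrt s) ((x - y) \<bullet> b - z \<bullet> b) * normal_density 0 (sqrt t) (z \<bullet> b))) \<partial>lborel)"
    using st by (simp add: gauss_prod prod_ennreal normal_density_nonneg prod.distrib ennreal_mult prod_nonneg inner_diff_left)
  also have "\<dots> = (\<Prod>b\<in>Basis. ennreal (normal_density 0 (sqrt (s + t)) ((x - y) \<bullet> b)))"
    by (subst nn_integral_lborel_prod[of "\<lambda>b z. ennreal (normal_density 0 (sqrt s) ((x - y) \<bullet> b - z) * normal_density 0 (sqrt t) z)"])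
       (simp_all add: one)
  also have "\<dots> = ennreal (gauss (s + t) (x - y))"
    using st by (simp add: gauss_prod prod_ennreal normal_density_nonneg)
  finally show ?thesis .
qed

lemma gauss_scale:
  fixes x :: "'a::euclidean_space"
  assumes "0 < c" "0 < t"
  shows "gauss (c\<^sup>2 * t) (c *\<^sub>R x) = gauss t x / c ^ DIM('a)"
proof -
  have "(2 * pi * (c\<^sup>2 * t)) powr (- (real DIM('a) / 2)) = (c powr 2 * (2 * pi * t)) powr (- (real DIM('a) / 2))"
    using assms by (simp add: mult_ac)
  also have "\<dots> = (2 * pi * t) powr (- (real DIM('a) / 2)) / c ^ DIM('a)"
    using assms powr_realpow[of c "DIM('a)"]
    by (simp add: powr_mult powr_powr powr_minus_divide del: powr_numeral)
  finally show ?thesis using assms by (simp add: gauss_def power_mult_distrib)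
qed

text \<open>A Fatou argument, valid also where \<open>h\<close> is infinite: after rescaling, all
  averages are taken against one fixed Gaussian, and \<open>h\<close> is evaluated at points tending
  to x.\<close>

lemma gauss_lsc:
  fixes h :: "'a::euclidean_space \<Rightarrow> ennreal"
  assumes lsc: "\<And>c. open {y. c < h y}" and c: "c < h x"
  shows "\<exists>\<delta>>0. \<forall>t. 0 < t \<and> t \<le> \<delta> \<longrightarrow> c \<le> (\<integral>\<^sup>+y. ennreal (gauss t (x - y)) * h y \<partial>lborel)"
proof (rule ccontr)
  have [measurable]: "h \<in> borel_measurable borel"
    by (rule borel_measurableI_greater) (simp add: lsc)
  assume "\<not> ?thesis"
  then have "\<forall>k::nat. \<exists>t. 0 < t \<and> t \<le> inverse (Suc k) \<and> (\<integral>\<^sup>+y. ennreal (gauss t (x - y)) * h y \<partial>lborel) < c"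
    by (metis not_le_imp_less inverse_positive_iff_positive of_nat_0_less_iff zero_less_Suc)
  then obtain t where t: "\<And>k. 0 < t k" "\<And>k::nat. t k \<le> inverse (Suc k)"
      "\<And>k. (\<integral>\<^sup>+y. ennreal (gauss (t k) (x - y)) * h y \<partial>lborel) < c" by metis
  have t0: "t \<longlonglongrightarrow> 0"
    by (rule tendsto_sandwich[OF _ _ tendsto_const LIMSEQ_inverse_real_of_nat])
       (use t in \<open>auto intro!: always_eventually less_imp_le simp del: of_nat_Suc\<close>)
  have eq: "(\<integral>\<^sup>+y. ennreal (gauss (t k) (x - y)) * h y \<partial>lborel) = (\<integral>\<^sup>+z. ennreal (gauss 1 z) * h (x + sqrt (t k) *\<^sub>R z) \<partial>lborel)" for k
  proof -
    have "(\<integral>\<^sup>+y. ennreal (gauss (t k) (x - y)) * h y \<partial>lborel) =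
      ennreal (sqrt (t k) ^ DIM('a)) * (\<integral>\<^sup>+z. ennreal (gauss (t k) (x - (x + sqrt (t k) *\<^sub>R z))) * h (x + sqrt (t k) *\<^sub>R z) \<partial>lborel)"
      by (rule nn_integral_lborel_scale) (use t in auto)
    also have "\<dots> = (\<integral>\<^sup>+z. ennreal (sqrt (t k) ^ DIM('a)) * (ennreal (gauss (t k) (x - (x + sqrt (t k) *\<^sub>R z))) * h (x + sqrt (t k) *\<^sub>R z)) \<partial>lborel)"
      by (rule nn_integral_cmult[symmetric]) measurable
    also have "\<dots> = (\<integral>\<^sup>+z. ennreal (gauss 1 z) * h (x + sqrt (t k) *\<^sub>R z) \<partial>lborel)"
    proof (rule nn_integral_cong)
      fix z :: 'a
      have "gauss (t k) (sqrt (t k) *\<^sub>R z) = gauss 1 z / sqrt (t k) ^ DIM('a)"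
        using gauss_scale[of "sqrt (t k)" 1 z] t(1)[of k] by simp
      then have "ennreal (sqrt (t k) ^ DIM('a)) * ennreal (gauss (t k) (sqrt (t k) *\<^sub>R z)) = ennreal (gauss 1 z)"
        using t(1)[of k] by (simp add: ennreal_mult[symmetric])
      then show "ennreal (sqrt (t k) ^ DIM('a)) * (ennreal (gauss (t k) (x - (x + sqrt (t k) *\<^sub>R z))) * h (x + sqrt (t k) *\<^sub>R z)) = ennreal (gauss 1 z) * h (x + sqrt (t k) *\<^sub>R z)"
        by (simp add: mult.assoc[symmetric])
    qed
    finally show ?thesis .
  qed
  \<comment> \<open>The averages stay below c, so the contradiction comes from Fatou at a level
    strictly above c.\<close>
  obtain c' where c': "c < c'" "c' < h x" using dense[OF c] by auto
  have "(\<integral>\<^sup>+z. ennreal (gauss 1 (z::'a)) * c' \<partial>lborel) \<le> (\<integral>\<^sup>+z. liminf (\<lambda>k. ennreal (gauss 1 z) * h (x + sqrt (t k) *\<^sub>R z)) \<partial>lborel)"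
  proof (rule nn_integral_mono)
    fix z :: 'a
    have "(\<lambda>k. x + sqrt (t k) *\<^sub>R z) \<longlonglongrightarrow> x + sqrt 0 *\<^sub>R z"
      by (intro tendsto_intros t0)
    then have "\<forall>\<^sub>F k in sequentially. x + sqrt (t k) *\<^sub>R z \<in> {y. c' < h y}"
      using topological_tendstoD[OF _ lsc[of c']] c' by simp
    then have "\<forall>\<^sub>F k in sequentially. ennreal (gauss 1 z) * c' \<le> ennreal (gauss 1 z) * h (x + sqrt (t k) *\<^sub>R z)"
      by eventually_elim (auto intro!: mult_left_mono)
    then show "ennreal (gauss 1 z) * c' \<le> liminf (\<lambda>k. ennreal (gauss 1 z) * h (x + sqrt (t k) *\<^sub>R z))"
      by (rule Liminf_bounded)
  qed
  also have "\<dots> \<le> liminf (\<lambda>k. \<integral>\<^sup>+z. ennreal (gauss 1 z) * h (x + sqrt (t k) *\<^sub>R z) \<partial>lborel)"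
    by (rule nn_integral_liminf) measurable
  also have "\<dots> \<le> c"
    unfolding eq[symmetric] by (rule Liminf_le) (use t(3) in \<open>auto intro!: always_eventually less_imp_le\<close>)
  also have "(\<integral>\<^sup>+z. ennreal (gauss 1 (z::'a)) * c' \<partial>lborel) = c'"
    by (simp add: nn_integral_multc nn_integral_gauss)
  finally show False using c' by simp
qed


section \<open>The Riesz kernel as a mixture of Gaussians\<close>

text \<open>Up to a constant this is the potential measure of the stable subordinator of index
  \<alpha>/2 (pure drift for \<alpha> = 2). The factor \<open>C\<close> is a parameter, fixed later
  by normalising the kernel at a unit vector.\<close>

definition rtime :: "real \<Rightarrow> real \<Rightarrow> real measure" where
  "rtime C \<alpha> = density lborel (\<lambda>t. ennreal (C * t powr (\<alpha> / 2 - 1)) * indicator {0<..} t)"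

lemma sets_rtime [simp, measurable_cong]: "sets (rtime C \<alpha>) = sets borel"
  by (simp add: rtime_def)

lemma space_rtime [simp]: "space (rtime C \<alpha>) = UNIV"
  by (simp add: rtime_def)

lemma sigma_finite_rtime: "sigma_finite_measure (rtime C \<alpha>)"
  unfolding rtime_def
  by (subst sigma_finite_measure.sigma_finite_iff_density_finite'[OF sigma_finite_lborel]) (auto simp: ennreal_mult_eq_top_iff indicator_def)

lemma nn_integral_rtime:
  assumes [measurable]: "f \<in> borel_measurable borel"
  shows "(\<integral>\<^sup>+t. f t \<partial>rtime C \<alpha>) = (\<integral>\<^sup>+t. ennreal (C * t powr (\<alpha> / 2 - 1)) * indicator {0<..} t * f t \<partial>lborel)"
  unfolding rtime_def by (subst nn_integral_density) auto

lemma AE_rtime_pos: "AE t in rtime C \<alpha>. 0 < t"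
  unfolding rtime_def by (subst AE_density) (auto simp: indicator_def)

lemma rtime_scale:
  assumes "0 < C" "f \<in> borel_measurable borel"
  shows "(\<integral>\<^sup>+t. f t \<partial>rtime C \<alpha>) = ennreal C * (\<integral>\<^sup>+t. f t \<partial>rtime 1 \<alpha>)"
  using assms
  by (simp add: nn_integral_rtime nn_integral_cmult[symmetric] ennreal_mult mult.assoc)

lemma emeasure_rtime_interval:
  assumes "0 < \<alpha>" "0 < C" "0 < r"
  shows "emeasure (rtime C \<alpha>) {0<..r} = ennreal (C * r powr (\<alpha> / 2) / (\<alpha> / 2))"
proof -
  have "emeasure (rtime C \<alpha>) {0<..r} = (\<integral>\<^sup>+t. ennreal (C * t powr (\<alpha> / 2 - 1)) * indicator {0<..} t * indicator {0<..r} t \<partial>lborel)"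
    by (subst nn_integral_rtime[symmetric]) (auto simp: nn_integral_indicator)
  also have "\<dots> = (\<integral>\<^sup>+t. ennreal (C * t powr (\<alpha> / 2 - 1)) * indicator {0..r} t \<partial>lborel)"
    by (rule nn_integral_cong) (auto simp: indicator_def)
  also have "\<dots> = ennreal (C * r powr (\<alpha> / 2) / (\<alpha> / 2))"
    by (rule nn_integral_has_integral_lebesgue')
       (use assms has_integral_mult_right[OF has_integral_powr_from_0[of "\<alpha>/2 - 1" r], of C] in \<open>auto simp: mult.assoc\<close>)
  finally show ?thesis .
qed

text \<open>Since \<alpha> < n, the power of t in the integrand, \<alpha>/2 - 1 - n/2, is below
  -1.\<close>

lemma nn_integral_rtime_tail_finite:
  assumes "0 < C" "\<alpha> < real DIM('a)" "0 < a"
  shows "(\<integral>\<^sup>+t. ennreal (gauss t (0::'a::euclidean_space)) * indicator {a<..} t \<partial>rtime C \<alpha>) < \<infinity>"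
proof -
  let ?n = "real DIM('a)"
  define e where "e = \<alpha>/2 - 1 - ?n / 2"
  have e: "e < -1" using assms by (simp add: e_def)
  define c where "c = C * (2 * pi) powr (- (?n / 2))"
  have "(\<integral>\<^sup>+t. ennreal (gauss t (0::'a)) * indicator {a<..} t \<partial>rtime C \<alpha>)
     = (\<integral>\<^sup>+t. ennreal (C * t powr (\<alpha> / 2 - 1)) * indicator {0<..} t * (ennreal (gauss t (0::'a)) * indicator {a<..} t) \<partial>lborel)"
    by (rule nn_integral_rtime) measurable
  also have "\<dots> \<le> (\<integral>\<^sup>+t. ennreal (c * t powr e) * indicator {a..} t \<partial>lborel)"
  proof (rule nn_integral_mono)
    fix t :: real
    have "C * t powr (\<alpha> / 2 - 1) * gauss t (0::'a) = c * t powr e" if "a < t"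
      using that assms by (simp add: gauss_def c_def e_def powr_mult powr_diff powr_minus_divide)
    then show "ennreal (C * t powr (\<alpha> / 2 - 1)) * indicator {0<..} t * (ennreal (gauss t (0::'a)) * indicator {a<..} t)
       \<le> ennreal (c * t powr e) * indicator {a..} t"
      using assms by (auto simp: indicator_def ennreal_mult[symmetric])
  qed
  also have "\<dots> = ennreal (c * (- (a powr (e+1)) / (e+1)))"
    by (rule nn_integral_has_integral_lebesgue')
       (use assms e has_integral_mult_right[OF has_integral_powr_to_inf[of e a], of c] in \<open>auto simp: c_def\<close>)
  finally show ?thesis by (rule order.strict_trans1) simp
qed

lemma exp_minus_le_fact_div_power:
  assumes "0 < (y::real)" shows "exp (- y) \<le> fact k / y ^ k"
proof -
  have "(\<Sum>n\<in>{k}. y ^ n /\<^sub>R fact n) \<le> (\<Sum>n. y ^ n /\<^sub>R fact n)"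
    using assms by (intro sum_le_suminf sums_summable[OF exp_converges]) auto
  then have "y ^ k / fact k \<le> exp y"
    using sums_unique[OF exp_converges[of y]] by (simp add: divide_inverse mult.commute)
  then show ?thesis using assms by (simp add: exp_minus field_simps)
qed

lemma riesz_mixture_finite:
  assumes "0 < \<alpha>" "\<alpha> < real DIM('a)" "norm (x::'a::euclidean_space) = 1"
  shows "(\<integral>\<^sup>+t. ennreal (gauss t x) \<partial>rtime 1 \<alpha>) < \<infinity>"
proof -
  let ?n = "DIM('a)"
  \<comment> \<open>From exp (-y) <= n! / y^n at y = 1/(2t): the factor t^n absorbs the singular
    prefactor t^(-n/2) of the Gaussian.\<close>
  define c :: real where "c = (2 * pi) powr (- (real ?n / 2)) * (fact ?n * 2 ^ ?n)"
  have "0 < c" by (simp add: c_def)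
  have bound: "gauss t x \<le> c" if "0 < t" "t \<le> 1" for t
  proof -
    have "exp (- (1 / (2 * t))) \<le> fact ?n / (1 / (2 * t)) ^ ?n"
      using that by (intro exp_minus_le_fact_div_power) auto
    also have "\<dots> = fact ?n * 2 ^ ?n * t ^ ?n" by (simp add: power_divide power_mult_distrib)
    finally have "gauss t x \<le> (2 * pi * t) powr (- (real ?n / 2)) * (fact ?n * 2 ^ ?n * t ^ ?n)"
      using assms by (simp add: gauss_def mult_left_mono)
    also have "\<dots> = c * t powr (real ?n / 2)"
      using that by (simp add: c_def powr_mult powr_realpow[symmetric] powr_add[symmetric])
    also have "\<dots> \<le> c * 1" using that \<open>0 < c\<close> by (intro mult_left_mono powr_le1) auto
    finally show ?thesis by simp
  qed
  have "(\<integral>\<^sup>+t. ennreal (gauss t x) \<partial>rtime 1 \<alpha>) \<le>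
      (\<integral>\<^sup>+t. (ennreal c * indicator {0<..1} t + ennreal (gauss t (0::'a)) * indicator {1<..} t) \<partial>rtime 1 \<alpha>)"
    by (rule nn_integral_mono_AE, rule AE_mp[OF AE_rtime_pos], rule AE_I2)
       (auto simp: indicator_def bound gauss_le_zero intro!: ennreal_leI)
  also have "\<dots> = ennreal c * emeasure (rtime 1 \<alpha>) {0<..1} + (\<integral>\<^sup>+t. ennreal (gauss t (0::'a)) * indicator {1<..} t \<partial>rtime 1 \<alpha>)"
    by (subst nn_integral_add) (auto simp: nn_integral_cmult)
  also have "\<dots> < \<infinity>"
    using assms nn_integral_rtime_tail_finite[where 'a='a, of 1 \<alpha> 1]
    by (simp add: emeasure_rtime_interval ennreal_mult_less_top)
  finally show ?thesis .
qed

text \<open>Substituting t by c^2 t. Together with rotation invariance this homogeneity determines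
  the mixture up to a constant, so no Gamma integral has to be evaluated.\<close>

lemma riesz_mixture_scale:
  assumes "0 < c"
  shows "(\<integral>\<^sup>+t. ennreal (gauss t (c *\<^sub>R x)) \<partial>rtime 1 \<alpha>) =
    ennreal (c powr (\<alpha> - real DIM('a))) * (\<integral>\<^sup>+t. ennreal (gauss t (x::'a::euclidean_space)) \<partial>rtime 1 \<alpha>)"
proof -
  have "(\<integral>\<^sup>+t. ennreal (gauss t (c *\<^sub>R x)) \<partial>rtime 1 \<alpha>) =
     (\<integral>\<^sup>+t. ennreal (1 * t powr (\<alpha> / 2 - 1)) * indicator {0<..} t * ennreal (gauss t (c *\<^sub>R x)) \<partial>lborel)"
    by (rule nn_integral_rtime) measurable
  also have "\<dots> = ennreal \<bar>c\<^sup>2\<bar> * (\<integral>\<^sup>+t. ennreal (1 * (0 + c\<^sup>2 * t) powr (\<alpha> / 2 - 1)) * indicator {0<..} (0 + c\<^sup>2 * t) * ennreal (gauss (0 + c\<^sup>2 * t) (c *\<^sub>R x)) \<partial>lborel)"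
    using assms by (intro nn_integral_real_affine) auto
  also have "\<dots> = (\<integral>\<^sup>+t. ennreal \<bar>c\<^sup>2\<bar> * (ennreal (1 * (0 + c\<^sup>2 * t) powr (\<alpha> / 2 - 1)) * indicator {0<..} (0 + c\<^sup>2 * t) * ennreal (gauss (0 + c\<^sup>2 * t) (c *\<^sub>R x))) \<partial>lborel)"
    by (rule nn_integral_cmult[symmetric]) measurable
  also have "\<dots> = (\<integral>\<^sup>+t. ennreal (c powr (\<alpha> - real DIM('a))) * (ennreal (1 * t powr (\<alpha> / 2 - 1)) * indicator {0<..} t * ennreal (gauss t x)) \<partial>lborel)"
  proof (rule nn_integral_cong)
    fix t :: real
    show "ennreal \<bar>c\<^sup>2\<bar> * (ennreal (1 * (0 + c\<^sup>2 * t) powr (\<alpha> / 2 - 1)) * indicator {0<..} (0 + c\<^sup>2 * t) * ennreal (gauss (0 + c\<^sup>2 * t) (c *\<^sub>R x)))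
      = ennreal (c powr (\<alpha> - real DIM('a))) * (ennreal (1 * t powr (\<alpha> / 2 - 1)) * indicator {0<..} t * ennreal (gauss t x))"
    proof (cases "0 < t")
      case True
      have "(c\<^sup>2 * t) powr (\<alpha> / 2 - 1) = c powr \<alpha> / c\<^sup>2 * t powr (\<alpha> / 2 - 1)"
      proof -
        have "(c\<^sup>2 * t) powr (\<alpha> / 2 - 1) = (c powr 2) powr (\<alpha> / 2 - 1) * t powr (\<alpha> / 2 - 1)"
          using assms True by (simp add: powr_mult)
        also have "(c powr 2) powr (\<alpha> / 2 - 1) = c powr (\<alpha> - 2)" unfolding powr_powr by (simp add: algebra_simps)
        also have "\<dots> = c powr \<alpha> / c\<^sup>2" using assms by (simp add: powr_diff)
        finally show ?thesis .
      qed
      moreover have "c powr (\<alpha> - real DIM('a)) = c powr \<alpha> / c ^ DIM('a)"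
        using assms by (simp add: powr_diff powr_realpow)
      ultimately show ?thesis using assms True
        by (simp add: gauss_scale ennreal_mult[symmetric])
    qed (use assms in \<open>auto simp: indicator_def zero_less_mult_iff\<close>)
  qed
  also have "\<dots> = ennreal (c powr (\<alpha> - real DIM('a))) * (\<integral>\<^sup>+t. (ennreal (1 * t powr (\<alpha> / 2 - 1)) * indicator {0<..} t * ennreal (gauss t x)) \<partial>lborel)"
    by (rule nn_integral_cmult) measurable
  also have "(\<integral>\<^sup>+t. (ennreal (1 * t powr (\<alpha> / 2 - 1)) * indicator {0<..} t * ennreal (gauss t x)) \<partial>lborel)
     = (\<integral>\<^sup>+t. ennreal (gauss t x) \<partial>rtime 1 \<alpha>)"
    by (rule nn_integral_rtime[symmetric]) measurable
  finally show ?thesis .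
qed

lemma riesz_mixture_pos: "0 < (\<integral>\<^sup>+t. ennreal (gauss t (x::'a::euclidean_space)) \<partial>rtime 1 \<alpha>)"
proof (rule ccontr)
  assume "\<not> ?thesis"
  then have "(\<integral>\<^sup>+t. ennreal (gauss t x) \<partial>rtime 1 \<alpha>) = 0" by simp
  then have "AE t in rtime 1 \<alpha>. ennreal (gauss t x) = 0"
    by (subst (asm) nn_integral_0_iff_AE) auto
  then have "AE t in rtime 1 \<alpha>. False"
    using AE_rtime_pos[of 1 \<alpha>] by eventually_elim (metis ennreal_eq_0_iff gauss_pos not_less)
  then have "AE t in lborel. \<not> 0 < (t::real)"
    unfolding rtime_def by (subst (asm) AE_density) (auto simp: indicator_def)
  then have null: "emeasure lborel {t \<in> space lborel. (0::real) < t} = 0"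
    by (rule emeasure_eq_0_AE)
  have "emeasure lborel {0<..<(1::real)} = 0"
    by (rule emeasure_eq_0[OF _ null]) auto
  then show False by simp
qed

text \<open>The mixture is radial and homogeneous of degree \<alpha> - n, hence a multiple of the
  kernel; \<open>C\<close> is the inverse of its value at a unit vector.\<close>

lemma riesz_kernel_mixture:
  assumes "0 < \<alpha>" "\<alpha> < real DIM('a::euclidean_space)"
  obtains C where "0 < C" "\<And>x y :: 'a. riesz_kernel \<alpha> x y = (\<integral>\<^sup>+t. ennreal (gauss t (x - y)) \<partial>rtime C \<alpha>)"
proof -
  define K where "K x = (\<integral>\<^sup>+t. ennreal (gauss t x) \<partial>rtime 1 \<alpha>)" for x :: 'a
  obtain e :: 'a where "e \<in> Basis" using nonempty_Basis by blast
  then have e: "norm e = 1" by simp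
  obtain k where k: "0 < k" "K e = ennreal k"
    using riesz_mixture_finite[OF assms e] riesz_mixture_pos[where x=e and \<alpha>=\<alpha>] unfolding K_def
    by (metis ennreal_cases ennreal_less_zero_iff less_irrefl infinity_ennreal_def)
  \<comment> \<open>At the origin, homogeneity makes the value a positive fixed point of
    multiplication by 2^(\<alpha>-n), which is not 1; so it is infinite, as the kernel is on the
    diagonal.\<close>
  have K0: "K 0 = \<infinity>"
  proof (rule ccontr)
    assume "K 0 \<noteq> \<infinity>"
    then obtain k0 where k0: "K 0 = ennreal k0" "0 < k0"
      using riesz_mixture_pos[where x="0::'a" and \<alpha>=\<alpha>] unfolding K_def
      by (metis ennreal_cases ennreal_less_zero_iff infinity_ennreal_def)
    have "K 0 = ennreal (2 powr (\<alpha> - real DIM('a))) * K 0"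
      using riesz_mixture_scale[where c=2 and x="0::'a" and \<alpha>=\<alpha>] by (simp add: K_def)
    then have "k0 = 2 powr (\<alpha> - real DIM('a)) * k0" using k0 by (simp add: ennreal_mult[symmetric])
    then have "2 powr (\<alpha> - real DIM('a)) = 1" using k0 by simp
    then show False using assms by simp
  qed
  have Kx: "K x = ennreal (norm x powr (\<alpha> - real DIM('a)) * k)" if "x \<noteq> 0" for x
  proof -
    have "gauss t x = gauss t (norm x *\<^sub>R e)" for t using e by (simp add: gauss_def)
    then have "K x = K (norm x *\<^sub>R e)" by (simp add: K_def)
    also have "\<dots> = ennreal (norm x powr (\<alpha> - real DIM('a))) * K e"
      using that unfolding K_def by (intro riesz_mixture_scale) simp
    finally show ?thesis using k by (simp add: ennreal_mult)
  qed
  show ?thesis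
  proof (rule that[of "1 / k"])
    fix x y :: 'a
    have "(\<integral>\<^sup>+t. ennreal (gauss t (x - y)) \<partial>rtime (1/k) \<alpha>) = ennreal (1 / k) * K (x - y)"
      using k unfolding K_def by (intro rtime_scale) auto
    also have "\<dots> = riesz_kernel \<alpha> x y"
      using k by (auto simp: riesz_kernel_def K0 Kx ennreal_mult_top ennreal_mult[symmetric])
    finally show "riesz_kernel \<alpha> x y = (\<integral>\<^sup>+t. ennreal (gauss t (x - y)) \<partial>rtime (1/k) \<alpha>)" ..
  qed (use k in auto)
qed

text \<open>With b = \<alpha>/2, the factor \<open>(s - r) powr (- b) / s\<close> is, up to a
  constant, the density of the position in which the stable subordinator first jumps over level r,
  and \<open>(x - s) powr (b - 1)\<close> is its potential density started from s.\<close>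

lemma nn_integral_overshoot:
  fixes b r x :: real
  assumes b: "0 < b" "b < 1" and r: "0 < r" "r < x"
  shows "(\<integral>\<^sup>+s. ennreal ((s - r) powr (- b) / s * (x - s) powr (b - 1)) * indicator {r..x} s \<partial>lborel)
     = ennreal (Beta (1 - b) b * (r powr (- b) * x powr (b - 1)))"
proof -
  define f :: "real \<Rightarrow> real" where "f w = w powr (- b) * (1 - w) powr (b - 1)" for w
  \<comment> \<open>This change of variable maps the interval from r to x onto the unit interval and
    turns the integrand into that of a Beta integral, up to the factor \<open>k\<close>.\<close>
  define g where "g s = x / (x - r) * (1 - r / s)" for s
  define g' where "g' s = x / (x - r) * (r / s\<^sup>2)" for s
  define k where "k = x powr (1 - b) * r powr b"
  have k: "0 < k" using r by (simp add: k_def)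
  have gr: "g r = 0" "g x = 1" using r by (auto simp: g_def field_simps)
  have "(\<integral>\<^sup>+w. ennreal (f w * indicator {g r..g x} w) \<partial>lborel) = (\<integral>\<^sup>+s. ennreal (f (g s) * g' s * indicator {r..x} s) \<partial>lborel)"
  proof (rule nn_integral_substitution)
    show "(g has_real_derivative g' s) (at s)" if "s \<in> {r..x}" for s
      unfolding g_def g'_def using that r
      by (auto intro!: derivative_eq_intros simp: power2_eq_square mult_ac)
    show "continuous_on {r..x} g'"
      unfolding g'_def using r by (intro continuous_intros) auto
    show "set_borel_measurable borel {g r..g x} f"
      unfolding set_borel_measurable_def f_def by measurable
  qed (use r in \<open>auto simp: g'_def\<close>)
  also have "(\<integral>\<^sup>+w. ennreal (f w * indicator {g r..g x} w) \<partial>lborel) = ennreal (Beta (1 - b) b)"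
  proof -
    have "(\<integral>\<^sup>+w. ennreal (f w) * indicator {0..1} w \<partial>lborel) = ennreal (Beta (1 - b) b)"
      by (rule nn_integral_has_integral_lebesgue')
         (use has_integral_Beta_real[of "1 - b" b] b in \<open>auto simp: f_def\<close>)
    moreover have "ennreal (f w * indicator {0..1} w) = ennreal (f w) * indicator {0..1} w" for w
      by (auto simp: indicator_def)
    ultimately show ?thesis by (simp add: gr)
  qed
  also have "(\<integral>\<^sup>+s. ennreal (f (g s) * g' s * indicator {r..x} s) \<partial>lborel) =
     (\<integral>\<^sup>+s. ennreal k * (ennreal ((s - r) powr (- b) / s * (x - s) powr (b - 1)) * indicator {r..x} s) \<partial>lborel)"
  proof (rule nn_integral_cong)
    fix s :: real
    have "f (g s) * g' s = k * ((s - r) powr (- b) / s * (x - s) powr (b - 1))" if s: "r \<le> s" "s \<le> x"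
    proof -
      have s0: "0 < s" using s r by simp
      have "1 - g s = r * (x - s) / ((x - r) * s)"
        using r s0 by (simp add: g_def field_simps)
      moreover have "g s = x * (s - r) / ((x - r) * s)"
        using r s0 by (simp add: g_def field_simps)
      ultimately have "f (g s) = (x powr (-b) * (s - r) powr (-b) / ((x - r) powr (-b) * s powr (-b))) *
          (r powr (b - 1) * (x - s) powr (b - 1) / ((x - r) powr (b - 1) * s powr (b - 1)))"
        unfolding f_def using r s s0 by (simp add: powr_mult powr_divide)
      then have "f (g s) * g' s = (x powr (-b) * x) * (r powr (b - 1) * r) / ((x - r) powr (-b) * (x - r) powr (b - 1) * (x - r)) / (s powr (-b) * s powr (b - 1) * s * s) * ((s - r) powr (-b) * (x - s) powr (b - 1))"
        by (simp add: g'_def power2_eq_square mult_ac)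
      moreover have "x powr (-b) * x = x powr (1 - b)" using r powr_add[of x "-b" 1] by simp
      moreover have "r powr (b - 1) * r = r powr b" using r powr_add[of r "b-1" 1] by simp
      moreover have "(x - r) powr (-b) * (x - r) powr (b - 1) * (x - r) = 1"
      proof -
        have "(x - r) powr (-b) * (x - r) powr (b - 1) = inverse (x - r)"
          using r by (simp add: powr_add[symmetric] powr_minus[of _ 1, simplified] inverse_eq_divide)
        then show ?thesis using r by simp
      qed
      moreover have "s powr (-b) * s powr (b - 1) * s * s = s"
      proof -
        have "s powr (-b) * s powr (b - 1) = inverse s"
          using s0 by (simp add: powr_add[symmetric] powr_minus[of _ 1, simplified] inverse_eq_divide)
        then show ?thesis using s0 by simp
      qed
      ultimately show ?thesis by (simp add: k_def)
    qed
    moreover have "ennreal (k * q) = ennreal k * ennreal q" if "0 \<le> q" for q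
      using that k by (simp add: ennreal_mult)
    ultimately show "ennreal (f (g s) * g' s * indicator {r..x} s) = ennreal k * (ennreal ((s - r) powr (- b) / s * (x - s) powr (b - 1)) * indicator {r..x} s)"
      using r by (cases "r \<le> s \<and> s \<le> x") (auto simp del: times_divide_eq_right times_divide_eq_left)
  qed
  also have "\<dots> = ennreal k * (\<integral>\<^sup>+s. ennreal ((s - r) powr (- b) / s * (x - s) powr (b - 1)) * indicator {r..x} s \<partial>lborel)"
    by (rule nn_integral_cmult) measurable
  finally have eq: "ennreal (Beta (1 - b) b) = ennreal k * (\<integral>\<^sup>+s. ennreal ((s - r) powr (- b) / s * (x - s) powr (b - 1)) * indicator {r..x} s \<partial>lborel)" .
  have k1: "1 / k = r powr (- b) * x powr (b - 1)"
    using r by (simp add: k_def powr_minus_divide powr_diff)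
  have "(\<integral>\<^sup>+s. ennreal ((s - r) powr (- b) / s * (x - s) powr (b - 1)) * indicator {r..x} s \<partial>lborel)
    = ennreal (1 / k) * ennreal (Beta (1 - b) b)"
    unfolding eq mult.assoc[symmetric] using k by (simp add: ennreal_mult[symmetric])
  also have "\<dots> = ennreal (Beta (1 - b) b * (r powr (- b) * x powr (b - 1)))"
    using k k1 b by (simp add: ennreal_mult''[symmetric] mult.commute)
  finally show ?thesis .
qed

text \<open>The strong Markov property at first passage over r: the potential measure beyond r is
  the law of the first passage position convolved with the potential measure. This is where \<alpha>
  <= 2 enters, as a subordinator has index \<alpha>/2 at most 1. For \<alpha> = 2 the motion is a
  drift and passes exactly at r.\<close>

lemma rtime_renewal:
  assumes \<alpha>: "0 < \<alpha>" "\<alpha> \<le> 2" and C: "0 < C" and r: "0 < r"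
  obtains \<eta> :: "real measure" where "sets \<eta> = sets borel" "sigma_finite_measure \<eta>" "AE s in \<eta>. r \<le> s"
    "\<And>\<phi> :: real \<Rightarrow> ennreal. \<phi> \<in> borel_measurable borel \<Longrightarrow>
      (\<integral>\<^sup>+t. (\<integral>\<^sup>+s. \<phi> (s + t) \<partial>\<eta>) \<partial>rtime C \<alpha>) = (\<integral>\<^sup>+x. \<phi> x * indicator {r<..} x \<partial>rtime C \<alpha>)"
proof (cases "\<alpha> = 2")
  case True
  show ?thesis
  proof (rule that[of "return borel r"])
    show "sigma_finite_measure (return borel r)"
      by (intro prob_space_imp_sigma_finite prob_space_return) simp
    show "AE s in return borel r. r \<le> s" by (subst AE_return) auto
    fix \<phi> :: "real \<Rightarrow> ennreal" assume [measurable]: "\<phi> \<in> borel_measurable borel"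
    have "(\<integral>\<^sup>+t. (\<integral>\<^sup>+s. \<phi> (s + t) \<partial>return borel r) \<partial>rtime C \<alpha>) = (\<integral>\<^sup>+t. \<phi> (r + t) \<partial>rtime C \<alpha>)"
      by (simp add: nn_integral_return)
    also have "\<dots> = (\<integral>\<^sup>+t. ennreal (C * t powr (\<alpha> / 2 - 1)) * indicator {0<..} t * \<phi> (r + t) \<partial>lborel)"
      by (rule nn_integral_rtime) measurable
    also have "\<dots> = (\<integral>\<^sup>+t. ennreal (C * (-r + t) powr (\<alpha> / 2 - 1)) * indicator {0<..} (-r + t) * \<phi> (r + (-r + t)) \<partial>lborel)"
      by (rule nn_integral_lborel_translate[symmetric]) measurable
    also have "\<dots> = (\<integral>\<^sup>+t. ennreal (C * t powr (\<alpha> / 2 - 1)) * indicator {0<..} t * (\<phi> t * indicator {r<..} t) \<partial>lborel)"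
      by (rule nn_integral_cong) (use r True in \<open>auto simp: indicator_def\<close>)
    also have "\<dots> = (\<integral>\<^sup>+x. \<phi> x * indicator {r<..} x \<partial>rtime C \<alpha>)"
      by (rule nn_integral_rtime[symmetric]) measurable
    finally show "(\<integral>\<^sup>+t. (\<integral>\<^sup>+s. \<phi> (s + t) \<partial>return borel r) \<partial>rtime C \<alpha>) = (\<integral>\<^sup>+x. \<phi> x * indicator {r<..} x \<partial>rtime C \<alpha>)" .
  qed simp
next
  case False
  define b where "b = \<alpha> / 2"
  have b: "0 < b" "b < 1" using \<alpha> False by (auto simp: b_def)
  define B where "B = (Beta (1 - b) b :: real)"
  have B: "0 < B" using b by (simp add: B_def Beta_def Gamma_real_pos)
  \<comment> \<open>The Dynkin-Lamperti density of the first passage position; the Beta value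
    normalises it.\<close>
  define e where "e s = ennreal (r powr b / B * ((s - r) powr (- b) / s)) * indicator {r..} s" for s
  have [measurable]: "e \<in> borel_measurable borel" unfolding e_def by measurable
  define \<eta> where "\<eta> = density lborel e"
  have [measurable_cong]: "sets \<eta> = sets borel" by (simp add: \<eta>_def)
  show ?thesis
  proof (rule that[of \<eta>])
    show "sets \<eta> = sets borel" by fact
    show "sigma_finite_measure \<eta>"
      unfolding \<eta>_def by (subst sigma_finite_measure.sigma_finite_iff_density_finite'[OF sigma_finite_lborel]) (auto simp: e_def ennreal_mult_eq_top_iff indicator_def)
    show "AE s in \<eta>. r \<le> s" unfolding \<eta>_def by (subst AE_density) (auto simp: e_def indicator_def)
    fix \<phi> :: "real \<Rightarrow> ennreal" assume [measurable]: "\<phi> \<in> borel_measurable borel"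
    define w where "w t = ennreal (C * t powr (b - 1)) * indicator {0<..} t" for t
    have [measurable]: "w \<in> borel_measurable borel" unfolding w_def by measurable
    \<comment> \<open>The renewal equation for densities. For x <= r the integrand vanishes, because
      s >= r leaves no positive time x - s.\<close>
    have inner: "(\<integral>\<^sup>+s. e s * w (x - s) \<partial>lborel) = w x * indicator {r<..} x" for x
    proof (cases "r < x")
      case True
      have "(\<integral>\<^sup>+s. e s * w (x - s) \<partial>lborel) = (\<integral>\<^sup>+s. ennreal (C * r powr b / B) * (ennreal ((s - r) powr (- b) / s * (x - s) powr (b - 1)) * indicator {r..x} s) \<partial>lborel)"
      proof (rule nn_integral_cong)
        fix s :: real
        show "e s * w (x - s) = ennreal (C * r powr b / B) * (ennreal ((s - r) powr (- b) / s * (x - s) powr (b - 1)) * indicator {r..x} s)"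
          \<comment> \<open>At s = x both sides vanish: on the left by the indicator, on the right
            because \<open>0 powr\<close> is 0.\<close>
          using r C B by (cases "s = x") (auto simp: e_def w_def indicator_def ennreal_mult[symmetric] mult_ac)
      qed
      also have "\<dots> = ennreal (C * r powr b / B) * ennreal (B * (r powr (- b) * x powr (b - 1)))"
        unfolding B_def using nn_integral_overshoot[OF b r True] by (subst nn_integral_cmult) auto
      also have "\<dots> = ennreal (C * x powr (b - 1))"
        using r True B C by (simp add: ennreal_mult[symmetric] powr_minus)
      finally show ?thesis using True r by (simp add: w_def)
    next
      case False
      then have "(\<lambda>s. e s * w (x - s)) = (\<lambda>_. 0)" by (auto simp: e_def w_def indicator_def)
      then show ?thesis using False by simp
    qed
    have "(\<integral>\<^sup>+t. (\<integral>\<^sup>+s. \<phi> (s + t) \<partial>\<eta>) \<partial>rtime C \<alpha>) = (\<integral>\<^sup>+t. w t * (\<integral>\<^sup>+s. e s * \<phi> (s + t) \<partial>lborel) \<partial>lborel)"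
      unfolding \<eta>_def by (subst nn_integral_rtime) (auto simp: w_def b_def nn_integral_density)
    also have "\<dots> = (\<integral>\<^sup>+t. (\<integral>\<^sup>+s. e s * w t * \<phi> (s + t) \<partial>lborel) \<partial>lborel)"
      by (intro nn_integral_cong) (auto simp: nn_integral_cmult[symmetric] mult_ac)
    also have "\<dots> = (\<integral>\<^sup>+s. (\<integral>\<^sup>+t. e s * w t * \<phi> (s + t) \<partial>lborel) \<partial>lborel)"
      by (rule lborel_pair.Fubini') measurable
    also have "\<dots> = (\<integral>\<^sup>+s. (\<integral>\<^sup>+x. e s * w (x - s) * \<phi> x \<partial>lborel) \<partial>lborel)"
    proof (rule nn_integral_cong)
      fix s :: real
      have "(\<integral>\<^sup>+t. e s * w t * \<phi> (s + t) \<partial>lborel) = (\<integral>\<^sup>+x. e s * w (-s + x) * \<phi> (s + (-s + x)) \<partial>lborel)"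
        by (rule nn_integral_lborel_translate[symmetric]) measurable
      then show "(\<integral>\<^sup>+t. e s * w t * \<phi> (s + t) \<partial>lborel) = (\<integral>\<^sup>+x. e s * w (x - s) * \<phi> x \<partial>lborel)" by simp
    qed
    also have "\<dots> = (\<integral>\<^sup>+x. (\<integral>\<^sup>+s. e s * w (x - s) * \<phi> x \<partial>lborel) \<partial>lborel)"
      by (rule lborel_pair.Fubini'[symmetric]) measurable
    also have "\<dots> = (\<integral>\<^sup>+x. (w x * (\<phi> x * indicator {r<..} x)) \<partial>lborel)"
    proof (rule nn_integral_cong)
      fix x :: real
      have "(\<integral>\<^sup>+s. e s * w (x - s) * \<phi> x \<partial>lborel) = (\<integral>\<^sup>+s. e s * w (x - s) \<partial>lborel) * \<phi> x"
        by (rule nn_integral_multc) measurable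
      then show "(\<integral>\<^sup>+s. e s * w (x - s) * \<phi> x \<partial>lborel) = w x * (\<phi> x * indicator {r<..} x)"
        by (simp add: inner mult_ac)
    qed
    also have "\<dots> = (\<integral>\<^sup>+x. \<phi> x * indicator {r<..} x \<partial>rtime C \<alpha>)"
      by (subst nn_integral_rtime) (auto simp: w_def b_def)
    finally show "(\<integral>\<^sup>+t. (\<integral>\<^sup>+s. \<phi> (s + t) \<partial>\<eta>) \<partial>rtime C \<alpha>) = (\<integral>\<^sup>+x. \<phi> x * indicator {r<..} x \<partial>rtime C \<alpha>)" .
  qed
qed


section \<open>Energies of measures\<close>

definition sigma_finite_borel :: "'a::euclidean_space measure \<Rightarrow> bool" where
  "sigma_finite_borel \<mu> \<longleftrightarrow> sigma_finite_measure \<mu> \<and> sets \<mu> = sets borel"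

lemma sigma_finite_borelD:
  assumes "sigma_finite_borel \<mu>"
  shows "sigma_finite_measure \<mu>" "sets \<mu> = sets borel" "space \<mu> = UNIV"
  using assms sets_eq_imp_space_eq[of \<mu> borel] by (auto simp: sigma_finite_borel_def)

lemma Tonelli_borel:
  assumes "sigma_finite_borel \<mu>" "sigma_finite_borel \<nu>"
    and "(\<lambda>(x, y). f x y) \<in> borel_measurable (borel \<Otimes>\<^sub>M borel)"
  shows "(\<integral>\<^sup>+x. (\<integral>\<^sup>+y. f x y \<partial>\<nu>) \<partial>\<mu>) = (\<integral>\<^sup>+y. (\<integral>\<^sup>+x. f x y \<partial>\<mu>) \<partial>\<nu>)"
proof -
  note [measurable_cong] = sigma_finite_borelD(2)[OF assms(1)] sigma_finite_borelD(2)[OF assms(2)]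
  interpret pair_sigma_finite \<mu> \<nu>
    by (simp add: pair_sigma_finite_def sigma_finite_borelD[OF assms(1)] sigma_finite_borelD[OF assms(2)])
  have "case_prod f \<in> borel_measurable (\<mu> \<Otimes>\<^sub>M \<nu>)" using assms(3) by measurable
  from Fubini'[OF this] show ?thesis by simp
qed

lemma borel_measurable_nn_integral_snd:
  assumes "sigma_finite_borel \<nu>"
    and "(\<lambda>(x, y). f x y) \<in> borel_measurable (N \<Otimes>\<^sub>M borel)"
  shows "(\<lambda>x. \<integral>\<^sup>+y. f x y \<partial>\<nu>) \<in> borel_measurable N"
proof -
  note [measurable_cong] = sigma_finite_borelD(2)[OF assms(1)]
  interpret sigma_finite_measure \<nu> by (rule sigma_finite_borelD[OF assms(1)])
  have "case_prod f \<in> borel_measurable (N \<Otimes>\<^sub>M \<nu>)" using assms(2) by measurable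
  then show ?thesis by (rule borel_measurable_nn_integral)
qed

lemma sigma_finite_borel_lborel: "sigma_finite_borel lborel"
  by (simp add: sigma_finite_borel_def sigma_finite_lborel)

lemma sigma_finite_borel_rtime: "sigma_finite_borel (rtime C \<alpha>)"
  by (simp add: sigma_finite_borel_def sigma_finite_rtime)

lemma sigma_finite_borel_finite:
  "sets \<mu> = sets borel \<Longrightarrow> emeasure \<mu> UNIV < \<infinity> \<Longrightarrow> sigma_finite_borel \<mu>"
  using sets_eq_imp_space_eq[of \<mu> borel]
  by (auto simp: sigma_finite_borel_def intro!: finite_measure.axioms(1) finite_measureI)

lemma sigma_finite_borel_locally_finite:
  fixes \<mu> :: "'a::euclidean_space measure"
  assumes "sets \<mu> = sets borel" "\<And>K. compact K \<Longrightarrow> emeasure \<mu> K < \<infinity>"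
  shows "sigma_finite_borel \<mu>"
proof -
  have "sigma_finite_measure \<mu>"
  proof
    show "\<exists>A. countable A \<and> A \<subseteq> sets \<mu> \<and> \<Union>A = space \<mu> \<and> (\<forall>a\<in>A. emeasure \<mu> a \<noteq> \<infinity>)"
    proof (intro exI conjI)
      show "\<Union>(range (\<lambda>k::nat. cball (0::'a) (real k))) = space \<mu>"
        using sets_eq_imp_space_eq[OF assms(1)] by (auto intro: real_arch_simple)
    qed (use assms in \<open>auto simp: less_top[symmetric] dest: order.strict_implies_not_eq\<close>)
  qed
  then show ?thesis using assms by (simp add: sigma_finite_borel_def)
qed

lemma sigma_finite_borel_density:
  assumes "sigma_finite_borel \<mu>" "f \<in> borel_measurable borel" "AE x in \<mu>. f x < \<infinity>"
  shows "sigma_finite_borel (density \<mu> f)"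
proof -
  have "f \<in> borel_measurable \<mu>" using assms(1,2) by (simp add: sigma_finite_borel_def cong: measurable_cong_sets)
  then show ?thesis
    using assms sigma_finite_measure.sigma_finite_iff_density_finite'[OF sigma_finite_borelD(1)[OF assms(1)], of f]
    by (auto simp: sigma_finite_borel_def less_top)
qed

lemma nn_integral_density_borel:
  assumes "sets \<mu> = sets borel" "f \<in> borel_measurable borel" "g \<in> borel_measurable borel"
  shows "(\<integral>\<^sup>+x. g x \<partial>density \<mu> f) = (\<integral>\<^sup>+x. f x * g x \<partial>\<mu>)"
  using assms by (intro nn_integral_density) (auto cong: measurable_cong_sets)

lemma nn_integral_add_measure:
  assumes s: "sets \<mu> = sets borel" "sets \<nu> = sets borel" and f: "f \<in> borel_measurable borel"
  shows "(\<integral>\<^sup>+x. f x \<partial>add_measure \<mu> \<nu>) = (\<integral>\<^sup>+x. f x \<partial>\<mu>) + (\<integral>\<^sup>+x. f x \<partial>\<nu>)"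
  using f
proof (induction rule: borel_measurable_induct)
  case (cong f g)
  then show ?case using s sets_eq_imp_space_eq[OF s(1)] sets_eq_imp_space_eq[OF s(2)]
    by (metis (full_types) ext space_borel UNIV_I)
next
  case (set A)
  then show ?case using s by (simp add: emeasure_add_measure)
next
  case (mult u c)
  then show ?case using s
    by (subst (1 2 3) nn_integral_cmult) (auto simp: distrib_left cong: measurable_cong_sets)
next
  case (add u v)
  then show ?case using s
    by (subst (1 2 3) nn_integral_add) (auto simp: ac_simps cong: measurable_cong_sets)
next
  case (seq U)
  have m: "U i \<in> borel_measurable \<mu>" "U i \<in> borel_measurable \<nu>" "U i \<in> borel_measurable (add_measure \<mu> \<nu>)" for i
    using seq(1) s by (auto cong: measurable_cong_sets)
  have sup: "(\<integral>\<^sup>+x. (SUP i. U i) x \<partial>M) = (SUP i. \<integral>\<^sup>+x. U i x \<partial>M)" if "\<And>i. U i \<in> borel_measurable M" for M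
    using seq.hyps that by (simp add: nn_integral_monotone_convergence_SUP image_comp)
  show ?case
    unfolding sup[OF m(1)] sup[OF m(2)] sup[OF m(3)] seq.IH
    by (rule ennreal_SUP_add) (use seq.hyps in \<open>auto simp: incseq_def le_fun_def intro!: nn_integral_mono\<close>)
qed

text \<open>Take the smaller of two strictly positive integrable functions, one for each measure: it
  is integrable for the sum, and its superlevel sets exhaust the space with finite mass.\<close>

lemma sigma_finite_borel_add:
  assumes "sigma_finite_borel \<mu>" "sigma_finite_borel \<nu>"
  shows "sigma_finite_borel (add_measure \<mu> \<nu>)"
proof -
  note s = sigma_finite_borelD[OF assms(1)] sigma_finite_borelD[OF assms(2)]
  have sp: "space (add_measure \<mu> \<nu>) = UNIV" using s by (simp add: add_measure_def space_measure_of_conv)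
  obtain f g where f: "f \<in> borel_measurable \<mu>" "integral\<^sup>N \<mu> f \<noteq> \<infinity>" "\<And>x. x \<in> space \<mu> \<Longrightarrow> 0 < f x" "\<And>x. x \<in> space \<mu> \<Longrightarrow> f x < \<infinity>"
    and g: "g \<in> borel_measurable \<nu>" "integral\<^sup>N \<nu> g \<noteq> \<infinity>" "\<And>x. x \<in> space \<nu> \<Longrightarrow> 0 < g x" "\<And>x. x \<in> space \<nu> \<Longrightarrow> g x < \<infinity>"
    using sigma_finite_measure.Ex_finite_integrable_function[OF s(1)]
      sigma_finite_measure.Ex_finite_integrable_function[OF s(4)] by auto
  define h where "h x = min (f x) (g x)" for x
  have [measurable]: "f \<in> borel_measurable borel" "g \<in> borel_measurable borel"
    using f g s by (auto cong: measurable_cong_sets)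
  have hm[measurable]: "h \<in> borel_measurable borel" unfolding h_def by measurable
  have "(\<integral>\<^sup>+x. h x \<partial>add_measure \<mu> \<nu>) = (\<integral>\<^sup>+x. h x \<partial>\<mu>) + (\<integral>\<^sup>+x. h x \<partial>\<nu>)"
    using s by (intro nn_integral_add_measure) auto
  also have "\<dots> \<le> (\<integral>\<^sup>+x. f x \<partial>\<mu>) + (\<integral>\<^sup>+x. g x \<partial>\<nu>)"
    by (intro add_mono nn_integral_mono) (auto simp: h_def)
  also have "\<dots> < \<infinity>" using f(2) g(2) by (simp add: less_top)
  finally have fin: "(\<integral>\<^sup>+x. h x \<partial>add_measure \<mu> \<nu>) < \<infinity>" .
  have hpos: "0 < h x" for x using f(3)[of x] g(3)[of x] s by (simp add: h_def)
  define S where "S k = {x. ennreal (1 / Suc k) \<le> h x}" for k :: nat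
  have [measurable]: "S k \<in> sets borel" for k unfolding S_def by measurable
  have "sigma_finite_measure (add_measure \<mu> \<nu>)"
  proof
    show "\<exists>A. countable A \<and> A \<subseteq> sets (add_measure \<mu> \<nu>) \<and> \<Union>A = space (add_measure \<mu> \<nu>) \<and> (\<forall>a\<in>A. emeasure (add_measure \<mu> \<nu>) a \<noteq> \<infinity>)"
    proof (intro exI[of _ "range S"] conjI ballI)
      show "\<Union>(range S) = space (add_measure \<mu> \<nu>)"
      proof -
        have "\<exists>k. ennreal (1 / Suc k) \<le> h x" for x
        proof (cases "h x")
          case (real r)
          then have "0 < r" using hpos[of x] by (simp add: ennreal_less_zero_iff)
          then obtain k where "inverse (real (Suc k)) < r" using reals_Archimedean by blast
          then show ?thesis using real by (auto intro!: exI[of _ k] ennreal_leI simp: inverse_eq_divide)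
        qed simp
        then show ?thesis by (auto simp: sp S_def)
      qed
      fix a assume "a \<in> range S"
      then obtain k where a: "a = S k" by auto
      have "ennreal (1 / Suc k) * emeasure (add_measure \<mu> \<nu>) (S k) = (\<integral>\<^sup>+x. ennreal (1 / Suc k) * indicator (S k) x \<partial>add_measure \<mu> \<nu>)"
        using s by (subst nn_integral_cmult_indicator) auto
      also have "\<dots> \<le> (\<integral>\<^sup>+x. h x \<partial>add_measure \<mu> \<nu>)"
        by (intro nn_integral_mono) (auto simp: S_def indicator_def)
      finally show "emeasure (add_measure \<mu> \<nu>) a \<noteq> \<infinity>"
        using fin unfolding a by (auto simp: ennreal_mult_top)
    qed (use s in auto)
  qed
  then show ?thesis using s by (simp add: sigma_finite_borel_def)
qed

lemma riesz_kernel_measurable [measurable]: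
  assumes [measurable]: "f \<in> borel_measurable M" "g \<in> borel_measurable M"
  shows "(\<lambda>w. riesz_kernel \<alpha> (f w) (g w :: 'a::euclidean_space)) \<in> borel_measurable M"
  unfolding riesz_kernel_def by measurable

lemma riesz_kernel_commute: "riesz_kernel \<alpha> x y = riesz_kernel \<alpha> y x"
  by (auto simp: riesz_kernel_def norm_minus_commute)

lemma potential_measurable [measurable (raw)]:
  assumes "sigma_finite_borel \<mu>" and [measurable]: "f \<in> borel_measurable M"
  shows "(\<lambda>x. potential \<alpha> \<mu> (f x)) \<in> borel_measurable M"
  unfolding potential_def by (rule borel_measurable_nn_integral_snd[OF assms(1)]) measurable

lemma nn_integral_potential_commute:
  assumes "sigma_finite_borel \<mu>" "sigma_finite_borel \<nu>"
  shows "(\<integral>\<^sup>+x. potential \<alpha> \<mu> x \<partial>\<nu>) = (\<integral>\<^sup>+x. potential \<alpha> \<nu> x \<partial>\<mu>)"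
  unfolding potential_def by (subst Tonelli_borel[OF assms(2,1)]) (simp_all add: riesz_kernel_commute)

lemma mutual_energy_potential: "mutual_energy \<alpha> \<mu> \<nu> = (\<integral>\<^sup>+x. potential \<alpha> \<nu> x \<partial>\<mu>)"
  by (simp add: mutual_energy_def potential_def)

lemma mutual_energy_commute:
  assumes "sigma_finite_borel \<mu>" "sigma_finite_borel \<nu>"
  shows "mutual_energy \<alpha> \<mu> \<nu> = mutual_energy \<alpha> \<nu> \<mu>"
  unfolding mutual_energy_potential by (rule nn_integral_potential_commute[OF assms(2,1)])

lemma potential_add_measure:
  assumes "sets \<mu> = sets borel" "sets \<nu> = sets borel"
  shows "potential \<alpha> (add_measure \<mu> \<nu>) x = potential \<alpha> \<mu> x + potential \<alpha> \<nu> x"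
  unfolding potential_def by (rule nn_integral_add_measure[OF assms]) measurable

lemma mutual_energy_add_left:
  assumes "sigma_finite_borel \<mu>" "sigma_finite_borel \<nu>" "sigma_finite_borel \<rho>"
  shows "mutual_energy \<alpha> (add_measure \<mu> \<nu>) \<rho> = mutual_energy \<alpha> \<mu> \<rho> + mutual_energy \<alpha> \<nu> \<rho>"
  unfolding mutual_energy_potential using assms
  by (intro nn_integral_add_measure) (auto dest: sigma_finite_borelD(2))

lemma mutual_energy_add_right:
  assumes "sigma_finite_borel \<mu>" "sigma_finite_borel \<nu>" "sigma_finite_borel \<rho>"
  shows "mutual_energy \<alpha> \<rho> (add_measure \<mu> \<nu>) = mutual_energy \<alpha> \<rho> \<mu> + mutual_energy \<alpha> \<rho> \<nu>"
  using mutual_energy_add_left[OF assms] assms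
  by (simp add: mutual_energy_commute[of \<rho>] sigma_finite_borel_add)

definition scale_borel :: "real \<Rightarrow> 'a measure \<Rightarrow> 'a measure" where
  "scale_borel c \<mu> = density \<mu> (\<lambda>_. ennreal c)"

lemma sets_scale_borel [simp]: "sets (scale_borel c \<mu>) = sets \<mu>"
  by (simp add: scale_borel_def)

lemma sigma_finite_borel_scale: "sigma_finite_borel \<mu> \<Longrightarrow> sigma_finite_borel (scale_borel c \<mu>)"
  unfolding scale_borel_def by (rule sigma_finite_borel_density) auto

lemma nn_integral_scale_borel:
  assumes "sets \<mu> = sets borel" "f \<in> borel_measurable borel"
  shows "(\<integral>\<^sup>+x. f x \<partial>scale_borel c \<mu>) = ennreal c * (\<integral>\<^sup>+x. f x \<partial>\<mu>)"
  unfolding scale_borel_def using assms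
  by (subst nn_integral_density_borel) (auto intro!: nn_integral_cmult cong: measurable_cong_sets)

lemma emeasure_scale_borel:
  assumes "sets \<mu> = sets borel" "A \<in> sets borel"
  shows "emeasure (scale_borel c \<mu>) A = ennreal c * emeasure \<mu> A"
  using assms nn_integral_scale_borel[of \<mu> "indicator A" c] by simp

lemma potential_scale:
  assumes "sets \<mu> = sets borel"
  shows "potential \<alpha> (scale_borel c \<mu>) x = ennreal c * potential \<alpha> \<mu> x"
  unfolding potential_def by (rule nn_integral_scale_borel[OF assms]) measurable

lemma mutual_energy_scale_left:
  assumes "sigma_finite_borel \<mu>" "sigma_finite_borel \<nu>"
  shows "mutual_energy \<alpha> (scale_borel c \<mu>) \<nu> = ennreal c * mutual_energy \<alpha> \<mu> \<nu>"
  unfolding mutual_energy_potential using assms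
  by (intro nn_integral_scale_borel) (auto dest: sigma_finite_borelD(2))

lemma mutual_energy_scale_right:
  assumes "sigma_finite_borel \<mu>" "sigma_finite_borel \<nu>"
  shows "mutual_energy \<alpha> \<mu> (scale_borel c \<nu>) = ennreal c * mutual_energy \<alpha> \<mu> \<nu>"
  using mutual_energy_scale_left[OF assms(2,1)] assms
  by (simp add: mutual_energy_commute[of \<mu>] sigma_finite_borel_scale)

lemma nn_integral_mono_dominated:
  assumes "sets \<mu> = sets borel" "sets \<nu> = sets borel" "\<And>A. A \<in> sets borel \<Longrightarrow> emeasure \<mu> A \<le> emeasure \<nu> A"
  shows "(\<integral>\<^sup>+x. f x \<partial>\<mu>) \<le> (\<integral>\<^sup>+x. f x \<partial>\<nu>)"
proof (rule nn_integral_mono_measure)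
  have "emeasure \<mu> A \<le> emeasure \<nu> A" for A
    using assms by (cases "A \<in> sets borel") (auto simp: emeasure_notin_sets)
  then show "\<mu> \<le> \<nu>"
    using assms sets_eq_imp_space_eq[of \<mu> \<nu>] by (auto simp: less_eq_measure.simps le_fun_def)
qed (use assms in auto)

lemma mutual_energy_mono:
  assumes "sets \<mu> = sets borel" "sets \<nu> = sets borel" "\<And>A. A \<in> sets borel \<Longrightarrow> emeasure \<mu> A \<le> emeasure \<nu> A"
  assumes "sets \<mu>' = sets borel" "sets \<nu>' = sets borel" "\<And>A. A \<in> sets borel \<Longrightarrow> emeasure \<mu>' A \<le> emeasure \<nu>' A"
  shows "mutual_energy \<alpha> \<mu> \<mu>' \<le> mutual_energy \<alpha> \<nu> \<nu>'"
proof -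
  have "mutual_energy \<alpha> \<mu> \<mu>' \<le> mutual_energy \<alpha> \<nu> \<mu>'"
    unfolding mutual_energy_def by (rule nn_integral_mono_dominated[OF assms(1-3)])
  also have "\<dots> \<le> mutual_energy \<alpha> \<nu> \<nu>'"
    unfolding mutual_energy_def by (intro nn_integral_mono nn_integral_mono_dominated[OF assms(4-6)])
  finally show ?thesis .
qed

section \<open>Heat evolutions and the energy as an inner product\<close>

definition heat :: "real \<Rightarrow> 'a::euclidean_space measure \<Rightarrow> 'a \<Rightarrow> ennreal" where
  "heat t \<mu> z = (\<integral>\<^sup>+x. ennreal (gauss t (z - x)) \<partial>\<mu>)"

lemma heat_measurable [measurable (raw)]:
  assumes "sigma_finite_borel \<mu>" and [measurable]: "f \<in> borel_measurable M" "g \<in> borel_measurable M"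
  shows "(\<lambda>w. heat (f w) \<mu> (g w)) \<in> borel_measurable M"
  unfolding heat_def by (rule borel_measurable_nn_integral_snd[OF assms(1)]) measurable

text \<open>Everything below uses the kernel only through this mixture and its explicit formula.
  \<open>dummy\<close> fixes the type of points, which neither \<alpha> nor \<open>C\<close>
  mentions.\<close>

locale riesz_space =
  fixes \<alpha> C :: real and dummy :: "'a::euclidean_space itself"
  assumes alpha: "0 < \<alpha>" "\<alpha> \<le> 2" and dim: "3 \<le> DIM('a)" and C: "0 < C"
    and kernel_mixture: "\<And>x y::'a. riesz_kernel \<alpha> x y = (\<integral>\<^sup>+t. ennreal (gauss t (x - y)) \<partial>rtime C \<alpha>)"
begin

lemma alpha_less_dim: "\<alpha> < real DIM('a)"
  using alpha dim by linarith

text \<open>Each measure evolves for half of the time; the semigroup law reassembles the Gaussian of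
  the full time.\<close>

lemma heat_inner:
  fixes \<mu> \<nu> :: "'a measure"
  assumes \<mu>: "sigma_finite_borel \<mu>" and \<nu>: "sigma_finite_borel \<nu>" and t: "0 < t"
  shows "(\<integral>\<^sup>+z. heat (t/2) \<mu> z * heat (t/2) \<nu> z \<partial>lborel) = (\<integral>\<^sup>+x. (\<integral>\<^sup>+y. ennreal (gauss t (x - y)) \<partial>\<nu>) \<partial>\<mu>)"
proof -
  note [measurable (raw)] = heat_measurable[OF \<mu>] heat_measurable[OF \<nu>]
  note [measurable_cong] = sigma_finite_borelD(2)[OF \<mu>] sigma_finite_borelD(2)[OF \<nu>]
  have "(\<integral>\<^sup>+z. heat (t/2) \<mu> z * heat (t/2) \<nu> z \<partial>lborel) = (\<integral>\<^sup>+z. (\<integral>\<^sup>+x. ennreal (gauss (t/2) (z - x)) * heat (t/2) \<nu> z \<partial>\<mu>) \<partial>lborel)"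
    unfolding heat_def[of _ \<mu>] by (intro nn_integral_cong nn_integral_multc[symmetric]) measurable
  also have "\<dots> = (\<integral>\<^sup>+x. (\<integral>\<^sup>+z. ennreal (gauss (t/2) (z - x)) * heat (t/2) \<nu> z \<partial>lborel) \<partial>\<mu>)"
    by (rule Tonelli_borel[OF sigma_finite_borel_lborel \<mu>]) measurable
  also have "\<dots> = (\<integral>\<^sup>+x. (\<integral>\<^sup>+y. ennreal (gauss t (x - y)) \<partial>\<nu>) \<partial>\<mu>)"
  proof (rule nn_integral_cong)
    fix x :: 'a
    have "(\<integral>\<^sup>+z. ennreal (gauss (t/2) (z - x)) * heat (t/2) \<nu> z \<partial>lborel) = (\<integral>\<^sup>+z. (\<integral>\<^sup>+y. ennreal (gauss (t/2) (x - z)) * ennreal (gauss (t/2) (z - y)) \<partial>\<nu>) \<partial>lborel)"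
      unfolding heat_def by (subst gauss_commute) (intro nn_integral_cong nn_integral_cmult[symmetric], measurable)
    also have "\<dots> = (\<integral>\<^sup>+y. (\<integral>\<^sup>+z. ennreal (gauss (t/2) (x - z)) * ennreal (gauss (t/2) (z - y)) \<partial>lborel) \<partial>\<nu>)"
      by (rule Tonelli_borel[OF sigma_finite_borel_lborel \<nu>]) measurable
    also have "\<dots> = (\<integral>\<^sup>+y. ennreal (gauss t (x - y)) \<partial>\<nu>)"
      using t by (simp add: gauss_conv)
    finally show "(\<integral>\<^sup>+z. ennreal (gauss (t/2) (z - x)) * heat (t/2) \<nu> z \<partial>lborel) = (\<integral>\<^sup>+y. ennreal (gauss t (x - y)) \<partial>\<nu>)" .
  qed
  finally show ?thesis .
qed

text \<open>This is the source of positivity: the energy becomes the inner product of the functions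
  (t, z) -> \<open>heat (t/2) \<mu> z\<close>, so Cauchy-Schwarz for integrals applies.\<close>

lemma energy_heat:
  fixes \<mu> \<nu> :: "'a measure"
  assumes \<mu>: "sigma_finite_borel \<mu>" and \<nu>: "sigma_finite_borel \<nu>"
  shows "mutual_energy \<alpha> \<mu> \<nu> = (\<integral>\<^sup>+t. (\<integral>\<^sup>+z. heat (t/2) \<mu> z * heat (t/2) \<nu> z \<partial>lborel) \<partial>rtime C \<alpha>)"
proof -
  have "mutual_energy \<alpha> \<mu> \<nu> = (\<integral>\<^sup>+x. (\<integral>\<^sup>+t. (\<integral>\<^sup>+y. ennreal (gauss t (x - y)) \<partial>\<nu>) \<partial>rtime C \<alpha>) \<partial>\<mu>)"
    unfolding mutual_energy_def kernel_mixture
    by (intro nn_integral_cong Tonelli_borel[OF \<nu> sigma_finite_borel_rtime]) measurable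
  also have "\<dots> = (\<integral>\<^sup>+t. (\<integral>\<^sup>+x. (\<integral>\<^sup>+y. ennreal (gauss t (x - y)) \<partial>\<nu>) \<partial>\<mu>) \<partial>rtime C \<alpha>)"
  proof (rule Tonelli_borel[OF \<mu> sigma_finite_borel_rtime])
    have "(\<lambda>w. \<integral>\<^sup>+y. ennreal (gauss (snd w) (fst w - y)) \<partial>\<nu>) \<in> borel_measurable (borel \<Otimes>\<^sub>M borel)"
      by (rule borel_measurable_nn_integral_snd[OF \<nu>]) measurable
    then show "(\<lambda>(x, t). \<integral>\<^sup>+y. ennreal (gauss t (x - y)) \<partial>\<nu>) \<in> borel_measurable (borel \<Otimes>\<^sub>M borel)"
      by (simp add: case_prod_beta')
  qed
  also have "\<dots> = (\<integral>\<^sup>+t. (\<integral>\<^sup>+z. heat (t/2) \<mu> z * heat (t/2) \<nu> z \<partial>lborel) \<partial>rtime C \<alpha>)"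
    by (rule nn_integral_cong_AE, rule AE_mp[OF AE_rtime_pos], rule AE_I2) (simp add: heat_inner[OF \<mu> \<nu>])
  finally show ?thesis .
qed

lemma energy_heat_pair:
  fixes \<mu> \<nu> :: "'a measure"
  assumes \<mu>: "sigma_finite_borel \<mu>" and \<nu>: "sigma_finite_borel \<nu>"
  shows "mutual_energy \<alpha> \<mu> \<nu> = (\<integral>\<^sup>+w. heat (fst w / 2) \<mu> (snd w) * heat (fst w / 2) \<nu> (snd w) \<partial>(rtime C \<alpha> \<Otimes>\<^sub>M lborel))"
proof -
  note [measurable (raw)] = heat_measurable[OF \<mu>] heat_measurable[OF \<nu>]
  have "(\<lambda>w. heat (fst w / 2) \<mu> (snd w) * heat (fst w / 2) \<nu> (snd w)) \<in> borel_measurable (rtime C \<alpha> \<Otimes>\<^sub>M lborel)"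
    by measurable
  from sigma_finite_measure.nn_integral_fst[OF sigma_finite_lborel this] show ?thesis
    unfolding energy_heat[OF \<mu> \<nu>] by simp
qed

lemma energy_Cauchy_Schwarz:
  fixes \<mu> \<nu> :: "'a measure"
  assumes \<mu>: "sigma_finite_borel \<mu>" and \<nu>: "sigma_finite_borel \<nu>"
  shows "(mutual_energy \<alpha> \<mu> \<nu>)\<^sup>2 \<le> mutual_energy \<alpha> \<mu> \<mu> * mutual_energy \<alpha> \<nu> \<nu>"
proof -
  note [measurable (raw)] = heat_measurable[OF \<mu>] heat_measurable[OF \<nu>]
  show ?thesis
    unfolding energy_heat_pair[OF \<mu> \<mu>] energy_heat_pair[OF \<nu> \<nu>] energy_heat_pair[OF \<mu> \<nu>] power2_eq_square[symmetric]
    unfolding power2_eq_square[of "nn_integral _ _"] 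
    using Cauchy_Schwarz_nn_integral[of "\<lambda>w. heat (fst w / 2) \<mu> (snd w)" "rtime C \<alpha> \<Otimes>\<^sub>M lborel" "\<lambda>w. heat (fst w / 2) \<nu> (snd w)"]
    by (simp add: power2_eq_square)
qed

definition finite_energy_measure :: "'a measure \<Rightarrow> bool" where
  "finite_energy_measure \<mu> \<longleftrightarrow> sigma_finite_borel \<mu> \<and> mutual_energy \<alpha> \<mu> \<mu> < \<infinity>"

definition en :: "'a measure \<Rightarrow> 'a measure \<Rightarrow> real" where
  "en \<mu> \<nu> = enn2real (mutual_energy \<alpha> \<mu> \<nu>)"

lemma finite_energy_measureD:
  assumes "finite_energy_measure \<mu>"
  shows "sigma_finite_borel \<mu>" "mutual_energy \<alpha> \<mu> \<mu> < \<infinity>" "sets \<mu> = sets borel"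
  using assms by (auto simp: finite_energy_measure_def sigma_finite_borel_def)

lemma mutual_energy_finite:
  assumes "finite_energy_measure \<mu>" "finite_energy_measure \<nu>"
  shows "mutual_energy \<alpha> \<mu> \<nu> < \<infinity>"
proof -
  have "(mutual_energy \<alpha> \<mu> \<nu>)\<^sup>2 \<le> mutual_energy \<alpha> \<mu> \<mu> * mutual_energy \<alpha> \<nu> \<nu>"
    using assms by (intro energy_Cauchy_Schwarz) (auto dest: finite_energy_measureD)
  also have "\<dots> < \<infinity>" using assms by (auto simp: ennreal_mult_less_top dest: finite_energy_measureD)
  finally show ?thesis by (auto simp: power2_eq_square ennreal_mult_less_top)
qed

lemma ennreal_en:
  assumes "finite_energy_measure \<mu>" "finite_energy_measure \<nu>"
  shows "mutual_energy \<alpha> \<mu> \<nu> = ennreal (en \<mu> \<nu>)"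
  using mutual_energy_finite[OF assms] by (simp add: en_def ennreal_enn2real less_top)

lemma en_nonneg [simp]: "0 \<le> en \<mu> \<nu>"
  by (simp add: en_def)

lemma en_commute:
  assumes "finite_energy_measure \<mu>" "finite_energy_measure \<nu>"
  shows "en \<mu> \<nu> = en \<nu> \<mu>"
  using assms mutual_energy_commute[of \<mu> \<nu> \<alpha>] by (simp add: en_def finite_energy_measureD)

lemma finite_energy_measure_add:
  assumes "finite_energy_measure \<mu>" "finite_energy_measure \<nu>"
  shows "finite_energy_measure (add_measure \<mu> \<nu>)"
  unfolding finite_energy_measure_def
  using finite_energy_measureD[OF assms(1)] finite_energy_measureD[OF assms(2)]
    mutual_energy_finite[OF assms] mutual_energy_finite[OF assms(2,1)]
  by (simp add: mutual_energy_add_left mutual_energy_add_right sigma_finite_borel_add)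

lemma finite_energy_measure_scale:
  assumes "finite_energy_measure \<mu>"
  shows "finite_energy_measure (scale_borel c \<mu>)"
  unfolding finite_energy_measure_def using finite_energy_measureD[OF assms]
  by (simp add: mutual_energy_scale_left mutual_energy_scale_right sigma_finite_borel_scale ennreal_mult_less_top)

lemma finite_energy_measure_mono:
  assumes "finite_energy_measure \<nu>" "sigma_finite_borel \<mu>" "\<And>A. A \<in> sets borel \<Longrightarrow> emeasure \<mu> A \<le> emeasure \<nu> A"
  shows "finite_energy_measure \<mu>"
  unfolding finite_energy_measure_def
  using assms le_less_trans[OF mutual_energy_mono[of \<mu> \<nu> \<mu> \<nu> \<alpha>] finite_energy_measureD(2)[OF assms(1)]]
  by (auto dest: finite_energy_measureD sigma_finite_borelD)

lemma en_add_left: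
  assumes "finite_energy_measure \<mu>" "finite_energy_measure \<nu>" "finite_energy_measure \<rho>"
  shows "en (add_measure \<mu> \<nu>) \<rho> = en \<mu> \<rho> + en \<nu> \<rho>"
  using assms mutual_energy_finite[OF assms(1,3)] mutual_energy_finite[OF assms(2,3)]
  by (simp add: en_def mutual_energy_add_left finite_energy_measureD enn2real_plus)

lemma en_add_right:
  assumes "finite_energy_measure \<mu>" "finite_energy_measure \<nu>" "finite_energy_measure \<rho>"
  shows "en \<rho> (add_measure \<mu> \<nu>) = en \<rho> \<mu> + en \<rho> \<nu>"
  using en_add_left[OF assms] assms by (simp add: en_commute[of \<rho>] finite_energy_measure_add)

lemma en_scale_left:
  assumes "finite_energy_measure \<mu>" "finite_energy_measure \<nu>" "0 \<le> c"
  shows "en (scale_borel c \<mu>) \<nu> = c * en \<mu> \<nu>"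
  using assms by (simp add: en_def mutual_energy_scale_left finite_energy_measureD enn2real_mult)

lemma en_scale_right:
  assumes "finite_energy_measure \<mu>" "finite_energy_measure \<nu>" "0 \<le> c"
  shows "en \<mu> (scale_borel c \<nu>) = c * en \<mu> \<nu>"
  using assms by (simp add: en_def mutual_energy_scale_right finite_energy_measureD enn2real_mult)

lemma en_Cauchy_Schwarz:
  assumes "finite_energy_measure \<mu>" "finite_energy_measure \<nu>"
  shows "(en \<mu> \<nu>)\<^sup>2 \<le> en \<mu> \<mu> * en \<nu> \<nu>"
proof -
  have "ennreal ((en \<mu> \<nu>)\<^sup>2) \<le> ennreal (en \<mu> \<mu> * en \<nu> \<nu>)"
    using energy_Cauchy_Schwarz[of \<mu> \<nu>] assms
    by (simp add: ennreal_en finite_energy_measureD ennreal_mult ennreal_power)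
  then show ?thesis by (subst (asm) ennreal_le_iff) auto
qed

lemma en_diff_nonneg:
  assumes "finite_energy_measure \<mu>" "finite_energy_measure \<nu>"
  shows "0 \<le> en \<mu> \<mu> + en \<nu> \<nu> - 2 * en \<mu> \<nu>"
proof -
  have "en \<mu> \<nu> \<le> sqrt (en \<mu> \<mu> * en \<nu> \<nu>)"
    by (rule real_le_rsqrt[OF en_Cauchy_Schwarz[OF assms]])
  then have "2 * en \<mu> \<nu> \<le> en \<mu> \<mu> + en \<nu> \<nu>"
    using arith_geo_mean_sqrt[of "en \<mu> \<mu>" "en \<nu> \<nu>"] by simp
  then show ?thesis by simp
qed

text \<open>Cauchy-Schwarz for the signed measure \<mu> - \<nu> without forming it: the energy of
  \<mu> - \<nu> + s \<gamma> is a nonnegative quadratic polynomial in s.\<close>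

lemma en_diff_Cauchy_Schwarz:
  assumes "finite_energy_measure \<mu>" "finite_energy_measure \<nu>" "finite_energy_measure \<gamma>"
  shows "(en \<mu> \<gamma> - en \<nu> \<gamma>)\<^sup>2 \<le> (en \<mu> \<mu> + en \<nu> \<nu> - 2 * en \<mu> \<nu>) * en \<gamma> \<gamma>"
proof -
  define A where "A = en \<mu> \<mu> + en \<nu> \<nu> - 2 * en \<mu> \<nu>"
  define B where "B = en \<mu> \<gamma> - en \<nu> \<gamma>"
  define G where "G = en \<gamma> \<gamma>"
  \<comment> \<open>Since \<open>scale_borel\<close> takes nonnegative factors, the sign of s
    decides which of the two measures receives the multiple of \<gamma>.\<close>
  have pos: "0 \<le> A + 2 * s * B + s\<^sup>2 * G" for s
  proof (cases "0 \<le> s")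
    case True
    have "0 \<le> en (add_measure \<mu> (scale_borel s \<gamma>)) (add_measure \<mu> (scale_borel s \<gamma>)) + en \<nu> \<nu> - 2 * en (add_measure \<mu> (scale_borel s \<gamma>)) \<nu>"
      using assms by (intro en_diff_nonneg finite_energy_measure_add finite_energy_measure_scale)
    also have "\<dots> = A + 2 * s * B + s\<^sup>2 * G"
      using assms True by (simp add: A_def B_def G_def en_add_left en_add_right en_scale_left en_scale_right
          finite_energy_measure_add finite_energy_measure_scale en_commute[of \<gamma> \<mu>] en_commute[of \<gamma> \<nu>] power2_eq_square algebra_simps)
    finally show ?thesis .
  next
    case False
    then have "0 \<le> - s" by simp
    have "0 \<le> en \<mu> \<mu> + en (add_measure \<nu> (scale_borel (-s) \<gamma>)) (add_measure \<nu> (scale_borel (-s) \<gamma>)) - 2 * en \<mu> (add_measure \<nu> (scale_borel (-s) \<gamma>))"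
      using assms by (intro en_diff_nonneg finite_energy_measure_add finite_energy_measure_scale)
    also have "\<dots> = A + 2 * s * B + s\<^sup>2 * G"
      using assms \<open>0 \<le> - s\<close> by (simp add: A_def B_def G_def en_add_left en_add_right en_scale_left[OF _ _ \<open>0 \<le> - s\<close>] en_scale_right[OF _ _ \<open>0 \<le> - s\<close>]
          finite_energy_measure_add finite_energy_measure_scale en_commute[of \<gamma> \<mu>] en_commute[of \<gamma> \<nu>] power2_eq_square algebra_simps)
    finally show ?thesis .
  qed
  have "B\<^sup>2 \<le> A * G"
  proof (cases "G = 0")
    case True
    have "B = 0"
    proof (rule ccontr)
      assume "B \<noteq> 0"
      \<comment> \<open>With G = 0 the polynomial is affine in s, and this s gives it the value
        -1.\<close>
      then show False using pos[of "- (A + 1) / (2 * B)"] True by (simp add: field_simps)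
    qed
    then show ?thesis using True by simp
  next
    case False
    then have "0 < G" by (simp add: G_def less_le)
    then show ?thesis using pos[of "- B / G"] by (simp add: power2_eq_square field_simps)
  qed
  then show ?thesis by (simp add: A_def B_def G_def)
qed

end


section \<open>Convolutions and the domination principle\<close>

definition conv :: "('a::euclidean_space \<Rightarrow> ennreal) \<Rightarrow> ('a \<Rightarrow> ennreal) \<Rightarrow> 'a \<Rightarrow> ennreal" where
  "conv k h x = (\<integral>\<^sup>+y. k (x - y) * h y \<partial>lborel)"

lemma conv_measurable [measurable]:
  fixes k h :: "'a::euclidean_space \<Rightarrow> ennreal"
  assumes [measurable]: "k \<in> borel_measurable borel" "h \<in> borel_measurable borel" "f \<in> borel_measurable M"
  shows "(\<lambda>x. conv k h (f x)) \<in> borel_measurable M"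
  unfolding conv_def by measurable

lemma conv_commute:
  fixes k h :: "'a::euclidean_space \<Rightarrow> ennreal"
  assumes [measurable]: "k \<in> borel_measurable borel" "h \<in> borel_measurable borel"
  shows "conv k h x = conv h k x"
  unfolding conv_def
  by (subst nn_integral_lborel_reflect[of _ x, symmetric]) (simp_all add: mult.commute)

lemma nn_integral_conv_measure:
  fixes k l :: "'a::euclidean_space \<Rightarrow> ennreal"
  assumes [measurable]: "k \<in> borel_measurable borel" "l \<in> borel_measurable borel"
    and \<nu>: "sigma_finite_borel \<nu>"
  shows "conv k (\<lambda>y. \<integral>\<^sup>+z. l (y - z) \<partial>\<nu>) x = (\<integral>\<^sup>+z. conv k l (x - z) \<partial>\<nu>)"
proof -
  note [measurable_cong] = sigma_finite_borelD(2)[OF \<nu>]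
  have "conv k (\<lambda>y. \<integral>\<^sup>+z. l (y - z) \<partial>\<nu>) x = (\<integral>\<^sup>+y. (\<integral>\<^sup>+z. k (x - y) * l (y - z) \<partial>\<nu>) \<partial>lborel)"
    unfolding conv_def by (intro nn_integral_cong nn_integral_cmult[symmetric]) measurable
  also have "\<dots> = (\<integral>\<^sup>+z. (\<integral>\<^sup>+y. k (x - y) * l (y - z) \<partial>lborel) \<partial>\<nu>)"
    by (rule Tonelli_borel[OF sigma_finite_borel_lborel \<nu>]) measurable
  also have "\<dots> = (\<integral>\<^sup>+z. conv k l (x - z) \<partial>\<nu>)"
  proof (rule nn_integral_cong)
    fix z :: 'a
    have "(\<integral>\<^sup>+y. k (x - y) * l (y - z) \<partial>lborel) = (\<integral>\<^sup>+y. k (x - (z + y)) * l (z + y - z) \<partial>lborel)"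
      by (rule nn_integral_lborel_translate[symmetric]) measurable
    then show "(\<integral>\<^sup>+y. k (x - y) * l (y - z) \<partial>lborel) = conv k l (x - z)"
      by (simp add: conv_def diff_diff_eq)
  qed
  finally show ?thesis .
qed

lemma conv_assoc:
  fixes k l h :: "'a::euclidean_space \<Rightarrow> ennreal"
  assumes [measurable]: "k \<in> borel_measurable borel" "l \<in> borel_measurable borel" "h \<in> borel_measurable borel"
  shows "conv k (conv l h) x = conv (conv k l) h x"
proof -
  have "conv k (conv l h) x = (\<integral>\<^sup>+y. (\<integral>\<^sup>+z. k (x - y) * (l (y - z) * h z) \<partial>lborel) \<partial>lborel)"
    unfolding conv_def by (intro nn_integral_cong nn_integral_cmult[symmetric]) measurable
  also have "\<dots> = (\<integral>\<^sup>+z. (\<integral>\<^sup>+y. k (x - y) * (l (y - z) * h z) \<partial>lborel) \<partial>lborel)"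
    by (rule Tonelli_borel[OF sigma_finite_borel_lborel sigma_finite_borel_lborel]) measurable
  also have "\<dots> = (\<integral>\<^sup>+z. conv k l (x - z) * h z \<partial>lborel)"
  proof (rule nn_integral_cong)
    fix z :: 'a
    have "(\<integral>\<^sup>+y. k (x - y) * (l (y - z) * h z) \<partial>lborel) = (\<integral>\<^sup>+y. k (x - y) * l (y - z) \<partial>lborel) * h z"
      by (subst nn_integral_multc[symmetric]) (measurable, simp add: mult.assoc)
    also have "(\<integral>\<^sup>+y. k (x - y) * l (y - z) \<partial>lborel) = (\<integral>\<^sup>+y. k (x - (z + y)) * l (z + y - z) \<partial>lborel)"
      by (rule nn_integral_lborel_translate[symmetric]) measurable
    also have "\<dots> = conv k l (x - z)" by (simp add: conv_def diff_diff_eq)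
    finally show "(\<integral>\<^sup>+y. k (x - y) * (l (y - z) * h z) \<partial>lborel) = conv k l (x - z) * h z" .
  qed
  finally show ?thesis by (simp add: conv_def)
qed

lemma conv_mono: "(\<And>x. h x \<le> h' x) \<Longrightarrow> conv k h x \<le> conv k h' x"
  unfolding conv_def by (intro nn_integral_mono mult_left_mono) auto

lemma conv_mono_left: "(\<And>x. k x \<le> k' x) \<Longrightarrow> conv k h x \<le> conv k' h x"
  unfolding conv_def by (intro nn_integral_mono mult_right_mono) auto

lemma conv_add:
  fixes k h h' :: "'a::euclidean_space \<Rightarrow> ennreal"
  assumes [measurable]: "k \<in> borel_measurable borel" "h \<in> borel_measurable borel" "h' \<in> borel_measurable borel"
  shows "conv k (\<lambda>x. h x + h' x) x = conv k h x + conv k h' x"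
  unfolding conv_def by (subst nn_integral_add[symmetric]) (auto simp: distrib_left)

lemma conv_suminf:
  fixes k :: "'a::euclidean_space \<Rightarrow> ennreal"
  assumes [measurable]: "k \<in> borel_measurable borel" "\<And>j. h j \<in> borel_measurable borel"
  shows "conv k (\<lambda>x. \<Sum>j. h j x) x = (\<Sum>j. conv k (h j) x)"
  unfolding conv_def by (subst nn_integral_suminf[symmetric]) (auto simp: ennreal_suminf_cmult)

definition mix :: "real measure \<Rightarrow> (real \<Rightarrow> ennreal) \<Rightarrow> 'a::euclidean_space \<Rightarrow> ennreal" where
  "mix \<theta> a x = (\<integral>\<^sup>+t. ennreal (gauss t x) * a t \<partial>\<theta>)"

lemma mix_measurable:
  assumes "sigma_finite_borel \<theta>" "a \<in> borel_measurable borel" "f \<in> borel_measurable M"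
  shows "(\<lambda>x. mix \<theta> a (f x :: 'a::euclidean_space)) \<in> borel_measurable M"
proof -
  note [measurable] = assms(2,3)
  show ?thesis unfolding mix_def by (rule borel_measurable_nn_integral_snd[OF assms(1)]) measurable
qed

lemma conv_mix:
  fixes h :: "'a::euclidean_space \<Rightarrow> ennreal"
  assumes \<theta>: "sigma_finite_borel \<theta>" and [measurable]: "a \<in> borel_measurable borel" "h \<in> borel_measurable borel"
  shows "conv (mix \<theta> a) h x = (\<integral>\<^sup>+t. conv (\<lambda>z. ennreal (gauss t z)) h x * a t \<partial>\<theta>)"
proof -
  note [measurable_cong] = sigma_finite_borelD(2)[OF \<theta>]
  have "conv (mix \<theta> a) h x = (\<integral>\<^sup>+y. (\<integral>\<^sup>+t. ennreal (gauss t (x - y)) * a t * h y \<partial>\<theta>) \<partial>lborel)"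
    unfolding conv_def mix_def by (intro nn_integral_cong nn_integral_multc[symmetric]) measurable
  also have "\<dots> = (\<integral>\<^sup>+t. (\<integral>\<^sup>+y. ennreal (gauss t (x - y)) * a t * h y \<partial>lborel) \<partial>\<theta>)"
    by (rule Tonelli_borel[OF sigma_finite_borel_lborel \<theta>]) measurable
  also have "\<dots> = (\<integral>\<^sup>+t. conv (\<lambda>z. ennreal (gauss t z)) h x * a t \<partial>\<theta>)"
    unfolding conv_def by (intro nn_integral_cong, subst nn_integral_multc[symmetric]) (measurable, simp add: mult_ac)
  finally show ?thesis .
qed

lemma conv_gauss_mix:
  assumes \<theta>: "sigma_finite_borel \<theta>" and [measurable]: "a \<in> borel_measurable borel"
    and pos: "AE t in \<theta>. 0 < t" and s: "0 < s"
  shows "conv (\<lambda>z. ennreal (gauss s z)) (mix \<theta> a) x = (\<integral>\<^sup>+t. ennreal (gauss (s + t) (x::'a::euclidean_space)) * a t \<partial>\<theta>)"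
proof -
  have [measurable]: "mix \<theta> a \<in> borel_measurable (borel :: 'a measure)"
    by (rule mix_measurable[OF \<theta>, of a "\<lambda>x. x"]) auto
  have "conv (\<lambda>z. ennreal (gauss s z)) (mix \<theta> a) x = conv (mix \<theta> a) (\<lambda>z. ennreal (gauss s z)) x"
    by (rule conv_commute) measurable
  also have "\<dots> = (\<integral>\<^sup>+t. conv (\<lambda>z. ennreal (gauss t z)) (\<lambda>z. ennreal (gauss s z)) x * a t \<partial>\<theta>)"
    by (rule conv_mix[OF \<theta>]) measurable
  also have "\<dots> = (\<integral>\<^sup>+t. ennreal (gauss (s + t) x) * a t \<partial>\<theta>)"
  proof (rule nn_integral_cong_AE, use pos in eventually_elim)
    fix t :: real assume "0 < t"
    then have "conv (\<lambda>z. ennreal (gauss t z)) (\<lambda>z. ennreal (gauss s z)) x = ennreal (gauss (s + t) x)"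
      using gauss_conv[of t s x 0] s by (simp add: conv_def add.commute)
    then show "conv (\<lambda>z. ennreal (gauss t z)) (\<lambda>z. ennreal (gauss s z)) x * a t = ennreal (gauss (s + t) x) * a t" by simp
  qed
  finally show ?thesis .
qed

section \<open>Parts of the kernel by time, and the renewal kernel\<close>

context riesz_space
begin

text \<open>The contribution to the Riesz kernel of the times in A: \<open>km {0<..}\<close> is the
  whole kernel, \<open>km {0<..r}\<close> its short-time part, \<open>km {r<..}\<close> a bounded
  tail when r > 0.\<close>

definition km :: "real set \<Rightarrow> 'a \<Rightarrow> ennreal" where
  "km A = mix (rtime C \<alpha>) (indicator A)"

lemma km_measurable [measurable]:
  assumes "A \<in> sets borel" "f \<in> borel_measurable M"
  shows "(\<lambda>x. km A (f x)) \<in> borel_measurable M"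
  unfolding km_def using assms by (intro mix_measurable[OF sigma_finite_borel_rtime]) auto

lemma km_mono: "A \<subseteq> B \<Longrightarrow> km A x \<le> km B x"
  unfolding km_def mix_def by (intro nn_integral_mono mult_left_mono) (auto simp: indicator_def)

lemma riesz_kernel_km: "riesz_kernel \<alpha> x y = km {0<..} (x - y)"
proof -
  have "(\<integral>\<^sup>+t. ennreal (gauss t (x - y)) \<partial>rtime C \<alpha>) = (\<integral>\<^sup>+t. ennreal (gauss t (x - y)) * indicator {0<..} t \<partial>rtime C \<alpha>)"
    by (rule nn_integral_cong_AE, use AE_rtime_pos[of C \<alpha>] in eventually_elim) simp
  then show ?thesis by (simp add: kernel_mixture km_def mix_def)
qed

lemma potential_km: "potential \<alpha> \<nu> x = (\<integral>\<^sup>+y. km {0<..} (x - y) \<partial>\<nu>)"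
  by (simp add: potential_def riesz_kernel_km)

lemma km_split: "0 < r \<Longrightarrow> km {0<..} x = km {0<..r} x + km {r<..} x"
  unfolding km_def mix_def
  by (subst nn_integral_add[symmetric]) (auto intro!: nn_integral_cong simp: indicator_def)

lemma km_le_zero: "km A x \<le> km A 0"
  unfolding km_def mix_def
  by (rule nn_integral_mono_AE, use AE_rtime_pos[of C \<alpha>] in eventually_elim)
     (auto intro!: mult_right_mono ennreal_leI gauss_le_zero)

lemma km_tail_tendsto_0: "(\<lambda>k. km {real k<..} 0) \<longlonglongrightarrow> 0"
proof -
  have fin: "(\<integral>\<^sup>+t. ennreal (gauss t (0::'a)) * indicator {1<..} t \<partial>rtime C \<alpha>) < \<infinity>"
    by (rule nn_integral_rtime_tail_finite) (use C alpha_less_dim in auto)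
  have "(\<lambda>k. \<integral>\<^sup>+t. ennreal (gauss t (0::'a)) * indicator {real (Suc k)<..} t \<partial>rtime C \<alpha>) \<longlonglongrightarrow> (\<integral>\<^sup>+t. 0 \<partial>rtime C \<alpha>)"
  proof (rule nn_integral_dominated_convergence[where w="\<lambda>t. ennreal (gauss t (0::'a)) * indicator {1<..} t"])
    show "AE t in rtime C \<alpha>. (\<lambda>k. ennreal (gauss t (0::'a)) * indicator {real (Suc k)<..} t) \<longlonglongrightarrow> 0"
    proof (rule AE_I2)
      fix t :: real
      obtain N where N: "t \<le> real N" using real_arch_simple by blast
      have "\<forall>\<^sub>F k in sequentially. ennreal (gauss t (0::'a)) * indicator {real (Suc k)<..} t = 0"
        by (rule eventually_sequentiallyI[of N]) (use N in \<open>auto simp: indicator_def\<close>)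
      then show "(\<lambda>k. ennreal (gauss t (0::'a)) * indicator {real (Suc k)<..} t) \<longlonglongrightarrow> 0"
        by (rule tendsto_eventually)
    qed
  qed (use fin in \<open>auto simp: indicator_def\<close>)
  then show ?thesis unfolding km_def mix_def by (subst filterlim_sequentially_Suc[symmetric]) simp
qed

lemma km_shift_finite: "(\<integral>\<^sup>+t. ennreal (gauss (1 + t) (0::'a)) \<partial>rtime C \<alpha>) < \<infinity>"
proof -
  have dec: "gauss s (0::'a) \<le> gauss t (0::'a)" if "0 < t" "t \<le> s" for s t
    using that by (simp add: gauss_def powr_mono2')
  have "(\<integral>\<^sup>+t. ennreal (gauss (1 + t) (0::'a)) \<partial>rtime C \<alpha>) \<le>
    (\<integral>\<^sup>+t. ennreal (gauss 1 (0::'a)) * indicator {0<..1} t + ennreal (gauss t (0::'a)) * indicator {1<..} t \<partial>rtime C \<alpha>)"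
    by (rule nn_integral_mono_AE, use AE_rtime_pos[of C \<alpha>] in eventually_elim)
       (auto simp: indicator_def intro!: ennreal_leI dec)
  also have "\<dots> = ennreal (gauss 1 (0::'a)) * emeasure (rtime C \<alpha>) {0<..1} + (\<integral>\<^sup>+t. ennreal (gauss t (0::'a)) * indicator {1<..} t \<partial>rtime C \<alpha>)"
    by (subst nn_integral_add) (auto simp: nn_integral_cmult)
  also have "\<dots> < \<infinity>"
    using alpha C alpha_less_dim nn_integral_rtime_tail_finite[where 'a='a, of C \<alpha> 1]
    by (simp add: emeasure_rtime_interval ennreal_mult_less_top)
  finally show ?thesis .
qed

lemma conv_km: "A \<in> sets borel \<Longrightarrow> h \<in> borel_measurable borel \<Longrightarrow>
    conv (km A) h x = (\<integral>\<^sup>+t. conv (\<lambda>z. ennreal (gauss t z)) h x * indicator A t \<partial>rtime C \<alpha>)"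
  unfolding km_def by (rule conv_mix[OF sigma_finite_borel_rtime]) auto

text \<open>\<open>p\<close> mixes heat kernels over the first passage law of
  \<open>rtime_renewal\<close>; convolving with it removes the times up to r. The last clause holds
  because passage times are at least r, so each further convolution by \<open>p\<close> advances all
  times by at least r.\<close>

lemma renewal_kernel:
  assumes r: "0 < r"
  obtains p :: "'a \<Rightarrow> ennreal" where "p \<in> borel_measurable borel"
    "\<And>x. conv p (km {0<..}) x = km {r<..} x"
    "\<And>c x. conv p (km {c<..}) x \<le> km {c + r<..} x"
proof -
  obtain \<eta> :: "real measure" where \<eta>: "sets \<eta> = sets borel" "sigma_finite_measure \<eta>" "AE s in \<eta>. r \<le> s"
    "\<And>\<phi> :: real \<Rightarrow> ennreal. \<phi> \<in> borel_measurable borel \<Longrightarrow>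
      (\<integral>\<^sup>+t. (\<integral>\<^sup>+s. \<phi> (s + t) \<partial>\<eta>) \<partial>rtime C \<alpha>) = (\<integral>\<^sup>+x. \<phi> x * indicator {r<..} x \<partial>rtime C \<alpha>)"
    using rtime_renewal[OF alpha C r] by blast
  note [measurable_cong] = \<eta>(1)
  have sf: "sigma_finite_borel \<eta>" using \<eta> by (simp add: sigma_finite_borel_def)
  define p :: "'a \<Rightarrow> ennreal" where "p = mix \<eta> (\<lambda>_. 1)"
  have pm: "p \<in> borel_measurable borel"
    unfolding p_def by (rule mix_measurable[OF sf, of _ "\<lambda>x. x"]) auto
  have main: "conv p (km {c<..}) x = (\<integral>\<^sup>+t. (\<integral>\<^sup>+s. ennreal (gauss (s + t) x) * indicator {c<..} t \<partial>\<eta>) \<partial>rtime C \<alpha>)" for c x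
  proof -
    have "conv p (km {c<..}) x = (\<integral>\<^sup>+s. conv (\<lambda>z. ennreal (gauss s z)) (km {c<..}) x * 1 \<partial>\<eta>)"
      unfolding p_def by (rule conv_mix[OF sf]) measurable
    also have "\<dots> = (\<integral>\<^sup>+s. (\<integral>\<^sup>+t. ennreal (gauss (s + t) x) * indicator {c<..} t \<partial>rtime C \<alpha>) \<partial>\<eta>)"
    proof (rule nn_integral_cong_AE, use \<eta>(3) in eventually_elim)
      fix s assume "r \<le> s"
      then show "conv (\<lambda>z. ennreal (gauss s z)) (km {c<..}) x * 1 = (\<integral>\<^sup>+t. ennreal (gauss (s + t) x) * indicator {c<..} t \<partial>rtime C \<alpha>)"
        unfolding km_def using r by (subst conv_gauss_mix[OF sigma_finite_borel_rtime]) (auto simp: AE_rtime_pos)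
    qed
    also have "\<dots> = (\<integral>\<^sup>+t. (\<integral>\<^sup>+s. ennreal (gauss (s + t) x) * indicator {c<..} t \<partial>\<eta>) \<partial>rtime C \<alpha>)"
      by (rule Tonelli_borel[OF sf sigma_finite_borel_rtime]) measurable
    finally show ?thesis .
  qed
  show ?thesis
  proof (rule that[OF pm])
    fix x :: 'a
    have "conv p (km {0<..}) x = (\<integral>\<^sup>+t. (\<integral>\<^sup>+s. ennreal (gauss (s + t) x) \<partial>\<eta>) \<partial>rtime C \<alpha>)"
      unfolding main by (rule nn_integral_cong_AE, use AE_rtime_pos[of C \<alpha>] in eventually_elim) simp
    also have "\<dots> = km {r<..} x"
      unfolding km_def mix_def by (rule \<eta>(4)) measurable
    finally show "conv p (km {0<..}) x = km {r<..} x" .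
  next
    fix x :: 'a and c
    have "conv p (km {c<..}) x \<le> (\<integral>\<^sup>+t. (\<integral>\<^sup>+s. ennreal (gauss (s + t) x) * indicator {c + r<..} (s + t) \<partial>\<eta>) \<partial>rtime C \<alpha>)"
      unfolding main
      by (rule nn_integral_mono, rule nn_integral_mono_AE, use \<eta>(3) in eventually_elim) (auto simp: indicator_def)
    also have "\<dots> = (\<integral>\<^sup>+t. ennreal (gauss t x) * indicator {c + r<..} t * indicator {r<..} t \<partial>rtime C \<alpha>)"
      by (rule \<eta>(4)) measurable
    also have "\<dots> \<le> km {c + r<..} x"
      unfolding km_def mix_def by (intro nn_integral_mono) (auto simp: indicator_def)
    finally show "conv p (km {c<..}) x \<le> km {c + r<..} x" .
  qed
qed

lemma funpow_conv_measurable: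
  assumes "p \<in> borel_measurable borel" "h \<in> borel_measurable (borel :: 'a measure)"
  shows "(conv p ^^ j) h \<in> borel_measurable borel"
  using assms by (induction j) auto

lemma funpow_conv_conv:
  assumes [measurable]: "p \<in> borel_measurable borel" "h \<in> borel_measurable (borel :: 'a measure)" "k \<in> borel_measurable borel"
  shows "conv ((conv p ^^ j) k) h = conv k ((conv p ^^ j) h)"
proof (induction j)
  case (Suc j)
  note [measurable] = funpow_conv_measurable[OF assms(1)]
  show ?case
  proof
    fix x
    have "conv ((conv p ^^ Suc j) k) h x = conv p (conv k ((conv p ^^ j) h)) x"
      by (simp add: conv_assoc[symmetric] Suc)
    also have "\<dots> = conv (conv p k) ((conv p ^^ j) h) x" by (rule conv_assoc) measurable
    also have "conv p k = conv k p" by (rule ext, rule conv_commute) measurable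
    also have "conv (conv k p) ((conv p ^^ j) h) x = conv k (conv p ((conv p ^^ j) h)) x" by (rule conv_assoc[symmetric]) measurable
    finally show "conv ((conv p ^^ Suc j) k) h x = conv k ((conv p ^^ Suc j) h) x" by simp
  qed
qed simp

text \<open>Neumann expansion of h = g + p h, stopped after K terms with its exact
  remainder.\<close>

lemma funpow_conv_telescope:
  assumes [measurable]: "p \<in> borel_measurable borel" "h \<in> borel_measurable (borel :: 'a measure)" "g \<in> borel_measurable borel"
    and h: "\<And>x. h x = g x + conv p h x"
  shows "h x = (\<Sum>j<K. (conv p ^^ j) g x) + (conv p ^^ K) h x"
proof (induction K)
  case (Suc K)
  note [measurable] = funpow_conv_measurable[OF assms(1)]
  have "(conv p ^^ K) h x = (conv p ^^ K) g x + (conv p ^^ Suc K) h x" for x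
  proof (induction K arbitrary: x)
    case 0
    then show ?case using h[of x] by simp
  next
    case (Suc K)
    have "(conv p ^^ K) h = (\<lambda>x. (conv p ^^ K) g x + (conv p ^^ Suc K) h x)"
      by (rule ext) (rule Suc)
    then have "(conv p ^^ Suc K) h x = conv p (\<lambda>x. (conv p ^^ K) g x + (conv p ^^ Suc K) h x) x"
      by (metis funpow.simps(2) o_apply)
    also have "\<dots> = (conv p ^^ Suc K) g x + (conv p ^^ Suc (Suc K)) h x"
      by (subst conv_add) (simp_all add: funpow_conv_measurable)
    finally show ?case .
  qed
  then show ?case using Suc by (simp add: add.assoc)
qed simp

lemma telescope_suminf:
  fixes g :: "nat \<Rightarrow> ennreal"
  assumes "\<And>K. h = (\<Sum>j<K. g j) + e K" and "e \<longlonglongrightarrow> 0"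
  shows "h = (\<Sum>j. g j)"
proof -
  have "(\<lambda>K. (\<Sum>j<K. g j) + e K) \<longlonglongrightarrow> (\<Sum>j. g j) + 0"
    by (intro tendsto_add assms(2) summable_LIMSEQ) auto
  then show ?thesis using assms(1)[symmetric] by (simp add: LIMSEQ_const_iff)
qed

text \<open>Iterating the renewal kernel K times leaves only times beyond K r; the remainders of
  both Neumann series below therefore vanish.\<close>

lemma conv_remainder:
  assumes r: "0 < r" and p: "p \<in> borel_measurable borel" and pk: "\<And>c x. conv p (km {c<..}) x \<le> km {c + r<..} x"
  shows "(conv p ^^ K) (km {0<..}) x \<le> km {real K * r<..} x"
proof (induction K arbitrary: x)
  case (Suc K)
  have "(conv p ^^ Suc K) (km {0<..}) x \<le> conv p (km {real K * r<..}) x"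
    using Suc by (simp add: conv_mono)
  also have "\<dots> \<le> km {real K * r + r<..} x" by (rule pk)
  finally show ?case by (simp add: algebra_simps)
qed simp

lemma km_tail_scaled_tendsto_0: "0 < r \<Longrightarrow> (\<lambda>K. km {real K * r<..} 0) \<longlonglongrightarrow> 0"
proof (rule tendsto_sandwich[OF _ _ tendsto_const])
  assume r: "0 < r"
  have "filterlim (\<lambda>K. nat \<lfloor>real K * r\<rfloor>) sequentially sequentially"
    using r by real_asymp
  from filterlim_compose[OF km_tail_tendsto_0 this]
  show "(\<lambda>K. km {real (nat \<lfloor>real K * r\<rfloor>)<..} 0) \<longlonglongrightarrow> 0" .
  show "\<forall>\<^sub>F K in sequentially. km {real K * r<..} 0 \<le> km {real (nat \<lfloor>real K * r\<rfloor>)<..} 0"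
    using r by (intro always_eventually allI km_mono) (auto intro: order.strict_trans1[OF of_nat_floor])
qed auto

text \<open>\<open>\<rho> = h - p * h\<close> is the charge whose potential is the smoothing of \<open>h\<close> by the short-time part
  of the kernel; this replaces the Riesz representation of the excessive function \<open>h\<close>.\<close>

lemma potential_charge:
  assumes r: "0 < r" and p[measurable]: "p \<in> borel_measurable borel"
    and p0: "\<And>x. conv p (km {0<..}) x = km {r<..} x" and pk: "\<And>c x. conv p (km {c<..}) x \<le> km {c + r<..} x"
    and \<nu>: "sigma_finite_borel \<nu>" "emeasure \<nu> UNIV < \<infinity>"
    and h[measurable]: "h \<in> borel_measurable borel" and hu: "\<And>x. h x \<le> potential \<alpha> \<nu> x" and ph: "\<And>x. conv p h x \<le> h x"
  shows "conv (km {0<..}) (\<lambda>x. h x - conv p h x) x = conv (km {0<..r}) h x"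
proof -
  note [measurable] = funpow_conv_measurable[OF p]
  define \<rho> where "\<rho> x = h x - conv p h x" for x
  have [measurable]: "\<rho> \<in> borel_measurable borel" unfolding \<rho>_def by measurable
  have hsum: "h x = (\<Sum>j. (conv p ^^ j) \<rho> x)" for x
  proof (rule telescope_suminf)
    show "h x = (\<Sum>j<K. (conv p ^^ j) \<rho> x) + (conv p ^^ K) h x" for K
      by (rule funpow_conv_telescope) (simp_all add: \<rho>_def ph diff_add_cancel_ennreal)
    \<comment> \<open>The remainder is at most K applications of \<open>p\<close> to the potential
      of \<nu>. Its kernel then has only times beyond K r, hence is bounded by its value at 0, and
      \<nu> has finite mass.\<close>
    have bound: "(conv p ^^ K) h x \<le> km {real K * r<..} 0 * emeasure \<nu> UNIV" for K
    proof -
      have "(conv p ^^ K) h x \<le> (conv p ^^ K) (\<lambda>x. \<integral>\<^sup>+y. km {0<..} (x - y) \<partial>\<nu>) x" for x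
      proof (induction K arbitrary: x)
        case 0 then show ?case using hu by (simp add: potential_km)
      qed (simp add: conv_mono)
      also have "(conv p ^^ K) (\<lambda>x. \<integral>\<^sup>+y. km {0<..} (x - y) \<partial>\<nu>) = (\<lambda>x. \<integral>\<^sup>+y. (conv p ^^ K) (km {0<..}) (x - y) \<partial>\<nu>)"
      proof (induction K)
        case (Suc K)
        then show ?case by (simp add: nn_integral_conv_measure \<nu> funpow_conv_measurable)
      qed simp
      also have "\<dots> x \<le> (\<integral>\<^sup>+y. km {real K * r<..} 0 \<partial>\<nu>)"
        by (intro nn_integral_mono order_trans[OF conv_remainder[OF r p pk] km_le_zero])
      also have "\<dots> = km {real K * r<..} 0 * emeasure \<nu> UNIV"
        using sigma_finite_borelD[OF \<nu>(1)] by simp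
      finally show ?thesis .
    qed
    have lim: "(\<lambda>K. km {real K * r<..} 0 * emeasure \<nu> UNIV) \<longlonglongrightarrow> 0 * emeasure \<nu> UNIV"
      by (rule tendsto_mult_ennreal[OF km_tail_scaled_tendsto_0[OF r] tendsto_const]) (use \<nu> in auto)
    show "(\<lambda>K. (conv p ^^ K) h x) \<longlonglongrightarrow> 0"
    proof (rule tendsto_sandwich[OF _ _ tendsto_const])
      show "\<forall>\<^sub>F K in sequentially. (conv p ^^ K) h x \<le> km {real K * r<..} 0 * emeasure \<nu> UNIV"
        using bound by simp
      show "(\<lambda>K. km {real K * r<..} 0 * emeasure \<nu> UNIV) \<longlonglongrightarrow> 0" using lim by simp
    qed simp
  qed
  have ksum: "km {0<..} x = (\<Sum>j. (conv p ^^ j) (km {0<..r}) x)" for x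
  proof (rule telescope_suminf)
    show "km {0<..} x = (\<Sum>j<K. (conv p ^^ j) (km {0<..r}) x) + (conv p ^^ K) (km {0<..}) x" for K
    proof (rule funpow_conv_telescope)
      show "km {0<..} x = km {0<..r} x + conv p (km {0<..}) x" for x
        unfolding p0 by (rule km_split[OF r])
    qed (auto intro: km_measurable[of _ "\<lambda>x. x"])
    show "(\<lambda>K. (conv p ^^ K) (km {0<..}) x) \<longlonglongrightarrow> 0"
      by (rule tendsto_sandwich[OF _ _ tendsto_const km_tail_scaled_tendsto_0[OF r]])
         (auto intro!: always_eventually order_trans[OF conv_remainder[OF r p pk] km_le_zero])
  qed
  \<comment> \<open>Both h and the kernel are geometric series in \<open>p\<close>, with first terms
    \<rho> and the short-time kernel. Commuting convolutions moves the powers of \<open>p\<close>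
    from the kernel to \<rho>, where they sum to h.\<close>
  have "conv (km {0<..}) \<rho> x = conv \<rho> (\<lambda>x. \<Sum>j. (conv p ^^ j) (km {0<..r}) x) x"
    unfolding ksum[symmetric] by (rule conv_commute) measurable
  also have "\<dots> = (\<Sum>j. conv \<rho> ((conv p ^^ j) (km {0<..r})) x)"
    by (rule conv_suminf) measurable
  also have "\<dots> = (\<Sum>j. conv (km {0<..r}) ((conv p ^^ j) \<rho>) x)"
  proof (rule suminf_cong)
    fix j
    have "conv \<rho> ((conv p ^^ j) (km {0<..r})) x = conv ((conv p ^^ j) (km {0<..r})) \<rho> x"
      by (rule conv_commute) measurable
    then show "conv \<rho> ((conv p ^^ j) (km {0<..r})) x = conv (km {0<..r}) ((conv p ^^ j) \<rho>) x"
      by (simp add: funpow_conv_conv)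
  qed
  also have "\<dots> = conv (km {0<..r}) (\<lambda>x. \<Sum>j. (conv p ^^ j) \<rho> x) x"
    by (rule conv_suminf[symmetric]) measurable
  also have "\<dots> = conv (km {0<..r}) h x" by (simp add: hsum[symmetric])
  finally show ?thesis by (simp add: \<rho>_def[abs_def])
qed

end


lemma conv_even:
  fixes k h :: "'a::euclidean_space \<Rightarrow> ennreal"
  assumes [measurable]: "k \<in> borel_measurable borel" "h \<in> borel_measurable borel"
    and "\<And>x. k (- x) = k x" "\<And>x. h (- x) = h x"
  shows "conv k h (- x) = conv k h x"
proof -
  have "conv k h x = (\<integral>\<^sup>+y. k (x - (0 - y)) * h (0 - y) \<partial>lborel)"
    unfolding conv_def by (rule nn_integral_lborel_reflect[symmetric]) measurable
  also have "\<dots> = conv k h (- x)"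
    unfolding conv_def
  proof (rule nn_integral_cong)
    fix y :: 'a
    show "k (x - (0 - y)) * h (0 - y) = k (- x - y) * h y"
      using assms(3)[of "- x - y"] assms(4)[of y] by (simp add: add.commute)
  qed
  finally show ?thesis by simp
qed

text \<open>Heat evolution contracts L2: Cauchy-Schwarz with the Gaussian split into two square
  roots, then Tonelli, since the Gaussian has mass 1 in either variable.\<close>

lemma Young_gauss:
  fixes F :: "'a::euclidean_space \<Rightarrow> ennreal"
  assumes [measurable]: "F \<in> borel_measurable borel" and s: "0 < s"
  shows "(\<integral>\<^sup>+z. (conv (\<lambda>z. ennreal (gauss s z)) F z)\<^sup>2 \<partial>lborel) \<le> (\<integral>\<^sup>+z. (F z)\<^sup>2 \<partial>lborel)"
proof -
  have one: "(\<integral>\<^sup>+y. ennreal (gauss s (z - y)) \<partial>lborel) = 1" for z :: 'a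
    using nn_integral_lborel_reflect[of "\<lambda>y. ennreal (gauss s y)" z] s by (simp add: nn_integral_gauss)
  have sq: "(ennreal (sqrt (gauss s y)))\<^sup>2 = ennreal (gauss s y)" for y :: 'a
    by (simp add: ennreal_power)
  have "(\<integral>\<^sup>+z. (conv (\<lambda>z. ennreal (gauss s z)) F z)\<^sup>2 \<partial>lborel) \<le> (\<integral>\<^sup>+z. (\<integral>\<^sup>+y. ennreal (gauss s (z - y)) * (F y)\<^sup>2 \<partial>lborel) \<partial>lborel)"
  proof (rule nn_integral_mono)
    fix z :: 'a
    have "(conv (\<lambda>z. ennreal (gauss s z)) F z)\<^sup>2 = (\<integral>\<^sup>+y. ennreal (sqrt (gauss s (z - y))) * (ennreal (sqrt (gauss s (z - y))) * F y) \<partial>lborel)\<^sup>2"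
      unfolding conv_def by (simp add: mult.assoc[symmetric] ennreal_mult[symmetric])
    also have "\<dots> \<le> (\<integral>\<^sup>+y. (ennreal (sqrt (gauss s (z - y))))\<^sup>2 \<partial>lborel) * (\<integral>\<^sup>+y. (ennreal (sqrt (gauss s (z - y))) * F y)\<^sup>2 \<partial>lborel)"
      by (rule Cauchy_Schwarz_nn_integral) measurable
    also have "\<dots> = (\<integral>\<^sup>+y. ennreal (gauss s (z - y)) * (F y)\<^sup>2 \<partial>lborel)"
      by (simp add: sq one power_mult_distrib)
    finally show "(conv (\<lambda>z. ennreal (gauss s z)) F z)\<^sup>2 \<le> (\<integral>\<^sup>+y. ennreal (gauss s (z - y)) * (F y)\<^sup>2 \<partial>lborel)" .
  qed
  also have "\<dots> = (\<integral>\<^sup>+y. (\<integral>\<^sup>+z. ennreal (gauss s (z - y)) * (F y)\<^sup>2 \<partial>lborel) \<partial>lborel)"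
    by (rule Tonelli_borel[OF sigma_finite_borel_lborel sigma_finite_borel_lborel]) measurable
  also have "\<dots> = (\<integral>\<^sup>+y. (F y)\<^sup>2 \<partial>lborel)"
  proof (rule nn_integral_cong)
    fix y :: 'a
    have "(\<integral>\<^sup>+z. ennreal (gauss s (z - y)) * (F y)\<^sup>2 \<partial>lborel) = (\<integral>\<^sup>+z. ennreal (gauss s (z - y)) \<partial>lborel) * (F y)\<^sup>2"
      by (rule nn_integral_multc) measurable
    also have "(\<integral>\<^sup>+z. ennreal (gauss s (z - y)) \<partial>lborel) = 1"
      using one[of y] by (simp add: gauss_commute)
    finally show "(\<integral>\<^sup>+z. ennreal (gauss s (z - y)) * (F y)\<^sup>2 \<partial>lborel) = (F y)\<^sup>2" by simp
  qed
  finally show ?thesis .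
qed

lemma gauss_continuous: "0 < t \<Longrightarrow> (f \<longlongrightarrow> l) F \<Longrightarrow> ((\<lambda>n. gauss t (f n)) \<longlongrightarrow> gauss t l) F"
  unfolding gauss_def by (intro tendsto_intros) auto

section \<open>Excessive functions and the charges of minima of potentials\<close>

context riesz_space
begin

text \<open>Fatou twice: in time, where each Gaussian is continuous, and then against \<nu>.\<close>

lemma potential_lsc:
  assumes \<nu>: "sigma_finite_borel \<nu>"
  shows "open {x. c < potential \<alpha> \<nu> (x :: 'a)}"
proof -
  note [measurable_cong] = sigma_finite_borelD(2)[OF \<nu>]
  have "closed {x. potential \<alpha> \<nu> x \<le> c}"
    unfolding closed_sequential_limits
  proof (intro allI impI, elim conjE)
    fix X :: "nat \<Rightarrow> 'a" and l assume X: "\<forall>n. X n \<in> {x. potential \<alpha> \<nu> x \<le> c}" and lim: "X \<longlonglongrightarrow> l"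
    have k: "riesz_kernel \<alpha> l y \<le> liminf (\<lambda>n. riesz_kernel \<alpha> (X n) y)" for y
    proof -
      have "riesz_kernel \<alpha> l y = (\<integral>\<^sup>+t. liminf (\<lambda>n. ennreal (gauss t (X n - y))) \<partial>rtime C \<alpha>)"
        unfolding kernel_mixture
      proof (rule nn_integral_cong_AE, use AE_rtime_pos[of C \<alpha>] in eventually_elim)
        fix t :: real assume "0 < t"
        then have "(\<lambda>n. ennreal (gauss t (X n - y))) \<longlonglongrightarrow> ennreal (gauss t (l - y))"
          by (intro tendsto_ennrealI gauss_continuous tendsto_intros lim)
        then show "ennreal (gauss t (l - y)) = liminf (\<lambda>n. ennreal (gauss t (X n - y)))"
          by (rule lim_imp_Liminf[OF trivial_limit_sequentially, symmetric])
      qed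
      also have "\<dots> \<le> liminf (\<lambda>n. riesz_kernel \<alpha> (X n) y)"
        unfolding kernel_mixture by (rule nn_integral_liminf) measurable
      finally show ?thesis .
    qed
    have "potential \<alpha> \<nu> l \<le> (\<integral>\<^sup>+y. liminf (\<lambda>n. riesz_kernel \<alpha> (X n) y) \<partial>\<nu>)"
      unfolding potential_def by (intro nn_integral_mono k)
    also have "\<dots> \<le> liminf (\<lambda>n. potential \<alpha> \<nu> (X n))"
      unfolding potential_def by (rule nn_integral_liminf) measurable
    also have "\<dots> \<le> c" by (rule Liminf_le) (use X in auto)
    finally show "l \<in> {x. potential \<alpha> \<nu> x \<le> c}" by simp
  qed
  then have "open (- {x. potential \<alpha> \<nu> x \<le> c})" by (rule open_Compl)
  moreover have "- {x. potential \<alpha> \<nu> x \<le> c} = {x. c < potential \<alpha> \<nu> x}" by auto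
  ultimately show ?thesis by simp
qed

lemma potential_borel [measurable]: "sigma_finite_borel \<nu> \<Longrightarrow> potential \<alpha> \<nu> \<in> borel_measurable (borel :: 'a measure)"
  using potential_measurable[of \<nu> "\<lambda>x. x"] by simp

lemma conv_potential:
  assumes \<nu>: "sigma_finite_borel \<nu>" and k[measurable]: "k \<in> borel_measurable borel"
  shows "conv k (potential \<alpha> \<nu>) x = (\<integral>\<^sup>+z. conv k (km {0<..}) (x - z) \<partial>\<nu>)"
  unfolding potential_km[abs_def] by (rule nn_integral_conv_measure) (use \<nu> in \<open>auto intro: km_measurable[of _ "\<lambda>x. x"]\<close>)

text \<open>Smoothing by s replaces each time t by s + t; half of s falls on each heat evolution,
  where it contracts L2.\<close>

lemma energy_heat_decreasing:
  assumes \<nu>: "sigma_finite_borel (\<nu> :: 'a measure)" and s: "0 < s"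
  shows "(\<integral>\<^sup>+x. conv (\<lambda>z. ennreal (gauss s z)) (potential \<alpha> \<nu>) x \<partial>\<nu>) \<le> mutual_energy \<alpha> \<nu> \<nu>"
proof -
  note [measurable_cong] = sigma_finite_borelD(2)[OF \<nu>]
  note [measurable (raw)] = heat_measurable[OF \<nu>]
  have "(\<integral>\<^sup>+x. conv (\<lambda>z. ennreal (gauss s z)) (potential \<alpha> \<nu>) x \<partial>\<nu>) =
      (\<integral>\<^sup>+x. (\<integral>\<^sup>+z. (\<integral>\<^sup>+t. ennreal (gauss (s + t) (x - z)) * indicator {0<..} t \<partial>rtime C \<alpha>) \<partial>\<nu>) \<partial>\<nu>)"
    by (simp add: conv_potential[OF \<nu>] km_def conv_gauss_mix[OF sigma_finite_borel_rtime _ AE_rtime_pos s])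
  also have "\<dots> = (\<integral>\<^sup>+x. (\<integral>\<^sup>+t. (\<integral>\<^sup>+z. ennreal (gauss (s + t) (x - z)) * indicator {0<..} t \<partial>\<nu>) \<partial>rtime C \<alpha>) \<partial>\<nu>)"
    by (intro nn_integral_cong Tonelli_borel[OF \<nu> sigma_finite_borel_rtime]) measurable
  also have "\<dots> = (\<integral>\<^sup>+t. (\<integral>\<^sup>+x. (\<integral>\<^sup>+z. ennreal (gauss (s + t) (x - z)) * indicator {0<..} t \<partial>\<nu>) \<partial>\<nu>) \<partial>rtime C \<alpha>)"
  proof (rule Tonelli_borel[OF \<nu> sigma_finite_borel_rtime])
    have "(\<lambda>w. \<integral>\<^sup>+z. ennreal (gauss (s + snd w) (fst w - z)) * indicator {0<..} (snd w) \<partial>\<nu>) \<in> borel_measurable (borel \<Otimes>\<^sub>M borel)"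
      by (rule borel_measurable_nn_integral_snd[OF \<nu>]) measurable
    then show "(\<lambda>(x, t). \<integral>\<^sup>+z. ennreal (gauss (s + t) (x - z)) * indicator {0<..} t \<partial>\<nu>) \<in> borel_measurable (borel \<Otimes>\<^sub>M borel)"
      by (simp add: case_prod_beta')
  qed
  also have "\<dots> \<le> (\<integral>\<^sup>+t. (\<integral>\<^sup>+z. heat (t/2) \<nu> z * heat (t/2) \<nu> z \<partial>lborel) \<partial>rtime C \<alpha>)"
  proof (rule nn_integral_mono_AE, use AE_rtime_pos[of C \<alpha>] in eventually_elim)
    fix t :: real assume t: "0 < t"
    have heat: "heat ((s + t) / 2) \<nu> z = conv (\<lambda>z. ennreal (gauss (s/2) z)) (heat (t/2) \<nu>) z" for z
    proof -
      have "conv (\<lambda>z. ennreal (gauss (s/2) z)) (heat (t/2) \<nu>) z = (\<integral>\<^sup>+y. conv (\<lambda>z. ennreal (gauss (s/2) z)) (\<lambda>z. ennreal (gauss (t/2) z)) (z - y) \<partial>\<nu>)"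
        unfolding heat_def[abs_def] by (rule nn_integral_conv_measure) (use \<nu> in auto)
      also have "\<dots> = heat ((s + t) / 2) \<nu> z"
        unfolding heat_def conv_def
        using gauss_conv[of "s/2" "t/2" _ "0::'a"] s t by (simp add: add_divide_distrib)
      finally show ?thesis ..
    qed
    have "(\<integral>\<^sup>+x. (\<integral>\<^sup>+z. ennreal (gauss (s + t) (x - z)) * indicator {0<..} t \<partial>\<nu>) \<partial>\<nu>) = (\<integral>\<^sup>+z. (heat ((s + t)/2) \<nu> z)\<^sup>2 \<partial>lborel)"
      using heat_inner[OF \<nu> \<nu>, of "s + t"] s t by (simp add: power2_eq_square)
    also have "\<dots> \<le> (\<integral>\<^sup>+z. (heat (t/2) \<nu> z)\<^sup>2 \<partial>lborel)"
      unfolding heat by (rule Young_gauss) (use s in auto)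
    finally show "(\<integral>\<^sup>+x. (\<integral>\<^sup>+z. ennreal (gauss (s + t) (x - z)) * indicator {0<..} t \<partial>\<nu>) \<partial>\<nu>) \<le> (\<integral>\<^sup>+z. heat (t/2) \<nu> z * heat (t/2) \<nu> z \<partial>lborel)"
      by (simp add: power2_eq_square)
  qed
  also have "\<dots> = mutual_energy \<alpha> \<nu> \<nu>" by (rule energy_heat[OF \<nu> \<nu>, symmetric])
  finally show ?thesis .
qed

lemma potential_density_lborel:
  assumes [measurable]: "\<rho> \<in> borel_measurable borel"
  shows "potential \<alpha> (density lborel \<rho>) (x :: 'a) = conv (km {0<..}) \<rho> x"
  unfolding potential_def conv_def riesz_kernel_km
  by (subst nn_integral_density_borel) (auto simp: mult.commute intro: km_measurable)

text \<open>By symmetry this is the \<nu>-integral of the potential of a Gaussian. With s >= 1 all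
  times involved are at least 1 + t, so that potential is bounded uniformly.\<close>

lemma nn_integral_potential_gauss_finite:
  assumes \<nu>: "sigma_finite_borel (\<nu> :: 'a measure)" "emeasure \<nu> UNIV < \<infinity>" and s: "1 \<le> s"
  shows "(\<integral>\<^sup>+x. ennreal (gauss s x) * potential \<alpha> \<nu> x \<partial>lborel) < \<infinity>"
proof -
  have sf: "sigma_finite_borel (density lborel (\<lambda>x::'a. ennreal (gauss s x)))"
    by (rule sigma_finite_borel_density[OF sigma_finite_borel_lborel]) auto
  have "(\<integral>\<^sup>+x. ennreal (gauss s x) * potential \<alpha> \<nu> x \<partial>lborel) = (\<integral>\<^sup>+x. potential \<alpha> \<nu> x \<partial>density lborel (\<lambda>x::'a. ennreal (gauss s x)))"
    by (rule nn_integral_density_borel[symmetric]) (use \<nu> in auto)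
  also have "\<dots> = (\<integral>\<^sup>+x. potential \<alpha> (density lborel (\<lambda>x::'a. ennreal (gauss s x))) x \<partial>\<nu>)"
    by (rule nn_integral_potential_commute[OF \<nu>(1) sf])
  also have "\<dots> \<le> (\<integral>\<^sup>+x. (\<integral>\<^sup>+t. ennreal (gauss (1 + t) (0::'a)) \<partial>rtime C \<alpha>) \<partial>\<nu>)"
  proof (rule nn_integral_mono)
    fix x :: 'a
    have "potential \<alpha> (density lborel (\<lambda>x::'a. ennreal (gauss s x))) x = conv (km {0<..}) (\<lambda>x. ennreal (gauss s x)) x"
      by (rule potential_density_lborel) measurable
    also have "\<dots> = conv (\<lambda>x. ennreal (gauss s x)) (km {0<..}) x"
      by (rule conv_commute) (auto intro: km_measurable[of _ "\<lambda>x. x"])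
    also have "\<dots> = (\<integral>\<^sup>+t. ennreal (gauss (s + t) x) * indicator {0<..} t \<partial>rtime C \<alpha>)"
      unfolding km_def using s by (intro conv_gauss_mix sigma_finite_borel_rtime AE_rtime_pos) auto
    also have "\<dots> \<le> (\<integral>\<^sup>+t. ennreal (gauss (1 + t) (0::'a)) \<partial>rtime C \<alpha>)"
    proof (rule nn_integral_mono_AE, use AE_rtime_pos[of C \<alpha>] in eventually_elim)
      fix t :: real assume t: "0 < t"
      have "gauss (s + t) x \<le> gauss (s + t) (0::'a)" using s t by (intro gauss_le_zero) auto
      also have "\<dots> \<le> gauss (1 + t) (0::'a)" using s t by (simp add: gauss_def powr_mono2')
      finally show "ennreal (gauss (s + t) x) * indicator {0<..} t \<le> ennreal (gauss (1 + t) (0::'a))"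
        using t by (simp add: ennreal_leI)
    qed
    finally show "potential \<alpha> (density lborel (\<lambda>x::'a. ennreal (gauss s x))) x \<le> (\<integral>\<^sup>+t. ennreal (gauss (1 + t) (0::'a)) \<partial>rtime C \<alpha>)" .
  qed
  also have "\<dots> < \<infinity>"
    using km_shift_finite \<nu> sigma_finite_borelD[OF \<nu>(1)] by (simp add: ennreal_mult_less_top)
  finally show ?thesis .
qed

lemma potential_finite_AE_lborel:
  assumes \<nu>: "sigma_finite_borel (\<nu> :: 'a measure)" "emeasure \<nu> UNIV < \<infinity>"
  shows "AE x in lborel. potential \<alpha> \<nu> x < \<infinity>"
proof -
  have "AE x in lborel. ennreal (gauss 1 x) * potential \<alpha> \<nu> x \<noteq> \<infinity>"
    by (rule nn_integral_PInf_AE) (use nn_integral_potential_gauss_finite[OF \<nu>, of 1] \<nu> in auto)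
  then show ?thesis
    by eventually_elim (metis ennreal_eq_0_iff ennreal_mult_eq_top_iff gauss_pos infinity_ennreal_def less_top not_less zero_less_one)
qed

lemma conv_renewal_potential_le:
  assumes p[measurable]: "p \<in> borel_measurable borel" and p0: "\<And>x. conv p (km {0<..}) x = km {r<..} x" and r: "0 < r"
    and \<nu>: "sigma_finite_borel (\<nu> :: 'a measure)"
  shows "conv p (potential \<alpha> \<nu>) x = (\<integral>\<^sup>+z. km {r<..} (x - z) \<partial>\<nu>)" "conv p (potential \<alpha> \<nu>) x \<le> potential \<alpha> \<nu> x"
proof -
  show eq: "conv p (potential \<alpha> \<nu>) x = (\<integral>\<^sup>+z. km {r<..} (x - z) \<partial>\<nu>)"
    by (simp add: conv_potential[OF \<nu> p] p0)
  show "conv p (potential \<alpha> \<nu>) x \<le> potential \<alpha> \<nu> x"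
    unfolding eq potential_km by (intro nn_integral_mono km_mono) (use r in auto)
qed

text \<open>Convolution with the renewal kernel decreases every potential, since it drops times;
  hence it decreases a minimum of two potentials. This is the stability of excessive functions under
  minima, and it makes h - p h a positive charge.\<close>

lemma charge_of_min:
  assumes \<nu>: "sigma_finite_borel \<nu>" "emeasure \<nu> UNIV < \<infinity>" and \<sigma>: "sigma_finite_borel \<sigma>" and r: "0 < r"
  obtains \<rho> where "\<rho> \<in> borel_measurable borel" "\<And>x::'a. \<rho> x \<le> potential \<alpha> \<nu> x"
    "\<And>x. conv (km {0<..}) \<rho> x = conv (km {0<..r}) (\<lambda>x. min (potential \<alpha> \<nu> x) (potential \<alpha> \<sigma> x)) x"
proof -
  note [measurable (raw)] = potential_measurable[OF \<nu>(1)] potential_measurable[OF \<sigma>]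
  obtain p :: "'a \<Rightarrow> ennreal" where p: "p \<in> borel_measurable borel" 
    "\<And>x. conv p (km {0<..}) x = km {r<..} x"
    "\<And>c x. conv p (km {c<..}) x \<le> km {c + r<..} x"
    using renewal_kernel[OF r] by blast
  define h where "h x = min (potential \<alpha> \<nu> x) (potential \<alpha> \<sigma> x)" for x
  have [measurable]: "h \<in> borel_measurable borel" unfolding h_def by measurable
  have ph: "conv p h x \<le> h x" for x
  proof -
    have "conv p h x \<le> potential \<alpha> \<nu> x"
      by (rule order_trans[OF conv_mono conv_renewal_potential_le(2)[OF p(1,2) r \<nu>(1)]]) (simp add: h_def)
    moreover have "conv p h x \<le> potential \<alpha> \<sigma> x"
      by (rule order_trans[OF conv_mono conv_renewal_potential_le(2)[OF p(1,2) r \<sigma>]]) (simp add: h_def)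
    ultimately show ?thesis by (simp add: h_def)
  qed
  show ?thesis
  proof (rule that)
    note [measurable] = p(1)
    show "(\<lambda>x. h x - conv p h x) \<in> borel_measurable borel" by measurable
    show "h x - conv p h x \<le> potential \<alpha> \<nu> x" for x
      by (rule order_trans[OF diff_le_self_ennreal]) (simp add: h_def)
    show "conv (km {0<..}) (\<lambda>x. h x - conv p h x) x = conv (km {0<..r}) (\<lambda>x. min (potential \<alpha> \<nu> x) (potential \<alpha> \<sigma> x)) x" for x
      unfolding h_def[symmetric]
      by (rule potential_charge[OF r p \<nu> _ _ ph]) (auto simp: h_def)
  qed
qed

end


section \<open>Energy bounds for the charges, and domination\<close>

context riesz_space
begin

lemma km_borel [measurable]: "A \<in> sets borel \<Longrightarrow> km A \<in> borel_measurable borel"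
  using km_measurable[of A "\<lambda>x. x"] by simp

text \<open>Two smoothings by \<open>km A\<close> form a double mixture of heat kernels; each
  component does not raise the energy, and the total weight is the square of the time mass of
  A.\<close>

lemma nn_integral_smoothed_potential_le:
  assumes \<nu>: "sigma_finite_borel (\<nu> :: 'a measure)" and A: "A \<in> sets borel"
  shows "(\<integral>\<^sup>+x. conv (km A) (conv (km A) (potential \<alpha> \<nu>)) x \<partial>\<nu>) \<le> (emeasure (rtime C \<alpha>) A)\<^sup>2 * mutual_energy \<alpha> \<nu> \<nu>"
proof -
  note [measurable_cong] = sigma_finite_borelD(2)[OF \<nu>]
  note [measurable] = A potential_borel[OF \<nu>]
  have inner: "conv (km A) (conv (km A) (potential \<alpha> \<nu>)) x =
    (\<integral>\<^sup>+s. (\<integral>\<^sup>+t. conv (\<lambda>z. ennreal (gauss (t + s) z)) (potential \<alpha> \<nu>) x * (indicator A t * indicator A s) \<partial>rtime C \<alpha>) \<partial>rtime C \<alpha>)" for x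
  proof -
    have "conv (km A) (conv (km A) (potential \<alpha> \<nu>)) x = (\<integral>\<^sup>+s. conv (\<lambda>z. ennreal (gauss s z)) (conv (km A) (potential \<alpha> \<nu>)) x * indicator A s \<partial>rtime C \<alpha>)"
      by (rule conv_km) measurable
    also have "\<dots> = (\<integral>\<^sup>+s. (\<integral>\<^sup>+t. conv (\<lambda>z. ennreal (gauss (t + s) z)) (potential \<alpha> \<nu>) x * (indicator A t * indicator A s) \<partial>rtime C \<alpha>) \<partial>rtime C \<alpha>)"
    proof (rule nn_integral_cong_AE, use AE_rtime_pos[of C \<alpha>] in eventually_elim)
      fix s :: real assume s: "0 < s"
      let ?g = "\<lambda>t z. ennreal (gauss t (z::'a))"
      have "conv (?g s) (conv (km A) (potential \<alpha> \<nu>)) x = conv (conv (?g s) (km A)) (potential \<alpha> \<nu>) x"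
        by (rule conv_assoc) measurable
      also have "conv (?g s) (km A) = conv (km A) (?g s)" by (rule ext, rule conv_commute) measurable
      also have "conv (conv (km A) (?g s)) (potential \<alpha> \<nu>) x = conv (km A) (conv (?g s) (potential \<alpha> \<nu>)) x"
        by (rule conv_assoc[symmetric]) measurable
      also have "\<dots> = (\<integral>\<^sup>+t. conv (?g t) (conv (?g s) (potential \<alpha> \<nu>)) x * indicator A t \<partial>rtime C \<alpha>)"
        by (rule conv_km) measurable
      also have "\<dots> = (\<integral>\<^sup>+t. conv (?g (t + s)) (potential \<alpha> \<nu>) x * indicator A t \<partial>rtime C \<alpha>)"
      proof (rule nn_integral_cong_AE, use AE_rtime_pos[of C \<alpha>] in eventually_elim)
        fix t :: real assume t: "0 < t"
        have "conv (?g t) (conv (?g s) (potential \<alpha> \<nu>)) x = conv (conv (?g t) (?g s)) (potential \<alpha> \<nu>) x"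
          by (rule conv_assoc) measurable
        also have "conv (?g t) (?g s) = ?g (t + s)"
          using gauss_conv[OF t s, of _ "0::'a"] by (auto simp: conv_def)
        finally show "conv (?g t) (conv (?g s) (potential \<alpha> \<nu>)) x * indicator A t = conv (?g (t + s)) (potential \<alpha> \<nu>) x * indicator A t" by simp
      qed
      finally have "conv (?g s) (conv (km A) (potential \<alpha> \<nu>)) x * indicator A s =
        (\<integral>\<^sup>+t. conv (?g (t + s)) (potential \<alpha> \<nu>) x * indicator A t \<partial>rtime C \<alpha>) * indicator A s" by simp
      also have "\<dots> = (\<integral>\<^sup>+t. conv (?g (t + s)) (potential \<alpha> \<nu>) x * (indicator A t * indicator A s) \<partial>rtime C \<alpha>)"
        unfolding conv_def by (subst nn_integral_multc[symmetric]) (measurable, simp add: mult.assoc)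
      finally show "conv (?g s) (conv (km A) (potential \<alpha> \<nu>)) x * indicator A s = (\<integral>\<^sup>+t. conv (?g (t + s)) (potential \<alpha> \<nu>) x * (indicator A t * indicator A s) \<partial>rtime C \<alpha>)" .
    qed
    finally show ?thesis .
  qed
  have m3: "(\<lambda>w. conv (\<lambda>z. ennreal (gauss (fst (snd w) + fst w) z)) (potential \<alpha> \<nu>) (snd (snd w))) \<in> borel_measurable (borel \<Otimes>\<^sub>M (borel \<Otimes>\<^sub>M borel))"
    unfolding conv_def by measurable
  have "(\<integral>\<^sup>+x. conv (km A) (conv (km A) (potential \<alpha> \<nu>)) x \<partial>\<nu>) =
    (\<integral>\<^sup>+s. (\<integral>\<^sup>+x. (\<integral>\<^sup>+t. conv (\<lambda>z. ennreal (gauss (t + s) z)) (potential \<alpha> \<nu>) x * (indicator A t * indicator A s) \<partial>rtime C \<alpha>) \<partial>\<nu>) \<partial>rtime C \<alpha>)"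
    unfolding inner
  proof (rule Tonelli_borel[OF \<nu> sigma_finite_borel_rtime])
    have "(\<lambda>w. \<integral>\<^sup>+t. conv (\<lambda>z. ennreal (gauss (t + snd w) z)) (potential \<alpha> \<nu>) (fst w) * (indicator A t * indicator A (snd w)) \<partial>rtime C \<alpha>) \<in> borel_measurable (borel \<Otimes>\<^sub>M borel)"
      unfolding conv_def by (rule borel_measurable_nn_integral_snd[OF sigma_finite_borel_rtime]) measurable
    then show "(\<lambda>(x, s). \<integral>\<^sup>+t. conv (\<lambda>z. ennreal (gauss (t + s) z)) (potential \<alpha> \<nu>) x * (indicator A t * indicator A s) \<partial>rtime C \<alpha>) \<in> borel_measurable (borel \<Otimes>\<^sub>M borel)"
      by (simp add: case_prod_beta')
  qed
  also have "\<dots> = (\<integral>\<^sup>+s. (\<integral>\<^sup>+t. (\<integral>\<^sup>+x. conv (\<lambda>z. ennreal (gauss (t + s) z)) (potential \<alpha> \<nu>) x * (indicator A t * indicator A s) \<partial>\<nu>) \<partial>rtime C \<alpha>) \<partial>rtime C \<alpha>)"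
    unfolding conv_def by (intro nn_integral_cong Tonelli_borel[OF \<nu> sigma_finite_borel_rtime]) measurable
  also have "\<dots> \<le> (\<integral>\<^sup>+s. (\<integral>\<^sup>+t. mutual_energy \<alpha> \<nu> \<nu> * (indicator A t * indicator A s) \<partial>rtime C \<alpha>) \<partial>rtime C \<alpha>)"
  proof (rule nn_integral_mono_AE, use AE_rtime_pos[of C \<alpha>] in eventually_elim)
    fix s :: real assume s: "0 < s"
    show "(\<integral>\<^sup>+t. (\<integral>\<^sup>+x. conv (\<lambda>z. ennreal (gauss (t + s) z)) (potential \<alpha> \<nu>) x * (indicator A t * indicator A s) \<partial>\<nu>) \<partial>rtime C \<alpha>)
      \<le> (\<integral>\<^sup>+t. mutual_energy \<alpha> \<nu> \<nu> * (indicator A t * indicator A s) \<partial>rtime C \<alpha>)"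
    proof (rule nn_integral_mono_AE, use AE_rtime_pos[of C \<alpha>] in eventually_elim)
      fix t :: real assume t: "0 < t"
      have "(\<integral>\<^sup>+x. conv (\<lambda>z. ennreal (gauss (t + s) z)) (potential \<alpha> \<nu>) x * (indicator A t * indicator A s) \<partial>\<nu>)
        = (\<integral>\<^sup>+x. conv (\<lambda>z. ennreal (gauss (t + s) z)) (potential \<alpha> \<nu>) x \<partial>\<nu>) * (indicator A t * indicator A s)"
        by (rule nn_integral_multc) measurable
      also have "\<dots> \<le> mutual_energy \<alpha> \<nu> \<nu> * (indicator A t * indicator A s)"
        by (intro mult_right_mono energy_heat_decreasing[OF \<nu>]) (use s t in auto)
      finally show "(\<integral>\<^sup>+x. conv (\<lambda>z. ennreal (gauss (t + s) z)) (potential \<alpha> \<nu>) x * (indicator A t * indicator A s) \<partial>\<nu>) \<le> mutual_energy \<alpha> \<nu> \<nu> * (indicator A t * indicator A s)" .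
    qed
  qed
  also have "\<dots> = (\<integral>\<^sup>+s. mutual_energy \<alpha> \<nu> \<nu> * emeasure (rtime C \<alpha>) A * indicator A s \<partial>rtime C \<alpha>)"
  proof (rule nn_integral_cong)
    fix s :: real
    have "(\<integral>\<^sup>+t. mutual_energy \<alpha> \<nu> \<nu> * (indicator A t * indicator A s) \<partial>rtime C \<alpha>) = (\<integral>\<^sup>+t. (mutual_energy \<alpha> \<nu> \<nu> * indicator A s) * indicator A t \<partial>rtime C \<alpha>)"
      by (simp add: mult_ac)
    also have "\<dots> = (mutual_energy \<alpha> \<nu> \<nu> * indicator A s) * emeasure (rtime C \<alpha>) A"
      by (rule nn_integral_cmult_indicator) (use A in auto)
    finally show "(\<integral>\<^sup>+t. mutual_energy \<alpha> \<nu> \<nu> * (indicator A t * indicator A s) \<partial>rtime C \<alpha>) = mutual_energy \<alpha> \<nu> \<nu> * emeasure (rtime C \<alpha>) A * indicator A s"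
      by (simp add: mult_ac)
  qed
  also have "\<dots> = (mutual_energy \<alpha> \<nu> \<nu> * emeasure (rtime C \<alpha>) A) * emeasure (rtime C \<alpha>) A"
    by (rule nn_integral_cmult_indicator) (use A in auto)
  also have "\<dots> = (emeasure (rtime C \<alpha>) A)\<^sup>2 * mutual_energy \<alpha> \<nu> \<nu>" by (simp add: power2_eq_square mult_ac)
  finally show ?thesis .
qed

text \<open>The energy is the integral of \<rho> against km A * h, at most that against km A *
  U^\<nu>. The kernels are even, so this equals the \<nu>-integral of km A applied to the potential
  of \<rho>, that is, of km A * km A * h; bounding h by U^\<nu> again ends in the twice smoothed
  potential.\<close>

lemma energy_of_charge_le:
  assumes \<nu>: "sigma_finite_borel (\<nu> :: 'a measure)" "emeasure \<nu> UNIV < \<infinity>" and A: "A \<in> sets borel"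
    and \<rho>[measurable]: "\<rho> \<in> borel_measurable borel" and h[measurable]: "h \<in> borel_measurable borel"
    and hu: "\<And>x. h x \<le> potential \<alpha> \<nu> x" and \<rho>u: "\<And>x. \<rho> x \<le> potential \<alpha> \<nu> x"
    and U\<rho>: "\<And>x. conv (km {0<..}) \<rho> x = conv (km A) h x"
  shows "mutual_energy \<alpha> (density lborel \<rho>) (density lborel \<rho>) \<le> (emeasure (rtime C \<alpha>) A)\<^sup>2 * mutual_energy \<alpha> \<nu> \<nu>"
proof -
  note [measurable_cong] = sigma_finite_borelD(2)[OF \<nu>(1)]
  note [measurable] = A potential_borel[OF \<nu>(1)]
  have fin: "AE x in lborel. \<rho> x < \<infinity>"
    using potential_finite_AE_lborel[OF \<nu>] by eventually_elim (use \<rho>u le_less_trans in blast)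
  have "mutual_energy \<alpha> (density lborel \<rho>) (density lborel \<rho>) = (\<integral>\<^sup>+x. \<rho> x * conv (km {0<..}) \<rho> x \<partial>lborel)"
    using potential_borel[OF sigma_finite_borel_density[OF sigma_finite_borel_lborel \<rho> fin]]
    unfolding mutual_energy_potential by (subst nn_integral_density_borel) (auto simp: potential_density_lborel)
  also have "\<dots> \<le> (\<integral>\<^sup>+x. \<rho> x * conv (km A) (potential \<alpha> \<nu>) x \<partial>lborel)"
    unfolding U\<rho> by (intro nn_integral_mono mult_left_mono conv_mono hu) auto
  also have "\<dots> = (\<integral>\<^sup>+x. (\<integral>\<^sup>+z. \<rho> x * conv (km A) (km {0<..}) (x - z) \<partial>\<nu>) \<partial>lborel)"
    by (simp add: conv_potential[OF \<nu>(1)] nn_integral_cmult[symmetric])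
  also have "\<dots> = (\<integral>\<^sup>+z. (\<integral>\<^sup>+x. \<rho> x * conv (km A) (km {0<..}) (x - z) \<partial>lborel) \<partial>\<nu>)"
    by (rule Tonelli_borel[OF sigma_finite_borel_lborel \<nu>(1)]) measurable
  also have "\<dots> = (\<integral>\<^sup>+z. conv (conv (km A) (km {0<..})) \<rho> z \<partial>\<nu>)"
  proof (rule nn_integral_cong)
    fix z :: 'a
    have even0: "km B (- x) = km B x" for B x by (simp add: km_def mix_def)
    have even: "conv (km A) (km {0<..}) (- y) = conv (km A) (km {0<..}) y" for y
      by (rule conv_even[OF km_borel[OF A] km_borel even0 even0]) simp
    have "conv (km A) (km {0<..}) (x - z) = conv (km A) (km {0<..}) (z - x)" for x
      using even[of "z - x"] by simp
    then show "(\<integral>\<^sup>+x. \<rho> x * conv (km A) (km {0<..}) (x - z) \<partial>lborel) = conv (conv (km A) (km {0<..})) \<rho> z"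
      by (simp add: conv_def[of "conv _ _"] mult.commute)
  qed
  also have "\<dots> = (\<integral>\<^sup>+z. conv (km A) (conv (km A) h) z \<partial>\<nu>)"
    by (simp add: conv_assoc[symmetric] U\<rho>[abs_def])
  also have "\<dots> \<le> (\<integral>\<^sup>+z. conv (km A) (conv (km A) (potential \<alpha> \<nu>)) z \<partial>\<nu>)"
    by (intro nn_integral_mono conv_mono hu)
  also have "\<dots> \<le> (emeasure (rtime C \<alpha>) A)\<^sup>2 * mutual_energy \<alpha> \<nu> \<nu>"
    by (rule nn_integral_smoothed_potential_le[OF \<nu>(1) A])
  finally show ?thesis .
qed

definition short_mass :: "real \<Rightarrow> real" where
  "short_mass r = C * r powr (\<alpha> / 2) / (\<alpha> / 2)"

lemma short_mass: "0 < r \<Longrightarrow> 0 < short_mass r" "0 < r \<Longrightarrow> emeasure (rtime C \<alpha>) {0<..r} = ennreal (short_mass r)"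
  using alpha C by (auto simp: short_mass_def emeasure_rtime_interval)

text \<open>Divided by the mass of its times, the short-time kernel is an average of heat kernels of
  small times, each of which recovers h from below.\<close>

lemma smoothing_liminf:
  assumes h: "\<And>c. open {y. c < h (y :: 'a)}" and r: "\<And>k. 0 < r k" "r \<longlonglongrightarrow> 0"
  shows "h x \<le> liminf (\<lambda>k. ennreal (1 / short_mass (r k)) * conv (km {0<..r k}) h x)"
proof (rule dense_le)
  have [measurable]: "h \<in> borel_measurable borel"
    by (rule borel_measurableI_greater) (simp add: h)
  fix c assume "c < h x"
  from gauss_lsc[OF h this] obtain \<delta> where \<delta>: "0 < \<delta>" "\<And>t. 0 < t \<Longrightarrow> t \<le> \<delta> \<Longrightarrow> c \<le> (\<integral>\<^sup>+y. ennreal (gauss t (x - y)) * h y \<partial>lborel)"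
    by blast
  have "\<forall>\<^sub>F k in sequentially. r k < \<delta>" using order_tendstoD(2)[OF r(2) \<delta>(1)] .
  then show "c \<le> liminf (\<lambda>k. ennreal (1 / short_mass (r k)) * conv (km {0<..r k}) h x)"
  proof (intro Liminf_bounded, elim eventually_mono)
    fix k assume k: "r k < \<delta>"
    have "ennreal (short_mass (r k)) * c = (\<integral>\<^sup>+t. c * indicator {0<..r k} t \<partial>rtime C \<alpha>)"
      by (subst nn_integral_cmult_indicator) (use r in \<open>auto simp: short_mass mult.commute\<close>)
    also have "\<dots> \<le> (\<integral>\<^sup>+t. conv (\<lambda>z. ennreal (gauss t z)) h x * indicator {0<..r k} t \<partial>rtime C \<alpha>)"
      by (rule nn_integral_mono) (use \<delta>(2) k in \<open>auto simp: indicator_def conv_def\<close>)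
    also have "\<dots> = conv (km {0<..r k}) h x" by (rule conv_km[symmetric]) auto
    finally have "ennreal (1 / short_mass (r k)) * (ennreal (short_mass (r k)) * c) \<le> ennreal (1 / short_mass (r k)) * conv (km {0<..r k}) h x"
      by (rule mult_left_mono) simp
    moreover have "ennreal (1 / short_mass (r k)) * ennreal (short_mass (r k)) = 1"
      using short_mass(1)[OF r(1), of k] by (simp add: ennreal_mult[symmetric])
    ultimately show "c \<le> ennreal (1 / short_mass (r k)) * conv (km {0<..r k}) h x"
      by (simp add: mult.assoc[symmetric])
  qed
qed

text \<open>Let h be the smaller potential. The normalised charges \<mu>_k, whose potentials are
  short-time averages of h, have energy at most that of \<nu>, and their mutual energy with \<nu> is
  asymptotically at least E(\<nu>). So they converge to \<nu> in energy norm. Testing with a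
  Gaussian measure gives h = U^\<nu> Lebesgue-almost everywhere, and the renewal kernels carry this
  to every point.\<close>

theorem domination_principle:
  assumes \<nu>: "finite_energy_measure \<nu>" "emeasure \<nu> UNIV < \<infinity>" and \<sigma>: "sigma_finite_borel \<sigma>"
    and dom: "AE x in \<nu>. potential \<alpha> \<nu> x \<le> potential \<alpha> \<sigma> x"
  shows "potential \<alpha> \<nu> x \<le> potential \<alpha> \<sigma> x"
proof -
  have sf: "sigma_finite_borel \<nu>" using \<nu> by (simp add: finite_energy_measureD)
  note [measurable_cong] = sigma_finite_borelD(2)[OF sf]
  define u where "u = potential \<alpha> \<nu>"
  define v where "v = potential \<alpha> \<sigma>"
  define h where "h x = min (u x) (v x)" for x
  note [measurable] = potential_borel[OF sf, folded u_def] potential_borel[OF \<sigma>, folded v_def]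
  have [measurable]: "h \<in> borel_measurable borel" unfolding h_def by measurable
  have hu: "h x \<le> u x" for x by (simp add: h_def)
  have h_lsc: "open {y. c < h y}" for c
    using open_Int[OF potential_lsc[OF sf, of c] potential_lsc[OF \<sigma>, of c]]
    by (simp add: h_def u_def v_def Collect_conj_eq)
  define r where "r k = 1 / real (Suc k)" for k
  have r: "0 < r k" "r k \<le> 1" for k by (auto simp: r_def)
  have r0: "r \<longlonglongrightarrow> 0" unfolding r_def by real_asymp
  define M where "M k = short_mass (r k)" for k
  have M: "0 < M k" "emeasure (rtime C \<alpha>) {0<..r k} = ennreal (M k)" for k
    using short_mass[OF r(1)] by (auto simp: M_def)
  have "\<exists>\<rho>. \<rho> \<in> borel_measurable borel \<and> (\<forall>x::'a. \<rho> x \<le> u x) \<and> (\<forall>x. conv (km {0<..}) \<rho> x = conv (km {0<..r k}) h x)" for k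
    using charge_of_min[OF sf \<nu>(2) \<sigma> r(1)[of k]] unfolding u_def v_def h_def[abs_def] by metis
  then obtain \<rho> where \<rho>[measurable]: "\<And>k. \<rho> k \<in> borel_measurable borel" and \<rho>u: "\<And>k x. \<rho> k x \<le> u x"
    and U\<rho>: "\<And>k x. conv (km {0<..}) (\<rho> k) x = conv (km {0<..r k}) h x" by metis
  have \<rho>fin: "AE x in lborel. \<rho> k x < \<infinity>" for k
    using potential_finite_AE_lborel[OF sf \<nu>(2)] by eventually_elim (rule le_less_trans[OF \<rho>u], simp add: u_def)
  have sf\<rho>: "sigma_finite_borel (density lborel (\<rho> k))" for k
    by (rule sigma_finite_borel_density[OF sigma_finite_borel_lborel _ \<rho>fin]) auto
  have E\<rho>: "mutual_energy \<alpha> (density lborel (\<rho> k)) (density lborel (\<rho> k)) \<le> (ennreal (M k))\<^sup>2 * mutual_energy \<alpha> \<nu> \<nu>" for k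
    unfolding M(2)[symmetric]
    by (rule energy_of_charge_le[OF sf \<nu>(2) _ \<rho> _ _ _ U\<rho>]) (use hu \<rho>u in \<open>auto simp: u_def\<close>)
  have fe\<rho>: "finite_energy_measure (density lborel (\<rho> k))" for k
    unfolding finite_energy_measure_def
  proof
    have "(ennreal (M k))\<^sup>2 * mutual_energy \<alpha> \<nu> \<nu> < \<infinity>"
      using finite_energy_measureD(2)[OF \<nu>(1)] M(1)[of k] by (simp add: ennreal_mult_less_top ennreal_power less_imp_le)
    then show "mutual_energy \<alpha> (density lborel (\<rho> k)) (density lborel (\<rho> k)) < \<infinity>"
      by (rule le_less_trans[OF E\<rho>])
  qed (rule sf\<rho>)
  define \<mu> where "\<mu> k = scale_borel (1 / M k) (density lborel (\<rho> k))" for k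
  have fe\<mu>: "finite_energy_measure (\<mu> k)" for k
    unfolding \<mu>_def by (rule finite_energy_measure_scale[OF fe\<rho>])
  have en\<mu>: "en (\<mu> k) (\<mu> k) \<le> en \<nu> \<nu>" for k
  proof -
    have "en (density lborel (\<rho> k)) (density lborel (\<rho> k)) \<le> (M k)\<^sup>2 * en \<nu> \<nu>"
      using E\<rho>[of k] M(1)[of k] by (simp add: ennreal_en fe\<rho> \<nu> ennreal_power ennreal_mult[symmetric])
    then show ?thesis
      using M(1)[of k] by (simp add: \<mu>_def en_scale_left en_scale_right fe\<rho> finite_energy_measure_scale power2_eq_square field_simps)
  qed
  have E\<mu>: "mutual_energy \<alpha> (\<mu> k) \<gamma> = ennreal (1 / M k) * (\<integral>\<^sup>+x. conv (km {0<..r k}) h x \<partial>\<gamma>)" if "sigma_finite_borel \<gamma>" for k \<gamma>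
  proof -
    have "mutual_energy \<alpha> (\<mu> k) \<gamma> = ennreal (1 / M k) * mutual_energy \<alpha> (density lborel (\<rho> k)) \<gamma>"
      unfolding \<mu>_def by (rule mutual_energy_scale_left[OF sf\<rho> that])
    also have "mutual_energy \<alpha> (density lborel (\<rho> k)) \<gamma> = (\<integral>\<^sup>+x. conv (km {0<..r k}) h x \<partial>\<gamma>)"
      by (simp add: mutual_energy_potential[of _ \<gamma>] mutual_energy_commute[OF sf\<rho> that] potential_density_lborel U\<rho>)
    finally show ?thesis .
  qed
  \<comment> \<open>The hypothesis enters here: \<nu>-almost everywhere the minimum h is U^\<nu>
    itself.\<close>
  have E\<nu>: "ennreal (en \<nu> \<nu>) = (\<integral>\<^sup>+x. h x \<partial>\<nu>)"
    unfolding ennreal_en[OF \<nu>(1) \<nu>(1), symmetric] mutual_energy_potential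
    by (rule nn_integral_cong_AE, use dom in eventually_elim) (simp add: h_def u_def v_def min_def)
  also have "\<dots> \<le> (\<integral>\<^sup>+x. liminf (\<lambda>k. ennreal (1 / M k) * conv (km {0<..r k}) h x) \<partial>\<nu>)"
    unfolding M_def by (intro nn_integral_mono smoothing_liminf h_lsc r r0)
  also have "\<dots> \<le> liminf (\<lambda>k. \<integral>\<^sup>+x. ennreal (1 / M k) * conv (km {0<..r k}) h x \<partial>\<nu>)"
    by (rule nn_integral_liminf) measurable
  also have "\<dots> = liminf (\<lambda>k. ennreal (en (\<mu> k) \<nu>))"
    by (simp add: nn_integral_cmult E\<mu>[OF sf, symmetric] ennreal_en[OF fe\<mu> \<nu>(1)])
  finally have lim: "ennreal (en \<nu> \<nu>) \<le> liminf (\<lambda>k. ennreal (en (\<mu> k) \<nu>))" .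
  have ev: "\<forall>\<^sub>F k in sequentially. en \<nu> \<nu> - \<epsilon> < en (\<mu> k) \<nu>" if "0 < \<epsilon>" for \<epsilon>
  proof (cases "en \<nu> \<nu> - \<epsilon> < 0")
    case True
    then show ?thesis by (intro always_eventually allI less_le_trans[OF True en_nonneg])
  next
    case False
    then have "ennreal (en \<nu> \<nu> - \<epsilon>) < liminf (\<lambda>k. ennreal (en (\<mu> k) \<nu>))"
      using that by (intro less_le_trans[OF _ lim]) (simp add: ennreal_less_iff)
    then have "\<forall>\<^sub>F k in sequentially. ennreal (en \<nu> \<nu> - \<epsilon>) < ennreal (en (\<mu> k) \<nu>)"
      by (rule less_LiminfD)
    then show ?thesis by eventually_elim (use False in \<open>simp add: ennreal_less_iff\<close>)
  qed
  \<comment> \<open>A measure of finite energy with a strictly positive density, so that comparing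
    integrals against it settles almost every point.\<close>
  define \<gamma> where "\<gamma> = density lborel (\<lambda>x::'a. ennreal (gauss 1 x))"
  have sf\<gamma>: "sigma_finite_borel \<gamma>"
    unfolding \<gamma>_def by (rule sigma_finite_borel_density[OF sigma_finite_borel_lborel]) auto
  have m\<gamma>: "emeasure \<gamma> UNIV = 1"
    unfolding \<gamma>_def by (subst emeasure_density) (auto simp: nn_integral_gauss)
  have E\<gamma>': "mutual_energy \<alpha> \<gamma> \<tau> = (\<integral>\<^sup>+x. ennreal (gauss 1 x) * potential \<alpha> \<tau> x \<partial>lborel)" if "sigma_finite_borel \<tau>" for \<tau>
    unfolding mutual_energy_potential \<gamma>_def by (rule nn_integral_density_borel) (use that in auto)
  have fe\<gamma>: "finite_energy_measure \<gamma>"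
    unfolding finite_energy_measure_def E\<gamma>'[OF sf\<gamma>]
    using sf\<gamma> nn_integral_potential_gauss_finite[OF sf\<gamma>, of 1] m\<gamma> by auto
  \<comment> \<open>Bounds \<open>gauss (1 + t)\<close> for all t up to r k at once: the prefactor
    of time 1 with the exponential of time 1 + r k. It decreases to \<open>gauss 1\<close> as r k
    tends to 0.\<close>
  define G where "G k x = ennreal ((2 * pi) powr (- (real DIM('a) / 2)) * exp (- (norm x)\<^sup>2 / (2 * (1 + r k))))" for k and x :: 'a
  have [measurable]: "G k \<in> borel_measurable borel" for k unfolding G_def by measurable
  have Eup: "ennreal (en (\<mu> k) \<gamma>) \<le> (\<integral>\<^sup>+x. G k x * h x \<partial>lborel)" for k
  proof -
    have "(\<integral>\<^sup>+x. conv (km {0<..r k}) h x \<partial>\<gamma>) = (\<integral>\<^sup>+x. ennreal (gauss 1 (0 - x)) * conv (km {0<..r k}) h x \<partial>lborel)"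
      unfolding \<gamma>_def by (subst nn_integral_density_borel) auto
    also have "\<dots> = conv (\<lambda>x. ennreal (gauss 1 x)) (conv (km {0<..r k}) h) 0" by (simp add: conv_def[of "\<lambda>x. ennreal (gauss 1 x)"])
    also have "\<dots> = conv (conv (\<lambda>x. ennreal (gauss 1 x)) (km {0<..r k})) h 0" by (rule conv_assoc) measurable
    also have "\<dots> \<le> conv (\<lambda>x. ennreal (M k) * G k x) h 0"
    proof (rule conv_mono_left)
      fix x :: 'a
      have "conv (\<lambda>x. ennreal (gauss 1 x)) (km {0<..r k}) x = (\<integral>\<^sup>+t. ennreal (gauss (1 + t) x) * indicator {0<..r k} t \<partial>rtime C \<alpha>)"
        unfolding km_def by (intro conv_gauss_mix sigma_finite_borel_rtime AE_rtime_pos) auto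
      also have "\<dots> \<le> (\<integral>\<^sup>+t. G k x * indicator {0<..r k} t \<partial>rtime C \<alpha>)"
      proof (rule nn_integral_mono)
        fix t
        have "gauss (1 + t) x \<le> (2 * pi) powr (- (real DIM('a) / 2)) * exp (- (norm x)\<^sup>2 / (2 * (1 + r k)))" if "0 < t" "t \<le> r k"
        proof -
          have "(norm x)\<^sup>2 / (2 * (1 + r k)) \<le> (norm x)\<^sup>2 / (2 * (1 + t))"
            using that by (intro divide_left_mono) auto
          then show ?thesis
            unfolding gauss_def using that by (intro mult_mono) (auto intro!: powr_mono2')
        qed
        then show "ennreal (gauss (1 + t) x) * indicator {0<..r k} t \<le> G k x * indicator {0<..r k} t"
          by (auto simp: indicator_def G_def intro: ennreal_leI)
      qed
      also have "\<dots> = ennreal (M k) * G k x" by (subst nn_integral_cmult_indicator) (auto simp: M mult.commute)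
      finally show "conv (\<lambda>x. ennreal (gauss 1 x)) (km {0<..r k}) x \<le> ennreal (M k) * G k x" .
    qed
    also have "\<dots> = ennreal (M k) * (\<integral>\<^sup>+x. G k x * h x \<partial>lborel)"
      unfolding conv_def by (subst nn_integral_cmult[symmetric]) (auto simp: mult.assoc G_def)
    finally have "ennreal (1 / M k) * (\<integral>\<^sup>+x. conv (km {0<..r k}) h x \<partial>\<gamma>) \<le> ennreal (1 / M k) * (ennreal (M k) * (\<integral>\<^sup>+x. G k x * h x \<partial>lborel))"
      by (rule mult_left_mono) simp
    moreover have "ennreal (1 / M k) * ennreal (M k) = 1" using M(1)[of k] by (simp add: ennreal_mult[symmetric])
    ultimately show ?thesis
      by (simp add: ennreal_en[OF fe\<mu> fe\<gamma>, symmetric] E\<mu>[OF sf\<gamma>] mult.assoc[symmetric])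
  qed
  \<comment> \<open>As r k <= 1, the exponential is at most that of time 2; the factor 2^(n/2) is
    the ratio of the prefactors of times 1 and 2.\<close>
  have dominator: "G k x \<le> ennreal (2 powr (real DIM('a) / 2)) * ennreal (gauss 2 x)" for k x
  proof -
    have "exp (- (norm x)\<^sup>2 / (2 * (1 + r k))) \<le> exp (- (norm x)\<^sup>2 / (2 * 2))"
    proof -
      have "(norm x)\<^sup>2 / (2 * 2) \<le> (norm x)\<^sup>2 / (2 * (1 + r k))"
        using r[of k] by (intro divide_left_mono) auto
      then show ?thesis unfolding exp_le_cancel_iff minus_divide_left[symmetric] by (simp only: neg_le_iff_le)
    qed
    moreover have "(2 * pi) powr (- (real DIM('a) / 2)) = 2 powr (real DIM('a) / 2) * (2 * pi * 2) powr (- (real DIM('a) / 2))"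
    proof -
      have "(2 * pi * 2) powr (- (real DIM('a) / 2)) = (2 * pi) powr (- (real DIM('a) / 2)) * 2 powr (- (real DIM('a) / 2))"
        by (rule powr_mult)
      then show ?thesis using powr_add[of 2 "real DIM('a) / 2" "- (real DIM('a) / 2)"] by (simp only:) simp
    qed
    ultimately show ?thesis
      unfolding G_def gauss_def by (simp add: ennreal_mult[symmetric] ennreal_leI mult_left_mono)
  qed
  have Glim: "(\<lambda>k. \<integral>\<^sup>+x. G k x * h x \<partial>lborel) \<longlonglongrightarrow> (\<integral>\<^sup>+x. ennreal (gauss 1 x) * h x \<partial>lborel)"
  proof (rule nn_integral_dominated_convergence[where w="\<lambda>x. ennreal (2 powr (real DIM('a) / 2)) * (ennreal (gauss 2 x) * u x)"])
    show "AE x in lborel. G j x * h x \<le> ennreal (2 powr (real DIM('a) / 2)) * (ennreal (gauss 2 x) * u x)" for j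
      by (intro AE_I2) (use mult_mono[OF dominator hu] in \<open>auto simp: mult.assoc\<close>)
    show "(\<integral>\<^sup>+x. ennreal (2 powr (real DIM('a) / 2)) * (ennreal (gauss 2 x) * u x) \<partial>lborel) < \<infinity>"
      using nn_integral_potential_gauss_finite[OF sf \<nu>(2), of 2]
      by (subst nn_integral_cmult) (auto simp: ennreal_mult_less_top u_def[symmetric])
    show "AE x in lborel. (\<lambda>k. G k x * h x) \<longlonglongrightarrow> ennreal (gauss 1 x) * h x"
    proof (use potential_finite_AE_lborel[OF sf \<nu>(2)] in eventually_elim)
      fix x :: 'a assume fin: "potential \<alpha> \<nu> x < \<infinity>"
      have "(\<lambda>k. G k x) \<longlonglongrightarrow> ennreal ((2 * pi) powr (- (real DIM('a) / 2)) * exp (- (norm x)\<^sup>2 / (2 * (1 + 0))))"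
        unfolding G_def by (intro tendsto_ennrealI tendsto_intros r0) auto
      moreover have "h x \<noteq> \<infinity>" using hu[of x] fin by (auto simp: u_def)
      ultimately show "(\<lambda>k. G k x * h x) \<longlonglongrightarrow> ennreal (gauss 1 x) * h x"
        by (intro tendsto_mult_ennreal tendsto_const) (auto simp: gauss_def)
    qed
  qed measurable
  have fin_h: "(\<integral>\<^sup>+x. ennreal (gauss 1 x) * h x \<partial>lborel) < \<infinity>"
    by (rule le_less_trans[OF nn_integral_mono nn_integral_potential_gauss_finite[OF sf \<nu>(2) order_refl]])
       (auto simp: u_def[symmetric] intro!: mult_left_mono hu)
  define j where "j = enn2real (\<integral>\<^sup>+x. ennreal (gauss 1 x) * h x \<partial>lborel)"
  have j: "(\<integral>\<^sup>+x. ennreal (gauss 1 x) * h x \<partial>lborel) = ennreal j" "0 \<le> j"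
    using fin_h by (auto simp: j_def ennreal_enn2real less_top)
  have "en \<nu> \<gamma> \<le> j"
  proof (rule ccontr)
    assume "\<not> en \<nu> \<gamma> \<le> j"
    define d where "d = (en \<nu> \<gamma> - j) / 2"
    have d: "0 < d" "j + d = en \<nu> \<gamma> - d" using \<open>\<not> en \<nu> \<gamma> \<le> j\<close> by (auto simp: d_def field_simps)
    define g where "g = en \<gamma> \<gamma>"
    have g: "0 \<le> g" by (simp add: g_def)
    \<comment> \<open>Chosen so that 2 \<epsilon> g < d^2: the squared energy distance of
      \<open>\<mu> k\<close> to \<nu> is eventually below 2 \<epsilon>, while their mutual energies
      with \<gamma> would differ by at least d.\<close>
    define \<epsilon> where "\<epsilon> = d\<^sup>2 / (2 * (g + 1))"
    have \<epsilon>: "0 < \<epsilon>" using d g by (simp add: \<epsilon>_def)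
    have "\<forall>\<^sub>F k in sequentially. (\<integral>\<^sup>+x. G k x * h x \<partial>lborel) < ennreal (j + d)"
      by (rule order_tendstoD(2)[OF Glim]) (use j d in \<open>auto simp: ennreal_less_iff\<close>)
    with ev[OF \<epsilon>] have "\<forall>\<^sub>F k in sequentially. False"
    proof eventually_elim
      fix k assume 1: "en \<nu> \<nu> - \<epsilon> < en (\<mu> k) \<nu>" and 2: "(\<integral>\<^sup>+x. G k x * h x \<partial>lborel) < ennreal (j + d)"
      have "ennreal (en (\<mu> k) \<gamma>) < ennreal (j + d)" by (rule le_less_trans[OF Eup 2])
      then have "en (\<mu> k) \<gamma> < en \<nu> \<gamma> - d" using d by (simp add: ennreal_less_iff)
      then have "d \<le> en \<nu> \<gamma> - en (\<mu> k) \<gamma>" by simp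
      then have "d\<^sup>2 \<le> (en \<nu> \<gamma> - en (\<mu> k) \<gamma>)\<^sup>2" using d by (intro power_mono) auto
      also have "\<dots> = (en (\<mu> k) \<gamma> - en \<nu> \<gamma>)\<^sup>2" by (rule power2_commute)
      also have "\<dots> \<le> (en (\<mu> k) (\<mu> k) + en \<nu> \<nu> - 2 * en (\<mu> k) \<nu>) * g"
        unfolding g_def by (rule en_diff_Cauchy_Schwarz[OF fe\<mu> \<nu>(1) fe\<gamma>])
      also have "\<dots> \<le> (2 * \<epsilon>) * g" using 1 en\<mu>[of k] g by (intro mult_right_mono) auto
      also have "\<dots> = d\<^sup>2 * (g / (g + 1))" using g by (simp add: \<epsilon>_def field_simps)
      also have "\<dots> < d\<^sup>2 * 1" using d g by (intro mult_strict_left_mono) auto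
      finally show False by simp
    qed
    then show False by simp
  qed
  then have "(\<integral>\<^sup>+x. ennreal (gauss 1 x) * u x \<partial>lborel) \<le> (\<integral>\<^sup>+x. ennreal (gauss 1 x) * h x \<partial>lborel)"
    unfolding j u_def E\<gamma>'[OF sf, symmetric] by (simp add: mutual_energy_commute[OF sf\<gamma> sf] ennreal_en[OF \<nu>(1) fe\<gamma>] ennreal_leI)
  moreover have "(\<integral>\<^sup>+x. ennreal (gauss 1 x) * u x - ennreal (gauss 1 x) * h x \<partial>lborel) = (\<integral>\<^sup>+x. ennreal (gauss 1 x) * u x \<partial>lborel) - (\<integral>\<^sup>+x. ennreal (gauss 1 x) * h x \<partial>lborel)"
    by (rule nn_integral_diff) (use fin_h hu in \<open>auto intro!: mult_left_mono\<close>)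
  ultimately have "(\<integral>\<^sup>+x. ennreal (gauss 1 x) * u x - ennreal (gauss 1 x) * h x \<partial>lborel) = 0"
    by (metis diff_eq_0_ennreal ennreal_less_top j(1) le_less_trans)
  then have "AE x in lborel. ennreal (gauss 1 x) * u x - ennreal (gauss 1 x) * h x = 0"
    by (subst (asm) nn_integral_0_iff_AE) auto
  then have ae: "AE x in lborel. u x = h x"
    using potential_finite_AE_lborel[OF sf \<nu>(2)]
  proof eventually_elim
    fix x :: 'a assume 1: "ennreal (gauss 1 x) * u x - ennreal (gauss 1 x) * h x = 0" and 2: "potential \<alpha> \<nu> x < \<infinity>"
    have "ennreal (gauss 1 x) * u x \<le> ennreal (gauss 1 x) * h x"
      using 1 by (rule ennreal_minus_eq_0)
    moreover obtain a where "u x = ennreal a" "0 \<le> a" using 2 by (cases "u x") (auto simp: u_def)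
    moreover obtain b where "h x = ennreal b" "0 \<le> b" using 2 hu[of x] by (cases "h x") (auto simp: u_def top_unique)
    ultimately have "u x \<le> h x"
      using gauss_pos[of 1 x] by (simp add: ennreal_mult[symmetric])
    then show "u x = h x" using hu[of x] by simp
  qed
  \<comment> \<open>Convolution does not see null sets, so u may be replaced by h inside it; the
    result holds at every x. Letting r k tend to 0 restores the missing short times.\<close>
  have tail: "(\<integral>\<^sup>+z. km {r k<..} (x - z) \<partial>\<nu>) \<le> v x" for k
  proof -
    obtain p :: "'a \<Rightarrow> ennreal" where p: "p \<in> borel_measurable borel" "\<And>x. conv p (km {0<..}) x = km {r k<..} x"
      by (rule renewal_kernel[OF r(1)[of k]]) (rule that)
    have "(\<integral>\<^sup>+z. km {r k<..} (x - z) \<partial>\<nu>) = conv p u x"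
      unfolding u_def by (rule conv_renewal_potential_le(1)[OF p r(1) sf, symmetric])
    also have "\<dots> = conv p h x"
      unfolding conv_def by (rule nn_integral_cong_AE, use ae in eventually_elim) simp
    also have "\<dots> \<le> conv p v x" by (rule conv_mono) (simp add: h_def)
    also have "\<dots> \<le> v x" unfolding v_def by (rule conv_renewal_potential_le(2)[OF p r(1) \<sigma>])
    finally show ?thesis .
  qed
  have inc: "incseq (\<lambda>k x. km {r k<..} (x :: 'a))"
    by (auto simp: incseq_def le_fun_def r_def field_simps intro!: km_mono)
  have sup: "km {0<..} y = (SUP k. km {r k<..} y)" for y
  proof -
    have "km {0<..} y = (\<integral>\<^sup>+t. (SUP k. ennreal (gauss t y) * indicator {r k<..} t) \<partial>rtime C \<alpha>)"
      unfolding km_def mix_def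
    proof (rule nn_integral_cong_AE, use AE_rtime_pos[of C \<alpha>] in eventually_elim)
      fix t :: real assume t: "0 < t"
      then obtain k where "r k < t" unfolding r_def using reals_Archimedean[of t] by (auto simp: inverse_eq_divide)
      then have "ennreal (gauss t y) \<le> (SUP k. ennreal (gauss t y) * indicator {r k<..} t)"
        by (intro SUP_upper2[of k]) auto
      moreover have "(SUP k. ennreal (gauss t y) * indicator {r k<..} t) \<le> ennreal (gauss t y)"
        by (intro SUP_least) (auto simp: indicator_def)
      ultimately show "ennreal (gauss t y) * indicator {0<..} t = (SUP k. ennreal (gauss t y) * indicator {r k<..} t)"
        using t by simp
    qed
    also have "\<dots> = (SUP k. km {r k<..} y)"
      unfolding km_def mix_def
    proof (rule nn_integral_monotone_convergence_SUP)
      show "incseq (\<lambda>k t. ennreal (gauss t y) * indicator {r k<..} t)"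
        unfolding incseq_def le_fun_def
      proof (intro allI impI)
        fix m n :: nat and t :: real assume "m \<le> n"
        then have "r n \<le> r m" by (simp add: r_def field_simps)
        then show "ennreal (gauss t y) * indicator {r m<..} t \<le> ennreal (gauss t y) * indicator {r n<..} t"
          by (auto simp: indicator_def)
      qed
    qed measurable
    finally show ?thesis .
  qed
  have "potential \<alpha> \<nu> x = (SUP k. \<integral>\<^sup>+z. km {r k<..} (x - z) \<partial>\<nu>)"
    unfolding potential_km sup
    by (rule nn_integral_monotone_convergence_SUP) (use inc in \<open>auto simp: incseq_def le_fun_def\<close>)
  also have "\<dots> \<le> v x" by (rule SUP_least) (rule tail)
  finally show ?thesis by (simp add: v_def)
qed

end


section \<open>Vague compactness\<close>

definition evens :: "real set" where "evens = range (\<lambda>k::int. 2 * real_of_int k)"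

lemma infdist_evens:
  assumes "0 \<le> r" "r \<le> 1"
  shows "infdist (2 * real_of_int i + r) evens = r"
proof (rule antisym)
  have "infdist (2 * real_of_int i + r) evens \<le> dist (2 * real_of_int i + r) (2 * real_of_int i)"
    by (rule infdist_le) (auto simp: evens_def)
  then show "infdist (2 * real_of_int i + r) evens \<le> r" using assms by (simp add: dist_real_def)
  have "r \<le> dist (2 * real_of_int i + r) a" if "a \<in> evens" for a
  proof -
    from that obtain k where a: "a = 2 * real_of_int k" by (auto simp: evens_def)
    consider "k = i" | "k \<le> i - 1" | "i + 1 \<le> k" by linarith
    then show ?thesis
    proof cases
      case 2
      then have "real_of_int k \<le> real_of_int i - 1" by linarith
      then show ?thesis using assms by (simp add: a dist_real_def)
    next
      case 3
      then have "real_of_int i + 1 \<le> real_of_int k" by linarith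
      then show ?thesis using assms by (simp add: a dist_real_def)
    qed (use assms in \<open>simp add: a dist_real_def\<close>)
  qed
  then show "r \<le> infdist (2 * real_of_int i + r) evens"
    by (subst infdist_notempty) (auto simp: evens_def intro!: cINF_greatest)
qed

text \<open>Schoenberg's function: even, 2-periodic, 0 on [0, 1/3], affine in between, 1 on
  [2/3, 1]. The distance to the even integers builds in evenness and periodicity.\<close>

definition zigzag :: "real \<Rightarrow> real" where
  "zigzag t = max 0 (min 1 (3 * infdist t evens - 1))"

lemma zigzag_bounds: "0 \<le> zigzag t" "zigzag t \<le> 1"
  by (auto simp: zigzag_def)

lemma zigzag_continuous: "continuous_on A f \<Longrightarrow> continuous_on A (\<lambda>x. zigzag (f x))"
  unfolding zigzag_def by (intro continuous_intros)

text \<open>The point of the Cantor set whose ternary digits are twice the given binary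
  digits.\<close>

definition cantor_code :: "(nat \<Rightarrow> int) \<Rightarrow> real" where
  "cantor_code d = (\<Sum>j. 2 * real_of_int (d j) / 3 ^ Suc j)"

lemma cantor_code:
  assumes d: "\<And>j. d j \<in> {0, 1}"
  shows "cantor_code d = 2 * real_of_int (d 0) / 3 + cantor_code (\<lambda>j. d (Suc j)) / 3" (is ?A)
    and "0 \<le> cantor_code d" "cantor_code d \<le> 1"
proof -
  have g: "(\<lambda>j. 2 / 3 ^ Suc j) sums (1::real)"
    using sums_mult[OF geometric_sums[of "1/3::real"], of "2/3"] by (simp add: power_divide)
  have le: "0 \<le> 2 * real_of_int (d j) / 3 ^ Suc j" "2 * real_of_int (d j) / 3 ^ Suc j \<le> 2 / 3 ^ Suc j" for j
    using d[of j] by auto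
  have sm: "summable (\<lambda>j. 2 * real_of_int (d j) / 3 ^ Suc j)"
    by (rule summable_comparison_test'[OF sums_summable[OF g], of 0], subst real_norm_def, subst abs_of_nonneg[OF le(1)], rule le(2))
  show "0 \<le> cantor_code d" unfolding cantor_code_def by (rule suminf_nonneg[OF sm le(1)])
  show "cantor_code d \<le> 1"
    using suminf_le[OF le(2) sm sums_summable[OF g]] sums_unique[OF g] by (simp add: cantor_code_def)
  have le': "0 \<le> 2 * real_of_int (d (Suc j)) / 3 ^ Suc j" "2 * real_of_int (d (Suc j)) / 3 ^ Suc j \<le> 2 / 3 ^ Suc j" for j
    using d[of "Suc j"] by auto
  have sm': "summable (\<lambda>j. 2 * real_of_int (d (Suc j)) / 3 ^ Suc j)"
    by (rule summable_comparison_test'[OF sums_summable[OF g], of 0], subst real_norm_def, subst abs_of_nonneg[OF le'(1)], rule le'(2))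
  have "cantor_code d = 2 * real_of_int (d 0) / 3 + (\<Sum>j. 2 * real_of_int (d (Suc j)) / 3 ^ Suc (Suc j))"
    unfolding cantor_code_def by (subst suminf_split_head[OF sm]) simp
  also have "(\<Sum>j. 2 * real_of_int (d (Suc j)) / 3 ^ Suc (Suc j)) = (\<Sum>j. 2 * real_of_int (d (Suc j)) / 3 ^ Suc j / 3)"
    by (rule suminf_cong) simp
  also have "\<dots> = cantor_code (\<lambda>j. d (Suc j)) / 3"
    unfolding cantor_code_def by (rule suminf_divide[OF sm'])
  finally show ?A .
qed

text \<open>Ternary digits are 0 or 2, so the integer part split off by a shift is even and
  invisible to the 2-periodic \<open>zigzag\<close>.\<close>

lemma cantor_code_shift:
  assumes d: "\<And>j. d j \<in> {0, 1}"
  shows "\<exists>i. 3 ^ j * cantor_code d = 2 * real_of_int i + cantor_code (\<lambda>l. d (l + j))"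
proof (induction j)
  case 0
  show ?case by (rule exI[of _ 0]) simp
next
  case (Suc j)
  then obtain i where i: "3 ^ j * cantor_code d = 2 * real_of_int i + cantor_code (\<lambda>l. d (l + j))" by blast
  have "cantor_code (\<lambda>l. d (l + j)) = 2 * real_of_int (d (0 + j)) / 3 + cantor_code (\<lambda>l. d (Suc l + j)) / 3"
    by (rule cantor_code(1)) (rule d)
  then have "3 ^ Suc j * cantor_code d = 2 * real_of_int (3 * i + d j) + cantor_code (\<lambda>l. d (l + Suc j))"
    using i by simp
  then show ?case by blast
qed

text \<open>After the shift the remaining fraction lies in [0, 1/3] or in [2/3, 1] according to the
  digit d j, and there \<open>zigzag\<close> is constant.\<close>

lemma zigzag_cantor_code:
  assumes d: "\<And>j. d j \<in> {0, 1}"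
  shows "zigzag (3 ^ j * cantor_code d) = real_of_int (d j)"
proof -
  obtain i where i: "3 ^ j * cantor_code d = 2 * real_of_int i + cantor_code (\<lambda>l. d (l + j))"
    using cantor_code_shift[where d=d and j=j] d by blast
  have r: "0 \<le> cantor_code (\<lambda>l. d (l + j))" "cantor_code (\<lambda>l. d (l + j)) \<le> 1"
    by (intro cantor_code(2,3) d)+
  have r': "0 \<le> cantor_code (\<lambda>l. d (Suc l + j))" "cantor_code (\<lambda>l. d (Suc l + j)) \<le> 1"
    by (intro cantor_code(2,3) d)+
  have "cantor_code (\<lambda>l. d (l + j)) = 2 * real_of_int (d (0 + j)) / 3 + cantor_code (\<lambda>l. d (Suc l + j)) / 3"
    by (rule cantor_code(1)) (rule d)
  then show ?thesis
    unfolding zigzag_def i infdist_evens[OF r] using d[of j] r' by auto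
qed

definition binary_digit :: "real \<Rightarrow> nat \<Rightarrow> int" where
  "binary_digit y k = \<lfloor>2 ^ Suc k * y\<rfloor> mod 2"

lemma binary_digit_sums:
  assumes "0 \<le> y" "y < 1"
  shows "(\<lambda>k. real_of_int (binary_digit y k) / 2 ^ Suc k) sums y"
proof -
  define F where "F k = real_of_int \<lfloor>2 ^ k * y\<rfloor> / 2 ^ k" for k
  have step: "real_of_int (binary_digit y k) / 2 ^ Suc k = F (Suc k) - F k" for k
  proof -
    have "\<lfloor>2 ^ k * y\<rfloor> = \<lfloor>2 ^ Suc k * y\<rfloor> div 2"
      using floor_divide_real_eq_div[of 2 "2 ^ Suc k * y"] by simp
    then have "\<lfloor>2 ^ Suc k * y\<rfloor> = 2 * \<lfloor>2 ^ k * y\<rfloor> + binary_digit y k"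
      unfolding binary_digit_def by simp
    then show ?thesis by (simp add: F_def field_simps)
  qed
  have "F \<longlonglongrightarrow> y"
  proof (rule tendsto_sandwich[of "\<lambda>k. y - 1 / 2 ^ k" _ _ "\<lambda>_. y"])
    have up: "F k \<le> y" for k unfolding F_def by (simp add: divide_le_eq mult.commute)
    have low: "y - 1 / 2 ^ k \<le> F k" for k
    proof -
      have "(2 ^ k * y - 1) / 2 ^ k \<le> real_of_int \<lfloor>2 ^ k * y\<rfloor> / 2 ^ k"
        by (rule divide_right_mono) (linarith, simp)
      then show ?thesis unfolding F_def by (simp add: diff_divide_distrib)
    qed
    show "\<forall>\<^sub>F k in sequentially. y - 1 / 2 ^ k \<le> F k" "\<forall>\<^sub>F k in sequentially. F k \<le> y"
      using up low by auto
    have "(\<lambda>k. y - 1 / 2 ^ k) \<longlonglongrightarrow> y - 0"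
      using LIMSEQ_power_zero[of "1/2::real"] by (intro tendsto_diff tendsto_const) (simp add: power_divide)
    then show "(\<lambda>k. y - 1 / 2 ^ k) \<longlonglongrightarrow> y" by simp
  qed auto
  moreover have "F 0 = 0" using assms by (simp add: F_def floor_eq_iff)
  ultimately show ?thesis unfolding step using telescope_sums[of F y] by simp
qed

text \<open>Schoenberg's space-filling curve \<open>\<Phi>\<close>, together with a Borel right inverse \<open>T\<close> that reads off
  and interleaves binary digits.\<close>

lemma space_filling_curve:
  obtains T :: "'a::euclidean_space \<Rightarrow> real" and \<Phi> :: "real \<Rightarrow> 'a"
  where "T \<in> borel_measurable borel" "\<And>x. 0 \<le> T x" "\<And>x. T x \<le> 1"
    "continuous_on UNIV \<Phi>" "\<And>x. (\<And>b. b \<in> Basis \<Longrightarrow> 0 \<le> x \<bullet> b \<and> x \<bullet> b < 1) \<Longrightarrow> \<Phi> (T x) = x" "\<Phi> 0 = 0"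
proof -
  let ?n = "DIM('a)"
  obtain e where e: "bij_betw e (Basis :: 'a set) {0..<?n}"
    using ex_bij_betw_finite_nat[OF finite_Basis] by blast
  define e' where "e' = inv_into (Basis :: 'a set) e"
  have e'e: "e' (e b) = b" if "b \<in> Basis" for b
    unfolding e'_def using bij_betw_inv_into_left[OF e that] .
  have en: "e b < ?n" if "b \<in> Basis" for b using bij_betwE[OF e] that by auto
  define D where "D x j = binary_digit (x \<bullet> e' (j mod ?n)) (j div ?n)" for x :: 'a and j
  have D: "D x j \<in> {0, 1}" for x j unfolding D_def binary_digit_def by auto
  define T where "T x = cantor_code (D x)" for x
  define \<phi> where "\<phi> b t = (\<Sum>k. zigzag (3 ^ (k * ?n + e b) * t) / 2 ^ Suc k)" for b and t :: real
  define \<Phi> where "\<Phi> t = (\<Sum>b\<in>Basis. \<phi> b t *\<^sub>R b)" for t :: real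
  have geo: "summable (\<lambda>k. 1 / 2 ^ Suc k :: real)"
    using sums_summable[OF power_half_series] by (simp add: power_divide)
  show ?thesis
  proof (rule that[of T \<Phi>])
    show "T \<in> borel_measurable borel"
      unfolding T_def cantor_code_def D_def binary_digit_def by measurable
    show "0 \<le> T x" "T x \<le> 1" for x unfolding T_def by (intro cantor_code(2,3) D)+
    have cont: "continuous_on UNIV (\<phi> b)" for b
      unfolding \<phi>_def
    proof (rule uniform_limit_theorem[where F = sequentially])
      show "uniform_limit UNIV (\<lambda>n t. \<Sum>k<n. zigzag (3 ^ (k * ?n + e b) * t) / 2 ^ Suc k) (\<lambda>t. \<Sum>k. zigzag (3 ^ (k * ?n + e b) * t) / 2 ^ Suc k) sequentially"
        by (rule Weierstrass_m_test[OF _ geo]) (use zigzag_bounds in \<open>auto simp: divide_right_mono\<close>)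
      show "\<forall>\<^sub>F n in sequentially. continuous_on UNIV (\<lambda>t. \<Sum>k<n. zigzag (3 ^ (k * ?n + e b) * t) / 2 ^ Suc k)"
        by (intro always_eventually allI continuous_intros zigzag_continuous) auto
    qed simp
    then show "continuous_on UNIV \<Phi>" unfolding \<Phi>_def by (intro continuous_intros)
    have "zigzag 0 = 0" using infdist_evens[of 0 0] by (simp add: zigzag_def)
    then show "\<Phi> 0 = 0" by (simp add: \<Phi>_def \<phi>_def)
    fix x :: 'a assume x: "\<And>b. b \<in> Basis \<Longrightarrow> 0 \<le> x \<bullet> b \<and> x \<bullet> b < 1"
    have "\<phi> b (T x) = x \<bullet> b" if b: "b \<in> Basis" for b
    proof -
      have "zigzag (3 ^ (k * ?n + e b) * T x) = real_of_int (binary_digit (x \<bullet> b) k)" for k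
        unfolding T_def zigzag_cantor_code[OF D] using en[OF b] e'e[OF b] by (simp add: D_def)
      then show ?thesis
        unfolding \<phi>_def using sums_unique[OF binary_digit_sums[of "x \<bullet> b"]] x[OF b] by simp
    qed
    then show "\<Phi> (T x) = x" unfolding \<Phi>_def by (simp add: euclidean_representation)
  qed
qed

text \<open>Coordinatewise arctan, scaled: a homeomorphism onto the open unit cube. Infinity goes to
  the boundary of the cube.\<close>

lemma cube_compression:
  obtains h h' :: "'a::euclidean_space \<Rightarrow> 'a"
  where "continuous_on UNIV h" "\<And>x. h' (h x) = x" "\<And>x b. b \<in> Basis \<Longrightarrow> 0 < h x \<bullet> b \<and> h x \<bullet> b < 1"
    "open (range h)" "continuous_on (range h) h'"
proof -
  define h where "h x = (\<Sum>b\<in>Basis. (1/2 + arctan (x \<bullet> b) / pi) *\<^sub>R b)" for x :: 'a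
  define h' where "h' y = (\<Sum>b\<in>Basis. tan (pi * (y \<bullet> b - 1/2)) *\<^sub>R b)" for y :: 'a
  have hb: "h x \<bullet> b = 1/2 + arctan (x \<bullet> b) / pi" if "b \<in> Basis" for x b
    using that by (simp add: h_def)
  have h'b: "h' y \<bullet> b = tan (pi * (y \<bullet> b - 1/2))" if "b \<in> Basis" for y b
    using that by (simp add: h'_def)
  have inv: "h' (h x) = x" for x
    by (rule euclidean_eqI) (simp add: hb h'b tan_arctan)
  have bd: "0 < h x \<bullet> b \<and> h x \<bullet> b < 1" if "b \<in> Basis" for x b
    using arctan_lbound[of "x \<bullet> b"] arctan_ubound[of "x \<bullet> b"] by (simp add: hb[OF that] field_simps)
  have inv': "h (h' y) = y" if y: "\<And>b. b \<in> Basis \<Longrightarrow> 0 < y \<bullet> b \<and> y \<bullet> b < 1" for y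
  proof (rule euclidean_eqI)
    fix b :: 'a assume b: "b \<in> Basis"
    have "arctan (tan (pi * (y \<bullet> b - 1/2))) = pi * (y \<bullet> b - 1/2)"
      using y[OF b] by (intro arctan_tan) (auto simp: field_simps)
    then show "h (h' y) \<bullet> b = y \<bullet> b" by (simp add: hb[OF b] h'b[OF b])
  qed
  have rng: "range h = box 0 One"
  proof
    show "range h \<subseteq> box 0 One" using bd by (auto simp: mem_box)
    show "box 0 One \<subseteq> range h"
    proof
      fix y :: 'a assume "y \<in> box 0 One"
      then have "h (h' y) = y" by (intro inv') (auto simp: mem_box)
      then show "y \<in> range h" by (metis rangeI)
    qed
  qed
  show ?thesis
  proof (rule that[OF _ inv bd])
    show "continuous_on UNIV h" unfolding h_def by (intro continuous_intros) auto
    show "open (range h)" unfolding rng by (rule open_box)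
    have "cos (pi * (y \<bullet> b - 1/2)) \<noteq> 0" if "y \<in> range h" "b \<in> Basis" for y b
    proof -
      have "0 < y \<bullet> b" "y \<bullet> b < 1" using that bd by auto
      then have "0 < cos (pi * (y \<bullet> b - 1/2))" by (intro cos_gt_zero_pi) (auto simp: field_simps)
      then show ?thesis by simp
    qed
    then have "continuous_on (range h) (\<lambda>y. tan (pi * (y \<bullet> b - 1/2)))" if "b \<in> Basis" for b
      unfolding continuous_on_def using that by (intro ballI isCont_tendsto_compose[OF isCont_tan] tendsto_intros)
    then show "continuous_on (range h) h'"
      unfolding h'_def by (intro continuous_on_sum continuous_on_scaleR continuous_on_const)
  qed
qed

text \<open>Transport to the line by x -> T (h x) and use compactness of probability measures on a
  bounded interval. T is only measurable, but the curve that inverts it is continuous, so test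
  functions pull back to continuous functions on the line. Mass escaping to infinity reaches the
  boundary of the cube and is cut away.\<close>

theorem vague_compactness:
  fixes \<nu> :: "nat \<Rightarrow> 'a::euclidean_space measure"
  assumes sets: "\<And>k. sets (\<nu> k) = sets borel" and mass: "\<And>k. emeasure (\<nu> k) UNIV \<le> ennreal m"
  obtains s \<mu> where "strict_mono (s :: nat \<Rightarrow> nat)" "sets \<mu> = sets borel" "emeasure \<mu> UNIV \<le> ennreal m"
    "\<And>f :: 'a \<Rightarrow> real. continuous_on UNIV f \<Longrightarrow> (\<And>x. 0 \<le> f x) \<Longrightarrow> (f \<longlongrightarrow> 0) at_infinity \<Longrightarrow>
      (\<lambda>k. \<integral>\<^sup>+x. ennreal (f x) \<partial>\<nu> (s k)) \<longlonglongrightarrow> (\<integral>\<^sup>+x. ennreal (f x) \<partial>\<mu>)"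
proof -
  note [measurable_cong] = sets
  define m' where "m' = max m 1"
  have m': "0 < m'" "m \<le> m'" by (auto simp: m'_def)
  have mass': "emeasure (\<nu> k) UNIV \<le> ennreal m'" for k
    using mass[of k] m' by (meson ennreal_leI order_trans)
  have spc: "space (\<nu> k) = UNIV" for k using sets_eq_imp_space_eq[OF sets] by simp
  obtain T :: "'a \<Rightarrow> real" and \<Phi> :: "real \<Rightarrow> 'a" where T[measurable]: "T \<in> borel_measurable borel" and T01: "\<And>x. 0 \<le> T x" "\<And>x. T x \<le> 1"
    and \<Phi>: "continuous_on UNIV \<Phi>" and \<Phi>T: "\<And>x. (\<And>b. b \<in> Basis \<Longrightarrow> 0 \<le> x \<bullet> b \<and> x \<bullet> b < 1) \<Longrightarrow> \<Phi> (T x) = x" and \<Phi>0: "\<Phi> 0 = 0"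
    by (rule space_filling_curve) blast
  obtain h h' :: "'a \<Rightarrow> 'a" where h: "continuous_on UNIV h" and h'h: "\<And>x. h' (h x) = x"
    and hb: "\<And>x b. b \<in> Basis \<Longrightarrow> 0 < h x \<bullet> b \<and> h x \<bullet> b < 1"
    and hopen: "open (range h)" and h': "continuous_on (range h) h'"
    by (rule cube_compression) blast
  have [measurable]: "h \<in> borel_measurable borel" "\<Phi> \<in> borel_measurable borel"
    using h \<Phi> by (auto intro: borel_measurable_continuous_onI)
  define S where "S x = T (h x)" for x
  have [measurable]: "S \<in> borel_measurable borel" unfolding S_def by measurable
  have \<Phi>S: "\<Phi> (S x) = h x" for x unfolding S_def by (rule \<Phi>T) (use hb less_imp_le in blast)
  \<comment> \<open>The missing mass is placed at the parameter 0 to obtain probabilities; the curve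
    sends 0 to the origin, which is not in the open cube, so test functions vanish there.\<close>
  define N where "N k = scale_borel (1 / m') (add_measure (distr (\<nu> k) borel S) (scale_borel (m' - enn2real (emeasure (\<nu> k) UNIV)) (return borel 0)))" for k
  have setsN: "sets (N k) = sets borel" for k by (simp add: N_def)
  note [measurable_cong] = setsN
  have intN: "(\<integral>\<^sup>+t. g t \<partial>N k) = ennreal (1 / m') * ((\<integral>\<^sup>+x. g (S x) \<partial>\<nu> k) + ennreal (m' - enn2real (emeasure (\<nu> k) UNIV)) * g 0)"
    if [measurable]: "g \<in> borel_measurable borel" for g k
    unfolding N_def
    by (simp add: nn_integral_scale_borel nn_integral_add_measure nn_integral_distr nn_integral_return)
  have massfin: "emeasure (\<nu> k) UNIV = ennreal (enn2real (emeasure (\<nu> k) UNIV))" "enn2real (emeasure (\<nu> k) UNIV) \<le> m'" for k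
    using mass'[of k] m' by (auto simp: ennreal_enn2real_if top_unique intro: enn2real_leI)
  have N1: "emeasure (N k) (space (N k)) = 1" for k
  proof -
    have "emeasure (N k) (space (N k)) = (\<integral>\<^sup>+t. 1 \<partial>N k)" by simp
    also have "\<dots> = ennreal (1 / m') * (emeasure (\<nu> k) UNIV + ennreal (m' - enn2real (emeasure (\<nu> k) UNIV)))"
      by (subst intN) (auto simp: spc)
    also have "\<dots> = 1"
      using m' massfin(2)[of k] by (subst massfin(1)) (simp add: ennreal_plus[symmetric] ennreal_mult[symmetric] del: ennreal_plus)
    finally show ?thesis .
  qed
  have rdN: "real_distribution (N k)" for k
    by (intro real_distribution.intro prob_spaceI N1 real_distribution_axioms.intro setsN)
  have "tight N"
    unfolding tight_def
  proof (intro conjI allI impI rdN)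
    fix \<epsilon> :: real assume "0 < \<epsilon>"
    have "measure (N k) {-1<..1} > 1 - \<epsilon>" for k
    proof -
    have ind: "emeasure (N k) {-1<..1} = (\<integral>\<^sup>+t. indicator {-1<..1} t \<partial>N k)"
      by (simp add: nn_integral_indicator setsN)
    also have "\<dots> = (\<integral>\<^sup>+t. 1 \<partial>N k)"
    proof -
      have "S x \<in> {-1<..1}" for x using T01[of "h x"] by (auto simp: S_def)
      then show ?thesis by (subst (1 2) intN) auto
    qed
    also have "\<dots> = 1" using N1[of k] by simp
    finally show ?thesis using \<open>0 < \<epsilon>\<close> by (simp add: measure_def)
    qed
    then show "\<exists>a b. a < b \<and> (\<forall>n. measure (N n) {a<..b} > 1 - \<epsilon>)"
      by (intro exI[of _ "-1"] exI[of _ 1]) simp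
  qed
  from tight_imp_convergent_subsubsequence[OF this strict_mono_id]
  obtain s M where s: "strict_mono (s :: nat \<Rightarrow> nat)" and M: "real_distribution M" and wc: "weak_conv_m (N \<circ> id \<circ> s) M"
    by blast
  interpret M: real_distribution M by (rule M)
  \<comment> \<open>The parameters over the open cube. What the limit \<open>M\<close> charges
    outside \<open>I\<close> is the added atom or mass lost at infinity.\<close>
  define I where "I = \<Phi> -` range h"
  have Iopen: "open I" unfolding I_def by (rule open_vimage[OF hopen \<Phi>])
  have [measurable]: "I \<in> sets borel" using Iopen by simp
  define g where "g t = (if t \<in> I then h' (\<Phi> t) else 0)" for t
  have gcont: "continuous_on I (\<lambda>t. h' (\<Phi> t))"
    by (rule continuous_on_compose2[OF h' continuous_on_subset[OF \<Phi>]]) (auto simp: I_def)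
  have [measurable]: "g \<in> borel_measurable borel"
    unfolding g_def by (rule borel_measurable_continuous_on_if) (use gcont in auto)
  define \<mu> where "\<mu> = scale_borel m' (distr (density M (indicator I)) borel g)"
  have int\<mu>: "(\<integral>\<^sup>+x. f x \<partial>\<mu>) = ennreal m' * (\<integral>\<^sup>+t. indicator I t * f (g t) \<partial>M)" if [measurable]: "f \<in> borel_measurable borel" for f
    unfolding \<mu>_def
    by (simp add: nn_integral_scale_borel nn_integral_distr nn_integral_density)
  have conv: "(\<lambda>k. \<integral>\<^sup>+x. ennreal (f x) \<partial>\<nu> (s k)) \<longlonglongrightarrow> (\<integral>\<^sup>+x. ennreal (f x) \<partial>\<mu>)"
    if f: "continuous_on UNIV f" "\<And>x. 0 \<le> f x" "(f \<longlongrightarrow> 0) at_infinity" for f :: "'a \<Rightarrow> real"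
  proof -
    have [measurable]: "f \<in> borel_measurable borel" using f(1) by (rule borel_measurable_continuous_onI)
    define \<psi> where "\<psi> t = indicator I t * f (g t)" for t
    have [measurable]: "\<psi> \<in> borel_measurable borel" unfolding \<psi>_def by measurable
    have \<psi>0: "0 \<le> \<psi> t" for t using f(2) by (simp add: \<psi>_def)
    have small: "\<exists>K. compact K \<and> (\<forall>x. x \<notin> K \<longrightarrow> f x < \<epsilon>)" if "0 < \<epsilon>" for \<epsilon>
    proof -
      have "\<forall>\<^sub>F x in at_infinity. f x < \<epsilon>" using order_tendstoD(2)[OF f(3) that] .
      then obtain R where "\<And>x. R \<le> norm x \<Longrightarrow> f x < \<epsilon>" by (auto simp: eventually_at_infinity)
      then show ?thesis by (intro exI[of _ "cball 0 R"]) (auto simp: not_le intro: less_imp_le)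
    qed
    obtain B where B: "\<And>x. f x \<le> B"
    proof -
      obtain K where K: "compact K" "\<And>x. x \<notin> K \<Longrightarrow> f x < 1" using small[of 1] by auto
      have "bounded (f ` K)" by (rule compact_imp_bounded[OF compact_continuous_image[OF continuous_on_subset[OF f(1)] K(1)]]) auto
      then obtain b where b: "\<And>x. x \<in> K \<Longrightarrow> \<bar>f x\<bar> \<le> b" by (auto simp: bounded_iff)
      show ?thesis
      proof (rule that)
        show "f x \<le> max b 1" for x using K(2)[of x] b[of x] by (cases "x \<in> K") auto
      qed
    qed
    have B0: "0 \<le> B" using B[of 0] f(2)[of 0] by simp
    have \<psi>B: "\<psi> t \<le> B" for t using B B0 by (simp add: \<psi>_def indicator_def)
    have cont: "isCont \<psi> t" for t
    proof (cases "t \<in> I")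
      case True
      have "continuous_on I (\<lambda>t. f (h' (\<Phi> t)))"
        by (rule continuous_on_compose2[OF f(1) gcont]) auto
      then have "continuous_on I \<psi>"
        by (rule continuous_on_eq) (simp add: \<psi>_def g_def)
      then show ?thesis using True Iopen by (simp add: continuous_on_eq_continuous_at)
    next
      case False
      then have \<psi>t: "\<psi> t = 0" by (simp add: \<psi>_def)
      show ?thesis
        unfolding isCont_def \<psi>t
      proof (rule tendstoI)
        fix \<epsilon> :: real assume "0 < \<epsilon>"
        \<comment> \<open>At a parameter outside \<open>I\<close> continuity uses that f vanishes at
          infinity: f is large only on a compact set, whose image in the cube is closed and misses
          the curve point of t.\<close>
        then obtain K where K: "compact K" "\<And>x. x \<notin> K \<Longrightarrow> f x < \<epsilon>" using small by blast
        have "compact (h ` K)" by (rule compact_continuous_image[OF continuous_on_subset[OF h] K(1)]) auto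
        then have "open (- (h ` K))" by (intro open_Compl compact_imp_closed)
        then have "open (\<Phi> -` (- (h ` K)))" by (rule open_vimage[OF _ \<Phi>])
        moreover have "t \<in> \<Phi> -` (- (h ` K))" using False by (auto simp: I_def)
        ultimately have "\<forall>\<^sub>F u in at t. u \<in> \<Phi> -` (- (h ` K))" by (rule eventually_at_in_open')
        then show "\<forall>\<^sub>F u in at t. dist (\<psi> u) 0 < \<epsilon>"
        proof eventually_elim
          fix u assume u: "u \<in> \<Phi> -` (- (h ` K))"
          show "dist (\<psi> u) 0 < \<epsilon>"
          proof (cases "u \<in> I")
            case True
            then obtain x where x: "\<Phi> u = h x" by (auto simp: I_def)
            then have "x \<notin> K" using u by auto
            then show ?thesis using K(2) f(2) True by (simp add: \<psi>_def g_def x h'h)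
          qed (use \<open>0 < \<epsilon>\<close> in \<open>simp add: \<psi>_def\<close>)
        qed
      qed
    qed
    have \<psi>S: "\<psi> (S x) = f x" for x by (simp add: \<psi>_def g_def I_def \<Phi>S h'h)
    have "0 \<notin> I"
    proof
      assume "0 \<in> I"
      then obtain x where "h x = 0" using \<Phi>0 by (auto simp: I_def)
      moreover obtain b :: 'a where "b \<in> Basis" using nonempty_Basis by blast
      ultimately show False using hb[of b x] by simp
    qed
    then have \<psi>00: "\<psi> 0 = 0" by (simp add: \<psi>_def)
    have "(\<lambda>k. integral\<^sup>L ((N \<circ> id \<circ> s) k) \<psi>) \<longlonglongrightarrow> integral\<^sup>L M \<psi>"
      by (rule weak_conv_imp_integral_bdd_continuous_conv[OF _ M wc cont, of B]) (use rdN \<psi>0 \<psi>B in auto)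
    then have "(\<lambda>k. ennreal (integral\<^sup>L (N (s k)) \<psi>)) \<longlonglongrightarrow> ennreal (integral\<^sup>L M \<psi>)"
      by (intro tendsto_ennrealI) simp
    moreover have toN: "ennreal (integral\<^sup>L Q \<psi>) = (\<integral>\<^sup>+t. ennreal (\<psi> t) \<partial>Q)" if "real_distribution Q" for Q
    proof -
      interpret Q: real_distribution Q by fact
      show ?thesis
        by (rule nn_integral_eq_integral[symmetric]) (auto intro!: Q.integrable_const_bound[of _ B] simp: \<psi>0 \<psi>B)
    qed
    ultimately have "(\<lambda>k. ennreal m' * (\<integral>\<^sup>+t. ennreal (\<psi> t) \<partial>N (s k))) \<longlonglongrightarrow> ennreal m' * (\<integral>\<^sup>+t. ennreal (\<psi> t) \<partial>M)"
      unfolding toN[OF rdN] toN[OF M] by (intro tendsto_mult_ennreal tendsto_const) (use m' in auto)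
    moreover have "ennreal m' * (\<integral>\<^sup>+t. ennreal (\<psi> t) \<partial>N k) = (\<integral>\<^sup>+x. ennreal (f x) \<partial>\<nu> k)" for k
      using m' by (subst intN) (simp_all add: \<psi>00 \<psi>S mult.assoc[symmetric] ennreal_mult[symmetric])
    moreover have "ennreal m' * (\<integral>\<^sup>+t. ennreal (\<psi> t) \<partial>M) = (\<integral>\<^sup>+x. ennreal (f x) \<partial>\<mu>)"
      by (subst int\<mu>) (auto simp: \<psi>_def indicator_def intro!: arg_cong2[where f="(*)"] nn_integral_cong)
    ultimately show ?thesis by simp
  qed
  have sets\<mu>: "sets \<mu> = sets borel" by (simp add: \<mu>_def)
  have bound: "emeasure \<mu> UNIV \<le> ennreal m"
  proof -
    \<comment> \<open>Compactly supported cutoffs increasing to 1; they pass the mass bound to the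
      limit although constants are not admissible test functions.\<close>
    define c where "c k x = max 0 (min 1 (real k + 1 - norm x))" for k :: nat and x :: 'a
    have clim: "(c k \<longlongrightarrow> 0) at_infinity" for k
    proof (rule tendsto_eventually)
      show "\<forall>\<^sub>F x in at_infinity. c k x = 0"
        unfolding eventually_at_infinity c_def by (rule exI[of _ "real k + 1"]) auto
    qed
    have cont: "continuous_on UNIV (c k)" for k unfolding c_def by (intro continuous_intros)
    have cm: "(\<integral>\<^sup>+x. ennreal (c k x) \<partial>\<mu>) \<le> ennreal m" for k
    proof (rule LIMSEQ_le_const2[OF conv[OF cont _ clim]])
      show "\<exists>N. \<forall>n\<ge>N. (\<integral>\<^sup>+x. ennreal (c k x) \<partial>\<nu> (s n)) \<le> ennreal m"
      proof (intro exI allI impI)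
        fix n
        have "(\<integral>\<^sup>+x. ennreal (c k x) \<partial>\<nu> (s n)) \<le> (\<integral>\<^sup>+x. 1 \<partial>\<nu> (s n))"
          by (intro nn_integral_mono) (auto simp: c_def ennreal_le_1)
        then show "(\<integral>\<^sup>+x. ennreal (c k x) \<partial>\<nu> (s n)) \<le> ennreal m" using mass[of "s n"] by (simp add: spc)
      qed
    qed (auto simp: c_def)
    have "emeasure \<mu> UNIV = (\<integral>\<^sup>+x. (SUP k. ennreal (c k x)) \<partial>\<mu>)"
    proof -
      have "(SUP k. ennreal (c k x)) = 1" for x
      proof (rule antisym)
        obtain k where "norm x \<le> real k" using real_arch_simple by blast
        then have "c k x = 1" by (simp add: c_def)
        then show "1 \<le> (SUP k. ennreal (c k x))" by (intro SUP_upper2[of k]) auto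
      qed (auto intro!: SUP_least simp: c_def ennreal_le_1)
      then show ?thesis using sets_eq_imp_space_eq[OF sets\<mu>] by simp
    qed
    also have "\<dots> = (SUP k. \<integral>\<^sup>+x. ennreal (c k x) \<partial>\<mu>)"
    proof (rule nn_integral_monotone_convergence_SUP)
      show "incseq (\<lambda>k x. ennreal (c k x))" by (auto simp: incseq_def le_fun_def c_def intro!: ennreal_leI)
      show "(\<lambda>x. ennreal (c k x)) \<in> borel_measurable \<mu>" for k
        unfolding c_def by (simp add: measurable_cong_sets[OF sets\<mu> refl])
    qed
    also have "\<dots> \<le> ennreal m" by (rule SUP_least) (rule cm)
    finally show ?thesis .
  qed
  show ?thesis by (rule that[OF s sets\<mu> bound conv])
qed


section \<open>Restrictions, sums and the weak maximum principle\<close>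

definition sum_measure :: "(nat \<Rightarrow> 'a::euclidean_space measure) \<Rightarrow> 'a measure" where
  "sum_measure \<mu> = measure_of UNIV (sets borel) (\<lambda>B. \<Sum>k. emeasure (\<mu> k) B)"

lemma sets_sum_measure [simp]: "sets (sum_measure \<mu>) = sets borel"
  unfolding sum_measure_def by (metis sets.sets_measure_of_eq space_borel)

lemma emeasure_sum_measure:
  assumes s: "\<And>k. sets (\<mu> k) = sets borel" and B: "B \<in> sets borel"
  shows "emeasure (sum_measure \<mu>) B = (\<Sum>k. emeasure (\<mu> k) B)"
proof (rule emeasure_measure_of[OF sum_measure_def])
  show "countably_additive (sets (sum_measure \<mu>)) (\<lambda>B. \<Sum>k. emeasure (\<mu> k) B)"
    unfolding countably_additive_def
  proof (intro allI impI)
    fix A :: "nat \<Rightarrow> 'a set" assume A: "range A \<subseteq> sets (sum_measure \<mu>)" "disjoint_family A"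
    have "(\<Sum>i. \<Sum>k. emeasure (\<mu> k) (A i)) = (\<integral>\<^sup>+k. (\<Sum>i. emeasure (\<mu> k) (A i)) \<partial>count_space UNIV)"
      by (subst nn_integral_suminf) (auto simp: nn_integral_count_space_nat)
    also have "\<dots> = (\<Sum>k. emeasure (\<mu> k) (\<Union> (range A)))"
      using A s by (simp add: nn_integral_count_space_nat suminf_emeasure)
    finally show "(\<Sum>i. \<Sum>k. emeasure (\<mu> k) (A i)) = (\<Sum>k. emeasure (\<mu> k) (\<Union> (range A)))" .
  qed
qed (use B in \<open>auto simp: positive_def\<close>)

lemma nn_integral_sum_measure:
  assumes s: "\<And>k. sets (\<mu> k) = sets borel" and f: "f \<in> borel_measurable borel"
  shows "(\<integral>\<^sup>+x. f x \<partial>sum_measure \<mu>) = (\<Sum>k. \<integral>\<^sup>+x. f x \<partial>\<mu> k)"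
  using f
proof (induction rule: borel_measurable_induct)
  case (cong f g)
  then show ?case by (metis (full_types) ext space_borel UNIV_I)
next
  case (set A)
  then show ?case using s by (simp add: emeasure_sum_measure)
next
  case (mult u c)
  have "u \<in> borel_measurable (\<mu> k)" "u \<in> borel_measurable (sum_measure \<mu>)" for k
    using mult s by (auto cong: measurable_cong_sets)
  then show ?case using mult by (simp add: nn_integral_cmult)
next
  case (add u v)
  have "u \<in> borel_measurable (\<mu> k)" "u \<in> borel_measurable (sum_measure \<mu>)" "v \<in> borel_measurable (\<mu> k)" "v \<in> borel_measurable (sum_measure \<mu>)" for k
    using add s by (auto cong: measurable_cong_sets)
  then show ?case using add by (simp add: nn_integral_add suminf_add[symmetric])
next
  case (seq U)
  have m: "U i \<in> borel_measurable (\<mu> k)" "U i \<in> borel_measurable (sum_measure \<mu>)" for i k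
    using seq(1) s by (auto cong: measurable_cong_sets)
  have sup: "(\<integral>\<^sup>+x. (SUP i. U i) x \<partial>M) = (SUP i. \<integral>\<^sup>+x. U i x \<partial>M)" if "\<And>i. U i \<in> borel_measurable M" for M
    using seq.hyps that by (simp add: nn_integral_monotone_convergence_SUP image_comp)
  have "(\<Sum>k. SUP i. \<integral>\<^sup>+x. U i x \<partial>\<mu> k) = (SUP i. \<Sum>k. \<integral>\<^sup>+x. U i x \<partial>\<mu> k)"
    by (rule ennreal_suminf_SUP_eq) (use seq.hyps in \<open>auto simp: incseq_def le_fun_def intro!: nn_integral_mono\<close>)
  then show ?case unfolding sup[OF m(1)] sup[OF m(2)] seq.IH by simp
qed

lemma ennreal_inverse_antimono: "a \<le> b \<Longrightarrow> inverse b \<le> inverse (a :: ennreal)"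
  by (cases a; cases b; cases "a = 0") (auto simp: inverse_ennreal top_unique less_le)

definition restrict_borel :: "'a measure \<Rightarrow> 'a set \<Rightarrow> 'a measure" where
  "restrict_borel \<mu> S = density \<mu> (indicator S)"

lemma sets_restrict_borel [simp]: "sets (restrict_borel \<mu> S) = sets \<mu>"
  by (simp add: restrict_borel_def)

lemma nn_integral_restrict_borel:
  fixes \<mu> :: "'a::euclidean_space measure"
  assumes "sets \<mu> = sets borel" "S \<in> sets borel" "f \<in> borel_measurable borel"
  shows "(\<integral>\<^sup>+x. f x \<partial>restrict_borel \<mu> S) = (\<integral>\<^sup>+x. indicator S x * f x \<partial>\<mu>)"
  unfolding restrict_borel_def using assms by (intro nn_integral_density_borel) auto

lemma emeasure_restrict_borel:
  fixes \<mu> :: "'a::euclidean_space measure"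
  assumes "sets \<mu> = sets borel" "S \<in> sets borel" "B \<in> sets borel"
  shows "emeasure (restrict_borel \<mu> S) B = emeasure \<mu> (S \<inter> B)"
  unfolding restrict_borel_def using assms
  by (subst emeasure_density) (auto simp: indicator_inter_arith[symmetric] nn_integral_indicator cong: measurable_cong_sets)

lemma emeasure_restrict_borel_le:
  fixes \<mu> :: "'a::euclidean_space measure"
  assumes "sets \<mu> = sets borel" "S \<in> sets borel" "B \<in> sets borel"
  shows "emeasure (restrict_borel \<mu> S) B \<le> emeasure \<mu> B"
  using assms by (simp add: emeasure_restrict_borel emeasure_mono)

lemma sigma_finite_borel_restrict:
  "sigma_finite_borel \<mu> \<Longrightarrow> S \<in> sets borel \<Longrightarrow> sigma_finite_borel (restrict_borel \<mu> S)"
  unfolding restrict_borel_def by (rule sigma_finite_borel_density) (auto simp: indicator_def)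

lemma AE_restrict_borel:
  fixes \<mu> :: "'a::euclidean_space measure"
  assumes "sets \<mu> = sets borel" "S \<in> sets borel"
  shows "(AE x in restrict_borel \<mu> S. P x) \<longleftrightarrow> (AE x in \<mu>. x \<in> S \<longrightarrow> P x)"
  unfolding restrict_borel_def using assms
  by (subst AE_density) (auto simp: indicator_def cong: measurable_cong_sets)

lemma compact_inner_approximation:
  fixes \<mu> :: "'a::euclidean_space measure"
  assumes "sets \<mu> = sets borel" "emeasure \<mu> UNIV < \<infinity>" "B \<in> sets borel" "c < emeasure \<mu> B"
  obtains K where "compact K" "K \<subseteq> B" "c < emeasure \<mu> K"
proof -
  have "emeasure \<mu> (space \<mu>) \<noteq> \<infinity>" using assms(2) sets_eq_imp_space_eq[OF assms(1)] by simp
  from inner_regular[OF assms(1) this assms(3)] assms(4)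
  have "c < (SUP K\<in>{K. K \<subseteq> B \<and> compact K}. emeasure \<mu> K)" by simp
  then show ?thesis using that by (auto simp: less_SUP_iff)
qed

lemma Markov_borel:
  fixes \<mu> :: "'a::euclidean_space measure"
  assumes "sets \<mu> = sets borel" and [measurable]: "f \<in> borel_measurable borel"
  shows "c * emeasure \<mu> {x. c < f x} \<le> (\<integral>\<^sup>+x. f x \<partial>\<mu>)"
proof -
  have "c * emeasure \<mu> {x. c < f x} = (\<integral>\<^sup>+x. c * indicator {x. c < f x} x \<partial>\<mu>)"
    using assms by (subst nn_integral_cmult_indicator) auto
  also have "\<dots> \<le> (\<integral>\<^sup>+x. f x \<partial>\<mu>)" by (intro nn_integral_mono) (auto simp: indicator_def)
  finally show ?thesis .
qed

lemma AE_in_iff: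
  fixes \<mu> :: "'a::euclidean_space measure"
  assumes "sets \<mu> = sets borel" "A \<in> sets borel"
  shows "(AE x in \<mu>. x \<in> A) \<longleftrightarrow> emeasure \<mu> (- A) = 0"
  using assms sets_eq_imp_space_eq[OF assms(1)]
  by (subst AE_iff_measurable[of "- A"]) auto

section \<open>Maximum principle, truncation to bounded potential, capacity\<close>

context riesz_space
begin

definition comparison :: ennreal where "comparison = ennreal (2 powr (real DIM('a) - \<alpha>))"

lemma comparison: "1 \<le> comparison" "comparison < \<infinity>" "comparison \<noteq> 0" "comparison \<noteq> \<top>"
  using alpha_less_dim by (auto simp: comparison_def ge_one_powr_ge_zero)

lemma riesz_kernel_le_scaled:
  assumes "norm (z - y) \<le> c * norm (x - y :: 'a)" "0 < c"
  shows "riesz_kernel \<alpha> x y \<le> ennreal (c powr (real DIM('a) - \<alpha>)) * riesz_kernel \<alpha> z y"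
proof (cases "z = y")
  case True
  then show ?thesis using assms by (simp add: riesz_kernel_def ennreal_mult_top)
next
  case False
  then have xy: "x \<noteq> y" "0 < norm (z - y)" "0 < norm (x - y)" using assms by auto
  have "norm (x - y) powr (\<alpha> - real DIM('a)) \<le> (norm (z - y) / c) powr (\<alpha> - real DIM('a))"
    using assms xy alpha_less_dim by (intro powr_mono2') (auto simp: field_simps)
  also have "\<dots> = c powr (real DIM('a) - \<alpha>) * norm (z - y) powr (\<alpha> - real DIM('a))"
    using assms xy by (simp add: powr_divide powr_minus_divide[of c "real DIM('a) - \<alpha>", symmetric] powr_diff field_simps)
  finally show ?thesis using xy False
    by (simp add: riesz_kernel_def ennreal_mult[symmetric] ennreal_leI)
qed

text \<open>Moving x to a nearest point of K at most doubles its distance to each point of K;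
  \<open>comparison\<close> is the corresponding factor 2^(n-\<alpha>) for the kernel.\<close>

lemma weak_maximum_principle:
  assumes \<tau>: "sets \<tau> = sets borel" "emeasure \<tau> (- K) = 0" and K: "compact K"
    and M: "\<And>x. x \<in> K \<Longrightarrow> potential \<alpha> \<tau> x \<le> M"
  shows "potential \<alpha> \<tau> (x :: 'a) \<le> comparison * M"
proof (cases "K = {}")
  case True
  then have "AE y in \<tau>. False" using \<tau> AE_in_iff[of \<tau> K] compact_imp_closed[OF K] by auto
  then have "potential \<alpha> \<tau> x = 0" unfolding potential_def by (intro nn_integral_0_iff_AE[THEN iffD2]) (auto simp: measurable_cong_sets[OF \<tau>(1) refl])
  then show ?thesis by simp
next
  case False
  have K': "closed K" using K by (rule compact_imp_closed)
  obtain x' where x': "x' \<in> K" "\<And>y. y \<in> K \<Longrightarrow> dist x x' \<le> dist x y"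
    using distance_attains_inf[OF K' False] by blast
  have "potential \<alpha> \<tau> x \<le> (\<integral>\<^sup>+y. comparison * riesz_kernel \<alpha> x' y \<partial>\<tau>)"
    unfolding potential_def
  proof (rule nn_integral_mono_AE)
    have "AE y in \<tau>. y \<in> K" using \<tau> AE_in_iff[of \<tau> K] K' by auto
    then show "AE y in \<tau>. riesz_kernel \<alpha> x y \<le> comparison * riesz_kernel \<alpha> x' y"
    proof eventually_elim
      fix y assume "y \<in> K"
      then have "norm (x - x') \<le> norm (x - y)" using x'(2) by (simp add: dist_norm)
      then have "norm (x' - y) \<le> 2 * norm (x - y)"
        using norm_triangle_ineq[of "x' - x" "x - y"] by (simp add: norm_minus_commute)
      then show "riesz_kernel \<alpha> x y \<le> comparison * riesz_kernel \<alpha> x' y"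
        unfolding comparison_def by (rule riesz_kernel_le_scaled) simp
    qed
  qed
  also have "\<dots> = comparison * potential \<alpha> \<tau> x'"
    unfolding potential_def by (rule nn_integral_cmult) (simp add: measurable_cong_sets[OF \<tau>(1) refl])
  also have "\<dots> \<le> comparison * M" by (intro mult_left_mono M x') simp
  finally show ?thesis .
qed

text \<open>Finite mass is part of the predicate: it makes heat evolutions finite and brings the
  measure within reach of vague compactness.\<close>

definition energy_on :: "'a set \<Rightarrow> 'a measure \<Rightarrow> bool" where
  "energy_on A \<mu> \<longleftrightarrow> sets \<mu> = sets borel \<and> emeasure \<mu> UNIV < \<infinity> \<and> mutual_energy \<alpha> \<mu> \<mu> < \<infinity> \<and> emeasure \<mu> (- A) = 0"

lemma energy_onD:
  assumes "energy_on A \<mu>"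
  shows "sets \<mu> = sets borel" "emeasure \<mu> UNIV < \<infinity>" "sigma_finite_borel \<mu>" "finite_energy_measure \<mu>" "emeasure \<mu> (- A) = 0"
  using assms sigma_finite_borel_finite[of \<mu>] by (auto simp: energy_on_def finite_energy_measure_def)

lemma energy_on_AE:
  assumes "energy_on A \<mu>" "A \<in> sets borel"
  shows "AE x in \<mu>. x \<in> A"
  using energy_onD[OF assms(1)] AE_in_iff[OF _ assms(2)] by blast

lemma energy_on_mono:
  assumes "energy_on A \<nu>" "sets \<mu> = sets borel" "\<And>B. B \<in> sets borel \<Longrightarrow> emeasure \<mu> B \<le> emeasure \<nu> B" "A \<in> sets borel"
  shows "energy_on A \<mu>"
  unfolding energy_on_def
proof (intro conjI)
  show "emeasure \<mu> UNIV < \<infinity>" using assms(3)[of UNIV] energy_onD(2)[OF assms(1)] by (auto intro: le_less_trans)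
  have "mutual_energy \<alpha> \<mu> \<mu> \<le> mutual_energy \<alpha> \<nu> \<nu>"
    by (rule mutual_energy_mono) (use assms(2,3) energy_onD(1)[OF assms(1)] in auto)
  then show "mutual_energy \<alpha> \<mu> \<mu> < \<infinity>"
    using assms(1) by (auto simp: energy_on_def)
  show "emeasure \<mu> (- A) = 0" using assms(3)[of "- A"] energy_onD(5)[OF assms(1)] assms(4) by auto
qed fact

lemma energy_on_subset: "energy_on A \<mu> \<Longrightarrow> A \<subseteq> B \<Longrightarrow> A \<in> sets borel \<Longrightarrow> energy_on B \<mu>"
  using emeasure_mono[of "- B" "- A" \<mu>] by (auto simp: energy_on_def)

lemma energy_on_restrict:
  assumes "energy_on A \<mu>" "S \<in> sets borel" "A \<in> sets borel"
  shows "energy_on A (restrict_borel \<mu> S)" "energy_on (A \<inter> S) (restrict_borel \<mu> S)"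
proof -
  note s = energy_onD[OF assms(1)]
  show 1: "energy_on A (restrict_borel \<mu> S)"
    by (rule energy_on_mono[OF assms(1)]) (use s assms in \<open>auto simp: emeasure_restrict_borel_le\<close>)
  have "emeasure \<mu> (S \<inter> - (A \<inter> S)) \<le> emeasure \<mu> (- A)" using s assms by (intro emeasure_mono) auto
  then have "emeasure (restrict_borel \<mu> S) (- (A \<inter> S)) = 0"
    using s assms by (simp add: emeasure_restrict_borel)
  then show "energy_on (A \<inter> S) (restrict_borel \<mu> S)" using 1 by (simp add: energy_on_def)
qed

lemma energy_on_scale:
  assumes "energy_on A \<mu>" "A \<in> sets borel"
  shows "energy_on A (scale_borel c \<mu>)"
  using energy_onD[OF assms(1)] finite_energy_measure_scale[of \<mu> c] assms(2)
  by (auto simp: energy_on_def emeasure_scale_borel ennreal_mult_less_top finite_energy_measure_def)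

lemma energy_on_add:
  assumes "energy_on A \<mu>" "energy_on A \<nu>" "A \<in> sets borel"
  shows "energy_on A (add_measure \<mu> \<nu>)"
  using energy_onD[OF assms(1)] energy_onD[OF assms(2)] finite_energy_measure_add[of \<mu> \<nu>] assms(3)
  by (auto simp: energy_on_def emeasure_add_measure finite_energy_measure_def)

lemma energy_on_null: "energy_on A (null_measure borel)"
  unfolding energy_on_def mutual_energy_def by simp

lemma mutual_energy_le_bound:
  assumes "sets \<mu> = sets borel" "\<And>x. potential \<alpha> \<mu> (x::'a) \<le> M"
  shows "mutual_energy \<alpha> \<mu> \<mu> \<le> M * emeasure \<mu> UNIV"
proof -
  have "mutual_energy \<alpha> \<mu> \<mu> \<le> (\<integral>\<^sup>+x. M \<partial>\<mu>)"
    unfolding mutual_energy_potential by (intro nn_integral_mono assms(2))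
  then show ?thesis using sets_eq_imp_space_eq[OF assms(1)] by simp
qed

text \<open>Markov's inequality discards little mass where the potential exceeds c, inner regularity
  yields a compact remainder K, and the maximum principle spreads the bound from K to the whole
  space.\<close>

lemma bounded_potential_part:
  assumes \<mu>: "energy_on A \<mu>" and A: "A \<in> sets borel" and c: "0 < c" "c < \<infinity>" "mutual_energy \<alpha> \<mu> \<mu> < c * e"
    and m: "emeasure \<mu> A > e + d"
  obtains K where "compact K" "K \<subseteq> A" "d < emeasure \<mu> K" "\<And>x. potential \<alpha> (restrict_borel \<mu> K) x \<le> comparison * c"
proof -
  note s = energy_onD[OF \<mu>]
  note [measurable] = potential_borel[OF s(3)]
  have "c * emeasure \<mu> {x. c < potential \<alpha> \<mu> x} \<le> mutual_energy \<alpha> \<mu> \<mu>"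
    unfolding mutual_energy_potential by (rule Markov_borel) (use s in auto)
  also have "\<dots> < c * e" by (rule c)
  finally have lt: "emeasure \<mu> {x. c < potential \<alpha> \<mu> x} < e" 
    by (meson mult_left_mono not_le zero_le)
  define S where "S = A \<inter> {x. potential \<alpha> \<mu> x \<le> c}"
  have S: "S \<in> sets borel" unfolding S_def using A by measurable
  have "emeasure \<mu> A \<le> emeasure \<mu> (S \<union> {x. c < potential \<alpha> \<mu> x})"
    using s S by (intro emeasure_mono) (auto simp: S_def not_le)
  also have "\<dots> \<le> emeasure \<mu> S + emeasure \<mu> {x. c < potential \<alpha> \<mu> x}"
    using s S by (intro emeasure_subadditive) auto
  finally have le: "emeasure \<mu> A \<le> emeasure \<mu> S + emeasure \<mu> {x. c < potential \<alpha> \<mu> x}" .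
  have "d < emeasure \<mu> S"
  proof (rule ccontr)
    assume "\<not> d < emeasure \<mu> S"
    then have "emeasure \<mu> A \<le> d + e" using le lt by (meson add_mono less_imp_le not_less order_trans)
    then show False using m by (simp add: add.commute)
  qed
  from compact_inner_approximation[OF s(1,2) S this] obtain K where K: "compact K" "K \<subseteq> S" "d < emeasure \<mu> K" by blast
  have Kb: "K \<in> sets borel" using K(1) by (intro borel_closed compact_imp_closed)
  have le_pot: "potential \<alpha> (restrict_borel \<mu> K) x \<le> potential \<alpha> \<mu> x" for x
    unfolding potential_def by (rule nn_integral_mono_dominated) (use s Kb in \<open>auto simp: emeasure_restrict_borel_le\<close>)
  show ?thesis
  proof (rule that[OF K(1) _ K(3)])
    show "K \<subseteq> A" using K by (auto simp: S_def)
    show "potential \<alpha> (restrict_borel \<mu> K) x \<le> comparison * c" for x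
    proof (rule weak_maximum_principle[OF _ _ K(1)])
      show "emeasure (restrict_borel \<mu> K) (- K) = 0" using s Kb by (simp add: emeasure_restrict_borel)
      show "potential \<alpha> (restrict_borel \<mu> K) y \<le> c" if "y \<in> K" for y
        using le_pot[of y] that K(2) by (auto simp: S_def)
    qed (use s in auto)
  qed
qed

lemma inner_cap_measure:
  assumes F: "F \<in> sets borel" and c: "ennreal c < inner_cap \<alpha> F" "0 < c"
  obtains \<mu> :: "'a measure" where "energy_on F \<mu>" "emeasure \<mu> UNIV = 1" "mutual_energy \<alpha> \<mu> \<mu> < ennreal (1 / c)"
proof -
  let ?I = "INF \<mu> \<in> {\<mu> \<in> finite_energy_pos \<alpha> F. emeasure (completion \<mu>) F = 1}. mutual_energy \<alpha> \<mu> \<mu>"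
  have "?I < ennreal (1 / c)"
  proof (rule ccontr)
    assume "\<not> ?I < ennreal (1 / c)"
    then have "inverse ?I \<le> inverse (ennreal (1 / c))" by (intro ennreal_inverse_antimono) simp
    also have "\<dots> = ennreal c" using c by (simp add: inverse_ennreal)
    finally show False using c by (simp add: inner_cap_def)
  qed
  then obtain \<mu> where \<mu>: "\<mu> \<in> finite_energy_pos \<alpha> F" "emeasure (completion \<mu>) F = 1" "mutual_energy \<alpha> \<mu> \<mu> < ennreal (1 / c)"
    by (auto simp: Inf_less_iff)
  have s: "sets \<mu> = sets borel" "mutual_energy \<alpha> \<mu> \<mu> < \<infinity>" "AE x in \<mu>. x \<in> F"
    using \<mu> by (auto simp: finite_energy_pos_def radon_measure_def carried_by_def)
  have F1: "emeasure \<mu> F = 1" using \<mu>(2) F s by simp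
  have F0: "emeasure \<mu> (- F) = 0" using s F AE_in_iff by blast
  have "emeasure \<mu> UNIV = emeasure \<mu> F + emeasure \<mu> (- F)"
    using s F plus_emeasure[of F \<mu> "- F"] by (simp add: Compl_partition)
  then have "emeasure \<mu> UNIV = 1" using F0 F1 by simp
  then show ?thesis using \<mu>(3) s F0 by (intro that[of \<mu>]) (auto simp: energy_on_def)
qed

text \<open>The potential of a finite measure is finite Lebesgue-almost everywhere, hence not
  identically infinite.\<close>

lemma radon_measure_energy_on:
  assumes "energy_on A \<mu>"
  shows "radon_measure \<alpha> \<mu>"
proof -
  note s = energy_onD[OF assms(1)]
  note [measurable] = potential_borel[OF s(3)]
  have "\<exists>x. potential \<alpha> \<mu> x < \<infinity>"
  proof (rule ccontr)
    assume "\<not> ?thesis"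
    then have "potential \<alpha> \<mu> x = \<infinity>" for x by (metis infinity_ennreal_def less_top)
    moreover have "AE x in lborel. potential \<alpha> \<mu> x < \<infinity>" by (rule potential_finite_AE_lborel[OF s(3,2)])
    ultimately have "AE x in (lborel :: 'a measure). False" by simp
    then have "emeasure (lborel :: 'a measure) UNIV = 0" by (subst (asm) AE_iff_measurable[of UNIV]) auto
    then show False by simp
  qed
  moreover have "emeasure \<mu> K < \<infinity>" for K
    using emeasure_mono[of K UNIV \<mu>] s(1,2) by (auto intro: le_less_trans)
  ultimately show ?thesis using s by (simp add: radon_measure_def)
qed

text \<open>Used in contrapositive form: an exceptional set of capacity zero contains no Borel
  carrier of a nonzero measure of finite energy. Since N may fail to be Borel, its mass is computed
  in the completion.\<close>

lemma inner_cap_pos: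
  assumes \<mu>: "energy_on F \<mu>" and F: "F \<in> sets borel" and m: "emeasure \<mu> UNIV \<noteq> 0" and sub: "F \<subseteq> N"
  shows "0 < inner_cap \<alpha> N"
proof -
  note s = energy_onD[OF \<mu>]
  define M where "M = enn2real (emeasure \<mu> UNIV)"
  have M: "emeasure \<mu> UNIV = ennreal M" "0 < M"
    using s(2) m by (auto simp: M_def ennreal_enn2real less_top enn2real_positive_iff zero_less_iff_neq_zero)
  define \<tau> where "\<tau> = scale_borel (1 / M) \<mu>"
  have \<tau>: "energy_on F \<tau>" unfolding \<tau>_def by (rule energy_on_scale[OF \<mu> F])
  note t = energy_onD[OF \<tau>]
  have "emeasure \<tau> UNIV = 1"
    unfolding \<tau>_def using s M by (simp add: emeasure_scale_borel ennreal_mult[symmetric])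
  then have 1: "emeasure \<tau> F = 1"
    using t F plus_emeasure[of F \<tau> "- F"] by (simp add: Compl_partition)
  have null: "- N \<subseteq> - F" "emeasure \<tau> (- F) = 0" using sub t by auto
  have Nc: "- N \<in> null_sets (completion \<tau>)"
    by (rule null_sets_completion_subset[OF null(1)], rule null_sets_completionI) (use t F null in auto)
  have sp: "space (completion \<tau>) = UNIV" using sets_eq_imp_space_eq[OF t(1)] by simp
  have N: "N \<in> sets (completion \<tau>)"
    using sets.Diff[OF sets.top[of "completion \<tau>"] null_setsD2[OF Nc]] sp by (simp add: Diff_eq)
  have "emeasure (completion \<tau>) F \<le> emeasure (completion \<tau>) N" using sub N by (rule emeasure_mono)
  moreover have "emeasure (completion \<tau>) N \<le> emeasure (completion \<tau>) UNIV"
    using sp by (metis emeasure_space)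
  ultimately have N1: "emeasure (completion \<tau>) N = 1"
    using 1 \<open>emeasure \<tau> UNIV = 1\<close> t F by simp
  have "\<tau> \<in> finite_energy_pos \<alpha> N"
    using radon_measure_energy_on[OF \<tau>] t energy_on_AE[OF \<tau> F] sub
    by (auto simp: finite_energy_pos_def carried_by_def finite_energy_measure_def elim: eventually_mono)
  then have "(INF \<mu> \<in> {\<mu> \<in> finite_energy_pos \<alpha> N. emeasure (completion \<mu>) N = 1}. mutual_energy \<alpha> \<mu> \<mu>) \<le> mutual_energy \<alpha> \<tau> \<tau>"
    using N1 by (intro INF_lower) auto
  also have "\<dots> < \<infinity>" using t by (auto simp: finite_energy_measure_def)
  finally show ?thesis unfolding inner_cap_def ennreal_inverse_positive by (metis infinity_ennreal_def less_irrefl)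
qed

end


section \<open>Test measures on sets that are not thin at infinity\<close>

definition inversion :: "'a::euclidean_space \<Rightarrow> 'a" where
  "inversion x = x /\<^sub>R (norm x)\<^sup>2"

lemma inversion_measurable [measurable]: "inversion \<in> borel_measurable borel"
  unfolding inversion_def by measurable

lemma norm_inversion: "norm (inversion x) = 1 / norm x"
  by (cases "x = 0") (simp_all add: inversion_def power2_eq_square field_simps)

lemma inversion_inversion: "inversion (inversion x) = x"
  by (cases "x = 0") (simp_all add: inversion_def power2_eq_square field_simps)

lemma norm_inversion_diff:
  assumes "x \<noteq> 0" "y \<noteq> (0::'a::euclidean_space)"
  shows "norm (inversion x - inversion y) = norm (x - y) / (norm x * norm y)"
proof -
  have "(norm (inversion x - inversion y))\<^sup>2 = 1 / (norm x)\<^sup>2 + 1 / (norm y)\<^sup>2 - 2 * (x \<bullet> y) / ((norm x)\<^sup>2 * (norm y)\<^sup>2)"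
  proof -
    have "(norm (inversion x - inversion y))\<^sup>2 = (norm (inversion x))\<^sup>2 + (norm (inversion y))\<^sup>2 - 2 * (inversion x \<bullet> inversion y)"
      by (simp add: power2_norm_eq_inner inner_diff inner_commute)
    then show ?thesis
      by (simp add: norm_inversion power_divide) (simp add: inversion_def divide_inverse)
  qed
  also have "\<dots> = ((norm x)\<^sup>2 + (norm y)\<^sup>2 - 2 * (x \<bullet> y)) / ((norm x)\<^sup>2 * (norm y)\<^sup>2)"
    using assms by (simp add: field_simps)
  also have "(norm x)\<^sup>2 + (norm y)\<^sup>2 - 2 * (x \<bullet> y) = (norm (x - y))\<^sup>2"
    by (simp add: power2_norm_eq_inner inner_diff inner_commute)
  also have "(norm (x - y))\<^sup>2 / ((norm x)\<^sup>2 * (norm y)\<^sup>2) = (norm (x - y) / (norm x * norm y))\<^sup>2"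
    by (simp add: power_divide power_mult_distrib)
  finally show ?thesis by (rule power2_eq_imp_eq) auto
qed

section \<open>Inversion, and measures on shells of A\<close>

context riesz_space
begin

lemma riesz_kernel_inversion:
  assumes "x \<noteq> 0" "y \<noteq> (0::'a)"
  shows "riesz_kernel \<alpha> (inversion x) (inversion y) = ennreal ((norm x * norm y) powr (real DIM('a) - \<alpha>)) * riesz_kernel \<alpha> x y"
proof (cases "x = y")
  case True
  then show ?thesis using assms by (simp add: riesz_kernel_def ennreal_mult_top)
next
  case False
  then have "inversion x \<noteq> inversion y" by (metis inversion_inversion)
  moreover have "(norm (x - y) / (norm x * norm y)) powr (\<alpha> - real DIM('a)) = (norm x * norm y) powr (real DIM('a) - \<alpha>) * norm (x - y) powr (\<alpha> - real DIM('a))"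
    using assms False powr_minus[of "norm x * norm y" "real DIM('a) - \<alpha>"]
    by (subst powr_divide) (auto simp: divide_inverse mult.commute)
  ultimately show ?thesis using False assms
    by (simp add: riesz_kernel_def norm_inversion_diff ennreal_mult[symmetric])
qed

text \<open>Distances in the unit ball are at most 2, so a unit measure there has energy at least
  2^(\<alpha>-n). Finiteness permits choosing a measure whose energy is close to the inverse of the
  capacity.\<close>

lemma inner_cap_bounded_finite:
  assumes F: "F \<in> sets borel" "\<And>x. x \<in> F \<Longrightarrow> norm (x::'a) \<le> 1"
  shows "inner_cap \<alpha> F \<le> comparison"
proof (rule dense_le)
  fix c assume c: "c < inner_cap \<alpha> F"
  show "c \<le> comparison"
  proof (cases "c = 0")
    case False
    have "c \<noteq> \<top>" using c by auto
    then obtain r where r: "c = ennreal r" "0 < r" using False by (cases c) (auto simp: less_le)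
    obtain \<mu> :: "'a measure" where \<mu>: "energy_on F \<mu>" "emeasure \<mu> UNIV = 1" "mutual_energy \<alpha> \<mu> \<mu> < ennreal (1 / r)"
      using inner_cap_measure[OF F(1)] c r by blast
    note s = energy_onD[OF \<mu>(1)] energy_on_AE[OF \<mu>(1) F(1)]
    have k: "ennreal (2 powr (\<alpha> - real DIM('a))) \<le> riesz_kernel \<alpha> x y" if "x \<in> F" "y \<in> F" for x y
    proof (cases "x = y")
      case False
      have "norm (x - y) \<le> 2" using norm_triangle_ineq4[of x y] F(2)[OF that(1)] F(2)[OF that(2)] by linarith
      then have "2 powr (\<alpha> - real DIM('a)) \<le> norm (x - y) powr (\<alpha> - real DIM('a))"
        using False alpha_less_dim by (intro powr_mono2') auto
      then show ?thesis using False by (simp add: riesz_kernel_def ennreal_leI)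
    qed (simp add: riesz_kernel_def)
    have "ennreal (2 powr (\<alpha> - real DIM('a))) = (\<integral>\<^sup>+x. (\<integral>\<^sup>+y. ennreal (2 powr (\<alpha> - real DIM('a))) \<partial>\<mu>) \<partial>\<mu>)"
      using \<mu>(2) sets_eq_imp_space_eq[OF s(1)] by simp
    also have "\<dots> \<le> mutual_energy \<alpha> \<mu> \<mu>"
      unfolding mutual_energy_def
    proof (rule nn_integral_mono_AE, use s(6) in eventually_elim)
      fix x assume x: "x \<in> F"
      show "(\<integral>\<^sup>+y. ennreal (2 powr (\<alpha> - real DIM('a))) \<partial>\<mu>) \<le> (\<integral>\<^sup>+y. riesz_kernel \<alpha> x y \<partial>\<mu>)"
        by (rule nn_integral_mono_AE, use s(6) in eventually_elim) (rule k[OF x])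
    qed
    also have "\<dots> < ennreal (1 / r)" by (rule \<mu>)
    finally have "2 powr (\<alpha> - real DIM('a)) < 1 / r" by (simp add: ennreal_less_iff)
    then have "r < 1 / 2 powr (\<alpha> - real DIM('a))" using r by (simp add: field_simps)
    also have "\<dots> = 2 powr (real DIM('a) - \<alpha>)" using powr_minus_divide[of 2 "\<alpha> - real DIM('a)"] by simp
    finally show ?thesis using r by (simp add: comparison_def ennreal_leI)
  qed simp
qed

text \<open>A nearly optimal measure on the shell F of the inverted set, cut down to bounded
  potential, moved to A by inversion and normalised to potential at most 1. On one shell the weights
  of the Kelvin transform are comparable to a constant, so the plain image measure suffices. Its
  potential at 0 dominates a fixed multiple of the k-th Wiener term.\<close>

lemma shell_measure:
  assumes A: "A \<in> sets borel" and q: "0 < q" "q < 1"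
    and F_def: "F = {x. inversion x \<in> A \<and> q ^ (k + 2) < norm x \<and> norm x \<le> q ^ (k + 1)}"
  obtains \<gamma> :: "'a measure" where "energy_on A \<gamma>" "\<And>x. potential \<alpha> \<gamma> x \<le> 1"
    "AE y in \<gamma>. 1 / q ^ (k + 1) \<le> norm y \<and> norm y \<le> 1 / q ^ (k + 2)"
    "ennreal (q powr (real DIM('a) - \<alpha>)) / (16 * comparison\<^sup>2) * (inner_cap \<alpha> F * ennreal (q powr (- real (Suc k) * (real DIM('a) - \<alpha>)))) \<le> potential \<alpha> \<gamma> 0"
proof (cases "inner_cap \<alpha> F = 0")
  case True
  show ?thesis
  proof (rule that[of "null_measure borel"])
    show "AE y :: 'a in null_measure borel. 1 / q ^ (k + 1) \<le> norm y \<and> norm y \<le> 1 / q ^ (k + 2)"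
      by (rule AE_I'[of UNIV]) (auto simp: null_sets_def)
  qed (auto simp: True energy_on_null potential_def)
next
  case False
  let ?p = "real DIM('a) - \<alpha>"
  define p where "p = real DIM('a) - \<alpha>"
  have p: "0 < p" using alpha_less_dim by (simp add: p_def)
  have F: "F \<in> sets borel"
    unfolding F_def using A by measurable
  have Fn: "x \<noteq> 0" "norm x \<le> q ^ (k + 1)" "q ^ (k + 2) < norm x" "inversion x \<in> A" if "x \<in> F" for x
    using that order.strict_trans[OF zero_less_power[OF q(1), of "k+2"], of "norm x"] unfolding F_def by auto
  have capfin: "inner_cap \<alpha> F \<le> comparison"
  proof (rule inner_cap_bounded_finite[OF F])
    show "norm x \<le> 1" if "x \<in> F" for x
      using Fn(2)[OF that] power_le_one[of q "k+1"] q by simp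
  qed
  then have "inner_cap \<alpha> F \<noteq> \<top>" using comparison(4) by (auto simp: top_unique)
  then obtain c2 where c2: "inner_cap \<alpha> F = ennreal c2" "0 < c2" using False by (cases "inner_cap \<alpha> F") (auto simp: less_le)
  \<comment> \<open>Half of the capacity is strictly below it, which secures a unit measure of
    energy below 1/c.\<close>
  define c where "c = c2 / 2"
  have c: "0 < c" "ennreal c < inner_cap \<alpha> F" using c2 by (auto simp: c_def ennreal_less_iff)
  obtain \<mu> :: "'a measure" where \<mu>: "energy_on F \<mu>" "emeasure \<mu> UNIV = 1" "mutual_energy \<alpha> \<mu> \<mu> < ennreal (1 / c)"
    using inner_cap_measure[OF F c(2,1)] by blast
  have \<mu>F: "emeasure \<mu> F = 1"
    using \<mu> energy_onD[OF \<mu>(1)] F plus_emeasure[of F \<mu> "- F"] by (simp add: Compl_partition)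
  \<comment> \<open>The threshold 2/c loses at most half of the mass since the energy is below (2/c)
    (1/2); more than a quarter then survives on a compact set.\<close>
  obtain K where K: "compact K" "K \<subseteq> F" "ennreal (1/4) < emeasure \<mu> K" "\<And>x. potential \<alpha> (restrict_borel \<mu> K) x \<le> comparison * ennreal (2 / c)"
  proof (rule bounded_potential_part[OF \<mu>(1) F, of "ennreal (2 / c)" "ennreal (1/2)" "ennreal (1/4)"])
    show "mutual_energy \<alpha> \<mu> \<mu> < ennreal (2 / c) * ennreal (1 / 2)"
      using \<mu>(3) c by (simp add: ennreal_mult[symmetric] del: ennreal_half)
    show "ennreal (1/2) + ennreal (1/4) < emeasure \<mu> F"
      unfolding \<mu>F by (simp add: ennreal_plus[symmetric] ennreal_less_one_iff del: ennreal_plus ennreal_half)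
  qed (use c that in auto)
  have Kb: "K \<in> sets borel" using K(1) by (intro borel_closed compact_imp_closed)
  define \<gamma>1 where "\<gamma>1 = restrict_borel \<mu> K"
  note m = energy_onD[OF \<mu>(1)]
  have \<gamma>1: "sets \<gamma>1 = sets borel" "emeasure \<gamma>1 UNIV = emeasure \<mu> K" "emeasure \<gamma>1 (- K) = 0"
    using m Kb by (auto simp: \<gamma>1_def emeasure_restrict_borel)
  note [measurable_cong] = \<gamma>1(1)
  have AEK: "AE y in \<gamma>1. y \<in> K" using AE_in_iff[OF \<gamma>1(1) Kb] \<gamma>1(3) by simp
  define \<gamma>2 where "\<gamma>2 = distr \<gamma>1 borel (inversion :: 'a \<Rightarrow> 'a)"
  have pot2: "potential \<alpha> \<gamma>2 z = (\<integral>\<^sup>+y. riesz_kernel \<alpha> z (inversion y) \<partial>\<gamma>1)" for z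
    unfolding potential_def \<gamma>2_def by (rule nn_integral_distr) measurable
  \<comment> \<open>On the shell both norms are at most q^(k+1), so inversion multiplies the kernel
    by at most \<open>b\<close>.\<close>
  define b where "b = (q ^ (k + 1) * q ^ (k + 1)) powr p"
  have b: "0 < b" using q by (simp add: b_def)
  define B where "B = 2 powr p * (b * (2 powr p * (2 / c)))"
  have B: "0 < B" using b c by (simp add: B_def)
  have bound2: "potential \<alpha> \<gamma>2 z \<le> ennreal B" for z
  proof -
    have "potential \<alpha> \<gamma>2 z \<le> comparison * (ennreal b * (comparison * ennreal (2 / c)))"
    proof (rule weak_maximum_principle)
      show "sets \<gamma>2 = sets borel" by (simp add: \<gamma>2_def)
      have "continuous_on K inversion" unfolding inversion_def using Fn(1) K(2) by (intro continuous_intros) auto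
      then show "compact (inversion ` K)" using K(1) by (rule compact_continuous_image)
      then have "inversion ` K \<in> sets borel" by (intro borel_closed compact_imp_closed)
      then have "emeasure \<gamma>2 (- inversion ` K) = emeasure \<gamma>1 (inversion -` (- inversion ` K) \<inter> space \<gamma>1)"
        unfolding \<gamma>2_def by (intro emeasure_distr) auto
      also have "\<dots> \<le> emeasure \<gamma>1 (- K)" using \<gamma>1 Kb by (intro emeasure_mono) auto
      finally show "emeasure \<gamma>2 (- inversion ` K) = 0" using \<gamma>1(3) by simp
      fix z assume "z \<in> inversion ` K"
      then obtain x where x: "x \<in> K" "z = inversion x" by blast
      have "potential \<alpha> \<gamma>2 z \<le> (\<integral>\<^sup>+y. ennreal b * riesz_kernel \<alpha> x y \<partial>\<gamma>1)"
        unfolding pot2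
      proof (rule nn_integral_mono_AE, use AEK in eventually_elim)
        fix y assume y: "y \<in> K"
        have xF: "x \<in> F" "y \<in> F" using x y K(2) by auto
        have "(norm x * norm y) powr p \<le> b"
          unfolding b_def using Fn(2)[OF xF(1)] Fn(2)[OF xF(2)] p less_imp_le[OF q(1)] by (intro powr_mono2 mult_mono) auto
        then show "riesz_kernel \<alpha> z (inversion y) \<le> ennreal b * riesz_kernel \<alpha> x y"
          unfolding x(2) riesz_kernel_inversion[OF Fn(1)[OF xF(1)] Fn(1)[OF xF(2)]] p_def[symmetric]
          by (intro mult_right_mono ennreal_leI) auto
      qed
      also have "\<dots> = ennreal b * potential \<alpha> \<gamma>1 x"
        unfolding potential_def by (rule nn_integral_cmult) measurable
      also have "\<dots> \<le> ennreal b * (comparison * ennreal (2 / c))"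
        unfolding \<gamma>1_def by (intro mult_left_mono K(4)) auto
      finally show "potential \<alpha> \<gamma>2 z \<le> ennreal b * (comparison * ennreal (2 / c))" .
    qed
    also have "\<dots> = ennreal B"
      unfolding B_def comparison_def p_def[symmetric] using b c by (simp add: ennreal_mult[symmetric])
    finally show ?thesis .
  qed
  define \<gamma> where "\<gamma> = scale_borel (1 / B) \<gamma>2"
  have sets2: "sets \<gamma>2 = sets borel" by (simp add: \<gamma>2_def)
  have mass2: "emeasure \<gamma>2 UNIV = emeasure \<mu> K"
    unfolding \<gamma>2_def using sets_eq_imp_space_eq[OF \<gamma>1(1)] \<gamma>1(2) by (subst emeasure_distr) auto
  have massfin: "emeasure \<mu> K < \<infinity>" using emeasure_mono[of K UNIV \<mu>] m \<mu>(2) Kb by (auto intro: le_less_trans)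
  have AE2: "AE y in \<gamma>2. P y" if "AE y in \<gamma>1. P (inversion y)" "Measurable.pred borel P" for P
    unfolding \<gamma>2_def using that by (subst AE_distr_iff) auto
  have A2: "energy_on A \<gamma>2"
    unfolding energy_on_def
  proof (intro conjI sets2)
    show "emeasure \<gamma>2 UNIV < \<infinity>" using mass2 massfin by simp
    have "mutual_energy \<alpha> \<gamma>2 \<gamma>2 \<le> ennreal B * emeasure \<gamma>2 UNIV"
      by (rule mutual_energy_le_bound[OF sets2 bound2])
    also have "\<dots> < \<infinity>" using massfin mass2 by (simp add: ennreal_mult_less_top)
    finally show "mutual_energy \<alpha> \<gamma>2 \<gamma>2 < \<infinity>" .
    have "AE y in \<gamma>2. y \<in> A"
      by (rule AE2) (use AEK A Fn(4) K(2) in \<open>auto elim!: eventually_mono\<close>)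
    then show "emeasure \<gamma>2 (- A) = 0" using AE_in_iff[OF sets2 A] by simp
  qed
  show ?thesis
  proof (rule that[of \<gamma>])
    show "energy_on A \<gamma>" unfolding \<gamma>_def by (rule energy_on_scale[OF A2 A])
    show "potential \<alpha> \<gamma> x \<le> 1" for x
    proof -
      have "potential \<alpha> \<gamma> x \<le> ennreal (1 / B) * ennreal B"
        unfolding \<gamma>_def potential_scale[OF sets2] by (intro mult_left_mono bound2) auto
      then show ?thesis using B by (simp add: ennreal_mult[symmetric])
    qed
    have "AE y in \<gamma>2. 1 / q ^ (k + 1) \<le> norm y \<and> norm y \<le> 1 / q ^ (k + 2)"
    proof (rule AE2)
      show "AE y in \<gamma>1. 1 / q ^ (k + 1) \<le> norm (inversion y) \<and> norm (inversion y) \<le> 1 / q ^ (k + 2)"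
        using AEK
      proof eventually_elim
        fix y assume "y \<in> K"
        then have y: "y \<in> F" using K(2) by auto
        have "0 < norm y" using Fn(1)[OF y] by simp
        then show "1 / q ^ (k + 1) \<le> norm (inversion y) \<and> norm (inversion y) \<le> 1 / q ^ (k + 2)"
          unfolding norm_inversion using Fn(2,3)[OF y] q by (auto intro!: divide_left_mono mult_pos_pos)
      qed
    qed measurable
    then show "AE y in \<gamma>. 1 / q ^ (k + 1) \<le> norm y \<and> norm y \<le> 1 / q ^ (k + 2)"
      unfolding \<gamma>_def scale_borel_def using sets2 by (subst AE_density) auto
    have "ennreal (1 / B) * (ennreal ((q ^ (k + 2)) powr p) * ennreal (1/4)) \<le> ennreal (1 / B) * (ennreal ((q ^ (k + 2)) powr p) * emeasure \<mu> K)"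
      by (intro mult_left_mono less_imp_le[OF K(3)]) auto
    also have "ennreal ((q ^ (k + 2)) powr p) * emeasure \<mu> K = (\<integral>\<^sup>+y. ennreal ((q ^ (k + 2)) powr p) \<partial>\<gamma>1)"
      using sets_eq_imp_space_eq[OF \<gamma>1(1)] \<gamma>1(2) by simp
    also have "\<dots> \<le> (\<integral>\<^sup>+y. riesz_kernel \<alpha> 0 (inversion y) \<partial>\<gamma>1)"
    proof (rule nn_integral_mono_AE, use AEK in eventually_elim)
      fix y assume "y \<in> K"
      then have y: "y \<in> F" using K(2) by auto
      have y0: "inversion y \<noteq> 0" using Fn(1)[OF y] by (metis norm_inversion divide_eq_0_iff norm_eq_zero zero_neq_one)
      have "(q ^ (k + 2)) powr p \<le> norm y powr p" using Fn(3)[OF y] p q by (intro powr_mono2) auto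
      also have "\<dots> = norm (inversion y) powr (\<alpha> - real DIM('a))"
        unfolding norm_inversion using Fn(1)[OF y] powr_minus_divide[of "norm y" "\<alpha> - real DIM('a)"]
        by (simp add: p_def powr_divide)
      finally show "ennreal ((q ^ (k + 2)) powr p) \<le> riesz_kernel \<alpha> 0 (inversion y)"
        using y0 by (auto simp: riesz_kernel_def intro: ennreal_leI)
    qed
    also have "\<dots> = potential \<alpha> \<gamma>2 0" by (rule pot2[symmetric])
    finally have low: "ennreal (1 / B) * (ennreal ((q ^ (k + 2)) powr p) * ennreal (1/4)) \<le> potential \<alpha> \<gamma> 0"
      unfolding \<gamma>_def potential_scale[OF sets2] by (simp add: mult_left_mono)
    \<comment> \<open>Origin of 16: a factor 4 from the surviving quarter of the mass, 2 from the
      threshold 2/c, 2 from c being half of the capacity. The square of 2^p comes from the two uses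
      of the maximum principle.\<close>
    have "q powr p / (16 * (2 powr p)\<^sup>2) * (c2 * q powr (- real (Suc k) * p)) = 1 / B * ((q ^ (k + 2)) powr p * (1/4))"
    proof -
      have e1: "(q ^ (k + 2)) powr p = q powr (real (k + 2) * p)" by (simp only: powr_realpow[OF q(1), symmetric] powr_powr)
      have e2: "b = q powr (2 * (real (k + 1) * p))"
        unfolding b_def unfolding power_add[symmetric] unfolding powr_realpow[OF q(1), symmetric] powr_powr by (simp add: algebra_simps)
      have e3: "q powr (real (k + 2) * p) / q powr (2 * (real (k + 1) * p)) = q powr p * q powr (- real (Suc k) * p)"
        using q by (simp add: powr_diff[symmetric] powr_add[symmetric] algebra_simps)
      have "1 / B * ((q ^ (k + 2)) powr p * (1/4)) = (q powr (real (k + 2) * p) / q powr (2 * (real (k + 1) * p))) * c2 / (16 * (2 powr p)\<^sup>2)"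
        unfolding B_def e1 e2 c_def using c2 by (simp add: field_simps power2_eq_square)
      then show ?thesis unfolding e3 by simp
    qed
    moreover have "ennreal (q powr p) / (16 * comparison\<^sup>2) * (inner_cap \<alpha> F * ennreal (q powr (- real (Suc k) * p)))
      = ennreal (q powr p / (16 * (2 powr p)\<^sup>2) * (c2 * q powr (- real (Suc k) * p)))"
    proof -
      have "16 * comparison\<^sup>2 = ennreal (16 * (2 powr p)\<^sup>2)"
        unfolding comparison_def p_def[symmetric] by (simp add: ennreal_power ennreal_mult)
      then have "ennreal (q powr p) / (16 * comparison\<^sup>2) = ennreal (q powr p / (16 * (2 powr p)\<^sup>2))"
        by (simp only:) (rule divide_ennreal, auto)
      then show ?thesis unfolding c2(1) using c2(2) by (simp only:) (simp add: ennreal_mult[symmetric])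
    qed
    moreover have "ennreal (1 / B) * (ennreal ((q ^ (k + 2)) powr p) * ennreal (1/4)) = ennreal (1 / B * ((q ^ (k + 2)) powr p * (1/4)))"
      using B by (simp add: ennreal_mult[symmetric] del: ennreal_half)
    ultimately show "ennreal (q powr (real DIM('a) - \<alpha>)) / (16 * comparison\<^sup>2) * (inner_cap \<alpha> F * ennreal (q powr (- real (Suc k) * (real DIM('a) - \<alpha>)))) \<le> potential \<alpha> \<gamma> 0"
      using low by (simp only: p_def[symmetric])
  qed
qed

lemma shell_measures:
  assumes A: "closed A" and q: "0 < q" "q < 1" and thin: "\<not> thin_at_infinity \<alpha> q A"
  obtains \<gamma> :: "nat \<Rightarrow> 'a measure" where "\<And>k. energy_on A (\<gamma> k)" "\<And>k x. potential \<alpha> (\<gamma> k) x \<le> 1"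
    "\<And>k. AE y in \<gamma> k. (1 / q) ^ (k + 1) \<le> norm y \<and> norm y \<le> (1 / q) ^ (k + 2)"
    "(\<Sum>k. potential \<alpha> (\<gamma> k) 0) = \<infinity>"
proof -
  let ?w = "\<lambda>k. ennreal (q powr (- real (Suc k) * (real DIM('a) - \<alpha>)))"
  define c where "c = ennreal (q powr (real DIM('a) - \<alpha>)) / (16 * comparison\<^sup>2)"
  have c: "c \<noteq> 0" using q comparison by (auto simp: c_def power2_eq_square ennreal_mult_eq_top_iff ennreal_eq_0_iff not_le)
  define F where "F k = {x. inversion x \<in> A \<and> q ^ (k + 2) < norm x \<and> norm x \<le> q ^ (k + 1)}" for k
  have F: "{x \<in> inverse_set A. q ^ (Suc k + 1) < norm (x - 0) \<and> norm (x - 0) \<le> q ^ Suc k} = F k" for k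
  proof -
    have "x \<in> inverse_set A \<longleftrightarrow> inversion x \<in> A" if "q ^ (Suc k + 1) < norm x" for x
    proof -
      have x0: "x \<noteq> 0" using that zero_less_power[OF q(1), of "Suc k + 1"] by auto
      have "x \<in> inverse_set A \<longleftrightarrow> (\<exists>y\<in>A - {0}. x = inversion y)"
        using x0 by (auto simp: inverse_set_def inversion_def)
      also have "\<dots> \<longleftrightarrow> inversion x \<in> A"
        using x0 inversion_inversion[of x] inversion_inversion by (metis Diff_iff inversion_def scaleR_zero_right singletonD)
      finally show ?thesis .
    qed
    then show ?thesis unfolding F_def by auto
  qed
  have inf: "(\<Sum>k. inner_cap \<alpha> (F k) * ?w k) = \<infinity>"
    using thin unfolding thin_at_infinity_def irregular_point_def F by (metis infinity_ennreal_def less_top)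
  have "\<forall>k. \<exists>\<gamma> :: 'a measure. energy_on A \<gamma> \<and> (\<forall>x. potential \<alpha> \<gamma> x \<le> 1) \<and> (AE y in \<gamma>. 1 / q ^ (k + 1) \<le> norm y \<and> norm y \<le> 1 / q ^ (k + 2)) \<and>
     c * (inner_cap \<alpha> (F k) * ?w k) \<le> potential \<alpha> \<gamma> 0"
  proof
    fix k
    show "\<exists>\<gamma> :: 'a measure. energy_on A \<gamma> \<and> (\<forall>x. potential \<alpha> \<gamma> x \<le> 1) \<and> (AE y in \<gamma>. 1 / q ^ (k + 1) \<le> norm y \<and> norm y \<le> 1 / q ^ (k + 2)) \<and>
     c * (inner_cap \<alpha> (F k) * ?w k) \<le> potential \<alpha> \<gamma> 0"
    proof (rule shell_measure[OF borel_closed[OF A] q F_def[of k]])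
      fix \<gamma> :: "'a measure"
      assume 1: "energy_on A \<gamma>" "\<And>x. potential \<alpha> \<gamma> x \<le> 1" "AE y in \<gamma>. 1 / q ^ (k + 1) \<le> norm y \<and> norm y \<le> 1 / q ^ (k + 2)"
        and 2: "ennreal (q powr (real DIM('a) - \<alpha>)) / (16 * comparison\<^sup>2) * (inner_cap \<alpha> (F k) * ?w k) \<le> potential \<alpha> \<gamma> 0"
      show ?thesis
        by (rule exI[of _ \<gamma>]) (intro conjI allI 1 2[folded c_def])
    qed
  qed
  from choice[OF this] obtain \<gamma> :: "nat \<Rightarrow> 'a measure" where *: "\<forall>k. energy_on A (\<gamma> k) \<and> (\<forall>x. potential \<alpha> (\<gamma> k) x \<le> 1) \<and>
     (AE y in \<gamma> k. 1 / q ^ (k + 1) \<le> norm y \<and> norm y \<le> 1 / q ^ (k + 2)) \<and>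
     c * (inner_cap \<alpha> (F k) * ?w k) \<le> potential \<alpha> (\<gamma> k) 0" by (rule exE)
  note \<gamma> = *[rule_format, THEN conjunct1] *[rule_format, THEN conjunct2, THEN conjunct1, rule_format]
    *[rule_format, THEN conjunct2, THEN conjunct2, THEN conjunct1] *[rule_format, THEN conjunct2, THEN conjunct2, THEN conjunct2]
  have "c * (\<Sum>k. inner_cap \<alpha> (F k) * ?w k) \<le> (\<Sum>k. potential \<alpha> (\<gamma> k) 0)"
    unfolding ennreal_suminf_cmult[symmetric] by (intro suminf_le \<gamma>(4)) auto
  then have "(\<Sum>k. potential \<alpha> (\<gamma> k) 0) = \<infinity>"
    unfolding inf using c by (simp add: ennreal_mult_top top_unique)
  then show ?thesis using \<gamma>(1-3) by (intro that[of \<gamma>]) (simp_all only: power_one_over)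
qed

end


section \<open>Potentials close to 1 on large balls\<close>

context riesz_space
begin

lemma potential_sum_measure:
  assumes "\<And>k. sets (\<mu> k) = sets borel"
  shows "potential \<alpha> (sum_measure \<mu>) (x :: 'a) = (\<Sum>k. potential \<alpha> (\<mu> k) x)"
  unfolding potential_def by (rule nn_integral_sum_measure[OF assms]) measurable

lemma potential_le_scaled:
  assumes \<gamma>: "sets \<gamma> = sets borel" and c: "0 < c" and AE: "AE y in \<gamma>. norm (z - y) \<le> c * norm (x - y :: 'a)"
  shows "potential \<alpha> \<gamma> x \<le> ennreal (c powr (real DIM('a) - \<alpha>)) * potential \<alpha> \<gamma> z"
proof -
  have "potential \<alpha> \<gamma> x \<le> (\<integral>\<^sup>+y. ennreal (c powr (real DIM('a) - \<alpha>)) * riesz_kernel \<alpha> z y \<partial>\<gamma>)"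
    unfolding potential_def
    by (rule nn_integral_mono_AE, use AE in eventually_elim) (rule riesz_kernel_le_scaled[OF _ c])
  also have "\<dots> = ennreal (c powr (real DIM('a) - \<alpha>)) * potential \<alpha> \<gamma> z"
    unfolding potential_def by (rule nn_integral_cmult) (simp add: measurable_cong_sets[OF \<gamma> refl])
  finally show ?thesis .
qed

text \<open>Measures on the shells whose potentials at \<open>0\<close> form a divergent series: a finite block far out,
  scaled by a small \<open>\<delta>\<close>, has a potential close to \<open>1\<close> near \<open>0\<close>, and each point feels only boundedly
  many shells in a way not controlled by the value at \<open>0\<close>.\<close>

lemma test_measure:
  assumes A: "closed A" and q: "0 < q" "q < 1" and thin: "\<not> thin_at_infinity \<alpha> q A"
    and \<epsilon>: "0 < \<epsilon>" "\<epsilon> < 1"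
  obtains \<tau> where "energy_on A \<tau>" "\<And>x::'a. potential \<alpha> \<tau> x \<le> ennreal (1 + \<epsilon>)"
    "\<And>x. norm x \<le> R \<Longrightarrow> ennreal (1 - \<epsilon>) \<le> potential \<alpha> \<tau> x"
proof -
  define p where "p = real DIM('a) - \<alpha>"
  have p: "0 < p" using alpha_less_dim by (simp add: p_def)
  define Q where "Q = 1 / q"
  have Q: "1 < Q" using q by (simp add: Q_def)
  have "\<exists>\<gamma> :: nat \<Rightarrow> 'a measure. (\<forall>k. energy_on A (\<gamma> k)) \<and> (\<forall>k x. potential \<alpha> (\<gamma> k) x \<le> 1) \<and>
    (\<forall>k. AE y in \<gamma> k. Q ^ (k + 1) \<le> norm y \<and> norm y \<le> Q ^ (k + 2)) \<and> (\<Sum>k. potential \<alpha> (\<gamma> k) 0) = \<infinity>"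
  proof (rule shell_measures[OF A q thin, folded Q_def])
    fix \<gamma> :: "nat \<Rightarrow> 'a measure"
    assume *: "\<And>k. energy_on A (\<gamma> k)" "\<And>k x. potential \<alpha> (\<gamma> k) x \<le> 1"
      "\<And>k. AE y in \<gamma> k. Q ^ (k + 1) \<le> norm y \<and> norm y \<le> Q ^ (k + 2)" "(\<Sum>k. potential \<alpha> (\<gamma> k) 0) = \<infinity>"
    show ?thesis by (rule exI[of _ \<gamma>]) (intro conjI allI *)
  qed
  then obtain \<gamma> :: "nat \<Rightarrow> 'a measure" where **: "(\<forall>k. energy_on A (\<gamma> k)) \<and> (\<forall>k x. potential \<alpha> (\<gamma> k) x \<le> 1) \<and>
    (\<forall>k. AE y in \<gamma> k. Q ^ (k + 1) \<le> norm y \<and> norm y \<le> Q ^ (k + 2)) \<and> (\<Sum>k. potential \<alpha> (\<gamma> k) 0) = \<infinity>"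
    by (rule exE)
  then have \<gamma>: "\<And>k. energy_on A (\<gamma> k)" "\<And>k x. potential \<alpha> (\<gamma> k) x \<le> 1"
    and inf: "(\<Sum>k. potential \<alpha> (\<gamma> k) 0) = \<infinity>" by auto
  have shell: "AE y in \<gamma> k. Q ^ (k + 1) \<le> norm y \<and> norm y \<le> Q ^ (k + 2)" for k
    using ** by blast
  note g = energy_onD[OF \<gamma>(1)]
  define v where "v k = enn2real (potential \<alpha> (\<gamma> k) 0)" for k
  have v: "potential \<alpha> (\<gamma> k) 0 = ennreal (v k)" "0 \<le> v k" "v k \<le> 1" for k
  proof -
    show 1: "potential \<alpha> (\<gamma> k) 0 = ennreal (v k)"
      unfolding v_def using \<gamma>(2)[of k 0] by (intro ennreal_enn2real[symmetric]) (auto intro: le_less_trans)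
    show "0 \<le> v k" by (simp add: v_def)
    show "v k \<le> 1" using \<gamma>(2)[of k 0] unfolding 1 by (simp add: ennreal_le_1)
  qed
  define \<theta> where "\<theta> = 1 + \<epsilon> / 4"
  have \<theta>: "1 < \<theta>" using \<epsilon> by (simp add: \<theta>_def)
  \<comment> \<open>If |x| is at most \<eta> times the norm of every point of a shell, the distances
    from x and from 0 differ by a factor at most 1/(1-\<eta>). This selects \<eta> so that
    potentials then differ by a factor at most \<theta>.\<close>
  have "((\<lambda>\<eta>. (1 / (1 - \<eta>)) powr p) \<longlongrightarrow> (1 / (1 - 0)) powr p) (at_right (0::real))"
    by (intro tendsto_intros) auto
  then have "\<forall>\<^sub>F \<eta> in at_right 0. (1 / (1 - \<eta>)) powr p < \<theta>"
    by (rule order_tendstoD(2)) (use \<theta> in simp)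
  then obtain b where b: "0 < b" "\<And>\<eta>. 0 < \<eta> \<Longrightarrow> \<eta> < b \<Longrightarrow> (1 / (1 - \<eta>)) powr p < \<theta>"
    unfolding eventually_at_right_field by auto
  define \<eta> where "\<eta> = min (b / 2) (1 / 2)"
  have \<eta>: "0 < \<eta>" "\<eta> < 1" "\<eta> < b" using b by (auto simp: \<eta>_def)
  define c where "c = 1 / (1 - \<eta>)"
  have c: "0 < c" "c powr p \<le> \<theta>" using b(2)[OF \<eta>(1,3)] \<eta> by (auto simp: c_def)
  \<comment> \<open>With 2 Q < \<eta> Q^N, of N + 1 consecutive shells the first and last cannot
    both be near the same x; so at most N shells are near.\<close>
  obtain N where "2 * Q / \<eta> < Q ^ N" using real_arch_pow[OF Q] by blast
  then have N: "2 * Q < \<eta> * Q ^ N" using \<eta> by (simp add: field_simps)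
  have N0: "0 < N"
  proof (rule ccontr)
    assume "\<not> 0 < N"
    then show False using N \<eta> Q by simp
  qed
  have inside: "potential \<alpha> (\<gamma> k) x \<le> ennreal (\<theta> * v k)" "ennreal (v k) \<le> ennreal \<theta> * potential \<alpha> (\<gamma> k) x"
    if x: "norm x \<le> \<eta> * Q ^ (k + 1)" for k x
  proof -
    have ae: "AE y in \<gamma> k. norm (0 - y) \<le> c * norm (x - y) \<and> norm (x - y) \<le> c * norm (0 - y)"
      using shell[of k]
    proof eventually_elim
      fix y :: 'a assume y: "Q ^ (k + 1) \<le> norm y \<and> norm y \<le> Q ^ (k + 2)"
      have xy: "norm x \<le> \<eta> * norm y" using x y \<eta> by (meson mult_left_mono order_trans less_imp_le)
      have "norm y \<le> c * norm (x - y)"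
      proof -
        have "(1 - \<eta>) * norm y \<le> norm (x - y)"
          using norm_triangle_ineq3[of x y] xy by (simp add: algebra_simps)
        then show ?thesis using \<eta> by (simp add: c_def field_simps)
      qed
      moreover have "norm (x - y) \<le> (1 + \<eta>) * norm y"
        using norm_triangle_ineq4[of x y] xy by (simp add: algebra_simps)
      moreover have "(1 + \<eta>) * norm y \<le> c * norm y"
        using \<eta> by (intro mult_right_mono) (auto simp: c_def field_simps)
      ultimately show "norm (0 - y) \<le> c * norm (x - y) \<and> norm (x - y) \<le> c * norm (0 - y)"
        by auto
    qed
    have "potential \<alpha> (\<gamma> k) x \<le> ennreal (c powr p) * potential \<alpha> (\<gamma> k) 0"
      unfolding p_def by (rule potential_le_scaled[OF g(1) c(1)]) (use ae in eventually_elim, simp)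
    also have "\<dots> \<le> ennreal \<theta> * ennreal (v k)" unfolding v(1) using c by (intro mult_right_mono ennreal_leI) auto
    finally show "potential \<alpha> (\<gamma> k) x \<le> ennreal (\<theta> * v k)" using \<theta> v(2)[of k] by (simp add: ennreal_mult)
    have "potential \<alpha> (\<gamma> k) 0 \<le> ennreal (c powr p) * potential \<alpha> (\<gamma> k) x"
      unfolding p_def by (rule potential_le_scaled[OF g(1) c(1)]) (use ae in eventually_elim, simp)
    also have "\<dots> \<le> ennreal \<theta> * potential \<alpha> (\<gamma> k) x" using c by (intro mult_right_mono ennreal_leI) auto
    finally show "ennreal (v k) \<le> ennreal \<theta> * potential \<alpha> (\<gamma> k) x" unfolding v(1) .
  qed
  have outside: "potential \<alpha> (\<gamma> k) x \<le> ennreal (\<theta> * v k)" if x: "2 * Q ^ (k + 2) \<le> norm x" for k x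
  proof -
    have "potential \<alpha> (\<gamma> k) x \<le> ennreal (1 powr p) * potential \<alpha> (\<gamma> k) 0"
      unfolding p_def
    proof (rule potential_le_scaled[OF g(1)])
      show "AE y in \<gamma> k. norm (0 - y) \<le> 1 * norm (x - y)"
        using shell[of k]
      proof eventually_elim
        fix y :: 'a assume "Q ^ (k + 1) \<le> norm y \<and> norm y \<le> Q ^ (k + 2)"
        then show "norm (0 - y) \<le> 1 * norm (x - y)"
          using x norm_triangle_ineq2[of x y] by simp
      qed
    qed simp
    also have "\<dots> \<le> ennreal (\<theta> * v k)"
      unfolding v(1) using mult_right_mono[of 1 \<theta> "v k"] \<theta> v(2)[of k] by (auto intro: ennreal_leI)
    finally show ?thesis .
  qed
  \<comment> \<open>For these shells x is neither deep inside nor far outside; their potentials are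
    bounded only by 1.\<close>
  define near where "near x = {k. \<eta> * Q ^ (k + 1) < norm x \<and> norm x < 2 * Q ^ (k + 2)}" for x :: 'a
  have near_card: "finite (near x) \<and> card (near x) \<le> N" for x
  proof (cases "near x = {}")
    case False
    define k0 where "k0 = (LEAST k. k \<in> near x)"
    have k0: "k0 \<in> near x" "\<And>k. k \<in> near x \<Longrightarrow> k0 \<le> k"
      unfolding k0_def using False by (auto intro: LeastI Least_le)
    have "near x \<subseteq> {k0..<k0 + N}"
    proof
      fix k assume k: "k \<in> near x"
      have "k < k0 + N"
      proof (rule ccontr)
        assume "\<not> k < k0 + N"
        then have "Q ^ (k0 + N + 1) \<le> Q ^ (k + 1)" using Q by (intro power_increasing) auto
        then have "\<eta> * Q ^ (k0 + N + 1) \<le> \<eta> * Q ^ (k + 1)" using \<eta> by (intro mult_left_mono) auto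
        also have "\<dots> < 2 * Q ^ (k0 + 2)" using k k0(1) by (simp add: near_def)
        also have "\<dots> = (2 * Q) * Q ^ (k0 + 1)" by simp
        also have "\<dots> \<le> (\<eta> * Q ^ N) * Q ^ (k0 + 1)" using N Q by (intro mult_right_mono) auto
        also have "\<dots> = \<eta> * Q ^ (k0 + N + 1)" by (simp add: power_add)
        finally show False by simp
      qed
      then show "k \<in> {k0..<k0 + N}" using k0(2)[OF k] by simp
    qed
    then show ?thesis using card_mono[of "{k0..<k0 + N}" "near x"] finite_subset by auto
  qed simp
  have each: "potential \<alpha> (\<gamma> k) x \<le> ennreal (indicator (near x) k + \<theta> * v k)" for k x
  proof (cases "k \<in> near x")
    case True
    have "potential \<alpha> (\<gamma> k) x \<le> ennreal 1" using \<gamma>(2) by simp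
    also have "\<dots> \<le> ennreal (1 + \<theta> * v k)" using \<theta> v(2)[of k] by (intro ennreal_leI) simp
    finally show ?thesis using True by simp
  next
    case False
    then show ?thesis using inside(1)[of x k] outside[of k x] by (auto simp: near_def not_less)
  qed
  \<comment> \<open>The at most N near shells contribute together at most \<epsilon>/4; moreover one
    further shell raises the sum \<open>S\<close> by at most \<delta>.\<close>
  define \<delta> where "\<delta> = \<epsilon> / (4 * real N)"
  have \<delta>: "0 < \<delta>" "\<delta> * real N = \<epsilon> / 4" "\<delta> \<le> \<epsilon> / 4"
    using \<epsilon> N0 by (auto simp: \<delta>_def field_simps)
  \<comment> \<open>From shell K on, the whole ball of radius R is deep inside, so values on it are
    comparable with the value at 0.\<close>
  obtain K where K: "R / \<eta> < Q ^ K" using real_arch_pow[OF Q] by blast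
  define S where "S L = \<delta> * (\<Sum>j=K..<L. v j)" for L
  \<comment> \<open>Divergence of the series at 0 survives dropping the first K terms, each at most
    1.\<close>
  have "\<exists>L. 1 - \<delta> < S L"
  proof (rule ccontr)
    assume "\<not> ?thesis"
    then have *: "(\<Sum>j=K..<L. v j) \<le> (1 - \<delta>) / \<delta>" for L
      using \<delta> by (auto simp: S_def not_less field_simps)
    have "(\<Sum>k. ennreal (v k)) \<le> ennreal (real K + (1 - \<delta>) / \<delta>)"
    proof (rule suminf_le_const)
      fix L
      have "(\<Sum>j<L. v j) \<le> (\<Sum>j\<in>{..<K} \<union> {K..<L}. v j)"
        by (rule sum_mono2) (auto simp: v)
      also have "\<dots> = (\<Sum>j<K. v j) + (\<Sum>j=K..<L. v j)" by (rule sum.union_disjoint) auto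
      also have "\<dots> \<le> real K + (1 - \<delta>) / \<delta>"
        using sum_mono[of "{..<K}" v "\<lambda>_. 1"] v(3) *[of L] by simp
      finally show "(\<Sum>j<L. ennreal (v j)) \<le> ennreal (real K + (1 - \<delta>) / \<delta>)"
        by (simp add: v(2) ennreal_leI)
    qed simp
    then show False using inf by (simp add: v(1) top_unique)
  qed
  then obtain L0 where L0: "1 - \<delta> < S L0" by blast
  \<comment> \<open>The first index at which the sum passes 1 - \<delta>: minimality and steps of
    size at most \<delta> keep it below 1.\<close>
  define L where "L = (LEAST L. 1 - \<delta> < S L)"
  have L: "1 - \<delta> < S L" unfolding L_def using L0 by (rule LeastI)
  have "S L \<le> 1"
  proof (cases L)
    case 0
    then show ?thesis by (simp add: S_def)
  next
    case (Suc L')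
    have "\<not> 1 - \<delta> < S L'" using not_less_Least[of L' "\<lambda>L. 1 - \<delta> < S L"] Suc by (simp add: L_def)
    moreover have "S (Suc L') \<le> S L' + \<delta>"
    proof (cases "K \<le> L'")
      case True
      then show ?thesis using v(3)[of L'] \<delta> by (simp add: S_def distrib_left mult_left_le)
    qed (use \<delta> in \<open>simp add: S_def\<close>)
    ultimately show ?thesis using Suc by simp
  qed
  define \<gamma>' where "\<gamma>' j = (if j \<in> {K..<L} then \<gamma> j else null_measure borel)" for j
  have \<gamma>': "sets (\<gamma>' j) = sets borel" for j using g(1) by (simp add: \<gamma>'_def)
  define \<tau> where "\<tau> = scale_borel \<delta> (sum_measure \<gamma>')"
  have pot\<tau>: "potential \<alpha> \<tau> x = ennreal \<delta> * (\<Sum>j=K..<L. potential \<alpha> (\<gamma> j) x)" for x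
  proof -
    have "potential \<alpha> (sum_measure \<gamma>') x = (\<Sum>j. potential \<alpha> (\<gamma>' j) x)"
      by (rule potential_sum_measure[OF \<gamma>'])
    also have "\<dots> = (\<Sum>j\<in>{K..<L}. potential \<alpha> (\<gamma>' j) x)"
      by (rule suminf_finite) (auto simp: \<gamma>'_def potential_def)
    also have "\<dots> = (\<Sum>j=K..<L. potential \<alpha> (\<gamma> j) x)" by (rule sum.cong) (auto simp: \<gamma>'_def)
    finally show ?thesis by (simp add: \<tau>_def potential_scale)
  qed
  have up: "potential \<alpha> \<tau> x \<le> ennreal (1 + \<epsilon>)" for x
  proof -
    have "(\<Sum>j=K..<L. potential \<alpha> (\<gamma> j) x) \<le> (\<Sum>j=K..<L. ennreal (indicator (near x) j + \<theta> * v j))"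
      by (intro sum_mono each)
    also have "\<dots> = ennreal (\<Sum>j=K..<L. indicator (near x) j + \<theta> * v j)"
      using \<theta> v(2) by (intro sum_ennreal) simp
    finally have "potential \<alpha> \<tau> x \<le> ennreal \<delta> * ennreal (\<Sum>j=K..<L. indicator (near x) j + \<theta> * v j)"
      unfolding pot\<tau> by (rule mult_left_mono) simp
    also have "\<dots> = ennreal (\<delta> * (\<Sum>j=K..<L. indicator (near x) j + \<theta> * v j))"
      using \<delta> \<theta> v(2) by (intro ennreal_mult[symmetric] sum_nonneg) auto
    also have "\<delta> * (\<Sum>j=K..<L. indicator (near x) j + \<theta> * v j) = \<delta> * real (card ({K..<L} \<inter> near x)) + \<theta> * S L"
      by (simp add: S_def sum.distrib distrib_left sum_distrib_left mult_ac indicator_def sum.If_cases Int_def)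
    also have "\<dots> \<le> \<delta> * real N + \<theta> * 1"
      using near_card[of x] card_mono[of "near x" "{K..<L} \<inter> near x"] \<delta> \<theta> \<open>S L \<le> 1\<close>
      \<comment> \<open>The total is \<epsilon>/4 from the near shells plus \<theta> = 1 +
        \<epsilon>/4 from the others.\<close>
      by (intro add_mono mult_left_mono) auto
    also have "\<dots> \<le> 1 + \<epsilon>" using \<delta> \<epsilon> by (simp add: \<theta>_def)
    finally show ?thesis by (simp add: ennreal_leI)
  qed
  show ?thesis
  proof (rule that[OF _ up])
    show "energy_on A \<tau>"
      unfolding energy_on_def
    proof (intro conjI)
      show "sets \<tau> = sets borel" by (simp add: \<tau>_def)
      have em: "emeasure \<tau> B = ennreal \<delta> * (\<Sum>j=K..<L. emeasure (\<gamma> j) B)" if "B \<in> sets borel" for B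
      proof -
        have "emeasure (sum_measure \<gamma>') B = (\<Sum>j. emeasure (\<gamma>' j) B)"
          by (rule emeasure_sum_measure[OF \<gamma>' that])
        also have "\<dots> = (\<Sum>j\<in>{K..<L}. emeasure (\<gamma>' j) B)"
          by (rule suminf_finite) (auto simp: \<gamma>'_def)
        also have "\<dots> = (\<Sum>j=K..<L. emeasure (\<gamma> j) B)" by (rule sum.cong) (auto simp: \<gamma>'_def)
        finally show ?thesis by (simp add: \<tau>_def emeasure_scale_borel that)
      qed
      show m: "emeasure \<tau> UNIV < \<infinity>" by (simp add: em ennreal_mult_less_top g(2)[simplified])
      have "mutual_energy \<alpha> \<tau> \<tau> \<le> ennreal (1 + \<epsilon>) * emeasure \<tau> UNIV"
        by (rule mutual_energy_le_bound[OF _ up]) (simp add: \<tau>_def)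
      also have "\<dots> < \<infinity>" using m by (simp add: ennreal_mult_less_top)
      finally show "mutual_energy \<alpha> \<tau> \<tau> < \<infinity>" .
      show "emeasure \<tau> (- A) = 0" using A by (simp add: em g(5))
    qed
    fix x :: 'a assume x: "norm x \<le> R"
    have "ennreal (\<delta> * (\<Sum>j=K..<L. v j)) = ennreal \<delta> * (\<Sum>j=K..<L. ennreal (v j))"
      using \<delta> by (simp add: ennreal_mult sum_nonneg v(2))
    also have "\<dots> \<le> ennreal \<delta> * (\<Sum>j=K..<L. ennreal \<theta> * potential \<alpha> (\<gamma> j) x)"
    proof (intro mult_left_mono sum_mono inside(2))
      fix j assume "j \<in> {K..<L}"
      then have "Q ^ K \<le> Q ^ (j + 1)" using Q by (intro power_increasing) auto
      moreover have "R < \<eta> * Q ^ K" using K \<eta> by (simp add: field_simps)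
      ultimately show "norm x \<le> \<eta> * Q ^ (j + 1)" using x \<eta>
        by (meson less_imp_le mult_left_mono order_trans)
    qed simp
    also have "\<dots> = ennreal \<theta> * potential \<alpha> \<tau> x"
      unfolding pot\<tau> sum_distrib_left[symmetric] by (simp add: mult_ac)
    finally have le: "ennreal (S L) \<le> ennreal \<theta> * potential \<alpha> \<tau> x" by (simp add: S_def)
    obtain w where w: "potential \<alpha> \<tau> x = ennreal w" "0 \<le> w"
      using up[of x] by (cases "potential \<alpha> \<tau> x") (auto simp: top_unique)
    have "S L \<le> \<theta> * w" using le \<theta> w by (simp add: ennreal_mult[symmetric])
    then have "1 - \<epsilon> / 4 \<le> (1 + \<epsilon> / 4) * w" using L \<delta> by (simp add: \<theta>_def)
    moreover have "(1 + \<epsilon> / 4) * (1 - \<epsilon>) \<le> 1 - \<epsilon> / 4" using \<epsilon> by (simp add: field_simps)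
    ultimately have "(1 + \<epsilon> / 4) * (1 - \<epsilon>) \<le> (1 + \<epsilon> / 4) * w" by linarith
    then have "1 - \<epsilon> \<le> w" using \<epsilon> by (subst (asm) mult_le_cancel_left_pos) auto
    then show "ennreal (1 - \<epsilon>) \<le> potential \<alpha> \<tau> x" unfolding w(1) by (rule ennreal_leI)
  qed
qed

end


section \<open>Balayage of measures of finite energy\<close>

lemma add_measure_split:
  fixes \<nu> :: "'a::euclidean_space measure"
  assumes s: "sets \<nu> = sets borel" and B: "B \<in> sets borel"
  shows "\<nu> = add_measure (restrict_borel \<nu> B) (restrict_borel \<nu> (- B))"
proof (rule measure_eqI)
  fix S assume "S \<in> sets \<nu>"
  then have S: "S \<in> sets borel" using s by simp
  have "emeasure \<nu> S = emeasure \<nu> (B \<inter> S) + emeasure \<nu> (- B \<inter> S)"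
    using s B S by (subst plus_emeasure) (auto intro!: arg_cong[where f="emeasure \<nu>"])
  then show "emeasure \<nu> S = emeasure (add_measure (restrict_borel \<nu> B) (restrict_borel \<nu> (- B))) S"
    using s B S by (simp add: emeasure_add_measure emeasure_restrict_borel)
qed (use s in simp)

lemma first_variation_nonneg:
  fixes a b t0 :: real
  assumes "\<And>t. 0 < t \<Longrightarrow> t \<le> t0 \<Longrightarrow> 0 \<le> 2 * t * a + t\<^sup>2 * b" "0 < t0"
  shows "0 \<le> a"
proof (rule ccontr)
  assume a: "\<not> 0 \<le> a"
  \<comment> \<open>A step at which the quadratic term is at most half the size of the negative
    linear one.\<close>
  define t where "t = min t0 (- a / (\<bar>b\<bar> + 1))"
  have t: "0 < t" "t \<le> t0" using a assms(2) by (auto simp: t_def divide_neg_pos)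
  have "t * \<bar>b\<bar> \<le> - a / (\<bar>b\<bar> + 1) * \<bar>b\<bar>" by (intro mult_right_mono) (auto simp: t_def)
  also have "\<dots> \<le> - a" using a by (simp add: field_simps)
  finally have "2 * a + t * b < 0" using a abs_ge_self[of b] mult_left_mono[of b "\<bar>b\<bar>" t] t by linarith
  then have "t * (2 * a + t * b) < 0" using t by (simp add: mult_pos_neg)
  then show False using assms(1)[OF t] by (simp add: algebra_simps power2_eq_square)
qed

context riesz_space
begin

lemma heat_finite:
  assumes "sets \<mu> = sets borel" "emeasure \<mu> UNIV < \<infinity>" "0 < t"
  shows "heat t \<mu> z \<noteq> \<infinity>"
proof -
  have "heat t \<mu> z \<le> (\<integral>\<^sup>+x. ennreal (gauss t (0::'b::euclidean_space)) \<partial>\<mu>)"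
    unfolding heat_def using assms(3) by (intro nn_integral_mono ennreal_leI gauss_le_zero)
  also have "\<dots> < \<infinity>" using assms sets_eq_imp_space_eq[OF assms(1)] by (simp add: ennreal_mult_less_top)
  finally show ?thesis by simp
qed

text \<open>The squared energy norm of \<sigma> - \<nu> for measures of finite energy, defined
  without subtracting energies; finiteness of both heat evolutions is enough for the integrand to
  have its meaning.\<close>

definition heat_distance :: "'a measure \<Rightarrow> 'a measure \<Rightarrow> ennreal" where
  "heat_distance \<sigma> \<nu> = (\<integral>\<^sup>+t. (\<integral>\<^sup>+z. ennreal ((enn2real (heat (t/2) \<sigma> z) - enn2real (heat (t/2) \<nu> z))\<^sup>2) \<partial>lborel) \<partial>rtime C \<alpha>)"

lemma heat_distance_energy:
  assumes \<sigma>: "energy_on UNIV \<sigma>" and \<nu>: "energy_on UNIV \<nu>"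
  shows "heat_distance \<sigma> \<nu> = ennreal (en \<sigma> \<sigma> + en \<nu> \<nu> - 2 * en \<sigma> \<nu>)"
proof -
  note s = energy_onD[OF \<sigma>] and n = energy_onD[OF \<nu>]
  note [measurable (raw)] = heat_measurable[OF s(3)] heat_measurable[OF n(3)]
  let ?d = "\<lambda>t z. ennreal ((enn2real (heat (t/2) \<sigma> z) - enn2real (heat (t/2) \<nu> z))\<^sup>2)"
  have pt: "?d t z + 2 * (heat (t/2) \<sigma> z * heat (t/2) \<nu> z) = heat (t/2) \<sigma> z * heat (t/2) \<sigma> z + heat (t/2) \<nu> z * heat (t/2) \<nu> z" if t: "0 < t" for t z
  proof -
    obtain a where a: "heat (t/2) \<sigma> z = ennreal a" "0 \<le> a"
      using heat_finite[OF s(1,2), of "t/2" z] t by (cases "heat (t/2) \<sigma> z") auto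
    obtain b where b: "heat (t/2) \<nu> z = ennreal b" "0 \<le> b"
      using heat_finite[OF n(1,2), of "t/2" z] t by (cases "heat (t/2) \<nu> z") auto
    have "ennreal ((a - b)\<^sup>2) + ennreal (2 * (a * b)) = ennreal ((a - b)\<^sup>2 + 2 * (a * b))"
      by (rule ennreal_plus[symmetric]) (use a b in auto)
    also have "(a - b)\<^sup>2 + 2 * (a * b) = a * a + b * b" by (simp add: power2_eq_square algebra_simps)
    finally have "ennreal ((a - b)\<^sup>2) + ennreal (2 * (a * b)) = ennreal (a * a + b * b)" .
    then show ?thesis unfolding a(1) b(1) using a(2) b(2)
      by (simp add: ennreal_mult)
  qed
  \<comment> \<open>The mixed energy is added on the left, since subtraction in
    \<open>ennreal\<close> would need finiteness first.\<close>
  have "heat_distance \<sigma> \<nu> + 2 * mutual_energy \<alpha> \<sigma> \<nu> = (\<integral>\<^sup>+t. (\<integral>\<^sup>+z. ?d t z + 2 * (heat (t/2) \<sigma> z * heat (t/2) \<nu> z) \<partial>lborel) \<partial>rtime C \<alpha>)"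
    unfolding heat_distance_def energy_heat[OF s(3) n(3)]
    by (simp add: nn_integral_add nn_integral_cmult)
  also have "\<dots> = (\<integral>\<^sup>+t. (\<integral>\<^sup>+z. heat (t/2) \<sigma> z * heat (t/2) \<sigma> z + heat (t/2) \<nu> z * heat (t/2) \<nu> z \<partial>lborel) \<partial>rtime C \<alpha>)"
    by (rule nn_integral_cong_AE, use AE_rtime_pos[of C \<alpha>] in eventually_elim) (simp add: pt)
  also have "\<dots> = mutual_energy \<alpha> \<sigma> \<sigma> + mutual_energy \<alpha> \<nu> \<nu>"
    unfolding energy_heat[OF s(3) s(3)] energy_heat[OF n(3) n(3)]
    by (simp add: nn_integral_add)
  finally have eq: "heat_distance \<sigma> \<nu> + ennreal (2 * en \<sigma> \<nu>) = ennreal (en \<sigma> \<sigma> + en \<nu> \<nu>)"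
    by (simp add: ennreal_en s(4) n(4) ennreal_mult)
  then obtain h where h: "heat_distance \<sigma> \<nu> = ennreal h" "0 \<le> h" by (cases "heat_distance \<sigma> \<nu>") (auto simp del: ennreal_plus)
  have "h + 2 * en \<sigma> \<nu> = en \<sigma> \<sigma> + en \<nu> \<nu>"
    using eq h(2) unfolding h(1) by (subst (asm) ennreal_plus[symmetric]) (auto simp del: ennreal_plus)
  then have "h = en \<sigma> \<sigma> + en \<nu> \<nu> - 2 * en \<sigma> \<nu>" by simp
  then show ?thesis using h by simp
qed

lemma energy_on_UNIV: "energy_on A \<mu> \<Longrightarrow> energy_on UNIV \<mu>"
  by (simp add: energy_on_def)

lemma gauss_vanishes: "0 < t \<Longrightarrow> ((\<lambda>x. gauss t (z - x :: 'a)) \<longlongrightarrow> 0) at_infinity"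
proof -
  assume t: "0 < t"
  have "filterlim (\<lambda>x. norm (z - x :: 'a)) at_top at_infinity"
  proof (rule filterlim_at_top_mono)
    show "filterlim (\<lambda>x. - norm z + norm (x :: 'a)) at_top at_infinity"
      by (intro filterlim_tendsto_add_at_top[OF tendsto_const] filterlim_norm_at_top)
    show "\<forall>\<^sub>F x in at_infinity. - norm z + norm x \<le> norm (z - x)"
      by (intro always_eventually allI) (metis add.commute diff_conv_add_uminus norm_minus_commute norm_triangle_ineq2)
  qed
  moreover have "((\<lambda>r. (2 * pi * t) powr (- (real DIM('a) / 2)) * exp (- r\<^sup>2 / (2 * t))) \<longlongrightarrow> 0) at_top"
    using t by real_asymp
  ultimately show ?thesis unfolding gauss_def by (rule filterlim_compose[rotated])
qed

text \<open>A Gaussian is a continuous function vanishing at infinity, so vague convergence gives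
  pointwise convergence of heat evolutions at every positive time; Fatou in space and then in time
  finishes.\<close>

lemma heat_distance_lsc:
  assumes \<sigma>: "sets \<sigma> = sets borel" "emeasure \<sigma> UNIV < \<infinity>" and \<nu>k: "\<And>k. sets (\<nu> k) = sets borel" "\<And>k. emeasure (\<nu> k) UNIV < \<infinity>"
    and \<mu>: "sets \<mu> = sets borel" "emeasure \<mu> UNIV < \<infinity>"
    and conv: "\<And>f :: 'a \<Rightarrow> real. continuous_on UNIV f \<Longrightarrow> (\<And>x. 0 \<le> f x) \<Longrightarrow> (f \<longlongrightarrow> 0) at_infinity \<Longrightarrow>
      (\<lambda>k. \<integral>\<^sup>+x. ennreal (f x) \<partial>\<nu> k) \<longlonglongrightarrow> (\<integral>\<^sup>+x. ennreal (f x) \<partial>\<mu>)"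
  shows "heat_distance \<sigma> \<mu> \<le> liminf (\<lambda>k. heat_distance \<sigma> (\<nu> k))"
proof -
  note [measurable (raw)] = heat_measurable[OF sigma_finite_borel_finite[OF \<sigma>]] heat_measurable[OF sigma_finite_borel_finite[OF \<nu>k]]
    heat_measurable[OF sigma_finite_borel_finite[OF \<mu>]]
  let ?d = "\<lambda>\<nu> t z. ennreal ((enn2real (heat (t/2) \<sigma> z) - enn2real (heat (t/2) \<nu> z))\<^sup>2)"
  have pt: "?d \<mu> t z = liminf (\<lambda>k. ?d (\<nu> k) t z)" if "0 < t" for t z
  proof -
    have L: "(\<lambda>k. heat (t/2) (\<nu> k) z) \<longlonglongrightarrow> heat (t/2) \<mu> z"
      unfolding heat_def
    proof (rule conv)
      show "continuous_on UNIV (\<lambda>x. gauss (t/2) (z - x))"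
        unfolding continuous_on_def using that by (intro ballI gauss_continuous tendsto_intros) auto
    qed (use that in \<open>auto intro: gauss_vanishes\<close>)
    have eq: "heat (t/2) \<mu> z = ennreal (enn2real (heat (t/2) \<mu> z))"
      using heat_finite[OF \<mu>, of "t/2" z] that by (simp add: ennreal_enn2real less_top)
    have "(\<lambda>k. heat (t/2) (\<nu> k) z) \<longlonglongrightarrow> ennreal (enn2real (heat (t/2) \<mu> z))"
      using L by (simp only: eq[symmetric])
    from tendsto_enn2real[OF this enn2real_nonneg]
    have "(\<lambda>k. enn2real (heat (t/2) (\<nu> k) z)) \<longlonglongrightarrow> enn2real (heat (t/2) \<mu> z)" .
    then have "(\<lambda>k. ?d (\<nu> k) t z) \<longlonglongrightarrow> ?d \<mu> t z"
      by (intro tendsto_ennrealI tendsto_power tendsto_diff tendsto_const)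
    then show ?thesis by (rule lim_imp_Liminf[OF trivial_limit_sequentially, symmetric])
  qed
  have "heat_distance \<sigma> \<mu> \<le> (\<integral>\<^sup>+t. liminf (\<lambda>k. \<integral>\<^sup>+z. ?d (\<nu> k) t z \<partial>lborel) \<partial>rtime C \<alpha>)"
    unfolding heat_distance_def
  proof (rule nn_integral_mono_AE, use AE_rtime_pos[of C \<alpha>] in eventually_elim)
    fix t :: real assume t: "0 < t"
    have "(\<integral>\<^sup>+z. ?d \<mu> t z \<partial>lborel) = (\<integral>\<^sup>+z. liminf (\<lambda>k. ?d (\<nu> k) t z) \<partial>lborel)" by (simp only: pt[OF t])
    also have "\<dots> \<le> liminf (\<lambda>k. \<integral>\<^sup>+z. ?d (\<nu> k) t z \<partial>lborel)" by (rule nn_integral_liminf) measurable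
    finally show "(\<integral>\<^sup>+z. ?d \<mu> t z \<partial>lborel) \<le> liminf (\<lambda>k. \<integral>\<^sup>+z. ?d (\<nu> k) t z \<partial>lborel)" .
  qed
  also have "\<dots> \<le> liminf (\<lambda>k. heat_distance \<sigma> (\<nu> k))"
    unfolding heat_distance_def by (rule nn_integral_liminf) measurable
  finally show ?thesis .
qed

text \<open>Test with the distance to A times a cutoff: positive off A inside a ball, and zero on
  A.\<close>

lemma vague_limit_carried:
  assumes A: "closed A" "A \<noteq> {}" and \<nu>k: "\<And>k. sets (\<nu> k) = sets borel" "\<And>k. emeasure (\<nu> k) (- A) = 0"
    and \<mu>: "sets \<mu> = sets borel"
    and conv: "\<And>f :: 'a \<Rightarrow> real. continuous_on UNIV f \<Longrightarrow> (\<And>x. 0 \<le> f x) \<Longrightarrow> (f \<longlongrightarrow> 0) at_infinity \<Longrightarrow>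
      (\<lambda>k. \<integral>\<^sup>+x. ennreal (f x) \<partial>\<nu> k) \<longlonglongrightarrow> (\<integral>\<^sup>+x. ennreal (f x) \<partial>\<mu>)"
  shows "emeasure \<mu> (- A) = 0"
proof -
  have "AE x in \<mu>. norm x < real N \<longrightarrow> x \<in> A" for N
  proof -
    define f where "f x = infdist x A * max 0 (real N - norm x)" for x
    have fc: "continuous_on UNIV f" unfolding f_def by (intro continuous_intros)
    then have [measurable]: "f \<in> borel_measurable borel" by (rule borel_measurable_continuous_onI)
    have "(\<integral>\<^sup>+x. ennreal (f x) \<partial>\<nu> k) = 0" for k
    proof -
      have "AE x in \<nu> k. x \<in> A" using AE_in_iff[OF \<nu>k(1), of A] A \<nu>k(2) by simp
      then have "AE x in \<nu> k. ennreal (f x) = 0" by eventually_elim (simp add: f_def)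
      then show ?thesis by (subst nn_integral_0_iff_AE) (auto simp: measurable_cong_sets[OF \<nu>k(1) refl])
    qed
    moreover have "(f \<longlongrightarrow> 0) at_infinity"
      by (rule tendsto_eventually) (auto simp: eventually_at_infinity f_def intro!: exI[of _ "real N"])
    ultimately have "(\<lambda>k. 0) \<longlonglongrightarrow> (\<integral>\<^sup>+x. ennreal (f x) \<partial>\<mu>)"
      using conv[OF fc] by (simp add: f_def infdist_nonneg)
    then have "(\<integral>\<^sup>+x. ennreal (f x) \<partial>\<mu>) = 0" by (simp add: LIMSEQ_const_iff)
    then have "AE x in \<mu>. ennreal (f x) = 0"
      by (subst (asm) nn_integral_0_iff_AE) (auto simp: measurable_cong_sets[OF \<mu> refl])
    then show ?thesis
    proof eventually_elim
      fix x assume "ennreal (f x) = 0"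
      moreover have "0 \<le> f x" by (simp add: f_def infdist_nonneg)
      ultimately have "f x = 0" by (simp add: ennreal_eq_0_iff antisym)
      show "norm x < real N \<longrightarrow> x \<in> A"
      proof
        assume "norm x < real N"
        then have "infdist x A = 0" using \<open>f x = 0\<close> by (simp add: f_def)
        then show "x \<in> A" by (rule in_closed_iff_infdist_zero[OF A, THEN iffD2])
      qed
    qed
  qed
  then have "AE x in \<mu>. \<forall>N. norm x < real N \<longrightarrow> x \<in> A" by (intro AE_all_countable[THEN iffD2] allI)
  then have "AE x in \<mu>. x \<in> A"
  proof eventually_elim
    fix x assume *: "\<forall>N. norm x < real N \<longrightarrow> x \<in> A"
    obtain N where "norm x < real N" using reals_Archimedean2[of "norm x"] by (rule exE)
    then show "x \<in> A" using *[rule_format, of N] by simp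
  qed
  then show ?thesis using AE_in_iff[OF \<mu>, of A] A by simp
qed

text \<open>The direct method: the bound m on the mass gives vague compactness, and lower
  semicontinuity is that of \<open>heat_distance\<close>, which differs from the functional by the
  constant E(\<sigma>).\<close>

lemma energy_minimizer:
  assumes \<sigma>: "energy_on UNIV \<sigma>" and A: "closed A" "A \<noteq> {}"
  obtains \<nu> where "energy_on A \<nu>" "emeasure \<nu> UNIV \<le> ennreal m"
    "\<And>\<nu>'. energy_on A \<nu>' \<Longrightarrow> emeasure \<nu>' UNIV \<le> ennreal m \<Longrightarrow> en \<nu> \<nu> - 2 * en \<sigma> \<nu> \<le> en \<nu>' \<nu>' - 2 * en \<sigma> \<nu>'"
proof -
  note s = energy_onD[OF \<sigma>]
  define J where "J \<nu> = en \<nu> \<nu> - 2 * en \<sigma> \<nu>" for \<nu>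
  define X where "X = {\<nu>. energy_on A \<nu> \<and> emeasure \<nu> UNIV \<le> ennreal m}"
  have "null_measure borel \<in> X" by (simp add: X_def energy_on_null)
  then have X: "X \<noteq> {}" by blast
  have Jlow: "- en \<sigma> \<sigma> \<le> J \<nu>" if "\<nu> \<in> X" for \<nu>
    using en_diff_nonneg[OF s(4), of \<nu>] energy_onD(4)[of A \<nu>] that by (simp add: X_def J_def)
  then have bdd: "bdd_below (J ` X)" by (intro bdd_belowI[of _ "- en \<sigma> \<sigma>"]) auto
  define I where "I = Inf (J ` X)"
  have "\<exists>\<nu>\<in>X. J \<nu> < I + 1 / real (Suc k)" for k
  proof -
    have "Inf (J ` X) < I + 1 / real (Suc k)" by (simp add: I_def)
    then show ?thesis using cInf_less_iff[OF _ bdd] X by auto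
  qed
  then obtain \<nu> where \<nu>: "\<And>k. \<nu> k \<in> X" "\<And>k. J (\<nu> k) < I + 1 / real (Suc k)" by metis
  have e: "energy_on A (\<nu> k)" and mass: "emeasure (\<nu> k) UNIV \<le> ennreal m" for k using \<nu>(1) by (auto simp: X_def)
  note n = energy_onD[OF e]
  obtain r \<mu> where r: "strict_mono (r :: nat \<Rightarrow> nat)" and \<mu>: "sets \<mu> = sets borel" "emeasure \<mu> UNIV \<le> ennreal m"
    and conv: "\<And>f :: 'a \<Rightarrow> real. continuous_on UNIV f \<Longrightarrow> (\<And>x. 0 \<le> f x) \<Longrightarrow> (f \<longlongrightarrow> 0) at_infinity \<Longrightarrow>
      (\<lambda>k. \<integral>\<^sup>+x. ennreal (f x) \<partial>\<nu> (r k)) \<longlonglongrightarrow> (\<integral>\<^sup>+x. ennreal (f x) \<partial>\<mu>)"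
    using vague_compactness[of \<nu> m, OF n(1) mass] by metis
  have \<mu>fin: "emeasure \<mu> UNIV < \<infinity>" using \<mu>(2) by (auto intro: le_less_trans)
  \<comment> \<open>Minimality bounds the functional only; positivity of the energy of \<nu> - 2
    \<sigma> converts this into a bound on E(\<nu>).\<close>
  have enb: "en (\<nu> k) (\<nu> k) \<le> 2 * (I + 1) + 4 * en \<sigma> \<sigma>" for k
  proof -
    have "0 \<le> en (\<nu> k) (\<nu> k) + en (scale_borel 2 \<sigma>) (scale_borel 2 \<sigma>) - 2 * en (\<nu> k) (scale_borel 2 \<sigma>)"
      by (intro en_diff_nonneg finite_energy_measure_scale n(4) s(4))
    then have "0 \<le> en (\<nu> k) (\<nu> k) + 4 * en \<sigma> \<sigma> - 4 * en \<sigma> (\<nu> k)"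
      by (simp add: en_scale_left en_scale_right finite_energy_measure_scale n(4) s(4) en_commute[OF n(4) s(4)])
    moreover have "en (\<nu> k) (\<nu> k) - 2 * en \<sigma> (\<nu> k) \<le> I + 1"
      using less_le_trans[OF \<nu>(2)[of k], of "I + 1"] by (simp add: J_def)
    moreover have "e \<le> 2 * (i + 1) + 4 * s" if "0 \<le> e + 4 * s - 4 * x" "e - 2 * x \<le> i + 1" for e i s x :: real
      using that by (simp add: algebra_simps)
    ultimately show ?thesis by blast
  qed
  \<comment> \<open>The distance to the zero measure is the energy, so the same semicontinuity shows
    that the vague limit has finite energy.\<close>
  have null: "heat_distance (null_measure borel) \<nu>' = ennreal (en \<nu>' \<nu>')" if "energy_on UNIV \<nu>'" for \<nu>'
    using heat_distance_energy[OF energy_on_null that] by (simp add: en_def mutual_energy_def)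
  have "mutual_energy \<alpha> \<mu> \<mu> \<le> heat_distance (null_measure borel) \<mu>"
    unfolding energy_heat[OF sigma_finite_borel_finite[OF \<mu>(1) \<mu>fin] sigma_finite_borel_finite[OF \<mu>(1) \<mu>fin]] heat_distance_def
  proof (rule nn_integral_mono_AE, use AE_rtime_pos[of C \<alpha>] in eventually_elim)
    fix t :: real assume "0 < t"
    then show "(\<integral>\<^sup>+z. heat (t/2) \<mu> z * heat (t/2) \<mu> z \<partial>lborel) \<le> (\<integral>\<^sup>+z. ennreal ((enn2real (heat (t/2) (null_measure borel) z) - enn2real (heat (t/2) \<mu> z))\<^sup>2) \<partial>lborel)"
    proof (intro nn_integral_mono)
      fix z
      obtain b where b: "heat (t/2) \<mu> z = ennreal b" "0 \<le> b"
        using heat_finite[OF \<mu>(1) \<mu>fin, of "t/2" z] \<open>0 < t\<close> by (cases "heat (t/2) \<mu> z") auto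
      show "heat (t/2) \<mu> z * heat (t/2) \<mu> z \<le> ennreal ((enn2real (heat (t/2) (null_measure borel) z) - enn2real (heat (t/2) \<mu> z))\<^sup>2)"
        unfolding b(1) using b(2) by (simp add: heat_def[of _ "null_measure borel"] ennreal_mult[symmetric] power2_eq_square)
    qed
  qed
  also have "\<dots> \<le> liminf (\<lambda>k. heat_distance (null_measure borel) (\<nu> (r k)))"
    by (rule heat_distance_lsc) (use n \<mu> \<mu>fin conv in auto)
  also have "\<dots> \<le> ennreal (2 * (I + 1) + 4 * en \<sigma> \<sigma>)"
  proof -
    have "\<forall>\<^sub>F k in sequentially. heat_distance (null_measure borel) (\<nu> (r k)) \<le> ennreal (2 * (I + 1) + 4 * en \<sigma> \<sigma>)"
      unfolding null[OF energy_on_UNIV[OF e]] by (intro always_eventually allI ennreal_leI enb)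
    then show ?thesis by (intro Liminf_le) simp_all
  qed
  finally have E\<mu>: "mutual_energy \<alpha> \<mu> \<mu> < \<infinity>" by (rule le_less_trans) simp
  have "emeasure \<mu> (- A) = 0"
    by (rule vague_limit_carried[OF A, of "\<lambda>k. \<nu> (r k)"]) (use n \<mu> conv in auto)
  then have e\<mu>: "energy_on A \<mu>" using \<mu> \<mu>fin E\<mu> by (simp add: energy_on_def)
  have "ennreal (en \<sigma> \<sigma> + J \<mu>) = heat_distance \<sigma> \<mu>"
    unfolding heat_distance_energy[OF \<sigma> energy_on_UNIV[OF e\<mu>]] J_def by (simp add: algebra_simps)
  also have "\<dots> \<le> liminf (\<lambda>k. heat_distance \<sigma> (\<nu> (r k)))"
    by (rule heat_distance_lsc) (use n \<mu> \<mu>fin conv s in auto)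
  also have "\<dots> = liminf (\<lambda>k. ennreal (en \<sigma> \<sigma> + J (\<nu> (r k))))"
    unfolding heat_distance_energy[OF \<sigma> energy_on_UNIV[OF e]] J_def by (simp add: algebra_simps)
  also have "\<dots> \<le> ennreal (en \<sigma> \<sigma> + I)"
  proof -
    have "liminf (\<lambda>k. ennreal (en \<sigma> \<sigma> + J (\<nu> (r k)))) \<le> liminf (\<lambda>k. ennreal (en \<sigma> \<sigma> + (I + 1 / real (Suc k))))"
    proof (rule Liminf_mono[OF always_eventually], rule allI)
      fix k
      have "J (\<nu> (r k)) \<le> I + 1 / real (Suc (r k))" using \<nu>(2) by (rule less_imp_le)
      also have "\<dots> \<le> I + 1 / real (Suc k)" using seq_suble[OF r, of k] by (simp add: divide_left_mono)
      finally show "ennreal (en \<sigma> \<sigma> + J (\<nu> (r k))) \<le> ennreal (en \<sigma> \<sigma> + (I + 1 / real (Suc k)))" by (intro ennreal_leI) simp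
    qed
    also have "\<dots> = ennreal (en \<sigma> \<sigma> + I)"
    proof (rule lim_imp_Liminf[OF trivial_limit_sequentially], rule tendsto_ennrealI)
      show "(\<lambda>k. en \<sigma> \<sigma> + (I + 1 / real (Suc k))) \<longlonglongrightarrow> en \<sigma> \<sigma> + I" by real_asymp
    qed
    finally show ?thesis .
  qed
  finally have "en \<sigma> \<sigma> + J \<mu> \<le> en \<sigma> \<sigma> + I"
  proof (subst (asm) ennreal_le_iff)
    have "- en \<sigma> \<sigma> \<le> I" unfolding I_def by (rule cInf_greatest) (use X Jlow in auto)
    then show "0 \<le> en \<sigma> \<sigma> + I" by simp
  qed
  then have J\<mu>: "J \<mu> \<le> I" by simp
  show ?thesis
  proof (rule that[OF e\<mu> \<mu>(2)])
    fix \<nu>' assume "energy_on A \<nu>'" "emeasure \<nu>' UNIV \<le> ennreal m"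
    then have "I \<le> J \<nu>'" unfolding I_def by (intro cInf_lower[OF _ bdd]) (auto simp: X_def)
    then show "en \<mu> \<mu> - 2 * en \<sigma> \<mu> \<le> en \<nu>' \<nu>' - 2 * en \<sigma> \<nu>'" using J\<mu> by (simp add: J_def)
  qed
qed

text \<open>Integrate the test measure's potential, which is nearly 1 on a large ball and at most
  slightly above 1 elsewhere, and exchange the roles of the two measures by symmetry of the
  kernel.\<close>

lemma mass_comparison:
  assumes A: "closed A" and q: "0 < q" "q < 1" and thin: "\<not> thin_at_infinity \<alpha> q A"
    and \<nu>: "sets \<nu> = sets borel" "emeasure \<nu> UNIV < \<infinity>" and \<sigma>: "sets \<sigma> = sets borel" "emeasure \<sigma> UNIV < \<infinity>"
    and le: "\<And>\<tau>. energy_on A \<tau> \<Longrightarrow> (\<integral>\<^sup>+x. potential \<alpha> \<nu> (x::'a) \<partial>\<tau>) \<le> (\<integral>\<^sup>+x. potential \<alpha> \<sigma> x \<partial>\<tau>)"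
  shows "emeasure \<nu> UNIV \<le> emeasure \<sigma> UNIV"
proof -
  note sf = sigma_finite_borel_finite[OF \<nu>] sigma_finite_borel_finite[OF \<sigma>]
  define s where "s = enn2real (emeasure \<sigma> UNIV)"
  have s: "emeasure \<sigma> UNIV = ennreal s" "0 \<le> s" using \<sigma>(2) by (auto simp: s_def ennreal_enn2real_if)
  have ball: "emeasure \<nu> (cball 0 R) \<le> emeasure \<sigma> UNIV" for R
  proof -
    have "emeasure \<nu> (cball 0 R) \<le> emeasure \<nu> UNIV" by (rule emeasure_mono) (use \<nu> in auto)
    then obtain a where a: "emeasure \<nu> (cball 0 R) = ennreal a" "0 \<le> a"
      using \<nu>(2) by (cases "emeasure \<nu> (cball 0 R)") (auto simp: top_unique)
    have key: "(1 - \<epsilon>) * a \<le> (1 + \<epsilon>) * s" if \<epsilon>: "0 < \<epsilon>" "\<epsilon> < 1" for \<epsilon>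
    proof -
      obtain \<tau> where \<tau>: "energy_on A \<tau>" "\<And>x::'a. potential \<alpha> \<tau> x \<le> ennreal (1 + \<epsilon>)"
        "\<And>x. norm x \<le> R \<Longrightarrow> ennreal (1 - \<epsilon>) \<le> potential \<alpha> \<tau> x"
        using test_measure[OF A q thin \<epsilon>, of R] by metis
      note t = energy_onD[OF \<tau>(1)]
      have "ennreal (1 - \<epsilon>) * emeasure \<nu> (cball 0 R) = (\<integral>\<^sup>+x. ennreal (1 - \<epsilon>) * indicator (cball 0 R) x \<partial>\<nu>)"
        using \<nu> by (subst nn_integral_cmult_indicator) auto
      also have "\<dots> \<le> (\<integral>\<^sup>+x. potential \<alpha> \<tau> x \<partial>\<nu>)"
        by (intro nn_integral_mono) (auto simp: indicator_def \<tau>(3))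
      also have "\<dots> = (\<integral>\<^sup>+x. potential \<alpha> \<nu> x \<partial>\<tau>)" by (rule nn_integral_potential_commute[OF t(3) sf(1)])
      also have "\<dots> \<le> (\<integral>\<^sup>+x. potential \<alpha> \<sigma> x \<partial>\<tau>)" by (rule le[OF \<tau>(1)])
      also have "\<dots> = (\<integral>\<^sup>+x. potential \<alpha> \<tau> x \<partial>\<sigma>)" by (rule nn_integral_potential_commute[OF sf(2) t(3)])
      also have "\<dots> \<le> (\<integral>\<^sup>+x. ennreal (1 + \<epsilon>) \<partial>\<sigma>)" by (intro nn_integral_mono \<tau>(2))
      also have "\<dots> = ennreal (1 + \<epsilon>) * emeasure \<sigma> UNIV" using sets_eq_imp_space_eq[OF \<sigma>(1)] by simp
      finally have "ennreal ((1 - \<epsilon>) * a) \<le> ennreal ((1 + \<epsilon>) * s)"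
        unfolding a(1) s(1) using a(2) s(2) \<epsilon> by (simp add: ennreal_mult)
      then show ?thesis using s(2) \<epsilon> by (subst (asm) ennreal_le_iff) auto
    qed
    have "a \<le> s"
    proof (rule ccontr)
      assume "\<not> a \<le> s"
      then have as: "s < a" "0 < a + s" using s(2) by auto
      \<comment> \<open>Makes \<epsilon> (a + s) equal to half of a - s, which contradicts the
        bound.\<close>
      define \<epsilon> where "\<epsilon> = (a - s) / 2 / (a + s)"
      have "0 < \<epsilon>" "\<epsilon> < 1" using as s(2) by (auto simp: \<epsilon>_def field_simps)
      from key[OF this] have "a - s \<le> \<epsilon> * (a + s)" by (simp add: algebra_simps)
      also have "\<dots> = (a - s) / 2" using as by (intro nonzero_eq_divide_eq[THEN iffD1]) (auto simp: \<epsilon>_def)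
      finally show False using as by simp
    qed
    then show ?thesis unfolding a(1) s(1) by (rule ennreal_leI)
  qed
  have "emeasure \<nu> UNIV = (SUP k. emeasure \<nu> (cball 0 (real k)))"
  proof -
    have "(\<Union>k. cball (0::'a) (real k)) = UNIV" by (auto intro: real_arch_simple)
    moreover have "incseq (\<lambda>k. cball (0::'a) (real k))" by (auto simp: incseq_def)
    ultimately show ?thesis using SUP_emeasure_incseq[of "\<lambda>k. cball (0::'a) (real k)" \<nu>] \<nu>(1)
      by (simp add: image_subset_iff)
  qed
  also have "\<dots> \<le> emeasure \<sigma> UNIV" by (rule SUP_least) (rule ball)
  finally show ?thesis .
qed

text \<open>The equality of potentials is required almost everywhere for every measure of finite
  mass and energy on A; this is the form in which "nearly everywhere" is used.\<close>

definition swept :: "'a set \<Rightarrow> 'a measure \<Rightarrow> 'a measure \<Rightarrow> bool" where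
  "swept A \<sigma> \<nu> \<longleftrightarrow> energy_on A \<nu> \<and> emeasure \<nu> UNIV = emeasure \<sigma> UNIV \<and> (\<forall>x. potential \<alpha> \<nu> x \<le> potential \<alpha> \<sigma> x) \<and>
     (\<forall>\<tau>. energy_on A \<tau> \<longrightarrow> (AE x in \<tau>. potential \<alpha> \<nu> x = potential \<alpha> \<sigma> x))"

lemma en_restrict:
  assumes "energy_on A \<tau>" "energy_on B \<nu>" "S \<in> sets borel" "A \<in> sets borel"
  shows "ennreal (en \<nu> (restrict_borel \<tau> S)) = (\<integral>\<^sup>+x. indicator S x * potential \<alpha> \<nu> x \<partial>\<tau>)"
proof -
  note t = energy_onD[OF assms(1)] and n = energy_onD[OF assms(2)] and r = energy_onD[OF energy_on_restrict(1)[OF assms(1,3,4)]]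
  have "ennreal (en \<nu> (restrict_borel \<tau> S)) = mutual_energy \<alpha> (restrict_borel \<tau> S) \<nu>"
    using ennreal_en[OF n(4) r(4)] mutual_energy_commute[OF n(3) r(3), of \<alpha>] by simp
  then show ?thesis
    unfolding mutual_energy_potential using t n assms by (simp add: nn_integral_restrict_borel)
qed

text \<open>Apply the hypothesis to the set S where the inequality fails: there the integrated
  inequality and the pointwise one are opposite, and finiteness forces S to be null.\<close>

lemma AE_potential_le:
  assumes \<tau>: "energy_on A \<tau>" "A \<in> sets borel" and e: "energy_on B \<nu>" "energy_on B' \<sigma>"
    and le: "\<And>S. S \<in> sets borel \<Longrightarrow> en \<nu> (restrict_borel \<tau> S) \<le> en \<sigma> (restrict_borel \<tau> S)"
  shows "AE x in \<tau>. potential \<alpha> \<nu> x \<le> potential \<alpha> \<sigma> x"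
proof -
  note n = energy_onD[OF e(1)] and s = energy_onD[OF e(2)] and t = energy_onD[OF \<tau>(1)]
  note [measurable] = potential_borel[OF n(3)] potential_borel[OF s(3)]
  note [measurable_cong] = t(1)
  define S where "S = {x. potential \<alpha> \<sigma> x < potential \<alpha> \<nu> x}"
  have S[measurable]: "S \<in> sets borel" unfolding S_def by measurable
  have "(\<integral>\<^sup>+x. indicator S x * potential \<alpha> \<nu> x \<partial>\<tau>) \<le> (\<integral>\<^sup>+x. indicator S x * potential \<alpha> \<sigma> x \<partial>\<tau>)"
    unfolding en_restrict[OF \<tau>(1) e(1) S \<tau>(2), symmetric] en_restrict[OF \<tau>(1) e(2) S \<tau>(2), symmetric]
    by (rule ennreal_leI[OF le[OF S]])
  moreover have fin: "(\<integral>\<^sup>+x. indicator S x * potential \<alpha> \<sigma> x \<partial>\<tau>) \<noteq> \<infinity>"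
    by (simp add: en_restrict[OF \<tau>(1) e(2) S \<tau>(2), symmetric])
  moreover have "(\<integral>\<^sup>+x. indicator S x * potential \<alpha> \<nu> x - indicator S x * potential \<alpha> \<sigma> x \<partial>\<tau>) =
     (\<integral>\<^sup>+x. indicator S x * potential \<alpha> \<nu> x \<partial>\<tau>) - (\<integral>\<^sup>+x. indicator S x * potential \<alpha> \<sigma> x \<partial>\<tau>)"
    by (rule nn_integral_diff) (use fin in \<open>auto simp: indicator_def S_def intro!: AE_I2\<close>)
  ultimately have "(\<integral>\<^sup>+x. indicator S x * potential \<alpha> \<nu> x - indicator S x * potential \<alpha> \<sigma> x \<partial>\<tau>) = 0"
    by (metis diff_eq_0_ennreal infinity_ennreal_def le_less_trans less_top)
  then have "AE x in \<tau>. indicator S x * potential \<alpha> \<nu> x - indicator S x * potential \<alpha> \<sigma> x = 0"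
    by (subst (asm) nn_integral_0_iff_AE) auto
  then show ?thesis
    by eventually_elim (metis S_def ennreal_minus_eq_0 indicator_simps(1) mem_Collect_eq mult_1 not_le)
qed

theorem swept_exists:
  assumes A: "closed A" and q: "0 < q" "q < 1" and thin: "\<not> thin_at_infinity \<alpha> q A" and \<sigma>: "energy_on UNIV \<sigma>"
  obtains \<nu> where "swept A \<sigma> \<nu>"
proof -
  note s = energy_onD[OF \<sigma>]
  have Ane: "A \<noteq> {}" using thin by (auto simp: thin_at_infinity_def)
  have Ab: "A \<in> sets borel" using A by simp
  \<comment> \<open>The extra 1 leaves room for adding mass to \<nu>, once its mass is known to be
    at most that of \<sigma>.\<close>
  define m where "m = enn2real (emeasure \<sigma> UNIV) + 1"
  have m: "emeasure \<sigma> UNIV + 1 = ennreal m"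
    using s(2) by (simp add: m_def ennreal_enn2real_if)
  obtain \<nu> where \<nu>: "energy_on A \<nu>" "emeasure \<nu> UNIV \<le> ennreal m"
    and min: "\<And>\<nu>'. energy_on A \<nu>' \<Longrightarrow> emeasure \<nu>' UNIV \<le> ennreal m \<Longrightarrow> en \<nu> \<nu> - 2 * en \<sigma> \<nu> \<le> en \<nu>' \<nu>' - 2 * en \<sigma> \<nu>'"
    using energy_minimizer[OF \<sigma> A Ane, of m] by metis
  note n = energy_onD[OF \<nu>(1)]
  have "AE x in \<nu>. potential \<alpha> \<nu> x \<le> potential \<alpha> \<sigma> x"
  proof (rule AE_potential_le[OF \<nu>(1) Ab \<nu>(1) \<sigma>])
    fix S :: "'a set" assume S: "S \<in> sets borel"
    define \<beta> where "\<beta> = restrict_borel \<nu> S"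
    define \<rho> where "\<rho> = restrict_borel \<nu> (- S)"
    have b: "energy_on A \<beta>" and r: "energy_on A \<rho>"
      unfolding \<beta>_def \<rho>_def using S Ab by (auto intro!: energy_on_restrict(1)[OF \<nu>(1)])
    note fb = energy_onD(4)[OF b] and fr = energy_onD(4)[OF r]
    have split: "\<nu> = add_measure \<rho> \<beta>"
      using add_measure_split[OF n(1), of "- S"] S by (simp add: \<beta>_def \<rho>_def)
    have "0 \<le> en \<sigma> \<beta> - en \<nu> \<beta>"
    proof (rule first_variation_nonneg[of 1 _ "en \<beta> \<beta>"])
      fix t :: real assume t: "0 < t" "t \<le> 1"
      \<comment> \<open>Removing part of \<nu> never raises the mass, so this competitor is always
        allowed; it yields only the inequality on the carrier of \<nu>.\<close>
      define \<nu>' where "\<nu>' = add_measure \<rho> (scale_borel (1 - t) \<beta>)"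
      have e': "energy_on A \<nu>'" unfolding \<nu>'_def by (intro energy_on_add energy_on_scale r b Ab)
      have "ennreal (1 - t) * emeasure \<beta> UNIV \<le> 1 * emeasure \<beta> UNIV" using t by (intro mult_right_mono) (auto simp: ennreal_le_1)
      then have "emeasure \<nu>' UNIV \<le> emeasure \<nu> UNIV"
        unfolding \<nu>'_def split using energy_onD(1)[OF b] energy_onD(1)[OF r]
        by (simp add: emeasure_add_measure emeasure_scale_borel add_left_mono)
      then have "emeasure \<nu>' UNIV \<le> ennreal m" using \<nu>(2) by (rule order_trans)
      from min[OF e' this] have "en \<nu> \<nu> - 2 * en \<sigma> \<nu> \<le> en \<nu>' \<nu>' - 2 * en \<sigma> \<nu>'" .
      moreover have "en \<nu> \<nu> = en \<rho> \<rho> + 2 * en \<rho> \<beta> + en \<beta> \<beta>" "en \<sigma> \<nu> = en \<sigma> \<rho> + en \<sigma> \<beta>" "en \<nu> \<beta> = en \<rho> \<beta> + en \<beta> \<beta>"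
        unfolding split by (simp_all add: en_add_left en_add_right fb fr s(4) finite_energy_measure_add en_commute[OF fb fr])
      moreover have "en \<nu>' \<nu>' = en \<rho> \<rho> + 2 * (1 - t) * en \<rho> \<beta> + (1 - t)\<^sup>2 * en \<beta> \<beta>" "en \<sigma> \<nu>' = en \<sigma> \<rho> + (1 - t) * en \<sigma> \<beta>"
        unfolding \<nu>'_def using t by (simp_all add: en_add_left en_add_right en_scale_left en_scale_right fb fr s(4)
            finite_energy_measure_add finite_energy_measure_scale en_commute[OF fb fr] power2_eq_square algebra_simps)
      ultimately show "0 \<le> 2 * t * (en \<sigma> \<beta> - en \<nu> \<beta>) + t\<^sup>2 * en \<beta> \<beta>"
        by (simp add: algebra_simps power2_eq_square)
    qed simp
    then show "en \<nu> (restrict_borel \<nu> S) \<le> en \<sigma> (restrict_borel \<nu> S)" by (simp add: \<beta>_def)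
  qed
  then have dom: "potential \<alpha> \<nu> x \<le> potential \<alpha> \<sigma> x" for x
    by (rule domination_principle[OF n(4,2) s(3)])
  have mass1: "emeasure \<nu> UNIV \<le> emeasure \<sigma> UNIV"
    by (rule mass_comparison[OF A q thin n(1,2) s(1,2)]) (intro nn_integral_mono dom)
  have eq: "AE x in \<tau>. potential \<alpha> \<nu> x = potential \<alpha> \<sigma> x" if \<tau>: "energy_on A \<tau>" for \<tau>
  proof -
    have "AE x in \<tau>. potential \<alpha> \<sigma> x \<le> potential \<alpha> \<nu> x"
    proof (rule AE_potential_le[OF \<tau> Ab \<sigma> \<nu>(1)])
      fix S :: "'a set" assume S: "S \<in> sets borel"
      define \<beta> where "\<beta> = restrict_borel \<tau> S"
      have b: "energy_on A \<beta>" unfolding \<beta>_def by (rule energy_on_restrict(1)[OF \<tau> S Ab])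
      note fb = energy_onD[OF b]
      \<comment> \<open>Steps up to 1/M add a mass of at most 1, exactly the room provided by
        \<open>m\<close>.\<close>
      define M where "M = enn2real (emeasure \<beta> UNIV) + 1"
      have M: "emeasure \<beta> UNIV \<le> ennreal M" "1 \<le> M" using fb(2) by (auto simp: M_def ennreal_enn2real_if)
      have "0 \<le> en \<nu> \<beta> - en \<sigma> \<beta>"
      proof (rule first_variation_nonneg[of "1 / M" _ "en \<beta> \<beta>"])
        fix t :: real assume t: "0 < t" "t \<le> 1 / M"
        define \<nu>' where "\<nu>' = add_measure \<nu> (scale_borel t \<beta>)"
        have e': "energy_on A \<nu>'" unfolding \<nu>'_def by (intro energy_on_add energy_on_scale \<nu>(1) b Ab)
        have "ennreal t * emeasure \<beta> UNIV \<le> ennreal (1 / M) * ennreal M" using t M by (intro mult_mono ennreal_leI) auto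
        also have "\<dots> = 1" using M by (simp add: ennreal_mult[symmetric])
        finally have "emeasure \<nu>' UNIV \<le> emeasure \<sigma> UNIV + 1"
          unfolding \<nu>'_def using mass1 fb(1) n(1) by (simp add: emeasure_add_measure emeasure_scale_borel add_mono)
        then have "emeasure \<nu>' UNIV \<le> ennreal m" by (simp add: m)
        from min[OF e' this] have "en \<nu> \<nu> - 2 * en \<sigma> \<nu> \<le> en \<nu>' \<nu>' - 2 * en \<sigma> \<nu>'" .
        moreover have "en \<nu>' \<nu>' = en \<nu> \<nu> + 2 * t * en \<nu> \<beta> + t\<^sup>2 * en \<beta> \<beta>" "en \<sigma> \<nu>' = en \<sigma> \<nu> + t * en \<sigma> \<beta>"
          unfolding \<nu>'_def using t by (simp_all add: en_add_left en_add_right en_scale_left en_scale_right fb(4) n(4) s(4)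
              finite_energy_measure_add finite_energy_measure_scale en_commute[OF fb(4) n(4)] power2_eq_square algebra_simps)
        ultimately show "0 \<le> 2 * t * (en \<nu> \<beta> - en \<sigma> \<beta>) + t\<^sup>2 * en \<beta> \<beta>"
          by (simp add: algebra_simps)
      qed (use M in simp)
      then show "en \<sigma> (restrict_borel \<tau> S) \<le> en \<nu> (restrict_borel \<tau> S)" by (simp add: \<beta>_def)
    qed
    then show ?thesis by eventually_elim (use dom in \<open>auto intro: antisym\<close>)
  qed
  \<comment> \<open>Equality of the potentials for measures on A lets the mass comparison run in the
    other direction too.\<close>
  have mass2: "emeasure \<sigma> UNIV \<le> emeasure \<nu> UNIV"
  proof (rule mass_comparison[OF A q thin s(1,2) n(1,2)])
    fix \<tau> :: "'a measure" assume "energy_on A \<tau>"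
    from eq[OF this] show "(\<integral>\<^sup>+x. potential \<alpha> \<sigma> x \<partial>\<tau>) \<le> (\<integral>\<^sup>+x. potential \<alpha> \<nu> x \<partial>\<tau>)"
      by (intro nn_integral_mono_AE) (auto elim!: eventually_mono)
  qed
  show ?thesis
    by (rule that[of \<nu>]) (auto simp: swept_def \<nu>(1) dom eq antisym[OF mass1 mass2])
qed

lemma sweptD:
  assumes "swept A \<sigma> \<nu>"
  shows "energy_on A \<nu>" "emeasure \<nu> UNIV = emeasure \<sigma> UNIV" "\<And>x. potential \<alpha> \<nu> x \<le> potential \<alpha> \<sigma> x"
    "\<And>\<tau>. energy_on A \<tau> \<Longrightarrow> AE x in \<tau>. potential \<alpha> \<nu> x = potential \<alpha> \<sigma> x"
  using assms by (auto simp: swept_def)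

text \<open>\<sigma> and \<nu> have the same mutual energy with every measure on A, so \<nu> is the
  orthogonal projection of \<sigma>, and the gap is the energy of \<nu> - \<nu>'.\<close>

lemma swept_minimal:
  assumes sw: "swept A \<sigma> \<nu>" and \<sigma>: "energy_on UNIV \<sigma>" and \<nu>': "energy_on A \<nu>'"
  shows "en \<sigma> \<sigma> + en \<nu> \<nu> - 2 * en \<sigma> \<nu> \<le> en \<sigma> \<sigma> + en \<nu>' \<nu>' - 2 * en \<sigma> \<nu>'"
    "en \<sigma> \<nu> = en \<nu> \<nu>"
proof -
  note n = energy_onD[OF sweptD(1)[OF sw]] and s = energy_onD[OF \<sigma>] 
  have eq: "en \<sigma> \<tau> = en \<nu> \<tau>" if "energy_on A \<tau>" for \<tau>
  proof -
    note t = energy_onD[OF that]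
    have "mutual_energy \<alpha> \<tau> \<sigma> = mutual_energy \<alpha> \<tau> \<nu>"
      unfolding mutual_energy_potential
      by (rule nn_integral_cong_AE, use sweptD(4)[OF sw that] in eventually_elim) simp
    then show ?thesis
      using mutual_energy_commute[OF t(3) s(3), of \<alpha>] mutual_energy_commute[OF t(3) n(3), of \<alpha>] by (simp add: en_def)
  qed
  show "en \<sigma> \<nu> = en \<nu> \<nu>" by (rule eq[OF sweptD(1)[OF sw]])
  then show "en \<sigma> \<sigma> + en \<nu> \<nu> - 2 * en \<sigma> \<nu> \<le> en \<sigma> \<sigma> + en \<nu>' \<nu>' - 2 * en \<sigma> \<nu>'"
    using eq[OF \<nu>'] en_diff_nonneg[OF n(4) energy_onD(4)[OF \<nu>']] by simp
qed

end


section \<open>External fields\<close>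

context riesz_space
begin

text \<open>The part of the measure where the property fails is carried by a Borel subset of an
  exceptional set of capacity zero, hence is zero.\<close>

lemma nearly_everywhere_AE:
  assumes ne: "nearly_everywhere_on \<alpha> A P" and \<tau>: "energy_on A \<tau>" and A: "A \<in> sets borel"
    and meas: "{x. \<not> P x} \<in> sets borel"
  shows "AE x in \<tau>. P x"
proof -
  obtain N where N: "inner_cap \<alpha> N = 0" "\<forall>x \<in> A - N. P x" using ne by (auto simp: nearly_everywhere_on_def)
  note t = energy_onD[OF \<tau>]
  let ?Z = "{x. \<not> P x}"
  have e: "energy_on (A \<inter> ?Z) (restrict_borel \<tau> ?Z)" by (rule energy_on_restrict(2)[OF \<tau> meas A])
  have "emeasure (restrict_borel \<tau> ?Z) UNIV = 0"
  proof (rule ccontr)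
    assume "emeasure (restrict_borel \<tau> ?Z) UNIV \<noteq> 0"
    then have "0 < inner_cap \<alpha> N"
      by (intro inner_cap_pos[OF e, of N]) (use N A meas in auto)
    then show False using N by simp
  qed
  then have "emeasure \<tau> ?Z = 0" using t meas by (simp add: emeasure_restrict_borel)
  then show ?thesis
    using AE_in_iff[OF t(1), of "- ?Z"] meas by auto
qed

lemma radon_measure_sigma_finite: "radon_measure \<alpha> \<mu> \<Longrightarrow> sigma_finite_borel (\<mu> :: 'a measure)"
  by (rule sigma_finite_borel_locally_finite) (auto simp: radon_measure_def)

text \<open>If the potential were infinite on a set charged by \<gamma>, a compact part of that set
  would carry a nonzero measure \<tau> of bounded potential. By symmetry the part of \<mu> in a ball
  has a finite \<tau>-integral of its potential, and the far part has finite potential on the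
  compact set: a contradiction.\<close>

lemma radon_potential_AE_finite:
  assumes \<mu>: "radon_measure \<alpha> \<mu>" and \<gamma>: "energy_on B \<gamma>"
  shows "AE x in \<gamma>. potential \<alpha> \<mu> x < \<infinity>"
proof (rule ccontr)
  assume not: "\<not> ?thesis"
  have sf: "sigma_finite_borel \<mu>" by (rule radon_measure_sigma_finite[OF \<mu>])
  note [measurable] = potential_borel[OF sf]
  have s: "sets \<mu> = sets borel" and comp: "\<And>K. compact K \<Longrightarrow> emeasure \<mu> K < \<infinity>" using \<mu> by (auto simp: radon_measure_def)
  obtain x0 where x0: "potential \<alpha> \<mu> x0 < \<infinity>" using \<mu> by (auto simp: radon_measure_def)
  note g = energy_onD[OF energy_on_UNIV[OF \<gamma>]]
  define Z where "Z = {x. potential \<alpha> \<mu> x = \<infinity>}"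
  have Z[measurable]: "Z \<in> sets borel" unfolding Z_def by measurable
  have "emeasure \<gamma> Z \<noteq> 0"
    using not AE_in_iff[OF g(1), of "- Z"] Z by (auto simp: Z_def less_top)
  moreover have "emeasure \<gamma> Z < \<infinity>" using emeasure_mono[of Z UNIV \<gamma>] g(1,2) by (auto intro: le_less_trans)
  ultimately obtain m where m: "emeasure \<gamma> Z = ennreal m" "0 < m" by (cases "emeasure \<gamma> Z") (auto simp: less_le)
  define \<gamma>1 where "\<gamma>1 = restrict_borel \<gamma> Z"
  have e1: "energy_on Z \<gamma>1"
    unfolding \<gamma>1_def using energy_on_restrict(2)[OF energy_on_UNIV[OF \<gamma>] Z] by simp
  note g1 = energy_onD[OF e1]
  define E where "E = en \<gamma>1 \<gamma>1"
  \<comment> \<open>Makes c m/2 = E + 1, so the threshold removes less than half of the mass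
    m.\<close>
  define c where "c = (E + 1) * (2 / m)"
  have E0: "0 \<le> E" by (simp add: E_def)
  obtain K where K: "compact K" "K \<subseteq> Z" "0 < emeasure \<gamma>1 K" "\<And>x. potential \<alpha> (restrict_borel \<gamma>1 K) x \<le> comparison * ennreal c"
  proof (rule bounded_potential_part[OF e1 Z, of "ennreal c" "ennreal (m / 2)" 0])
    show "mutual_energy \<alpha> \<gamma>1 \<gamma>1 < ennreal c * ennreal (m / 2)"
      unfolding ennreal_en[OF g1(4) g1(4)] using m E0 by (simp add: c_def E_def[symmetric] ennreal_mult[symmetric] ennreal_less_iff)
    have "emeasure \<gamma>1 Z = ennreal m" unfolding \<gamma>1_def using g Z m by (simp add: emeasure_restrict_borel)
    then show "ennreal (m / 2) + 0 < emeasure \<gamma>1 Z" using m by (simp add: ennreal_less_iff)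
    show "0 < ennreal c" "ennreal c < \<infinity>" using m E0 by (auto simp: c_def)
  qed (use that in auto)
  have Kb: "K \<in> sets borel" using K(1) by (intro borel_closed compact_imp_closed)
  define \<tau> where "\<tau> = restrict_borel \<gamma>1 K"
  have \<tau>: "energy_on (Z \<inter> K) \<tau>" unfolding \<tau>_def by (rule energy_on_restrict(2)[OF e1 Kb Z])
  note t = energy_onD[OF \<tau>]
  note [measurable_cong] = t(1)
  have tK: "AE x in \<tau>. x \<in> Z \<inter> K" by (rule energy_on_AE[OF \<tau>]) (use Z Kb in auto)
  obtain r where r: "0 < r" "\<And>x. x \<in> K \<Longrightarrow> norm x \<le> r"
    using compact_imp_bounded[OF K(1)] by (auto simp: bounded_pos)
  \<comment> \<open>Beyond this radius, distances to x0 are at most three times those to points of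
    K, which compares the far potential with its finite value at x0.\<close>
  define R where "R = 2 * r + 2 * norm x0"
  define \<mu>1 where "\<mu>1 = restrict_borel \<mu> (cball 0 R)"
  define \<mu>2 where "\<mu>2 = restrict_borel \<mu> (- cball 0 R)"
  have split: "potential \<alpha> \<mu> x = potential \<alpha> \<mu>1 x + potential \<alpha> \<mu>2 x" for x
    unfolding \<mu>1_def \<mu>2_def using s add_measure_split[OF s, of "cball 0 R"]
      potential_add_measure[of "restrict_borel \<mu> (cball 0 R)" "restrict_borel \<mu> (- cball 0 R)"] by auto
  have far: "potential \<alpha> \<mu>2 x < \<infinity>" if x: "x \<in> K" for x
  proof -
    have "potential \<alpha> \<mu>2 x \<le> ennreal (3 powr (real DIM('a) - \<alpha>)) * potential \<alpha> \<mu>2 x0"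
    proof (rule potential_le_scaled)
      show "sets \<mu>2 = sets borel" using s by (simp add: \<mu>2_def)
      show "AE y in \<mu>2. norm (x0 - y) \<le> 3 * norm (x - y)"
        unfolding \<mu>2_def
      proof (subst AE_restrict_borel[OF s])
        show "AE y in \<mu>. y \<in> - cball 0 R \<longrightarrow> norm (x0 - y) \<le> 3 * norm (x - y)"
        proof (rule AE_I2, rule impI)
          fix y :: 'a assume "y \<in> - cball 0 R"
          then have "2 * r + 2 * norm x0 < norm y" by (simp add: R_def)
          moreover have "norm (x0 - y) \<le> norm x0 + norm y" by (rule norm_triangle_ineq4)
          moreover have "norm y - norm x \<le> norm (x - y)" using norm_triangle_ineq3[of x y] by linarith
          moreover have "0 \<le> norm x0" by simp
          ultimately show "norm (x0 - y) \<le> 3 * norm (x - y)" using r(1) r(2)[OF x] by linarith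
        qed
      qed auto
    qed simp
    also have "\<dots> \<le> ennreal (3 powr (real DIM('a) - \<alpha>)) * potential \<alpha> \<mu> x0"
      by (intro mult_left_mono) (simp_all add: split[of x0])
    also have "\<dots> < \<infinity>" using x0 by (simp add: ennreal_mult_less_top)
    finally show ?thesis .
  qed
  have sf1: "sigma_finite_borel \<mu>1" unfolding \<mu>1_def by (rule sigma_finite_borel_restrict[OF sf]) simp
  note [measurable] = potential_borel[OF sf1]
  have "(\<integral>\<^sup>+x. potential \<alpha> \<mu>1 x \<partial>\<tau>) = (\<integral>\<^sup>+x. potential \<alpha> \<tau> x \<partial>\<mu>1)"
    by (rule nn_integral_potential_commute[OF sf1 t(3)])
  also have "\<dots> \<le> (\<integral>\<^sup>+x. comparison * ennreal c \<partial>\<mu>1)" unfolding \<tau>_def by (intro nn_integral_mono K(4))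
  also have "\<dots> = comparison * ennreal c * emeasure \<mu> (cball 0 R)"
    using sigma_finite_borelD(3)[OF sf1] s by (simp add: \<mu>1_def emeasure_restrict_borel)
  also have "\<dots> < \<infinity>" using comparison(2) comp[of "cball 0 R"] by (simp add: ennreal_mult_less_top)
  finally have "AE x in \<tau>. potential \<alpha> \<mu>1 x \<noteq> \<infinity>"
    by (intro nn_integral_PInf_AE) auto
  with tK have "AE x in \<tau>. False"
  proof eventually_elim
    fix x assume x: "x \<in> Z \<inter> K" and "potential \<alpha> \<mu>1 x \<noteq> \<infinity>"
    then have "potential \<alpha> \<mu> x < \<infinity>" using far[of x] by (simp add: split less_top)
    then show False using x by (simp add: Z_def)
  qed
  then have "emeasure \<tau> UNIV = 0" using AE_in_iff[OF t(1), of "{}"] by simp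
  then show False using K(3) g1 Kb by (simp add: \<tau>_def emeasure_restrict_borel)
qed

text \<open>Here \<open>a\<close> may have infinite mass and energy. If it charged the exceptional
  set, it would charge a compact subset K, of positive capacity by absolute continuity; K would
  carry a unit measure of finite energy, for which the potentials agree almost everywhere.\<close>

lemma swept_equal_AE:
  assumes a: "radon_measure \<alpha> a" and A: "closed A" and car: "AE x in a. x \<in> A"
    and cap: "\<And>K. compact K \<Longrightarrow> inner_cap \<alpha> K = 0 \<Longrightarrow> emeasure a K = 0"
    and sw: "swept A \<sigma> \<nu>" and \<sigma>: "energy_on UNIV \<sigma>"
  shows "AE x in a. potential \<alpha> \<nu> x = potential \<alpha> \<sigma> (x :: 'a)"
proof -
  have s: "sets a = sets borel" and comp: "\<And>K. compact K \<Longrightarrow> emeasure a K < \<infinity>" using a by (auto simp: radon_measure_def)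
  note [measurable] = potential_borel[OF energy_onD(3)[OF \<sigma>]] potential_borel[OF energy_onD(3)[OF sweptD(1)[OF sw]]]
  define Z where "Z = {x \<in> A. potential \<alpha> \<nu> x \<noteq> potential \<alpha> \<sigma> x}"
  have Z: "Z \<in> sets borel" unfolding Z_def using A by measurable
  have zero: "emeasure a (Z \<inter> cball 0 (real N)) = 0" for N
  proof (rule ccontr)
    assume "emeasure a (Z \<inter> cball 0 (real N)) \<noteq> 0"
    then have "0 < emeasure (restrict_borel a (cball 0 (real N))) Z"
      using s Z by (simp add: emeasure_restrict_borel zero_less_iff_neq_zero Int_commute)
    moreover have "emeasure (restrict_borel a (cball 0 (real N))) UNIV < \<infinity>"
      using s comp[of "cball 0 (real N)"] by (simp add: emeasure_restrict_borel)
    ultimately obtain K where K: "compact K" "K \<subseteq> Z" "0 < emeasure (restrict_borel a (cball 0 (real N))) K"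
      using compact_inner_approximation[of "restrict_borel a (cball 0 (real N))" Z 0] s Z by auto
    have Kb: "K \<in> sets borel" using K(1) by (intro borel_closed compact_imp_closed)
    have "inner_cap \<alpha> K = 0"
    proof (rule ccontr)
      assume "inner_cap \<alpha> K \<noteq> 0"
      then obtain c' where c': "0 < c'" "c' < inner_cap \<alpha> K" using dense zero_less_iff_neq_zero by blast
      then have "c' \<noteq> \<top>" by auto
      then obtain c where c: "c' = ennreal c" "0 < c" using c' by (cases c') (auto simp: less_le)
      obtain \<mu> :: "'a measure" where \<mu>: "energy_on K \<mu>" "emeasure \<mu> UNIV = 1"
        using inner_cap_measure[OF Kb] c c' by blast
      have "energy_on A \<mu>" by (rule energy_on_subset[OF \<mu>(1) _ Kb]) (use K in \<open>auto simp: Z_def\<close>)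
      from sweptD(4)[OF sw this] energy_on_AE[OF \<mu>(1) Kb] have "AE x in \<mu>. False"
        by eventually_elim (use K(2) in \<open>auto simp: Z_def\<close>)
      then have "emeasure \<mu> UNIV = 0" using AE_in_iff[OF energy_onD(1)[OF \<mu>(1)], of "{}"] by simp
      then show False using \<mu>(2) by simp
    qed
    then have "emeasure a K = 0" by (rule cap[OF K(1)])
    then show False using K(3) emeasure_restrict_borel_le[OF s, of "cball 0 (real N)" K] Kb by auto
  qed
  have "AE x in a. \<forall>N. x \<notin> Z \<inter> cball 0 (real N)"
  proof (intro AE_all_countable[THEN iffD2] allI)
    fix N
    have "Z \<inter> cball 0 (real N) \<in> null_sets a" using zero[of N] s Z by (auto simp: null_sets_def)
    then show "AE x in a. x \<notin> Z \<inter> cball 0 (real N)" by (rule AE_not_in)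
  qed
  with car show ?thesis
  proof eventually_elim
    fix x assume x: "x \<in> A" "\<forall>N. x \<notin> Z \<inter> cball 0 (real N)"
    obtain N where "norm x \<le> real N" using real_arch_simple by blast
    then have "x \<notin> Z" using x(2)[rule_format, of N] by simp
    then show "potential \<alpha> \<nu> x = potential \<alpha> \<sigma> x" using x(1) by (simp add: Z_def)
  qed
qed

text \<open>The truncation to sets where all four potentials are bounded makes every energy below finite; there
  \<open>E(a', \<sigma>) = E(a', \<nu>)\<close> for the balayage \<open>\<nu>\<close> of \<open>\<sigma>\<close>, and on the carrier of \<open>\<nu>\<close> the potentials of
  \<open>a - b\<close> and \<open>a' - b'\<close> agree.\<close>

lemma field_one_sided_bound:
  assumes A: "closed A" and q: "0 < q" "q < 1" and thin: "\<not> thin_at_infinity \<alpha> q A"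
    and radon: "radon_measure \<alpha> a" "radon_measure \<alpha> b" "radon_measure \<alpha> a'" "radon_measure \<alpha> b'"
    and car: "AE x in a'. x \<in> A" "AE x in b'. x \<in> A"
    and cap: "\<And>K. compact K \<Longrightarrow> inner_cap \<alpha> K = 0 \<Longrightarrow> emeasure a' K = 0" "\<And>K. compact K \<Longrightarrow> inner_cap \<alpha> K = 0 \<Longrightarrow> emeasure b' K = 0"
    and eq: "\<And>\<tau>. energy_on A \<tau> \<Longrightarrow> AE x in \<tau>. potential \<alpha> a' x + potential \<alpha> b x = potential \<alpha> a x + potential \<alpha> b' x"
    and \<gamma>: "energy_on UNIV (\<gamma> :: 'a measure)"
  shows "(\<integral>\<^sup>+x. (potential \<alpha> b x + potential \<alpha> a' x) - (potential \<alpha> a x + potential \<alpha> b' x) \<partial>\<gamma>) \<le> (\<integral>\<^sup>+x. potential \<alpha> b x \<partial>\<gamma>)"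
proof -
  note sf = radon[THEN radon_measure_sigma_finite]
  note [measurable] = sf[THEN potential_borel]
  note g = energy_onD[OF \<gamma>]
  note [measurable_cong] = g(1)
  let ?U = "potential \<alpha>"
  define d where "d x = (?U b x + ?U a' x) - (?U a x + ?U b' x)" for x
  have [measurable]: "d \<in> borel_measurable borel" unfolding d_def by measurable
  \<comment> \<open>Where d is positive and all four potentials are bounded, so that no subtraction
    below meets an infinite integral.\<close>
  define S where "S N = {x. ?U a x \<le> of_nat N \<and> ?U b x \<le> of_nat N \<and> ?U a' x \<le> of_nat N \<and> ?U b' x \<le> of_nat N \<and> ?U a x + ?U b' x < ?U b x + ?U a' x}" for N
  have S[measurable]: "S N \<in> sets borel" for N unfolding S_def by measurable
  have bound: "(\<integral>\<^sup>+x. indicator (S N) x * d x \<partial>\<gamma>) \<le> (\<integral>\<^sup>+x. ?U b x \<partial>\<gamma>)" for N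
  proof -
    define \<sigma> where "\<sigma> = restrict_borel \<gamma> (S N)"
    have \<sigma>: "energy_on UNIV \<sigma>" unfolding \<sigma>_def by (rule energy_on_restrict(1)[OF \<gamma> S]) simp
    note s = energy_onD[OF \<sigma>]
    note [measurable_cong] = s(1)
    obtain \<nu> where sw: "swept A \<sigma> \<nu>" using swept_exists[OF A q thin \<sigma>] by metis
    note n = energy_onD[OF sweptD(1)[OF sw]]
    note [measurable_cong] = n(1)
    have in_S: "AE x in \<sigma>. x \<in> S N" unfolding \<sigma>_def by (subst AE_restrict_borel[OF g(1) S]) simp
    have fin: "(\<integral>\<^sup>+x. ?U a x + ?U b' x \<partial>\<sigma>) < \<infinity>"
    proof -
      have "(\<integral>\<^sup>+x. ?U a x + ?U b' x \<partial>\<sigma>) \<le> (\<integral>\<^sup>+x. of_nat N + of_nat N \<partial>\<sigma>)"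
        by (rule nn_integral_mono_AE, use in_S in eventually_elim) (auto simp: S_def intro: add_mono)
      also have "\<dots> < \<infinity>" using s(2) sets_eq_imp_space_eq[OF s(1)] by (simp add: ennreal_mult_less_top of_nat_less_top)
      finally show ?thesis .
    qed
    \<comment> \<open>Sweeping \<sigma> does not change its integral against the potential of a
      measure that sees equal potentials, in particular against those of a' and b'.\<close>
    have comm: "(\<integral>\<^sup>+x. ?U c x \<partial>\<sigma>) = (\<integral>\<^sup>+x. ?U c x \<partial>\<nu>)" if "sigma_finite_borel c" "AE x in c. ?U \<nu> x = ?U \<sigma> x" for c
    proof -
      have "(\<integral>\<^sup>+x. ?U c x \<partial>\<sigma>) = (\<integral>\<^sup>+x. ?U \<sigma> x \<partial>c)" by (rule nn_integral_potential_commute[OF that(1) s(3)])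
      also have "\<dots> = (\<integral>\<^sup>+x. ?U \<nu> x \<partial>c)" by (rule nn_integral_cong_AE, use that(2) in eventually_elim) simp
      also have "\<dots> = (\<integral>\<^sup>+x. ?U c x \<partial>\<nu>)" by (rule nn_integral_potential_commute[OF n(3) that(1)])
      finally show ?thesis .
    qed
    have ca: "(\<integral>\<^sup>+x. ?U a' x \<partial>\<sigma>) = (\<integral>\<^sup>+x. ?U a' x \<partial>\<nu>)"
      by (rule comm[OF sf(3) swept_equal_AE[OF radon(3) A car(1) cap(1) sw \<sigma>]])
    have cb: "(\<integral>\<^sup>+x. ?U b' x \<partial>\<sigma>) = (\<integral>\<^sup>+x. ?U b' x \<partial>\<nu>)"
      by (rule comm[OF sf(4) swept_equal_AE[OF radon(4) A car(2) cap(2) sw \<sigma>]])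
    have "(\<integral>\<^sup>+x. ?U a x \<partial>\<nu>) = (\<integral>\<^sup>+x. ?U \<nu> x \<partial>a)" by (rule nn_integral_potential_commute[OF sf(1) n(3)])
    also have "\<dots> \<le> (\<integral>\<^sup>+x. ?U \<sigma> x \<partial>a)" by (intro nn_integral_mono sweptD(3)[OF sw])
    also have "\<dots> = (\<integral>\<^sup>+x. ?U a x \<partial>\<sigma>)" by (rule nn_integral_potential_commute[OF s(3) sf(1)])
    finally have le: "(\<integral>\<^sup>+x. ?U a x \<partial>\<nu>) \<le> (\<integral>\<^sup>+x. ?U a x \<partial>\<sigma>)" .
    \<comment> \<open>Pass from \<sigma> to its sweep, exchange the potentials by their balance on
      A, and return: a' and b' return with equality, a only with an inequality.\<close>
    have "(\<integral>\<^sup>+x. ?U a' x \<partial>\<sigma>) \<le> (\<integral>\<^sup>+x. ?U a' x + ?U b x \<partial>\<nu>)"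
      unfolding ca by (intro nn_integral_mono) simp
    also have "\<dots> = (\<integral>\<^sup>+x. ?U a x + ?U b' x \<partial>\<nu>)"
      by (rule nn_integral_cong_AE, use eq[OF sweptD(1)[OF sw]] in eventually_elim)
    also have "\<dots> = (\<integral>\<^sup>+x. ?U a x \<partial>\<nu>) + (\<integral>\<^sup>+x. ?U b' x \<partial>\<nu>)" by (rule nn_integral_add) measurable
    also have "\<dots> \<le> (\<integral>\<^sup>+x. ?U a x \<partial>\<sigma>) + (\<integral>\<^sup>+x. ?U b' x \<partial>\<sigma>)" unfolding cb using le by (rule add_right_mono)
    also have "\<dots> = (\<integral>\<^sup>+x. ?U a x + ?U b' x \<partial>\<sigma>)" by (rule nn_integral_add[symmetric]) measurable
    finally have key: "(\<integral>\<^sup>+x. ?U a' x \<partial>\<sigma>) \<le> (\<integral>\<^sup>+x. ?U a x + ?U b' x \<partial>\<sigma>)" .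
    have ae: "AE x in \<sigma>. ?U a x + ?U b' x \<le> ?U b x + ?U a' x"
      using in_S by eventually_elim (simp add: S_def less_imp_le)
    have "(\<integral>\<^sup>+x. indicator (S N) x * d x \<partial>\<gamma>) = (\<integral>\<^sup>+x. d x \<partial>\<sigma>)"
      unfolding \<sigma>_def using g by (simp add: nn_integral_restrict_borel)
    also have "\<dots> = (\<integral>\<^sup>+x. ?U b x + ?U a' x \<partial>\<sigma>) - (\<integral>\<^sup>+x. ?U a x + ?U b' x \<partial>\<sigma>)"
      unfolding d_def using ae fin by (intro nn_integral_diff) auto
    also have "(\<integral>\<^sup>+x. ?U b x + ?U a' x \<partial>\<sigma>) = (\<integral>\<^sup>+x. ?U b x \<partial>\<sigma>) + (\<integral>\<^sup>+x. ?U a' x \<partial>\<sigma>)" by (rule nn_integral_add) measurable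
    also have "\<dots> - (\<integral>\<^sup>+x. ?U a x + ?U b' x \<partial>\<sigma>) \<le> ((\<integral>\<^sup>+x. ?U b x \<partial>\<sigma>) + (\<integral>\<^sup>+x. ?U a x + ?U b' x \<partial>\<sigma>)) - (\<integral>\<^sup>+x. ?U a x + ?U b' x \<partial>\<sigma>)"
      by (intro ennreal_minus_mono add_left_mono key) auto
    also have "\<dots> = (\<integral>\<^sup>+x. ?U b x \<partial>\<sigma>)" using fin by simp
    also have "\<dots> \<le> (\<integral>\<^sup>+x. ?U b x \<partial>\<gamma>)"
      by (rule nn_integral_mono_dominated) (use g in \<open>auto simp: \<sigma>_def emeasure_restrict_borel_le\<close>)
    finally show ?thesis .
  qed
  have fin4: "AE x in \<gamma>. ?U a x < \<infinity> \<and> ?U b x < \<infinity> \<and> ?U a' x < \<infinity> \<and> ?U b' x < \<infinity>"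
    using radon[THEN radon_potential_AE_finite, OF \<gamma>] by (auto simp: eventually_conj_iff)
  \<comment> \<open>The truncations exhaust the set where d is positive up to a \<gamma>-null set,
    since all four potentials are finite almost everywhere.\<close>
  have "(\<integral>\<^sup>+x. d x \<partial>\<gamma>) \<le> (\<integral>\<^sup>+x. (SUP N. indicator (S N) x * d x) \<partial>\<gamma>)"
  proof (rule nn_integral_mono_AE, use fin4 in eventually_elim)
    fix x assume f: "?U a x < \<infinity> \<and> ?U b x < \<infinity> \<and> ?U a' x < \<infinity> \<and> ?U b' x < \<infinity>"
    show "d x \<le> (SUP N. indicator (S N) x * d x)"
    proof (cases "?U a x + ?U b' x < ?U b x + ?U a' x")
      case True
      define t where "t = ?U a x + ?U b x + ?U a' x + ?U b' x"
      have "t < \<infinity>" using f by (simp add: t_def)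
      then obtain N :: nat where N: "t < of_nat N" using ennreal_Ex_less_of_nat by auto
      have "?U a x \<le> t" "?U b x \<le> t" "?U a' x \<le> t" "?U b' x \<le> t"
        by (auto simp: t_def add_increasing add_increasing2)
      then have "x \<in> S N" using True N by (auto simp: S_def)
      then show ?thesis by (intro SUP_upper2[of N]) auto
    next
      case False
      then have "d x = 0" using f by (auto simp: d_def diff_eq_0_iff_ennreal not_less)
      then show ?thesis by simp
    qed
  qed
  also have "\<dots> = (SUP N. \<integral>\<^sup>+x. indicator (S N) x * d x \<partial>\<gamma>)"
  proof (rule nn_integral_monotone_convergence_SUP)
    show "incseq (\<lambda>N x. indicator (S N) x * d x)"
      unfolding incseq_def le_fun_def
    proof (intro allI impI mult_right_mono)
      fix m n :: nat and x assume "m \<le> n"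
      then have "(of_nat m :: ennreal) \<le> of_nat n" by simp
      then show "indicator (S m) x \<le> (indicator (S n) x :: ennreal)"
        by (auto simp: indicator_def S_def intro: order_trans)
    qed simp
  qed measurable
  also have "\<dots> \<le> (\<integral>\<^sup>+x. ?U b x \<partial>\<gamma>)" by (rule SUP_least) (rule bound)
  finally show ?thesis by (simp add: d_def)
qed

end


text \<open>Choose nearly minimal L2 norms in each of the decreasing convex sets. The minimal norms
  increase to a limit, so by the parallelogram law the choices form a Cauchy sequence; a fast
  subsequence converges almost everywhere.\<close>

lemma mazur_sequence:
  fixes \<xi> :: "'a::euclidean_space measure" and H :: "nat \<Rightarrow> ('a \<Rightarrow> real) set"
  assumes \<xi>: "sets \<xi> = sets borel" "emeasure \<xi> UNIV < \<infinity>"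
    and H: "\<And>k h. h \<in> H k \<Longrightarrow> h \<in> borel_measurable borel \<and> (\<forall>x. 0 \<le> h x \<and> h x \<le> 1)"
    and ne: "\<And>k. H k \<noteq> {}" and dec: "\<And>j k. j \<le> k \<Longrightarrow> H k \<subseteq> H j"
    and mid: "\<And>k h g. h \<in> H k \<Longrightarrow> g \<in> H k \<Longrightarrow> (\<lambda>x. (h x + g x) / 2) \<in> H k"
  obtains h g where "\<And>k. h k \<in> H k" "g \<in> borel_measurable borel" "\<And>x. 0 \<le> g x \<and> g x \<le> 1" "AE x in \<xi>. (\<lambda>k. h k x) \<longlonglongrightarrow> g x"
proof -
  note [measurable_cong] = \<xi>(1)
  have sp: "space \<xi> = UNIV" using sets_eq_imp_space_eq[OF \<xi>(1)] by simp
  interpret finite_measure \<xi> by (rule finite_measureI) (use \<xi> sp in auto)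
  have int: "integrable \<xi> f" if "f \<in> borel_measurable borel" "\<And>x. \<bar>f x\<bar> \<le> B" for f :: "'a \<Rightarrow> real" and B
    by (rule integrable_const_bound[of _ B]) (use that in auto)
  define Q where "Q h = (\<integral>x. (h x)\<^sup>2 \<partial>\<xi>)" for h :: "'a \<Rightarrow> real"
  have Q0: "0 \<le> Q h" for h by (simp add: Q_def)
  define d where "d k = Inf (Q ` H k)" for k
  have bdd: "bdd_below (Q ` H k)" for k by (intro bdd_belowI[of _ 0]) (use Q0 in auto)
  have d_le: "d k \<le> Q h" if "h \<in> H k" for k h unfolding d_def by (rule cInf_lower[OF _ bdd]) (use that in simp)
  have sqi: "integrable \<xi> (\<lambda>x. (h x)\<^sup>2)" if "h \<in> H k" for h k
    by (rule int[of _ 1]) (use H[OF that] in \<open>auto simp: abs_square_le_1 power_le_one\<close>)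
  have d_bound: "d k \<le> measure \<xi> UNIV" for k
  proof -
    obtain h where h: "h \<in> H k" using ne by blast
    have "Q h \<le> (\<integral>x. 1 \<partial>\<xi>)" unfolding Q_def
      by (rule integral_mono[OF sqi[OF h]]) (use H[OF h] in \<open>auto simp: power_le_one\<close>)
    then show ?thesis using d_le[OF h] sp by simp
  qed
  have d_mono: "d j \<le> d k" if "j \<le> k" for j k
    unfolding d_def by (rule cInf_superset_mono[OF _ bdd]) (use ne dec[OF that] in auto)
  have "convergent d"
  proof (rule Bseq_mono_convergent)
    have "0 \<le> d k" for k unfolding d_def by (rule cInf_greatest) (use ne Q0 in auto)
    then show "Bseq d" using d_bound by (intro BseqI'[of _ "measure \<xi> UNIV"]) simp
  qed (use d_mono in blast)
  then have Cd: "Cauchy d" by (rule convergent_Cauchy)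
  have "\<exists>h\<in>H k. Q h < d k + 1 / real (Suc k)" for k
  proof -
    have "Inf (Q ` H k) < d k + 1 / real (Suc k)" by (simp add: d_def)
    then show ?thesis using cInf_less_iff[OF _ bdd] ne by auto
  qed
  then obtain h where h: "\<And>k. h k \<in> H k" "\<And>k. Q (h k) < d k + 1 / real (Suc k)" by metis
  note hm = H[OF h(1)]
  have [measurable]: "h k \<in> borel_measurable borel" for k using hm by blast
  \<comment> \<open>The midpoint lies in the larger set \<open>H j\<close>, so its norm is at least
    the minimum there; the parallelogram law turns this into a bound on the difference.\<close>
  have diff: "(\<integral>x. (h j x - h k x)\<^sup>2 \<partial>\<xi>) \<le> 2 * (d k - d j) + 4 / real (Suc j)" if "j \<le> k" for j k
  proof -
    have hk: "h k \<in> H j" using dec[OF that] h(1) by blast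
    have "d j \<le> Q (\<lambda>x. (h j x + h k x) / 2)" by (rule d_le[OF mid[OF h(1) hk]])
    moreover have "(\<integral>x. (h j x - h k x)\<^sup>2 \<partial>\<xi>) = 2 * Q (h j) + 2 * Q (h k) - 4 * Q (\<lambda>x. (h j x + h k x) / 2)"
    proof -
      have "(\<integral>x. (h j x - h k x)\<^sup>2 \<partial>\<xi>) = (\<integral>x. 2 * (h j x)\<^sup>2 + 2 * (h k x)\<^sup>2 - 4 * ((h j x + h k x) / 2)\<^sup>2 \<partial>\<xi>)"
        by (rule Bochner_Integration.integral_cong) (auto simp: power2_eq_square field_simps)
      also have "\<dots> = 2 * Q (h j) + 2 * Q (h k) - 4 * Q (\<lambda>x. (h j x + h k x) / 2)"
        unfolding Q_def using sqi[OF h(1)[of j]] sqi[OF h(1)[of k]] sqi[OF mid[OF h(1) hk]] by simp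
      finally show ?thesis .
    qed
    moreover have "1 / real (Suc k) \<le> 1 / real (Suc j)" using that by (simp add: field_simps)
    ultimately show ?thesis using h(2)[of j] h(2)[of k] by simp
  qed
  have "\<exists>N. \<forall>j\<ge>N. \<forall>k\<ge>j. (\<integral>x. (h j x - h k x)\<^sup>2 \<partial>\<xi>) \<le> (1/4) ^ i" for i :: nat
  proof -
    have e: "(0::real) < (1/4) ^ i / 4" by simp
    obtain N1 where N1: "\<And>j k. N1 \<le> j \<Longrightarrow> N1 \<le> k \<Longrightarrow> \<bar>d k - d j\<bar> < (1/4) ^ i / 4"
      using CauchyD[OF Cd e] by auto
    obtain N2 where N2: "8 / (1/4) ^ i < real N2" using reals_Archimedean2 by blast
    show ?thesis
    proof (intro exI[of _ "max N1 N2"] allI impI)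
      fix j k assume j: "max N1 N2 \<le> j" and k: "j \<le> k"
      have "(8::real) < (1/4) ^ i * real N2" using N2 by (simp add: field_simps)
      also have "\<dots> \<le> (1/4) ^ i * real (Suc j)" using j by (intro mult_left_mono) auto
      finally have "4 / real (Suc j) \<le> (1/4) ^ i / 2" by (simp add: field_simps)
      moreover have "d k - d j < (1/4) ^ i / 4" using N1[of j k] j k abs_ge_self[of "d k - d j"] by linarith
      ultimately show "(\<integral>x. (h j x - h k x)\<^sup>2 \<partial>\<xi>) \<le> (1/4) ^ i" using diff[OF k] by simp
    qed
  qed
  then obtain N where N: "\<And>i j k. N i \<le> j \<Longrightarrow> j \<le> k \<Longrightarrow> (\<integral>x. (h j x - h k x)\<^sup>2 \<partial>\<xi>) \<le> (1/4) ^ i" by metis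
  define r where "r = rec_nat (N 0) (\<lambda>i p. max (Suc p) (N (Suc i)))"
  have r: "N i \<le> r i" "r i < r (Suc i)" for i
    by (cases i) (auto simp: r_def)
  have ri: "i \<le> r i" for i
  proof (induction i)
    case (Suc i)
    then show ?case using r(2)[of i] by simp
  qed simp
  define u where "u i x = \<bar>h (r i) x - h (r (Suc i)) x\<bar>" for i x
  have [measurable]: "u i \<in> borel_measurable borel" for i unfolding u_def by measurable
  have u1: "\<bar>h j x - h k x\<bar> \<le> 1" for j k x using hm[of j] hm[of k] by (auto simp: abs_le_iff) (smt (verit))+
  have uint: "(\<integral>\<^sup>+x. ennreal (u i x) \<partial>\<xi>) \<le> ennreal ((measure \<xi> UNIV + 1) * (1/2) ^ i)" for i
  proof -
    have i1: "integrable \<xi> (\<lambda>x. (h (r i) x - h (r (Suc i)) x)\<^sup>2)"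
      by (rule int[of _ 1]) (use u1 in \<open>auto simp: abs_square_le_1\<close>)
    have i2: "integrable \<xi> (u i)" by (rule int[of _ 1]) (use u1 in \<open>auto simp: u_def\<close>)
    have "(\<integral>x. u i x \<partial>\<xi>) \<le> (\<integral>x. (1/2) ^ i + 2 ^ i * (h (r i) x - h (r (Suc i)) x)\<^sup>2 \<partial>\<xi>)"
    proof (rule integral_mono[OF i2])
      \<comment> \<open>An arithmetic-geometric mean inequality with weight 2^i, turning the squared
        L2 bound 4^-i into a summable L1 bound of order 2^-i.\<close>
      show "u i x \<le> (1/2) ^ i + 2 ^ i * (h (r i) x - h (r (Suc i)) x)\<^sup>2" for x
      proof -
        have "0 \<le> (u i x - (1/2) ^ i)\<^sup>2 + u i x * (1/2) ^ i" by (simp add: u_def)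
        also have "\<dots> = (u i x)\<^sup>2 + ((1/2) ^ i)\<^sup>2 - u i x * (1/2) ^ i" by (simp add: power2_eq_square algebra_simps)
        finally have amgm: "u i x * (1/2) ^ i \<le> (u i x)\<^sup>2 + ((1/2) ^ i)\<^sup>2" by simp
        have "v \<le> p + q * v\<^sup>2" if "q * p = 1" "0 < q" "v * p \<le> v\<^sup>2 + p\<^sup>2" for v p q :: real
        proof -
          have "v = (q * p) * v" using that by simp
          also have "\<dots> = q * (v * p)" by (simp only: mult_ac)
          also have "\<dots> \<le> q * (v\<^sup>2 + p\<^sup>2)" using that by (intro mult_left_mono) auto
          also have "\<dots> = q * v\<^sup>2 + (q * p) * p" by (simp add: algebra_simps power2_eq_square)
          finally show ?thesis using that by simp
        qed
        from this[of "2 ^ i" "(1/2) ^ i" "u i x", OF _ _ amgm] show ?thesis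
          by (simp add: power_one_over u_def)
      qed
    qed (use i1 in simp)
    also have "\<dots> = (1/2) ^ i * measure \<xi> UNIV + 2 ^ i * (\<integral>x. (h (r i) x - h (r (Suc i)) x)\<^sup>2 \<partial>\<xi>)"
      using i1 sp by simp
    also have "\<dots> \<le> (1/2) ^ i * measure \<xi> UNIV + 2 ^ i * (1/4) ^ i"
      using N[OF r(1) less_imp_le[OF r(2)]] by (intro add_left_mono mult_left_mono) auto
    also have "(2::real) ^ i * (1/4) ^ i = (1/2) ^ i" by (simp add: power_mult_distrib[symmetric])
    finally have "(\<integral>x. u i x \<partial>\<xi>) \<le> (measure \<xi> UNIV + 1) * (1/2) ^ i" by (simp add: algebra_simps)
    moreover have "(\<integral>\<^sup>+x. ennreal (u i x) \<partial>\<xi>) = ennreal (\<integral>x. u i x \<partial>\<xi>)"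
      by (rule nn_integral_eq_integral[OF i2]) (simp add: u_def)
    ultimately show ?thesis by (simp only: ennreal_leI)
  qed
  have "(\<integral>\<^sup>+x. (\<Sum>i. ennreal (u i x)) \<partial>\<xi>) = (\<Sum>i. \<integral>\<^sup>+x. ennreal (u i x) \<partial>\<xi>)"
    by (rule nn_integral_suminf) measurable
  also have "\<dots> \<le> (\<Sum>i. ennreal ((measure \<xi> UNIV + 1) * (1/2) ^ i))" by (rule suminf_le[OF uint]) auto
  also have "\<dots> = ennreal (\<Sum>i. (measure \<xi> UNIV + 1) * (1/2) ^ i)"
    by (rule suminf_ennreal2) (auto intro!: summable_mult summable_geometric)
  also have "\<dots> < \<infinity>" by simp
  finally have "AE x in \<xi>. (\<Sum>i. ennreal (u i x)) \<noteq> \<infinity>"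
    by (intro nn_integral_PInf_AE) auto
  then have conv: "AE x in \<xi>. convergent (\<lambda>i. h (r i) x)"
  proof eventually_elim
    fix x assume "(\<Sum>i. ennreal (u i x)) \<noteq> \<infinity>"
    then have "summable (\<lambda>i. u i x)"
      by (intro summable_suminf_not_top) (auto simp: u_def)
    then have "summable (\<lambda>i. h (r (Suc i)) x - h (r i) x)"
      by (intro summable_norm_cancel[where f="\<lambda>i. h (r (Suc i)) x - h (r i) x"]) (simp add: u_def abs_minus_commute)
    then have "convergent (\<lambda>n. \<Sum>i<n. h (r (Suc i)) x - h (r i) x)" by (simp add: summable_iff_convergent)
    moreover have "(\<Sum>i<n. h (r (Suc i)) x - h (r i) x) = h (r n) x - h (r 0) x" for n
      by (induction n) simp_all
    ultimately have "convergent (\<lambda>n. h (r n) x - h (r 0) x)" by simp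
    then have "convergent (\<lambda>n. (h (r n) x - h (r 0) x) + h (r 0) x)" by (intro convergent_add convergent_const)
    then show "convergent (\<lambda>i. h (r i) x)" by simp
  qed
  define g where "g x = (if convergent (\<lambda>i. h (r i) x) then lim (\<lambda>i. h (r i) x) else 0)" for x
  show ?thesis
  proof (rule that[of "\<lambda>k. h (r k)" g])
    show "h (r k) \<in> H k" for k using dec[OF ri[of k]] h(1) by blast
    show "g \<in> borel_measurable borel"
      unfolding g_def Cauchy_convergent_iff[symmetric] by measurable
    show "0 \<le> g x \<and> g x \<le> 1" for x
    proof (cases "convergent (\<lambda>i. h (r i) x)")
      case True
      then have L: "(\<lambda>i. h (r i) x) \<longlonglongrightarrow> g x" by (simp add: g_def convergent_LIMSEQ_iff)
      then show ?thesis using hm by (auto intro: LIMSEQ_le_const[OF L] LIMSEQ_le_const2[OF L])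
    qed (simp add: g_def)
    show "AE x in \<xi>. (\<lambda>k. h (r k) x) \<longlonglongrightarrow> g x"
      using conv by eventually_elim (simp add: g_def convergent_LIMSEQ_iff)
  qed
qed


section \<open>Existence of a minimizer\<close>

text \<open>A Radon-Nikodym density exceeds 1 only on a null set; cutting it at 1 makes the bounds
  hold everywhere, as \<open>mazur_sequence\<close> requires.\<close>

lemma density_of_dominated:
  fixes \<xi> :: "'a::euclidean_space measure"
  assumes \<xi>: "sets \<xi> = sets borel" "emeasure \<xi> UNIV < \<infinity>" and \<sigma>: "sets \<sigma> = sets borel"
    and le: "\<And>B. B \<in> sets borel \<Longrightarrow> emeasure \<sigma> B \<le> emeasure \<xi> B"
  obtains h :: "'a \<Rightarrow> real" where "h \<in> borel_measurable borel" "\<And>x. 0 \<le> h x \<and> h x \<le> 1" "\<sigma> = density \<xi> (\<lambda>x. ennreal (h x))"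
proof -
  note [measurable_cong] = \<xi>(1)
  interpret finite_measure \<xi> by (rule finite_measureI) (use \<xi> sets_eq_imp_space_eq[OF \<xi>(1)] in auto)
  have "absolutely_continuous \<xi> \<sigma>"
    using le \<xi> \<sigma> by (auto simp: absolutely_continuous_def null_sets_def) (metis le_zero_eq)
  then obtain f where fm: "f \<in> borel_measurable \<xi>" and f: "density \<xi> f = \<sigma>"
    using Radon_Nikodym[of \<sigma>] \<xi> \<sigma> by auto
  have [measurable]: "f \<in> borel_measurable borel" using fm by (simp add: measurable_cong_sets[OF \<xi>(1) refl])
  define S where "S = {x. 1 < f x}"
  have [measurable]: "S \<in> sets borel" unfolding S_def by measurable
  have "(\<integral>\<^sup>+x. f x * indicator S x - indicator S x \<partial>\<xi>) = (\<integral>\<^sup>+x. f x * indicator S x \<partial>\<xi>) - (\<integral>\<^sup>+x. indicator S x \<partial>\<xi>)"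
  proof (rule nn_integral_diff)
    have "(\<integral>\<^sup>+x. indicator S x \<partial>\<xi>) = emeasure \<xi> S" by simp
    then show "(\<integral>\<^sup>+x. indicator S x \<partial>\<xi>) \<noteq> \<infinity>" by simp
  qed (auto simp: S_def indicator_def intro!: AE_I2)
  also have "(\<integral>\<^sup>+x. f x * indicator S x \<partial>\<xi>) = emeasure \<sigma> S"
    unfolding f[symmetric] by (rule emeasure_density[symmetric]) auto
  also have "emeasure \<sigma> S - (\<integral>\<^sup>+x. indicator S x \<partial>\<xi>) = 0"
    using le[of S] by (simp add: diff_eq_0_iff_ennreal emeasure_eq_measure less_top[symmetric] top_unique) (metis emeasure_eq_measure ennreal_neq_top top_unique)
  finally have "AE x in \<xi>. f x * indicator S x - indicator S x = 0"
    by (subst (asm) nn_integral_0_iff_AE) auto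
  then have f1: "AE x in \<xi>. f x \<le> 1"
  proof eventually_elim
    fix x assume 1: "f x * indicator S x - indicator S x = 0"
    show "f x \<le> 1"
    proof (rule ccontr)
      assume "\<not> f x \<le> 1"
      then have "x \<in> S" by (simp add: S_def)
      then have "f x \<le> 1" using 1 ennreal_minus_eq_0[of "f x" 1] by simp
      then show False using \<open>\<not> f x \<le> 1\<close> by simp
    qed
  qed
  define h where "h x = enn2real (min 1 (f x))" for x
  have hn: "ennreal (h x) = min 1 (f x)" for x
    unfolding h_def by (rule ennreal_enn2real) (rule le_less_trans[OF min.cobounded1 ennreal_one_less_top])
  show ?thesis
  proof (rule that[of h])
    show "h \<in> borel_measurable borel" unfolding h_def by measurable
    show "0 \<le> h x \<and> h x \<le> 1" for x
      unfolding h_def by (auto intro!: enn2real_leI)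
    have "density \<xi> f = density \<xi> (\<lambda>x. ennreal (h x))"
      by (rule density_cong) (use f1 in \<open>auto simp: hn min_def elim!: eventually_mono\<close>)
    then show "\<sigma> = density \<xi> (\<lambda>x. ennreal (h x))" using f by simp
  qed
qed

text \<open>The factor c may be infinite, where multiplication is not continuous at 0; only this
  one-sided statement remains.\<close>

lemma tendsto_fatou_mult_liminf:
  fixes c :: ennreal and h :: "nat \<Rightarrow> real"
  assumes "h \<longlonglongrightarrow> g"
  shows "c * ennreal g \<le> liminf (\<lambda>k. c * ennreal (h k))"
proof (cases "ennreal g = 0")
  case False
  then have "(\<lambda>k. c * ennreal (h k)) \<longlonglongrightarrow> c * ennreal g"
    by (cases "c = 0") (auto intro!: tendsto_mult_ennreal tendsto_ennrealI assms tendsto_const)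
  then show ?thesis by (simp add: lim_imp_Liminf)
qed simp

context riesz_space
begin

text \<open>\<open>e2ennreal\<close> sends negative values to 0, so this integrates the positive
  part of the field.\<close>

definition pos_part :: "('a \<Rightarrow> ereal) \<Rightarrow> 'a measure \<Rightarrow> ennreal" where
  "pos_part f \<sigma> = (\<integral>\<^sup>+x. e2ennreal (f x) \<partial>\<sigma>)"

definition neg_part :: "('a \<Rightarrow> ereal) \<Rightarrow> 'a measure \<Rightarrow> ennreal" where
  "neg_part f \<sigma> = (\<integral>\<^sup>+x. e2ennreal (- f x) \<partial>\<sigma>)"

text \<open>The carrier and finite energy of \<sigma>, and finiteness of the negative part of the
  field, are inherited from \<xi> by domination.\<close>

definition adm_pair :: "'a measure \<Rightarrow> 'a set \<Rightarrow> ('a \<Rightarrow> ereal) \<Rightarrow> 'a measure \<Rightarrow> 'a measure \<Rightarrow> bool" where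
  "adm_pair \<xi> A f \<sigma> \<nu> \<longleftrightarrow> sets \<sigma> = sets borel \<and> (\<forall>B \<in> sets borel. emeasure \<sigma> B \<le> emeasure \<xi> B) \<and> emeasure \<sigma> UNIV = 1 \<and>
     pos_part f \<sigma> < \<infinity> \<and> energy_on A \<nu> \<and> emeasure \<nu> UNIV = 1"

definition pair_energy :: "('a \<Rightarrow> ereal) \<Rightarrow> 'a measure \<Rightarrow> 'a measure \<Rightarrow> real" where
  "pair_energy f \<sigma> \<nu> = en \<sigma> \<sigma> + en \<nu> \<nu> - 2 * en \<sigma> \<nu> + 2 * (enn2real (pos_part f \<sigma>) - enn2real (neg_part f \<sigma>))"

lemma en_mono:
  assumes "finite_energy_measure \<nu>" "finite_energy_measure \<omega>" "sets \<mu> = sets borel" "\<And>B. B \<in> sets borel \<Longrightarrow> emeasure \<mu> B \<le> emeasure \<nu> B"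
  shows "en \<mu> \<omega> \<le> en \<nu> \<omega>"
proof -
  have "mutual_energy \<alpha> \<mu> \<omega> \<le> mutual_energy \<alpha> \<nu> \<omega>"
    by (rule mutual_energy_mono) (use assms finite_energy_measureD(3) in auto)
  then show ?thesis unfolding en_def using mutual_energy_finite[OF assms(1,2)] by (intro enn2real_mono) auto
qed

text \<open>The convexity gap is a multiple of the energy of (\<sigma>1 - \<nu>1) - (\<sigma>2 -
  \<nu>2), written as a difference of the positive measures \<sigma>1 + \<nu>2 and \<sigma>2 +
  \<nu>1; the field part is linear.\<close>

lemma pair_energy_midpoint:
  assumes s: "finite_energy_measure \<sigma>1" "finite_energy_measure \<sigma>2" and n: "finite_energy_measure \<nu>1" "finite_energy_measure \<nu>2"
    and f[measurable]: "f \<in> borel_measurable borel"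
    and P: "pos_part f \<sigma>1 < \<infinity>" "pos_part f \<sigma>2 < \<infinity>" and N: "neg_part f \<sigma>1 < \<infinity>" "neg_part f \<sigma>2 < \<infinity>"
  shows "pair_energy f (scale_borel (1/2) (add_measure \<sigma>1 \<sigma>2)) (scale_borel (1/2) (add_measure \<nu>1 \<nu>2)) \<le> (pair_energy f \<sigma>1 \<nu>1 + pair_energy f \<sigma>2 \<nu>2) / 2"
    "pos_part f (scale_borel (1/2) (add_measure \<sigma>1 \<sigma>2)) < \<infinity>"
proof -
  note sb = finite_energy_measureD(3)[OF s(1)] finite_energy_measureD(3)[OF s(2)]
  have P2: "pos_part f (scale_borel (1/2) (add_measure \<sigma>1 \<sigma>2)) = ennreal (1/2) * (pos_part f \<sigma>1 + pos_part f \<sigma>2)"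
    unfolding pos_part_def using sb by (subst nn_integral_scale_borel) (auto simp: nn_integral_add_measure simp del: ennreal_half)
  have N2: "neg_part f (scale_borel (1/2) (add_measure \<sigma>1 \<sigma>2)) = ennreal (1/2) * (neg_part f \<sigma>1 + neg_part f \<sigma>2)"
    unfolding neg_part_def using sb by (subst nn_integral_scale_borel) (auto simp: nn_integral_add_measure simp del: ennreal_half)
  show "pos_part f (scale_borel (1/2) (add_measure \<sigma>1 \<sigma>2)) < \<infinity>"
    unfolding P2 using P by (simp add: ennreal_mult_less_top del: ennreal_half)
  have e: "enn2real (pos_part f (scale_borel (1/2) (add_measure \<sigma>1 \<sigma>2))) = (enn2real (pos_part f \<sigma>1) + enn2real (pos_part f \<sigma>2)) / 2"
    "enn2real (neg_part f (scale_borel (1/2) (add_measure \<sigma>1 \<sigma>2))) = (enn2real (neg_part f \<sigma>1) + enn2real (neg_part f \<sigma>2)) / 2"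
    unfolding P2 N2 using P N by (simp_all add: enn2real_mult enn2real_plus del: ennreal_half)
  have "0 \<le> en (add_measure \<sigma>1 \<nu>2) (add_measure \<sigma>1 \<nu>2) + en (add_measure \<sigma>2 \<nu>1) (add_measure \<sigma>2 \<nu>1) - 2 * en (add_measure \<sigma>1 \<nu>2) (add_measure \<sigma>2 \<nu>1)"
    by (intro en_diff_nonneg finite_energy_measure_add s n)
  then show "pair_energy f (scale_borel (1/2) (add_measure \<sigma>1 \<sigma>2)) (scale_borel (1/2) (add_measure \<nu>1 \<nu>2)) \<le> (pair_energy f \<sigma>1 \<nu>1 + pair_energy f \<sigma>2 \<nu>2) / 2"
    unfolding pair_energy_def e
    apply (simp add: en_scale_left en_scale_right en_add_left en_add_right s n finite_energy_measure_add finite_energy_measure_scale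
        en_commute[OF s(2) s(1)] en_commute[OF n(2) n(1)] en_commute[OF n(1) s(1)] en_commute[OF n(1) s(2)] en_commute[OF n(2) s(1)] en_commute[OF n(2) s(2)])
    apply (simp add: algebra_simps diff_divide_distrib add_divide_distrib)
    done
qed

text \<open>Only first components are passed to the limit, as densities with respect to \<xi>. The
  second component is replaced by the sweep of the limit, which is at least as good as every
  \<nu>_k; it remains to see that exchanging \<sigma>_k for \<sigma> costs nothing in the
  limit.\<close>

theorem pair_minimizer:
  assumes A: "closed A" and q: "0 < q" "q < 1" and thin: "\<not> thin_at_infinity \<alpha> q A"
    and \<xi>: "energy_on UNIV \<xi>" and f[measurable]: "f \<in> borel_measurable borel"
    and N\<xi>: "neg_part f \<xi> < \<infinity>" and ne: "adm_pair \<xi> A f \<sigma>0 \<nu>0"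
  obtains \<sigma> \<nu> where "adm_pair \<xi> A f \<sigma> \<nu>" "\<And>\<sigma>' \<nu>'. adm_pair \<xi> A f \<sigma>' \<nu>' \<Longrightarrow> pair_energy f \<sigma> \<nu> \<le> pair_energy f \<sigma>' \<nu>'"
proof -
  note x = energy_onD[OF \<xi>]
  note [measurable_cong] = x(1)
  have sp: "space \<xi> = UNIV" using sets_eq_imp_space_eq[OF x(1)] by simp
  have Ab: "A \<in> sets borel" using A by simp
  have e\<sigma>: "energy_on UNIV \<sigma>" "neg_part f \<sigma> \<le> neg_part f \<xi>" "neg_part f \<sigma> < \<infinity>" if "adm_pair \<xi> A f \<sigma> \<nu>" for \<sigma> \<nu>
  proof -
    show "energy_on UNIV \<sigma>" by (rule energy_on_mono[OF \<xi>]) (use that in \<open>auto simp: adm_pair_def\<close>)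
    show "neg_part f \<sigma> \<le> neg_part f \<xi>"
      unfolding neg_part_def by (rule nn_integral_mono_dominated) (use that x in \<open>auto simp: adm_pair_def\<close>)
    then show "neg_part f \<sigma> < \<infinity>" using N\<xi> by (rule le_less_trans)
  qed
  define n\<xi> where "n\<xi> = enn2real (neg_part f \<xi>)"
  have nle: "enn2real (neg_part f \<sigma>) \<le> n\<xi>" if "adm_pair \<xi> A f \<sigma> \<nu>" for \<sigma> \<nu>
    unfolding n\<xi>_def using e\<sigma>(2)[OF that] N\<xi> by (intro enn2real_mono) auto
  have low: "- 2 * n\<xi> \<le> pair_energy f \<sigma> \<nu>" if adm: "adm_pair \<xi> A f \<sigma> \<nu>" for \<sigma> \<nu>
  proof -
    have "energy_on A \<nu>" using adm by (simp add: adm_pair_def)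
    from en_diff_nonneg[OF energy_onD(4)[OF e\<sigma>(1)[OF adm]] energy_onD(4)[OF this]]
    have "2 * (enn2real (pos_part f \<sigma>) - enn2real (neg_part f \<sigma>)) \<le> pair_energy f \<sigma> \<nu>" by (simp add: pair_energy_def)
    moreover have "- n\<xi> \<le> enn2real (pos_part f \<sigma>) - enn2real (neg_part f \<sigma>)"
      using nle[OF adm] enn2real_nonneg[of "pos_part f \<sigma>"] by linarith
    then have "2 * (- n\<xi>) \<le> 2 * (enn2real (pos_part f \<sigma>) - enn2real (neg_part f \<sigma>))" by (rule mult_left_mono) simp
    ultimately show ?thesis by simp
  qed
  define X where "X = {(\<sigma>, \<nu>). adm_pair \<xi> A f \<sigma> \<nu>}"
  define I where "I = Inf ((\<lambda>(\<sigma>, \<nu>). pair_energy f \<sigma> \<nu>) ` X)"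
  have Xne: "X \<noteq> {}" using ne by (auto simp: X_def)
  have bdd: "bdd_below ((\<lambda>(\<sigma>, \<nu>). pair_energy f \<sigma> \<nu>) ` X)"
    by (rule bdd_belowI[of _ "- 2 * n\<xi>"]) (use low in \<open>auto simp: X_def\<close>)
  have I_le: "I \<le> pair_energy f \<sigma> \<nu>" if "adm_pair \<xi> A f \<sigma> \<nu>" for \<sigma> \<nu>
    unfolding I_def by (rule cInf_lower[OF _ bdd]) (use that in \<open>auto simp: X_def image_iff\<close>)
  define dens where "dens h = density \<xi> (\<lambda>x. ennreal (h x))" for h
  have dint: "(\<integral>\<^sup>+x. F x \<partial>dens h) = (\<integral>\<^sup>+x. ennreal (h x) * F x \<partial>\<xi>)" if [measurable]: "h \<in> borel_measurable borel" "F \<in> borel_measurable borel" for h F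
    unfolding dens_def by (rule nn_integral_density_borel) (use x in auto)
  have dsets: "sets (dens h) = sets borel" for h using x by (simp add: dens_def)
  have dem: "emeasure (dens h) B = (\<integral>\<^sup>+x. ennreal (h x) * indicator B x \<partial>\<xi>)" if "h \<in> borel_measurable borel" "B \<in> sets borel" for h B
    using dint[OF that(1), of "indicator B"] that(2) by (simp add: dsets)
  have dle: "emeasure (dens h) B \<le> emeasure \<xi> B" if h: "h \<in> borel_measurable borel" "\<And>x. 0 \<le> h x \<and> h x \<le> 1" and B: "B \<in> sets borel" for h B
  proof -
    have "emeasure (dens h) B \<le> (\<integral>\<^sup>+x. indicator B x \<partial>\<xi>)"
      unfolding dem[OF h(1) B] by (rule nn_integral_mono) (use h(2) in \<open>auto simp: indicator_def ennreal_le_1\<close>)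
    then show ?thesis using B by simp
  qed
  have de: "energy_on UNIV (dens h)" if "h \<in> borel_measurable borel" "\<And>x. 0 \<le> h x \<and> h x \<le> 1" for h
    by (rule energy_on_mono[OF \<xi> dsets dle]) (use that in auto)
  \<comment> \<open>Densities that have some partner making the pair nearly optimal; convexity of
    the pair energy makes each of these sets closed under midpoints.\<close>
  define H where "H k = {h. h \<in> borel_measurable borel \<and> (\<forall>x. 0 \<le> h x \<and> h x \<le> 1) \<and> (\<exists>\<nu>. adm_pair \<xi> A f (dens h) \<nu> \<and> pair_energy f (dens h) \<nu> < I + 1 / real (Suc k))}" for k
  obtain h g where h: "\<And>k. h k \<in> H k" and g: "g \<in> borel_measurable borel" "\<And>x. 0 \<le> g x \<and> g x \<le> 1" and lim: "AE x in \<xi>. (\<lambda>k. h k x) \<longlonglongrightarrow> g x"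
  proof (rule mazur_sequence[of \<xi> H])
    show "sets \<xi> = sets borel" "emeasure \<xi> UNIV < \<infinity>" by (fact x)+
    show "h \<in> borel_measurable borel \<and> (\<forall>x. 0 \<le> h x \<and> h x \<le> 1)" if "h \<in> H k" for h k using that by (simp add: H_def)
    show "H k \<subseteq> H j" if "j \<le> k" for j k
    proof -
      have "1 / real (Suc k) \<le> 1 / real (Suc j)" using that by (simp add: field_simps)
      then show ?thesis unfolding H_def by (fastforce intro: less_le_trans)
    qed
    show "H k \<noteq> {}" for k
    proof -
      have "Inf ((\<lambda>(\<sigma>, \<nu>). pair_energy f \<sigma> \<nu>) ` X) < I + 1 / real (Suc k)" by (simp add: I_def)
      then have "\<exists>z \<in> (\<lambda>(\<sigma>, \<nu>). pair_energy f \<sigma> \<nu>) ` X. z < I + 1 / real (Suc k)"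
        by (rule cInf_lessD[rotated]) (use Xne in simp)
      then obtain \<sigma> \<nu> where *: "adm_pair \<xi> A f \<sigma> \<nu>" "pair_energy f \<sigma> \<nu> < I + 1 / real (Suc k)"
        by (auto simp: X_def)
      obtain h where "h \<in> borel_measurable borel" "\<And>x. 0 \<le> h x \<and> h x \<le> 1" "\<sigma> = dens h"
        unfolding dens_def by (rule density_of_dominated[OF x(1,2), of \<sigma>]) (use * in \<open>auto simp: adm_pair_def\<close>)
      then have "h \<in> H k" using * by (auto simp: H_def)
      then show ?thesis by blast
    qed
    fix k h g assume "h \<in> H k" "g \<in> H k"
    then obtain \<nu>1 \<nu>2 where hg[measurable]: "h \<in> borel_measurable borel" "g \<in> borel_measurable borel" and b: "\<And>x. 0 \<le> h x \<and> h x \<le> 1" "\<And>x. 0 \<le> g x \<and> g x \<le> 1"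
      and n1: "adm_pair \<xi> A f (dens h) \<nu>1" "pair_energy f (dens h) \<nu>1 < I + 1 / real (Suc k)"
      and n2: "adm_pair \<xi> A f (dens g) \<nu>2" "pair_energy f (dens g) \<nu>2 < I + 1 / real (Suc k)"
      by (auto simp: H_def)
    have v: "energy_on A \<nu>1" "energy_on A \<nu>2" "emeasure \<nu>1 UNIV = 1" "emeasure \<nu>2 UNIV = 1" "pos_part f (dens h) < \<infinity>" "pos_part f (dens g) < \<infinity>"
      "emeasure (dens h) UNIV = 1" "emeasure (dens g) UNIV = 1"
      using n1 n2 by (auto simp: adm_pair_def)
    let ?m = "\<lambda>x. (h x + g x) / 2"
    have eq: "dens ?m = scale_borel (1/2) (add_measure (dens h) (dens g))"
    proof (rule measure_eqI)
      fix B assume "B \<in> sets (dens ?m)"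
      then have B: "B \<in> sets borel" by (simp add: dsets)
      have mm: "?m \<in> borel_measurable borel" by measurable
      have "emeasure (dens ?m) B = (\<integral>\<^sup>+x. ennreal (1/2) * (ennreal (h x) * indicator B x + ennreal (g x) * indicator B x) \<partial>\<xi>)"
        unfolding dem[OF mm B]
      proof (rule nn_integral_cong)
        fix x
        have "ennreal (?m x) = ennreal (1/2) * (ennreal (h x) + ennreal (g x))"
          using b[of x] by (simp add: ennreal_plus[symmetric] ennreal_mult[symmetric] del: ennreal_plus ennreal_half)
        then show "ennreal (?m x) * indicator B x = ennreal (1/2) * (ennreal (h x) * indicator B x + ennreal (g x) * indicator B x)"
          by (simp add: distrib_right mult.assoc del: ennreal_half)
      qed
      also have "\<dots> = ennreal (1/2) * (emeasure (dens h) B + emeasure (dens g) B)"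
        using B by (simp add: nn_integral_cmult nn_integral_add dem del: ennreal_half)
      also have "\<dots> = emeasure (scale_borel (1/2) (add_measure (dens h) (dens g))) B"
        using B by (simp add: emeasure_scale_borel emeasure_add_measure dsets del: ennreal_half)
      finally show "emeasure (dens ?m) B = emeasure (scale_borel (1/2) (add_measure (dens h) (dens g))) B" .
    qed (simp add: dsets)
    define \<nu> where "\<nu> = scale_borel (1/2) (add_measure \<nu>1 \<nu>2)"
    have half: "ennreal (1/2) * (1 + 1) = 1"
    proof -
      have "ennreal (1/2) * (1 + 1) = ennreal (1/2) * ennreal 2" by simp
      also have "\<dots> = 1" by (subst ennreal_mult[symmetric]) auto
      finally show ?thesis .
    qed
    note fe = energy_onD(4)[OF e\<sigma>(1)[OF n1(1)]] energy_onD(4)[OF e\<sigma>(1)[OF n2(1)]] energy_onD(4)[OF v(1)] energy_onD(4)[OF v(2)]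
    have "adm_pair \<xi> A f (dens ?m) \<nu>"
      unfolding adm_pair_def
    proof (intro conjI ballI dsets)
      show "emeasure (dens ?m) B \<le> emeasure \<xi> B" if "B \<in> sets borel" for B
        by (rule dle[OF _ _ that]) (use b in \<open>auto simp: add_nonneg_nonneg\<close>, smt (verit))
      show "emeasure (dens ?m) UNIV = 1"
        unfolding eq using v half by (simp add: emeasure_scale_borel emeasure_add_measure dsets del: ennreal_half)
      show "pos_part f (dens ?m) < \<infinity>"
        unfolding eq by (rule pair_energy_midpoint(2)[OF fe f v(5,6) e\<sigma>(3)[OF n1(1)] e\<sigma>(3)[OF n2(1)]])
      show "energy_on A \<nu>" unfolding \<nu>_def by (intro energy_on_scale energy_on_add v Ab)
      show "emeasure \<nu> UNIV = 1"
        unfolding \<nu>_def using v half energy_onD(1)[OF v(1)] energy_onD(1)[OF v(2)] by (simp add: emeasure_scale_borel emeasure_add_measure del: ennreal_half)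
    qed
    moreover have "pair_energy f (dens ?m) \<nu> < I + 1 / real (Suc k)"
      unfolding eq \<nu>_def using pair_energy_midpoint(1)[OF fe f v(5,6) e\<sigma>(3)[OF n1(1)] e\<sigma>(3)[OF n2(1)]] n1(2) n2(2) unfolding add_divide_distrib by linarith
    moreover have "0 \<le> ?m x \<and> ?m x \<le> 1" for x using b(1)[of x] b(2)[of x] by simp
    ultimately show "?m \<in> H k" unfolding H_def by auto
  next
    fix h g assume "\<And>k. h k \<in> H k" "g \<in> borel_measurable borel" "\<And>x. 0 \<le> g x \<and> g x \<le> 1" "AE x in \<xi>. (\<lambda>k. h k x) \<longlonglongrightarrow> g x"
    from this show thesis by (rule that)
  qed
  have hm[measurable]: "h k \<in> borel_measurable borel" and h01: "0 \<le> h k x \<and> h k x \<le> 1" for k x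
    using h[of k] by (auto simp: H_def)
  note [measurable] = g(1)
  obtain \<nu>k where \<nu>k: "\<And>k. adm_pair \<xi> A f (dens (h k)) (\<nu>k k)" "\<And>k. pair_energy f (dens (h k)) (\<nu>k k) < I + 1 / real (Suc k)"
    using h unfolding H_def by simp metis
  define \<sigma> where "\<sigma> = dens g"
  define \<sigma>k where "\<sigma>k k = dens (h k)" for k
  \<comment> \<open>The signed difference of \<sigma>_k and \<sigma> is dominated by the positive
    measure with density |h_k - g|; errors in mutual energies are bounded by mutual energies with
    \<open>\<tau> k\<close>.\<close>
  define \<tau> where "\<tau> k = dens (\<lambda>x. \<bar>h k x - g x\<bar>)" for k
  have t01: "0 \<le> \<bar>h k x - g x\<bar> \<and> \<bar>h k x - g x\<bar> \<le> 1" for k x using h01[of k x] g(2)[of x] by auto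
  have s: "energy_on UNIV \<sigma>" unfolding \<sigma>_def by (rule de[OF g])
  have sk: "energy_on UNIV (\<sigma>k k)" for k unfolding \<sigma>k_def by (rule de[OF hm h01])
  have t: "energy_on UNIV (\<tau> k)" for k unfolding \<tau>_def by (rule de[OF _ t01]) measurable
  have nk: "energy_on A (\<nu>k k)" "emeasure (\<nu>k k) UNIV = 1" for k using \<nu>k(1)[of k] by (auto simp: adm_pair_def)
  note fs = energy_onD(4)[OF s] and fsk = energy_onD(4)[OF sk] and ft = energy_onD(4)[OF t] and fnk = energy_onD(4)[OF nk(1)]
  have conv: "(\<lambda>k. \<integral>\<^sup>+x. ennreal (h k x) * F x \<partial>\<xi>) \<longlonglongrightarrow> (\<integral>\<^sup>+x. ennreal (g x) * F x \<partial>\<xi>)"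
    if [measurable]: "F \<in> borel_measurable borel" and fin: "(\<integral>\<^sup>+x. F x \<partial>\<xi>) < \<infinity>" for F
  proof (rule nn_integral_dominated_convergence[where w=F])
    have "AE x in \<xi>. F x \<noteq> \<infinity>" by (rule nn_integral_PInf_AE) (use fin in auto)
    with lim show "AE x in \<xi>. (\<lambda>k. ennreal (h k x) * F x) \<longlonglongrightarrow> ennreal (g x) * F x"
      by eventually_elim (auto intro!: tendsto_mult_ennreal tendsto_ennrealI tendsto_const)
    show "AE x in \<xi>. ennreal (h j x) * F x \<le> F x" for j
      using h01 by (intro AE_I2) (metis ennreal_le_1 mult_1 mult_right_mono zero_le)
  qed (use fin in auto)
  have mass: "emeasure \<sigma> UNIV = 1"
  proof -
    have "(\<lambda>k. emeasure (dens (h k)) UNIV) \<longlonglongrightarrow> emeasure (dens g) UNIV"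
      using conv[of "\<lambda>_. 1"] x(2) sp by (simp add: dem)
    moreover have "emeasure (dens (h k)) UNIV = 1" for k using \<nu>k(1)[of k] by (simp add: adm_pair_def)
    ultimately show ?thesis unfolding \<sigma>_def by (simp add: LIMSEQ_const_iff)
  qed
  \<comment> \<open>The negative part is integrable for \<xi>, so it converges by dominated
    convergence; the positive part has no such bound and is treated by Fatou.\<close>
  have nconv: "(\<lambda>k. enn2real (neg_part f (\<sigma>k k))) \<longlonglongrightarrow> enn2real (neg_part f \<sigma>)"
  proof -
    have "(\<lambda>k. neg_part f (\<sigma>k k)) \<longlonglongrightarrow> neg_part f \<sigma>"
      unfolding neg_part_def \<sigma>_def \<sigma>k_def using conv[of "\<lambda>x. e2ennreal (- f x)"] N\<xi> by (simp add: dint neg_part_def)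
    moreover have "neg_part f \<sigma> \<le> neg_part f \<xi>"
      unfolding neg_part_def \<sigma>_def by (rule nn_integral_mono_dominated[OF dsets x(1) dle[OF g]])
    then have "neg_part f \<sigma> < \<infinity>" using N\<xi> by (rule le_less_trans)
    then have "neg_part f \<sigma> = ennreal (enn2real (neg_part f \<sigma>))" by (simp add: ennreal_enn2real)
    ultimately have "(\<lambda>k. neg_part f (\<sigma>k k)) \<longlonglongrightarrow> ennreal (enn2real (neg_part f \<sigma>))" by metis
    from tendsto_enn2real[OF this enn2real_nonneg] show ?thesis .
  qed
  have Pk: "pos_part f (\<sigma>k k) = ennreal (enn2real (pos_part f (\<sigma>k k)))" for k
    using \<nu>k(1)[of k] by (simp add: adm_pair_def \<sigma>k_def ennreal_enn2real)
  have epart: "0 \<le> en (\<sigma>k k) (\<sigma>k k) + en (\<nu>k k) (\<nu>k k) - 2 * en (\<sigma>k k) (\<nu>k k)" for k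
    by (rule en_diff_nonneg[OF fsk fnk])
  have Wk: "pair_energy f (\<sigma>k k) (\<nu>k k) < I + 1 / real (Suc k)" "pair_energy f (\<sigma>k k) (\<nu>k k) \<le> I + 1" for k
  proof -
    show 1: "pair_energy f (\<sigma>k k) (\<nu>k k) < I + 1 / real (Suc k)" using \<nu>k(2)[of k] by (simp add: \<sigma>k_def)
    have "1 / real (Suc k) \<le> 1" by simp
    then show "pair_energy f (\<sigma>k k) (\<nu>k k) \<le> I + 1" using 1 by linarith
  qed
  have nk_le: "enn2real (neg_part f (\<sigma>k k)) \<le> n\<xi>" for k using nle[OF \<nu>k(1)] by (simp add: \<sigma>k_def)
  have Pbound: "enn2real (pos_part f (\<sigma>k k)) \<le> (I + 1) / 2 + n\<xi>" for k
    using Wk(2)[of k] epart[of k] nk_le[of k] unfolding pair_energy_def right_diff_distrib distrib_left add_divide_distrib by linarith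
  have Pfatou: "pos_part f \<sigma> \<le> liminf (\<lambda>k. pos_part f (\<sigma>k k))"
  proof -
    have "pos_part f \<sigma> \<le> (\<integral>\<^sup>+x. liminf (\<lambda>k. ennreal (h k x) * e2ennreal (f x)) \<partial>\<xi>)"
      unfolding pos_part_def \<sigma>_def
    proof (subst dint, measurable, rule nn_integral_mono_AE, use lim in eventually_elim)
      fix x assume "(\<lambda>k. h k x) \<longlonglongrightarrow> g x"
      from tendsto_fatou_mult_liminf[OF this, of "e2ennreal (f x)"]
      show "ennreal (g x) * e2ennreal (f x) \<le> liminf (\<lambda>k. ennreal (h k x) * e2ennreal (f x))" by (simp add: mult.commute)
    qed
    also have "\<dots> \<le> liminf (\<lambda>k. \<integral>\<^sup>+x. ennreal (h k x) * e2ennreal (f x) \<partial>\<xi>)" by (rule nn_integral_liminf) measurable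
    also have "\<dots> = liminf (\<lambda>k. pos_part f (\<sigma>k k))" by (simp add: pos_part_def \<sigma>k_def dint)
    finally show ?thesis .
  qed
  have Pfin: "pos_part f \<sigma> < \<infinity>"
  proof -
    have "\<forall>\<^sub>F k in sequentially. pos_part f (\<sigma>k k) \<le> ennreal ((I + 1) / 2 + n\<xi>)"
      by (intro always_eventually allI) (subst Pk, rule ennreal_leI[OF Pbound])
    then have "liminf (\<lambda>k. pos_part f (\<sigma>k k)) \<le> ennreal ((I + 1) / 2 + n\<xi>)" by (intro Liminf_le) simp_all
    with Pfatou have "pos_part f \<sigma> \<le> ennreal ((I + 1) / 2 + n\<xi>)" by (rule order_trans)
    then show ?thesis by (rule le_less_trans) simp
  qed
  define p where "p = enn2real (pos_part f \<sigma>)"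
  have p: "pos_part f \<sigma> = ennreal p" "0 \<le> p" using Pfin by (auto simp: p_def ennreal_enn2real)
  have Pev: "\<forall>\<^sub>F k in sequentially. p - \<epsilon> \<le> enn2real (pos_part f (\<sigma>k k))" if "0 < \<epsilon>" for \<epsilon>
  proof (cases "p - \<epsilon> < 0")
    case True
    have "p - \<epsilon> \<le> enn2real (pos_part f (\<sigma>k k))" for k using True enn2real_nonneg[of "pos_part f (\<sigma>k k)"] by linarith
    then show ?thesis by simp
  next
    case False
    then have "ennreal (p - \<epsilon>) < liminf (\<lambda>k. pos_part f (\<sigma>k k))"
      using that by (intro less_le_trans[OF _ Pfatou]) (simp add: p(1) ennreal_less_iff)
    then have "\<forall>\<^sub>F k in sequentially. ennreal (p - \<epsilon>) < pos_part f (\<sigma>k k)" by (rule less_LiminfD)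
    then show ?thesis
    proof eventually_elim
      fix k assume "ennreal (p - \<epsilon>) < pos_part f (\<sigma>k k)"
      then have "ennreal (p - \<epsilon>) < ennreal (enn2real (pos_part f (\<sigma>k k)))" using Pk[of k] by simp
      then show "p - \<epsilon> \<le> enn2real (pos_part f (\<sigma>k k))" using False by (simp add: ennreal_less_iff)
    qed
  qed
  define \<delta> where "\<delta> k = en (\<tau> k) \<xi>" for k
  \<comment> \<open>Dominated convergence with the majorant U^\<xi>, which is \<xi>-integrable
    because \<xi> has finite energy.\<close>
  have \<delta>0: "\<delta> \<longlonglongrightarrow> 0"
  proof -
    note [measurable] = potential_borel[OF x(3)]
    have E: "mutual_energy \<alpha> (\<tau> k) \<xi> = (\<integral>\<^sup>+x. ennreal \<bar>h k x - g x\<bar> * potential \<alpha> \<xi> x \<partial>\<xi>)" for k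
      unfolding mutual_energy_potential \<tau>_def by (rule dint) measurable
    have fin: "(\<integral>\<^sup>+x. potential \<alpha> \<xi> x \<partial>\<xi>) < \<infinity>"
      using finite_energy_measureD(2)[OF x(4)] by (simp add: mutual_energy_potential)
    have "(\<lambda>k. \<integral>\<^sup>+x. ennreal \<bar>h k x - g x\<bar> * potential \<alpha> \<xi> x \<partial>\<xi>) \<longlonglongrightarrow> (\<integral>\<^sup>+x. 0 \<partial>\<xi>)"
    proof (rule nn_integral_dominated_convergence[where w="potential \<alpha> \<xi>"])
      have "AE x in \<xi>. potential \<alpha> \<xi> x \<noteq> \<infinity>" by (rule nn_integral_PInf_AE) (use fin in auto)
      with lim show "AE x in \<xi>. (\<lambda>k. ennreal \<bar>h k x - g x\<bar> * potential \<alpha> \<xi> x) \<longlonglongrightarrow> 0"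
      proof eventually_elim
        fix x assume L: "(\<lambda>k. h k x) \<longlonglongrightarrow> g x" and f: "potential \<alpha> \<xi> x \<noteq> \<infinity>"
        have "(\<lambda>k. \<bar>h k x - g x\<bar>) \<longlonglongrightarrow> \<bar>g x - g x\<bar>" by (intro tendsto_intros L)
        then have "(\<lambda>k. ennreal \<bar>h k x - g x\<bar>) \<longlonglongrightarrow> ennreal 0" by (intro tendsto_ennrealI) simp
        then have "(\<lambda>k. ennreal \<bar>h k x - g x\<bar> * potential \<alpha> \<xi> x) \<longlonglongrightarrow> ennreal 0 * potential \<alpha> \<xi> x"
          by (intro tendsto_mult_ennreal tendsto_const) (use f in auto)
        then show "(\<lambda>k. ennreal \<bar>h k x - g x\<bar> * potential \<alpha> \<xi> x) \<longlonglongrightarrow> 0" by simp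
      qed
      show "AE x in \<xi>. ennreal \<bar>h j x - g x\<bar> * potential \<alpha> \<xi> x \<le> potential \<alpha> \<xi> x" for j
        using t01 by (intro AE_I2) (metis ennreal_le_1 mult_1 mult_right_mono zero_le)
    qed (use fin in auto)
    then have "(\<lambda>k. mutual_energy \<alpha> (\<tau> k) \<xi>) \<longlonglongrightarrow> ennreal 0" by (simp add: E)
    from tendsto_enn2real[OF this order_refl] show ?thesis unfolding \<delta>_def en_def .
  qed
  have abs_le: "en \<sigma> \<omega> \<le> en (\<sigma>k k) \<omega> + en (\<tau> k) \<omega>" "en (\<sigma>k k) \<omega> \<le> en \<sigma> \<omega> + en (\<tau> k) \<omega>" if \<omega>: "finite_energy_measure \<omega>" for \<omega> k
  proof -
    have tri: "emeasure (dens u) B \<le> emeasure (add_measure (dens v) (dens w)) B"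
      if [measurable]: "u \<in> borel_measurable borel" "v \<in> borel_measurable borel" "w \<in> borel_measurable borel"
        and uvw: "\<And>x. u x \<le> v x + w x" "\<And>x. 0 \<le> v x" "\<And>x. 0 \<le> w x" and B: "B \<in> sets borel" for u v w B
    proof -
      have "(\<integral>\<^sup>+x. ennreal (u x) * indicator B x \<partial>\<xi>) \<le> (\<integral>\<^sup>+x. ennreal (v x) * indicator B x + ennreal (w x) * indicator B x \<partial>\<xi>)"
      proof (rule nn_integral_mono)
        fix x
        have "ennreal (u x) \<le> ennreal (v x) + ennreal (w x)"
          using ennreal_leI[OF uvw(1)[of x]] ennreal_plus[OF uvw(2,3)[of x]] by simp
        then show "ennreal (u x) * indicator B x \<le> ennreal (v x) * indicator B x + ennreal (w x) * indicator B x"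
          by (auto simp: indicator_def)
      qed
      also have "\<dots> = (\<integral>\<^sup>+x. ennreal (v x) * indicator B x \<partial>\<xi>) + (\<integral>\<^sup>+x. ennreal (w x) * indicator B x \<partial>\<xi>)"
        using B by (intro nn_integral_add) auto
      finally show ?thesis using B by (simp add: dem emeasure_add_measure dsets)
    qed
    have "en \<sigma> \<omega> \<le> en (add_measure (\<sigma>k k) (\<tau> k)) \<omega>"
    proof (rule en_mono[OF finite_energy_measure_add[OF fsk ft] \<omega>])
      show "emeasure \<sigma> B \<le> emeasure (add_measure (\<sigma>k k) (\<tau> k)) B" if "B \<in> sets borel" for B
        unfolding \<sigma>_def \<sigma>k_def \<tau>_def by (rule tri) (use h01 that in auto)
    qed (simp add: \<sigma>_def dsets)
    then show "en \<sigma> \<omega> \<le> en (\<sigma>k k) \<omega> + en (\<tau> k) \<omega>" by (simp add: en_add_left fsk ft \<omega>)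
    have "en (\<sigma>k k) \<omega> \<le> en (add_measure \<sigma> (\<tau> k)) \<omega>"
    proof (rule en_mono[OF finite_energy_measure_add[OF fs ft] \<omega>])
      show "emeasure (\<sigma>k k) B \<le> emeasure (add_measure \<sigma> (\<tau> k)) B" if "B \<in> sets borel" for B
        unfolding \<sigma>_def \<sigma>k_def \<tau>_def by (rule tri) (use g that in auto)
    qed (simp add: \<sigma>k_def dsets)
    then show "en (\<sigma>k k) \<omega> \<le> en \<sigma> \<omega> + en (\<tau> k) \<omega>" by (simp add: en_add_left fs ft \<omega>)
  qed
  have sub\<xi>: "en \<omega> (dens u) \<le> en \<omega> \<xi>" if "finite_energy_measure \<omega>" "u \<in> borel_measurable borel" "\<And>x. 0 \<le> u x \<and> u x \<le> 1" for \<omega> u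
    using en_mono[OF x(4) that(1) dsets dle[OF that(2,3)]] en_commute[OF that(1) x(4)] en_commute[OF that(1) energy_onD(4)[OF de[OF that(2,3)]]] by simp
  \<comment> \<open>A uniform bound on the energies of the \<nu>_k, obtained by comparing with 2
    \<sigma>_k; it controls their mutual energies with \<open>\<tau> k\<close>.\<close>
  define B where "B = 2 * (I + 1 + 2 * n\<xi>) + 4 * en \<xi> \<xi>"
  have nB: "en (\<nu>k k) (\<nu>k k) \<le> B" for k
  proof -
    have "0 \<le> en (\<nu>k k) (\<nu>k k) + en (scale_borel 2 (\<sigma>k k)) (scale_borel 2 (\<sigma>k k)) - 2 * en (\<nu>k k) (scale_borel 2 (\<sigma>k k))"
      by (intro en_diff_nonneg finite_energy_measure_scale fnk fsk)
    then have "0 \<le> en (\<nu>k k) (\<nu>k k) + 4 * en (\<sigma>k k) (\<sigma>k k) - 4 * en (\<sigma>k k) (\<nu>k k)"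
      by (simp add: en_scale_left en_scale_right finite_energy_measure_scale fnk fsk en_commute[OF fnk fsk])
    moreover have "en (\<sigma>k k) (\<sigma>k k) + en (\<nu>k k) (\<nu>k k) - 2 * en (\<sigma>k k) (\<nu>k k) \<le> I + 1 + 2 * n\<xi>"
      using Wk(2)[of k] nk_le[of k] enn2real_nonneg[of "pos_part f (\<sigma>k k)"] unfolding pair_energy_def right_diff_distrib distrib_left add_divide_distrib by linarith
    moreover have "en (\<sigma>k k) (\<sigma>k k) \<le> en \<xi> \<xi>"
    proof -
      have "en (\<sigma>k k) (\<sigma>k k) \<le> en (\<sigma>k k) \<xi>" unfolding \<sigma>k_def by (rule sub\<xi>[OF fsk[unfolded \<sigma>k_def] hm h01])
      also have "\<dots> = en \<xi> (\<sigma>k k)" by (rule en_commute[OF fsk x(4)])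
      also have "\<dots> \<le> en \<xi> \<xi>" unfolding \<sigma>k_def by (rule sub\<xi>[OF x(4) hm h01])
      finally show ?thesis .
    qed
    moreover have "v \<le> 2 * i + 4 * z" if "0 \<le> v + 4 * w - 4 * y" "w + v - 2 * y \<le> i" "w \<le> z" "0 \<le> w" for v w y i z :: real
      using that by (simp add: algebra_simps)
    ultimately show ?thesis unfolding B_def using en_nonneg by blast
  qed
  have B0: "0 \<le> B" using nB[of 0] en_nonneg order_trans by blast
  have \<delta>n: "0 \<le> \<delta> k" for k by (simp add: \<delta>_def)
  have en\<tau>\<nu>: "en (\<tau> k) (\<nu>k k) \<le> sqrt (\<delta> k * B)" for k
  proof (rule real_le_rsqrt)
    have "(en (\<tau> k) (\<nu>k k))\<^sup>2 \<le> en (\<tau> k) (\<tau> k) * en (\<nu>k k) (\<nu>k k)" by (rule en_Cauchy_Schwarz[OF ft fnk])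
    also have "\<dots> \<le> \<delta> k * B"
    proof (rule mult_mono)
      show "en (\<tau> k) (\<tau> k) \<le> \<delta> k" unfolding \<delta>_def using sub\<xi>[OF ft, of "\<lambda>x. \<bar>h k x - g x\<bar>" k] t01 by (simp add: \<tau>_def)
    qed (use nB \<delta>n in auto)
    finally show "(en (\<tau> k) (\<nu>k k))\<^sup>2 \<le> \<delta> k * B" .
  qed
  obtain \<nu> where sw: "swept A \<sigma> \<nu>" using swept_exists[OF A q thin s] by metis
  note n = energy_onD[OF sweptD(1)[OF sw]]
  have adm: "adm_pair \<xi> A f \<sigma> \<nu>"
    unfolding adm_pair_def using mass Pfin sweptD(1,2)[OF sw] dle[OF g] by (auto simp: \<sigma>_def dsets)
  \<comment> \<open>The near-optimal value plus all errors: two exchanges in the self-energy, one in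
    the mixed energy, the Fatou slack, and the change of the negative field part.\<close>
  define Xk where "Xk \<epsilon> k = I + 1 / real (Suc k) + 2 * \<delta> k + 2 * sqrt (\<delta> k * B) + 2 * \<epsilon> + 2 * (enn2real (neg_part f (\<sigma>k k)) - enn2real (neg_part f \<sigma>))" for \<epsilon> k
  have "pair_energy f \<sigma> \<nu> \<le> I + 2 * \<epsilon>" if \<epsilon>: "0 < \<epsilon>" for \<epsilon>
  proof (rule tendsto_lowerbound)
    have "(\<lambda>k. 1 / real (Suc k)) \<longlonglongrightarrow> 0" by real_asymp
    then have "Xk \<epsilon> \<longlonglongrightarrow> I + 0 + 2 * 0 + 2 * sqrt (0 * B) + 2 * \<epsilon> + 2 * (enn2real (neg_part f \<sigma>) - enn2real (neg_part f \<sigma>))"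
      unfolding Xk_def by (intro tendsto_intros \<delta>0 nconv)
    then show "Xk \<epsilon> \<longlonglongrightarrow> I + 2 * \<epsilon>" by simp
    show "\<forall>\<^sub>F k in sequentially. pair_energy f \<sigma> \<nu> \<le> Xk \<epsilon> k"
      using Pev[OF \<epsilon>]
    proof eventually_elim
      fix k assume P: "p - \<epsilon> \<le> enn2real (pos_part f (\<sigma>k k))"
      have m: "en \<sigma> \<sigma> + en \<nu> \<nu> - 2 * en \<sigma> \<nu> \<le> en \<sigma> \<sigma> + en (\<nu>k k) (\<nu>k k) - 2 * en \<sigma> (\<nu>k k)"
        by (rule swept_minimal(1)[OF sw s nk(1)])
      have "en \<sigma> \<sigma> \<le> en (\<sigma>k k) \<sigma> + en (\<tau> k) \<sigma>" by (rule abs_le(1)[OF fs])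
      moreover have "en (\<sigma>k k) \<sigma> = en \<sigma> (\<sigma>k k)" by (rule en_commute[OF fsk fs])
      moreover have "en \<sigma> (\<sigma>k k) \<le> en (\<sigma>k k) (\<sigma>k k) + en (\<tau> k) (\<sigma>k k)" by (rule abs_le(1)[OF fsk])
      moreover have "en (\<tau> k) \<sigma> \<le> \<delta> k" unfolding \<delta>_def \<sigma>_def by (rule sub\<xi>[OF ft g])
      moreover have "en (\<tau> k) (\<sigma>k k) \<le> \<delta> k" unfolding \<delta>_def \<sigma>k_def by (rule sub\<xi>[OF ft hm h01])
      moreover have "en (\<sigma>k k) (\<nu>k k) \<le> en \<sigma> (\<nu>k k) + en (\<tau> k) (\<nu>k k)" by (rule abs_le(2)[OF fnk])
      moreover note en\<tau>\<nu>[of k] Wk(1)[of k] P m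
      ultimately show "pair_energy f \<sigma> \<nu> \<le> Xk \<epsilon> k"
        unfolding pair_energy_def Xk_def p_def[symmetric] right_diff_distrib distrib_left by linarith
    qed
  qed simp
  then have "pair_energy f \<sigma> \<nu> \<le> I + e" if "0 < e" for e using that by (metis field_sum_of_halves half_gt_zero mult_2)
  then have le: "pair_energy f \<sigma> \<nu> \<le> I" by (rule field_le_epsilon)
  show ?thesis by (rule that[OF adm order_trans[OF le I_le]])
qed

end


section \<open>Admissible signed measures\<close>

lemma e2ennreal_diff_enn2ereal: "e2ennreal (enn2ereal p - enn2ereal m) = p - m"
  by transfer (simp add: sup_max)

text \<open>Only an inequality: for p = m = \<infinity> the left side is 0 by the convention for
  \<open>ereal\<close>, while the right side is \<infinity>.\<close>

lemma e2ennreal_minus_diff_le: "e2ennreal (- (enn2ereal p - enn2ereal m)) \<le> m - p"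
proof -
  have "- (enn2ereal p - enn2ereal m) \<le> enn2ereal m - enn2ereal p"
    by (cases "enn2ereal p"; cases "enn2ereal m") auto
  from e2ennreal_mono[OF this] show ?thesis by (simp add: e2ennreal_diff_enn2ereal)
qed

lemma enn2ereal_diff_eq_iff:
  assumes "a < \<infinity>" "b < \<infinity>" "c < \<infinity>" "d < \<infinity>"
  shows "enn2ereal a - enn2ereal b = enn2ereal c - enn2ereal d \<longleftrightarrow> a + d = c + b"
proof -
  from assms obtain a' b' c' d' where "a = ennreal a'" "0 \<le> a'" "b = ennreal b'" "0 \<le> b'" "c = ennreal c'" "0 \<le> c'" "d = ennreal d'" "0 \<le> d'"
    by (cases a; cases b; cases c; cases d) auto
  moreover from this have "ennreal a' + ennreal d' = ennreal c' + ennreal b' \<longleftrightarrow> a' + d' = c' + b'"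
    by (simp add: ennreal_plus[symmetric] del: ennreal_plus)
  ultimately show ?thesis by (auto simp: enn2ereal_ennreal)
qed

context riesz_space
begin

lemma field_case_I_properties:
  assumes f: "field_case_I \<alpha> A f" and A: "closed A"
  shows "f \<in> borel_measurable borel" "neg_part f \<sigma> = 0" "energy_on A \<tau> \<Longrightarrow> AE x in \<tau>. f (x :: 'a) = 0"
proof -
  show [measurable]: "f \<in> borel_measurable borel"
    by (rule borel_measurableI_greater) (use f in \<open>auto simp: field_case_I_def\<close>)
  show "neg_part f \<sigma> = 0"
    unfolding neg_part_def using f by (simp add: field_case_I_def e2ennreal_neg)
  show "AE x in \<tau>. f x = 0" if "energy_on A \<tau>"
    by (rule nearly_everywhere_AE[OF _ that]) (use f A in \<open>auto simp: field_case_I_def\<close>)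
qed

text \<open>For measures of finite energy all four potentials are finite almost everywhere, so the
  defining equation of the balayage can be rearranged into sums. The one-sided bound is then applied
  twice, with the roles of the positive and negative parts exchanged.\<close>

lemma field_case_II_properties:
  assumes A: "closed (- D)" and q: "0 < q" "q < 1" and thin: "\<not> thin_at_infinity \<alpha> q (- D)" and f: "field_case_II \<alpha> D \<zeta> f"
  shows "f \<in> borel_measurable borel" "\<And>\<tau>. energy_on (- D) \<tau> \<Longrightarrow> AE x in \<tau>. f (x :: 'a) = 0"
    "\<And>\<gamma>. energy_on UNIV \<gamma> \<Longrightarrow> pos_part f \<gamma> \<le> mutual_energy \<alpha> \<gamma> (fst \<zeta>)"
    "\<And>\<gamma>. energy_on UNIV \<gamma> \<Longrightarrow> neg_part f \<gamma> \<le> mutual_energy \<alpha> \<gamma> (snd \<zeta>)"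
    "finite_energy_measure (fst \<zeta>)" "finite_energy_measure (snd \<zeta>)"
proof -
  obtain a b where z: "\<zeta> = (a, b)" by (cases \<zeta>)
  from f obtain \<zeta>' where bal: "balayage \<alpha> D \<zeta> \<zeta>'" and f_eq: "f = signed_potential \<alpha> (diff_signed \<zeta> \<zeta>')"
    and ext: "extendible \<alpha> D \<zeta>" and E: "mutual_energy \<alpha> (total_variation \<zeta>) (total_variation \<zeta>) < \<infinity>"
    by (auto simp: field_case_II_def)
  obtain a' b' where z': "\<zeta>' = (a', b')" by (cases \<zeta>')
  have radon: "radon_measure \<alpha> a" "radon_measure \<alpha> b" "radon_measure \<alpha> a'" "radon_measure \<alpha> b'"
    using ext bal by (auto simp: extendible_def balayage_def signed_radon_def z z')
  note sf = radon[THEN radon_measure_sigma_finite]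
  note sets = sf[THEN sigma_finite_borelD(2)]
  note [measurable] = sf[THEN potential_borel]
  let ?p = "\<lambda>x. potential \<alpha> a x + potential \<alpha> b' x" and ?m = "\<lambda>x. potential \<alpha> b x + potential \<alpha> a' x"
  have fx: "f x = enn2ereal (?p x) - enn2ereal (?m x)" for x
    by (simp add: f_eq signed_potential_def diff_signed_def z z' potential_add_measure sets)
  then have f_eq: "f = (\<lambda>x. enn2ereal (?p x) - enn2ereal (?m x))" by auto
  show [measurable]: "f \<in> borel_measurable borel" unfolding f_eq by measurable
  have tv: "finite_energy_measure (total_variation \<zeta>)"
    using E sf by (auto simp: finite_energy_measure_def total_variation_def z intro: sigma_finite_borel_add)
  show "finite_energy_measure (fst \<zeta>)" "finite_energy_measure (snd \<zeta>)"
    by (rule finite_energy_measure_mono[OF tv]; use sf sets in \<open>simp add: z total_variation_def emeasure_add_measure\<close>)+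
  have car: "AE x in a'. x \<in> - D" "AE x in b'. x \<in> - D"
    using bal by (auto simp: balayage_def carried_by_def z')
  have cap: "emeasure a' K = 0" "emeasure b' K = 0" if "compact K" "inner_cap \<alpha> K = 0" for K
  proof -
    have "emeasure (add_measure a' b') K = 0" using bal that by (auto simp: balayage_def cap_abs_continuous_def total_variation_def z')
    then show "emeasure a' K = 0" "emeasure b' K = 0"
      using that(1) sets by (auto simp: emeasure_add_measure borel_compact)
  qed
  let ?P = "\<lambda>x. potential_defined \<alpha> \<zeta>' x \<and> potential_defined \<alpha> \<zeta> x \<and> signed_potential \<alpha> \<zeta>' x = signed_potential \<alpha> \<zeta> x"
  have eq: "AE x in \<tau>. potential \<alpha> a' x + potential \<alpha> b x = potential \<alpha> a x + potential \<alpha> b' x \<and> ?p x < \<infinity>" if \<tau>: "energy_on (- D) \<tau>" for \<tau>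
  proof -
    have "AE x in \<tau>. ?P x"
    proof (rule nearly_everywhere_AE[OF _ \<tau>])
      show "nearly_everywhere_on \<alpha> (- D) ?P" using bal by (simp add: balayage_def)
      show "{x. \<not> ?P x} \<in> sets borel" unfolding potential_defined_def signed_potential_def z z' fst_conv snd_conv by measurable
    qed (use A in simp)
    then show ?thesis
      using radon[THEN radon_potential_AE_finite[OF _ \<tau>]]
    proof eventually_elim
      fix x assume P: "?P x" and fin: "potential \<alpha> a x < \<infinity>" "potential \<alpha> b x < \<infinity>" "potential \<alpha> a' x < \<infinity>" "potential \<alpha> b' x < \<infinity>"
      then have "enn2ereal (potential \<alpha> a' x) - enn2ereal (potential \<alpha> b' x) = enn2ereal (potential \<alpha> a x) - enn2ereal (potential \<alpha> b x)"
        by (simp add: signed_potential_def z z')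
      with enn2ereal_diff_eq_iff[OF fin(3,4,1,2)] fin
      show "potential \<alpha> a' x + potential \<alpha> b x = ?p x \<and> ?p x < \<infinity>" by simp
    qed
  qed
  show "AE x in \<tau>. f x = 0" if "energy_on (- D) \<tau>" for \<tau>
    using eq[OF that]
  proof eventually_elim
    fix x assume *: "potential \<alpha> a' x + potential \<alpha> b x = ?p x \<and> ?p x < \<infinity>"
    then have "?m x = ?p x" by (simp add: add.commute)
    moreover obtain r where "?p x = ennreal r" "0 \<le> r" using * by (cases "?p x") auto
    ultimately show "f x = 0" unfolding fx by (simp add: enn2ereal_ennreal)
  qed
  have eq': "AE x in \<tau>. potential \<alpha> b' x + potential \<alpha> a x = potential \<alpha> b x + potential \<alpha> a' x" if "energy_on (- D) \<tau>" for \<tau>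
    using eq[OF that] by eventually_elim (simp add: add.commute)
  fix \<gamma> assume \<gamma>: "energy_on UNIV \<gamma>"
  have "pos_part f \<gamma> = (\<integral>\<^sup>+x. ?p x - ?m x \<partial>\<gamma>)"
    unfolding pos_part_def fx e2ennreal_diff_enn2ereal ..
  also have "\<dots> \<le> (\<integral>\<^sup>+x. potential \<alpha> a x \<partial>\<gamma>)"
    by (rule field_one_sided_bound[OF A q thin radon(2,1,4,3) car(2,1) cap(2,1) _ \<gamma>]) (use eq' in auto)
  finally show "pos_part f \<gamma> \<le> mutual_energy \<alpha> \<gamma> (fst \<zeta>)" by (simp add: mutual_energy_potential z)
  have "neg_part f \<gamma> \<le> (\<integral>\<^sup>+x. ?m x - ?p x \<partial>\<gamma>)"
    unfolding neg_part_def fx by (intro nn_integral_mono e2ennreal_minus_diff_le)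
  also have "\<dots> \<le> (\<integral>\<^sup>+x. potential \<alpha> b x \<partial>\<gamma>)"
    by (rule field_one_sided_bound[OF A q thin radon car cap _ \<gamma>]) (use eq in \<open>auto elim!: eventually_mono\<close>)
  finally show "neg_part f \<gamma> \<le> mutual_energy \<alpha> \<gamma> (snd \<zeta>)" by (simp add: mutual_energy_potential z)
qed

text \<open>What both kinds of fields have in common; the second component of an admissible measure
  then contributes nothing to the field integral.\<close>

definition field_vanishing_on :: "'a set \<Rightarrow> ('a \<Rightarrow> ereal) \<Rightarrow> bool" where
  "field_vanishing_on A f \<longleftrightarrow> f \<in> borel_measurable borel \<and> (\<forall>\<tau>. energy_on A \<tau> \<longrightarrow> (AE x in \<tau>. f x = 0))"

lemma energy_on_unit:
  assumes s: "sets \<mu> = sets borel" and A: "A \<in> sets borel" and car: "carried_by \<mu> A"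
    and m: "emeasure \<mu> A < \<infinity>" and E: "mutual_energy \<alpha> \<mu> (\<mu> :: 'a measure) < \<infinity>"
  shows "energy_on A \<mu>" "emeasure \<mu> UNIV = emeasure \<mu> A"
proof -
  have 0: "emeasure \<mu> (- A) = 0" using car AE_in_iff[OF s A] by (simp add: carried_by_def)
  show eq: "emeasure \<mu> UNIV = emeasure \<mu> A"
    by (rule emeasure_eq_AE) (use car s A in \<open>auto simp: carried_by_def\<close>)
  show "energy_on A \<mu>" unfolding energy_on_def using s 0 m E eq by simp
qed

lemma integral_real_of_ereal:
  assumes s: "sets \<sigma> = sets borel" and f[measurable]: "f \<in> borel_measurable borel"
    and fin: "pos_part f \<sigma> < \<infinity>" "neg_part f \<sigma> < \<infinity>"
  shows "(\<integral>x. real_of_ereal (f x) \<partial>\<sigma>) = enn2real (pos_part f \<sigma>) - enn2real (neg_part f \<sigma>)"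
proof -
  note [measurable_cong] = s
  have "AE x in \<sigma>. e2ennreal (f x) \<noteq> \<infinity>" by (rule nn_integral_PInf_AE) (use fin in \<open>auto simp: pos_part_def\<close>)
  moreover have "AE x in \<sigma>. e2ennreal (- f x) \<noteq> \<infinity>" by (rule nn_integral_PInf_AE) (use fin in \<open>auto simp: neg_part_def\<close>)
  ultimately have r: "AE x in \<sigma>. f x = ereal (real_of_ereal (f x))"
    by eventually_elim (metis abs_ereal.elims e2ennreal_infty ereal_real real_of_ereal.elims ereal_uminus_eq_reorder infinity_ennreal_def uminus_ereal.simps(3))
  have p: "(\<integral>\<^sup>+x. ennreal (real_of_ereal (f x)) \<partial>\<sigma>) = pos_part f \<sigma>"
    unfolding pos_part_def by (rule nn_integral_cong_AE, use r in eventually_elim) (metis e2ennreal_ereal)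
  have n: "(\<integral>\<^sup>+x. ennreal (- real_of_ereal (f x)) \<partial>\<sigma>) = neg_part f \<sigma>"
    unfolding neg_part_def by (rule nn_integral_cong_AE, use r in eventually_elim) (metis e2ennreal_ereal uminus_ereal.simps(1))
  have "integrable \<sigma> (\<lambda>x. real_of_ereal (f x))"
    unfolding real_integrable_def p n using fin by (auto simp: less_top)
  from real_lebesgue_integral_def[OF this] show ?thesis unfolding p n .
qed

text \<open>The passage from signed measures to pairs of positive measures, in which the minimum
  problem is solved.\<close>

lemma admissibleD:
  assumes A1: "A1 \<in> sets borel" and A: "A \<in> sets borel" and f: "field_vanishing_on A f" and \<mu>: "\<mu> \<in> admissible \<alpha> A1 A \<xi> f"
  shows "energy_on A1 (fst \<mu>)" "emeasure (fst \<mu>) UNIV = 1" "pos_part f (fst \<mu>) < \<infinity>" "neg_part f (fst \<mu>) < \<infinity>"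
    "energy_on A (snd \<mu>)" "emeasure (snd \<mu>) UNIV = 1" "weighted_energy \<alpha> f \<mu> = pair_energy f (fst \<mu>) (snd \<mu>)"
    "adm_pair \<xi> A f (fst \<mu>) (snd \<mu>)"
proof -
  have [measurable]: "f \<in> borel_measurable borel" using f by (simp add: field_vanishing_on_def)
  have sr: "signed_radon \<alpha> \<mu>" and E: "mutual_energy \<alpha> (total_variation \<mu>) (total_variation \<mu>) < \<infinity>"
    and car: "carried_by (fst \<mu>) A1" "carried_by (snd \<mu>) A" and mass: "emeasure (fst \<mu>) A1 = 1" "emeasure (snd \<mu>) A = 1"
    and le: "\<And>B. B \<in> sets borel \<Longrightarrow> emeasure (fst \<mu>) B \<le> emeasure \<xi> B" and int: "field_integrable f \<mu>"
    using \<mu> by (auto simp: admissible_def condenser_measures_def finite_energy_def)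
  have s: "sets (fst \<mu>) = sets borel" "sets (snd \<mu>) = sets borel"
    using sr by (auto simp: signed_radon_def radon_measure_def)
  have "mutual_energy \<alpha> (fst \<mu>) (fst \<mu>) \<le> mutual_energy \<alpha> (total_variation \<mu>) (total_variation \<mu>)"
    by (rule mutual_energy_mono) (auto simp: total_variation_def emeasure_add_measure s)
  moreover have "mutual_energy \<alpha> (snd \<mu>) (snd \<mu>) \<le> mutual_energy \<alpha> (total_variation \<mu>) (total_variation \<mu>)"
    by (rule mutual_energy_mono) (auto simp: total_variation_def emeasure_add_measure s)
  ultimately have E': "mutual_energy \<alpha> (fst \<mu>) (fst \<mu>) < \<infinity>" "mutual_energy \<alpha> (snd \<mu>) (snd \<mu>) < \<infinity>"
    using E by (auto intro: le_less_trans)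
  show 1: "energy_on A1 (fst \<mu>)" "energy_on A (snd \<mu>)"
    using energy_on_unit(1)[OF s(1) A1 car(1) _ E'(1)] energy_on_unit(1)[OF s(2) A car(2) _ E'(2)] mass by auto
  show m: "emeasure (fst \<mu>) UNIV = 1" "emeasure (snd \<mu>) UNIV = 1"
    using energy_on_unit(2)[OF s(1) A1 car(1) _ E'(1)] energy_on_unit(2)[OF s(2) A car(2) _ E'(2)] mass by auto
  have "(\<integral>\<^sup>+x. e2ennreal \<bar>f x\<bar> \<partial>fst \<mu>) < \<infinity>"
    using int by (auto simp: field_integrable_def total_variation_def nn_integral_add_measure s)
  moreover have "f x \<le> \<bar>f x\<bar>" "- f x \<le> \<bar>f x\<bar>" for x by (cases "f x"; simp)+
  then have "pos_part f (fst \<mu>) \<le> (\<integral>\<^sup>+x. e2ennreal \<bar>f x\<bar> \<partial>fst \<mu>)" "neg_part f (fst \<mu>) \<le> (\<integral>\<^sup>+x. e2ennreal \<bar>f x\<bar> \<partial>fst \<mu>)"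
    unfolding pos_part_def neg_part_def by (intro nn_integral_mono e2ennreal_mono; simp)+
  ultimately show fin: "pos_part f (fst \<mu>) < \<infinity>" "neg_part f (fst \<mu>) < \<infinity>" by (auto intro: le_less_trans)
  have "AE x in snd \<mu>. f x = 0" using f 1(2) by (simp add: field_vanishing_on_def)
  then have "(\<integral>x. real_of_ereal (f x) \<partial>snd \<mu>) = 0" by (intro integral_eq_zero_AE) (auto elim!: eventually_mono)
  then show "weighted_energy \<alpha> f \<mu> = pair_energy f (fst \<mu>) (snd \<mu>)"
    using en_commute[OF energy_onD(4)[OF 1(2)] energy_onD(4)[OF 1(1)]] integral_real_of_ereal[OF s(1) _ fin]
    by (simp add: weighted_energy_def signed_energy_def field_integral_def pair_energy_def en_def)
  show "adm_pair \<xi> A f (fst \<mu>) (snd \<mu>)" unfolding adm_pair_def using s le m fin 1 by simp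
qed

lemma admissibleI:
  assumes A1: "A1 \<in> sets borel" and A: "A \<in> sets borel" and dis: "A1 \<inter> A = {}" and f: "field_vanishing_on A f"
    and \<sigma>: "energy_on A1 \<sigma>" "emeasure \<sigma> UNIV = 1" "\<And>B. B \<in> sets borel \<Longrightarrow> emeasure \<sigma> B \<le> emeasure \<xi> B"
    and fin: "pos_part f \<sigma> < \<infinity>" "neg_part f \<sigma> < \<infinity>" and \<nu>: "energy_on A \<nu>" "emeasure \<nu> UNIV = 1"
  shows "(\<sigma>, \<nu>) \<in> admissible \<alpha> A1 A \<xi> f"
proof -
  have [measurable]: "f \<in> borel_measurable borel" using f by (simp add: field_vanishing_on_def)
  note s = energy_onD[OF \<sigma>(1)] and n = energy_onD[OF \<nu>(1)]
  note [measurable_cong] = s(1) n(1)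
  \<comment> \<open>The set A1 itself separates the two parts, as a Hahn-Jordan decomposition
    requires.\<close>
  have "emeasure \<nu> A1 \<le> emeasure \<nu> (- A)" by (rule emeasure_mono) (use dis A n in auto)
  then have "signed_radon \<alpha> (\<sigma>, \<nu>)"
    unfolding signed_radon_def using radon_measure_energy_on[OF \<sigma>(1)] radon_measure_energy_on[OF \<nu>(1)] s n A1
    by (auto intro!: bexI[of _ A1])
  moreover have "finite_energy_measure (add_measure \<sigma> \<nu>)" by (intro finite_energy_measure_add s n)
  moreover have car: "AE x in \<sigma>. x \<in> A1" "AE x in \<nu>. x \<in> A"
    using energy_on_AE[OF \<sigma>(1) A1] energy_on_AE[OF \<nu>(1) A] by auto
  moreover have "emeasure \<sigma> A1 = emeasure \<sigma> UNIV" by (rule emeasure_eq_AE) (use car s A1 in auto)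
  moreover have "emeasure \<nu> A = emeasure \<nu> UNIV" by (rule emeasure_eq_AE) (use car n A in auto)
  moreover have "field_integrable f (\<sigma>, \<nu>)"
  proof -
    have "(\<integral>\<^sup>+x. e2ennreal \<bar>f x\<bar> \<partial>\<sigma>) \<le> (\<integral>\<^sup>+x. e2ennreal (f x) + e2ennreal (- f x) \<partial>\<sigma>)"
    proof (rule nn_integral_mono)
      fix x
      have "\<bar>f x\<bar> = f x \<or> \<bar>f x\<bar> = - f x" by (cases "f x") auto
      then show "e2ennreal \<bar>f x\<bar> \<le> e2ennreal (f x) + e2ennreal (- f x)" by (auto simp: add_increasing add_increasing2)
    qed
    also have "\<dots> = pos_part f \<sigma> + neg_part f \<sigma>" unfolding pos_part_def neg_part_def by (rule nn_integral_add) measurable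
    finally have 1: "(\<integral>\<^sup>+x. e2ennreal \<bar>f x\<bar> \<partial>\<sigma>) < \<infinity>" using fin by (auto intro: le_less_trans)
    have "AE x in \<nu>. f x = 0" using f \<nu> by (simp add: field_vanishing_on_def)
    then have "(\<integral>\<^sup>+x. e2ennreal \<bar>f x\<bar> \<partial>\<nu>) = (\<integral>\<^sup>+x. 0 \<partial>\<nu>)" by (intro nn_integral_cong_AE) (auto elim!: eventually_mono simp: e2ennreal_neg)
    moreover have "f \<in> borel_measurable (add_measure \<sigma> \<nu>)"
      using s by (simp add: measurable_cong_sets[of "add_measure \<sigma> \<nu>" borel])
    ultimately show ?thesis using 1 s n by (simp add: field_integrable_def total_variation_def nn_integral_add_measure)
  qed
  ultimately show ?thesis
    unfolding admissible_def condenser_measures_def finite_energy_def carried_by_def total_variation_def mem_Collect_eq fst_conv snd_conv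
    using \<sigma> \<nu> finite_energy_measureD(2) by auto
qed

theorem solvable_of_finite_constraint:
  assumes A: "closed A" and q: "0 < q" "q < 1" and thin: "\<not> thin_at_infinity \<alpha> q A"
    and A1: "A1 \<in> sets borel" and dis: "A1 \<inter> A = {}" and \<xi>: "\<xi> \<in> constraints \<alpha> A1" "emeasure \<xi> A1 < \<infinity>"
    and f: "field_vanishing_on A f" and N: "energy_on UNIV \<xi> \<Longrightarrow> neg_part f \<xi> < \<infinity>" and ne: "admissible \<alpha> A1 A \<xi> f \<noteq> {}"
  shows "solvable \<alpha> A1 A \<xi> f"
proof -
  have Ab: "A \<in> sets borel" using A by simp
  have x: "sets \<xi> = sets borel" using \<xi> by (auto simp: constraints_def finite_energy_pos_def radon_measure_def)
  have \<xi>1: "energy_on A1 \<xi>"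
    by (rule energy_on_unit(1)) (use \<xi> A1 x in \<open>auto simp: constraints_def finite_energy_pos_def\<close>)
  note \<xi>U = energy_on_UNIV[OF \<xi>1]
  have fb: "f \<in> borel_measurable borel" using f by (simp add: field_vanishing_on_def)
  obtain \<mu>0 where "\<mu>0 \<in> admissible \<alpha> A1 A \<xi> f" using ne by blast
  note a0 = admissibleD(8)[OF A1 Ab f this]
  obtain \<sigma> \<nu> where adm: "adm_pair \<xi> A f \<sigma> \<nu>" and min: "\<And>\<sigma>' \<nu>'. adm_pair \<xi> A f \<sigma>' \<nu>' \<Longrightarrow> pair_energy f \<sigma> \<nu> \<le> pair_energy f \<sigma>' \<nu>'"
    by (rule pair_minimizer[OF A q thin \<xi>U fb N[OF \<xi>U] a0]) (rule that)
  have p: "sets \<sigma> = sets borel" "\<And>B. B \<in> sets borel \<Longrightarrow> emeasure \<sigma> B \<le> emeasure \<xi> B" "emeasure \<sigma> UNIV = 1" "pos_part f \<sigma> < \<infinity>" "energy_on A \<nu>" "emeasure \<nu> UNIV = 1"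
    using adm by (auto simp: adm_pair_def)
  have "neg_part f \<sigma> \<le> neg_part f \<xi>"
    unfolding neg_part_def by (rule nn_integral_mono_dominated[OF p(1) x p(2)])
  then have "neg_part f \<sigma> < \<infinity>" using N[OF \<xi>U] by (rule le_less_trans)
  then have mem: "(\<sigma>, \<nu>) \<in> admissible \<alpha> A1 A \<xi> f"
    by (intro admissibleI A1 Ab dis f p energy_on_mono[OF \<xi>1])
  have "ereal (weighted_energy \<alpha> f (\<sigma>, \<nu>)) \<le> min_weighted_energy \<alpha> A1 A \<xi> f"
    unfolding min_weighted_energy_def
  proof (rule INF_greatest)
    fix \<mu> assume \<mu>: "\<mu> \<in> admissible \<alpha> A1 A \<xi> f"
    show "ereal (weighted_energy \<alpha> f (\<sigma>, \<nu>)) \<le> ereal (weighted_energy \<alpha> f \<mu>)"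
      using min[OF admissibleD(8)[OF A1 Ab f \<mu>]] admissibleD(7)[OF A1 Ab f \<mu>] admissibleD(7)[OF A1 Ab f mem] by simp
  qed
  moreover have "min_weighted_energy \<alpha> A1 A \<xi> f \<le> ereal (weighted_energy \<alpha> f (\<sigma>, \<nu>))"
    unfolding min_weighted_energy_def by (rule INF_lower[OF mem])
  ultimately show ?thesis unfolding solvable_def using mem by (auto intro: antisym)
qed

end


section \<open>A constraint of infinite mass\<close>

context riesz_space
begin

text \<open>Distance zero forces equal evolutions at almost every time, and \<open>rtime\<close>
  charges every interval adjacent to 0; the factor 2 in the interval undoes the halving of
  times.\<close>

lemma heat_distance_0D:
  assumes \<sigma>: "energy_on UNIV \<sigma>" and \<nu>: "energy_on UNIV \<nu>" and 0: "heat_distance \<sigma> \<nu> = 0" and \<delta>: "0 < \<delta>"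
  shows "\<exists>s. 0 < s \<and> s \<le> \<delta> \<and> (AE z in lborel. heat s \<sigma> z = heat s \<nu> z)"
proof (rule ccontr)
  assume not: "\<not> ?thesis"
  note s = energy_onD[OF \<sigma>] and n = energy_onD[OF \<nu>]
  note [measurable (raw)] = heat_measurable[OF s(3)] heat_measurable[OF n(3)]
  let ?d = "\<lambda>t z. ennreal ((enn2real (heat (t/2) \<sigma> z) - enn2real (heat (t/2) \<nu> z))\<^sup>2)"
  have m: "(\<lambda>t. \<integral>\<^sup>+z. ?d t z \<partial>lborel) \<in> borel_measurable borel"
    by (rule sigma_finite_measure.borel_measurable_nn_integral[OF sigma_finite_lborel]) measurable
  have "AE t in rtime C \<alpha>. (\<integral>\<^sup>+z. ?d t z \<partial>lborel) = 0"
    using 0 unfolding heat_distance_def by (subst (asm) nn_integral_0_iff_AE) (use m in auto)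
  then have "AE t in rtime C \<alpha>. t \<notin> {0<..2 * \<delta>}"
  proof eventually_elim
    fix t assume I: "(\<integral>\<^sup>+z. ?d t z \<partial>lborel) = 0"
    show "t \<notin> {0<..2 * \<delta>}"
    proof
      assume t: "t \<in> {0<..2 * \<delta>}"
      have "AE z in lborel. ?d t z = 0" using I by (subst (asm) nn_integral_0_iff_AE) measurable
      then have "AE z in lborel. heat (t/2) \<sigma> z = heat (t/2) \<nu> z"
      proof eventually_elim
        fix z assume "?d t z = 0"
        then have "enn2real (heat (t/2) \<sigma> z) = enn2real (heat (t/2) \<nu> z)" by simp
        moreover have "ennreal (enn2real (heat (t/2) \<sigma> z)) = heat (t/2) \<sigma> z" "ennreal (enn2real (heat (t/2) \<nu> z)) = heat (t/2) \<nu> z"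
          using heat_finite[OF s(1,2), of "t/2" z] heat_finite[OF n(1,2), of "t/2" z] t by (auto intro!: ennreal_enn2real simp: less_top)
        ultimately show "heat (t/2) \<sigma> z = heat (t/2) \<nu> z" by metis
      qed
      with not t show False by (auto dest: spec[of _ "t/2"])
    qed
  qed
  then have "emeasure (rtime C \<alpha>) {0<..2 * \<delta>} = 0"
    by (subst (asm) AE_iff_measurable[of "{0<..2 * \<delta>}"]) auto
  then show False
    using emeasure_rtime_interval[of \<alpha> C "2 * \<delta>"] alpha C \<delta> by (simp add: ennreal_eq_0_iff mult_le_0_iff divide_le_0_iff)
qed

text \<open>Equal evolutions at times tending to 0 would identify the measures. Fatou recovers
  integrals only from below, so a function and its complement to 1 are tested together: the lower
  bound for one is an upper bound for the other.\<close>

lemma heat_distance_pos: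
  assumes A: "closed A" "A \<noteq> {}" and \<sigma>: "energy_on (- A) \<sigma>" "emeasure \<sigma> UNIV = 1" and \<nu>: "energy_on A \<nu>" "emeasure \<nu> UNIV = 1"
  shows "heat_distance \<sigma> \<nu> \<noteq> 0"
proof
  assume 0: "heat_distance \<sigma> \<nu> = 0"
  note s = energy_onD[OF \<sigma>(1)] and n = energy_onD[OF \<nu>(1)]
  note [measurable_cong] = s(1) n(1)
  note [measurable (raw)] = heat_measurable[OF s(3)] heat_measurable[OF n(3)]
  \<comment> \<open>Zero on A and positive off A; hence \<psi> = 1 holds \<nu>-almost
    everywhere.\<close>
  define u where "u x = min 1 (infdist x A)" for x
  have u01: "0 \<le> u x" "u x \<le> 1" for x by (auto simp: u_def infdist_nonneg)
  have uc: "continuous_on UNIV u" unfolding u_def by (intro continuous_intros)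
  define \<phi> where "\<phi> x = ennreal (u x)" for x
  define \<psi> where "\<psi> x = ennreal (1 - u x)" for x
  have c: "continuous_on UNIV \<phi>" "continuous_on UNIV \<psi>"
    unfolding \<phi>_def \<psi>_def by (intro continuous_on_ennreal continuous_intros uc)+
  have [measurable]: "\<phi> \<in> borel_measurable borel" "\<psi> \<in> borel_measurable borel"
    using c by (auto intro: borel_measurable_continuous_onI)
  have lsc: "open {y. c < \<phi> y}" "open {y. c < \<psi> y}" for c
    using c by (auto intro!: open_Collect_less continuous_on_const)
  have sum1: "\<phi> x + \<psi> x = 1" for x unfolding \<phi>_def \<psi>_def using u01[of x] by (subst ennreal_plus[symmetric]) auto
  have "\<forall>k. \<exists>t. 0 < t \<and> t \<le> inverse (real (Suc k)) \<and> (AE z in lborel. heat t \<sigma> z = heat t \<nu> z)"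
    using heat_distance_0D[OF energy_on_UNIV[OF \<sigma>(1)] energy_on_UNIV[OF \<nu>(1)] 0] by simp
  then obtain t where t: "\<And>k. 0 < t k" "\<And>k. t k \<le> inverse (real (Suc k))" "\<And>k. AE z in lborel. heat (t k) \<sigma> z = heat (t k) \<nu> z"
    by metis
  have t0: "\<forall>\<^sub>F k in sequentially. t k \<le> \<delta>" if "0 < \<delta>" for \<delta>
  proof -
    have "\<forall>\<^sub>F k in sequentially. inverse (real (Suc k)) < \<delta>"
      using LIMSEQ_inverse_real_of_nat that by (rule order_tendstoD(2))
    then show ?thesis
    proof eventually_elim
      fix k assume "inverse (real (Suc k)) < \<delta>"
      with t(2)[of k] show "t k \<le> \<delta>" by linarith
    qed
  qed
  define P where "P k h x = (\<integral>\<^sup>+y. ennreal (gauss (t k) (x - y)) * h y \<partial>lborel)" for k and h :: "'a \<Rightarrow> ennreal" and x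
  have P_liminf: "h x \<le> liminf (\<lambda>k. P k h x)" if "\<And>c. open {y. c < h y}" for h x
  proof (rule dense_le)
    fix c assume "c < h x"
    from gauss_lsc[of h, OF that this] obtain \<delta> where \<delta>: "0 < \<delta>" "\<And>t. 0 < t \<Longrightarrow> t \<le> \<delta> \<Longrightarrow> c \<le> (\<integral>\<^sup>+y. ennreal (gauss t (x - y)) * h y \<partial>lborel)"
      by auto
    show "c \<le> liminf (\<lambda>k. P k h x)"
      by (rule Liminf_bounded, use t0[OF \<delta>(1)] in eventually_elim) (use \<delta>(2) t(1) in \<open>auto simp: P_def\<close>)
  qed
  have Pm: "P k h \<in> borel_measurable borel" if [measurable]: "h \<in> borel_measurable borel" for k h
    unfolding P_def[abs_def] by (rule sigma_finite_measure.borel_measurable_nn_integral[OF sigma_finite_lborel]) measurable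
  have swap: "(\<integral>\<^sup>+x. P k h x \<partial>\<mu>) = (\<integral>\<^sup>+y. heat (t k) \<mu> y * h y \<partial>lborel)"
    if [measurable]: "h \<in> borel_measurable borel" and \<mu>: "sigma_finite_borel \<mu>" for k h \<mu>
  proof -
    note [measurable_cong] = sigma_finite_borelD(2)[OF \<mu>]
    have "(\<integral>\<^sup>+x. P k h x \<partial>\<mu>) = (\<integral>\<^sup>+y. (\<integral>\<^sup>+x. ennreal (gauss (t k) (x - y)) * h y \<partial>\<mu>) \<partial>lborel)"
      unfolding P_def by (rule Tonelli_borel[OF \<mu> sigma_finite_borel_lborel]) measurable
    also have "\<dots> = (\<integral>\<^sup>+y. heat (t k) \<mu> y * h y \<partial>lborel)"
    proof (rule nn_integral_cong)
      fix y
      show "(\<integral>\<^sup>+x. ennreal (gauss (t k) (x - y)) * h y \<partial>\<mu>) = heat (t k) \<mu> y * h y"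
        unfolding heat_def gauss_commute[of _ y] by (rule nn_integral_multc) measurable
    qed
    finally show ?thesis .
  qed
  have same: "(\<integral>\<^sup>+x. P k h x \<partial>\<sigma>) = (\<integral>\<^sup>+x. P k h x \<partial>\<nu>)" if "h \<in> borel_measurable borel" for k h
    unfolding swap[OF that s(3)] swap[OF that n(3)]
    by (rule nn_integral_cong_AE, use t(3)[of k] in eventually_elim) simp
  have fatou: "(\<integral>\<^sup>+x. h x \<partial>\<mu>) \<le> liminf (\<lambda>k. \<integral>\<^sup>+x. P k h x \<partial>\<mu>)"
    if h[measurable]: "h \<in> borel_measurable borel" and op: "\<And>c. open {y. c < h y}" and \<mu>: "sets \<mu> = sets borel" for h and \<mu> :: "'a measure"
  proof -
    note [measurable_cong] = \<mu>
    note [measurable] = Pm[OF h]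
    have "(\<integral>\<^sup>+x. h x \<partial>\<mu>) \<le> (\<integral>\<^sup>+x. liminf (\<lambda>k. P k h x) \<partial>\<mu>)" by (intro nn_integral_mono P_liminf op)
    also have "\<dots> \<le> liminf (\<lambda>k. \<integral>\<^sup>+x. P k h x \<partial>\<mu>)" by (rule nn_integral_liminf) measurable
    finally show ?thesis .
  qed
  let ?a = "\<lambda>k. \<integral>\<^sup>+x. P k \<phi> x \<partial>\<sigma>" and ?b = "\<lambda>k. \<integral>\<^sup>+x. P k \<psi> x \<partial>\<sigma>"
  have ab: "?a k + ?b k = 1" for k
  proof -
    note [measurable] = Pm
    have 1: "P k \<phi> x + P k \<psi> x = 1" for x
    proof -
      have "P k \<phi> x + P k \<psi> x = (\<integral>\<^sup>+y. ennreal (gauss (t k) (x - y)) * \<phi> y + ennreal (gauss (t k) (x - y)) * \<psi> y \<partial>lborel)"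
        unfolding P_def by (rule nn_integral_add[symmetric]) measurable
      also have "\<dots> = (\<integral>\<^sup>+y. ennreal (gauss (t k) (x - y)) \<partial>lborel)"
        by (simp add: distrib_left[symmetric] sum1)
      also have "\<dots> = (\<integral>\<^sup>+y. ennreal (gauss (t k) (y :: 'a)) \<partial>lborel)" by (rule nn_integral_lborel_reflect) measurable
      also have "\<dots> = 1" by (rule nn_integral_gauss[OF t(1)])
      finally show ?thesis .
    qed
    have "?a k + ?b k = (\<integral>\<^sup>+x. P k \<phi> x + P k \<psi> x \<partial>\<sigma>)" by (rule nn_integral_add[symmetric]) measurable
    also have "\<dots> = 1" unfolding 1 using \<sigma>(2) sets_eq_imp_space_eq[OF s(1)] by simp
    finally show ?thesis .
  qed
  have a: "(\<integral>\<^sup>+x. \<phi> x \<partial>\<sigma>) \<le> liminf ?a" by (rule fatou) (use lsc s in auto)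
  have "AE x in \<nu>. \<psi> x = 1"
    using energy_on_AE[OF \<nu>(1)] A by (auto elim!: eventually_mono simp: \<psi>_def u_def)
  then have "(\<integral>\<^sup>+x. \<psi> x \<partial>\<nu>) = (\<integral>\<^sup>+x. 1 \<partial>\<nu>)" by (rule nn_integral_cong_AE)
  also have "\<dots> = 1" using \<nu>(2) sets_eq_imp_space_eq[OF n(1)] by simp
  finally have "1 = (\<integral>\<^sup>+x. \<psi> x \<partial>\<nu>)" by simp
  also have "\<dots> \<le> liminf (\<lambda>k. \<integral>\<^sup>+x. P k \<psi> x \<partial>\<nu>)" by (rule fatou) (use lsc n in auto)
  also have "\<dots> = liminf ?b" by (simp add: same)
  finally have b: "1 \<le> liminf ?b" .
  \<comment> \<open>On the \<nu> side the averages of \<psi> tend to full mass, and they are shared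
    by \<sigma>; nothing is left for \<phi>, although \<phi> is positive on the carrier of
    \<sigma>.\<close>
  have "(\<integral>\<^sup>+x. \<phi> x \<partial>\<sigma>) = 0"
  proof (rule ccontr)
    assume "(\<integral>\<^sup>+x. \<phi> x \<partial>\<sigma>) \<noteq> 0"
    then have "0 < liminf ?a" using a by (metis le_zero_eq zero_less_iff_neq_zero)
    then obtain c where c: "0 < c" "c < liminf ?a" using dense by blast
    have "\<forall>\<^sub>F k in sequentially. ?b k \<le> 1 - c"
      using less_LiminfD[OF c(2)]
    proof eventually_elim
      fix k assume k: "c < ?a k"
      have le: "?a k \<le> 1" using ab[of k] by (metis le_iff_add)
      have "?a k \<noteq> \<infinity>" using le by (auto simp: top_unique)
      then have "?b k = 1 - ?a k" unfolding ab[of k, symmetric] by simp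
      then show "?b k \<le> 1 - c" using k by (simp add: ennreal_minus_mono)
    qed
    then have "liminf ?b \<le> 1 - c" by (intro Liminf_le) simp_all
    with b have 1: "1 \<le> 1 - c" by (rule order_trans)
    have "1 - c < 1"
    proof (cases "c < 1")
      case True
      then obtain r where "c = ennreal r" "0 \<le> r" "r < 1" by (cases c) (auto simp: ennreal_less_one_iff)
      with c(1) show ?thesis by (simp add: ennreal_minus ennreal_1[symmetric] ennreal_less_iff del: ennreal_1)
    qed (simp add: diff_eq_0_ennreal not_less diff_eq_0_iff_ennreal)
    with 1 show False by simp
  qed
  then have "AE x in \<sigma>. \<phi> x = 0" by (subst (asm) nn_integral_0_iff_AE) measurable
  moreover have "AE x in \<sigma>. x \<notin> A" using energy_on_AE[OF \<sigma>(1)] A by simp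
  ultimately have "AE x in \<sigma>. False"
  proof eventually_elim
    fix x assume "\<phi> x = 0" "x \<notin> A"
    moreover have "0 < infdist x A" using A \<open>x \<notin> A\<close> infdist_pos_not_in_closed by blast
    ultimately show False by (simp add: \<phi>_def u_def ennreal_eq_0_iff)
  qed
  then have "emeasure \<sigma> (space \<sigma>) = 0" by (simp add: AE_iff_null null_sets_def)
  then show False using \<sigma>(2) sets_eq_imp_space_eq[OF s(1)] by simp
qed

text \<open>On a bounded set the kernel is bounded below, so the energy dominates a multiple of the
  squared mass.\<close>

lemma compact_emeasure_finite_energy:
  assumes s: "sets \<xi> = sets borel" and E: "mutual_energy \<alpha> \<xi> \<xi> < \<infinity>" and K: "compact K"
  shows "emeasure \<xi> (K :: 'a set) < \<infinity>"
proof -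
  note [measurable_cong] = s
  have Kb[measurable]: "K \<in> sets borel" using K by (simp add: borel_compact)
  obtain R where R: "0 < R" "\<And>x. x \<in> K \<Longrightarrow> norm x \<le> R" using compact_imp_bounded[OF K] by (auto simp: bounded_pos)
  define c where "c = ennreal ((2 * R) powr (\<alpha> - real DIM('a)))"
  have ker: "c \<le> riesz_kernel \<alpha> x y" if "x \<in> K" "y \<in> K" for x y
  proof (cases "x = y")
    case False
    have "norm (x - y) \<le> 2 * R" using norm_triangle_ineq4[of x y] R(2)[OF that(1)] R(2)[OF that(2)] by linarith
    then have "(2 * R) powr (\<alpha> - real DIM('a)) \<le> norm (x - y) powr (\<alpha> - real DIM('a))"
      by (intro powr_mono2') (use False alpha_less_dim in auto)
    then show ?thesis using False by (simp add: c_def riesz_kernel_def ennreal_leI)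
  qed (simp add: riesz_kernel_def)
  have "c * emeasure \<xi> K * indicator K x \<le> potential \<alpha> \<xi> x" for x
  proof (cases "x \<in> K")
    case True
    have "c * emeasure \<xi> K = (\<integral>\<^sup>+y. c * indicator K y \<partial>\<xi>)" by (simp add: nn_integral_cmult_indicator)
    also have "\<dots> \<le> potential \<alpha> \<xi> x"
      unfolding potential_def by (rule nn_integral_mono) (use ker True in \<open>auto simp: indicator_def\<close>)
    finally show ?thesis using True by simp
  qed simp
  then have "(\<integral>\<^sup>+x. c * emeasure \<xi> K * indicator K x \<partial>\<xi>) \<le> mutual_energy \<alpha> \<xi> \<xi>"
    unfolding mutual_energy_potential by (intro nn_integral_mono)
  also have "(\<integral>\<^sup>+x. c * emeasure \<xi> K * indicator K x \<partial>\<xi>) = c * emeasure \<xi> K * emeasure \<xi> K"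
    by (rule nn_integral_cmult_indicator) simp
  finally have "c * emeasure \<xi> K * emeasure \<xi> K < \<infinity>" using E by (rule le_less_trans)
  moreover have "c \<noteq> 0" using R by (simp add: c_def ennreal_eq_0_iff)
  ultimately show ?thesis by (auto simp: ennreal_mult_less_top ennreal_mult_eq_top_iff less_top)
qed

text \<open>The energy norms are at most 2^-k, hence summable, so the sum has finite energy; each
  summand adds mass 1.\<close>

lemma constraint_of_infinite_mass:
  assumes A1: "A1 \<in> sets borel" and cap: "inner_cap \<alpha> A1 = \<infinity>"
  obtains \<xi> :: "'a measure" and \<mu> where "\<xi> \<in> constraints \<alpha> A1" "emeasure \<xi> A1 = \<infinity>"
    "\<And>k. energy_on A1 (\<mu> k)" "\<And>k. emeasure (\<mu> k) UNIV = 1" "\<And>k. en (\<mu> k) (\<mu> k) \<le> ((1/2) ^ k)\<^sup>2"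
    "\<And>k B. B \<in> sets borel \<Longrightarrow> emeasure (\<mu> k) B \<le> emeasure \<xi> B"
proof -
  have "\<exists>\<mu> :: 'a measure. energy_on A1 \<mu> \<and> emeasure \<mu> UNIV = 1 \<and> mutual_energy \<alpha> \<mu> \<mu> < ennreal (1 / (2 ^ k)\<^sup>2)" for k :: nat
  proof -
    have "ennreal ((2 ^ k)\<^sup>2) < inner_cap \<alpha> A1" "(0::real) < (2 ^ k)\<^sup>2" by (simp_all add: cap)
    from inner_cap_measure[OF A1 this] show ?thesis by blast
  qed
  then obtain \<mu> where \<mu>: "\<And>k. energy_on A1 (\<mu> k)" "\<And>k. emeasure (\<mu> k) UNIV = 1"
    and \<mu>E: "\<And>k. mutual_energy \<alpha> (\<mu> k) (\<mu> k) < ennreal (1 / (2 ^ k)\<^sup>2)"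
    by metis
  note m = energy_onD[OF \<mu>(1)]
  have en: "en (\<mu> k) (\<mu> k) \<le> ((1/2) ^ k)\<^sup>2" for k
  proof -
    have "en (\<mu> k) (\<mu> k) < 1 / (2 ^ k)\<^sup>2" using \<mu>E[of k] by (simp add: ennreal_en m ennreal_less_iff)
    then show ?thesis by (simp add: power_one_over)
  qed
  have en2: "en (\<mu> k) (\<mu> j) \<le> (1/2) ^ k * (1/2) ^ j" for k j
  proof (rule power2_le_imp_le)
    have "(en (\<mu> k) (\<mu> j))\<^sup>2 \<le> en (\<mu> k) (\<mu> k) * en (\<mu> j) (\<mu> j)" by (rule en_Cauchy_Schwarz) (rule m)+
    also have "\<dots> \<le> ((1/2) ^ k)\<^sup>2 * ((1/2) ^ j)\<^sup>2" by (intro mult_mono en) auto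
    finally show "(en (\<mu> k) (\<mu> j))\<^sup>2 \<le> ((1/2) ^ k * (1/2) ^ j)\<^sup>2" by (simp add: power_mult_distrib)
  qed simp
  define \<xi> where "\<xi> = sum_measure \<mu>"
  have s: "sets \<xi> = sets borel" by (simp add: \<xi>_def)
  have emb: "emeasure \<xi> B = (\<Sum>k. emeasure (\<mu> k) B)" if "B \<in> sets borel" for B
    unfolding \<xi>_def by (rule emeasure_sum_measure[OF m(1) that])
  have le: "emeasure (\<mu> k) B \<le> emeasure \<xi> B" if "B \<in> sets borel" for k B
    unfolding emb[OF that] using sum_le_suminf[of "\<lambda>k. emeasure (\<mu> k) B" "{k}"] by simp
  have mA1: "emeasure (\<mu> k) A1 = 1" for k
  proof -
    have "emeasure (\<mu> k) A1 = emeasure (\<mu> k) UNIV"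
      by (rule emeasure_eq_AE) (use energy_on_AE[OF \<mu>(1) A1] m(1) A1 in auto)
    then show ?thesis by (simp add: \<mu>(2))
  qed
  have mass: "emeasure \<xi> A1 = \<infinity>"
    using nn_integral_count_space_nat[of "\<lambda>_. 1"] by (simp add: emb[OF A1] mA1)
  have g: "(\<Sum>k. ennreal ((1/2) ^ k)) = ennreal (\<Sum>k. (1/2) ^ k)"
    by (rule suminf_ennreal2) (auto intro: summable_geometric)
  have "mutual_energy \<alpha> \<xi> \<xi> = (\<Sum>k. \<integral>\<^sup>+x. potential \<alpha> \<xi> x \<partial>\<mu> k)"
  proof -
    have [measurable]: "potential \<alpha> \<xi> \<in> borel_measurable borel"
      unfolding \<xi>_def potential_sum_measure[OF m(1), abs_def] using m(3)[THEN potential_borel] by measurable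
    show ?thesis unfolding mutual_energy_potential by (subst \<xi>_def) (rule nn_integral_sum_measure[OF m(1)], measurable)
  qed
  also have "\<dots> = (\<Sum>k. \<Sum>j. ennreal (en (\<mu> k) (\<mu> j)))"
  proof (rule suminf_cong)
    fix k
    note [measurable] = m(3)[THEN potential_borel]
    note [measurable_cong] = m(1)
    have "(\<integral>\<^sup>+x. potential \<alpha> \<xi> x \<partial>\<mu> k) = (\<Sum>j. \<integral>\<^sup>+x. potential \<alpha> (\<mu> j) x \<partial>\<mu> k)"
      unfolding \<xi>_def potential_sum_measure[OF m(1)] by (rule nn_integral_suminf) measurable
    then show "(\<integral>\<^sup>+x. potential \<alpha> \<xi> x \<partial>\<mu> k) = (\<Sum>j. ennreal (en (\<mu> k) (\<mu> j)))"
      by (simp add: ennreal_en[OF m(4) m(4), symmetric] mutual_energy_potential)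
  qed
  also have "\<dots> \<le> (\<Sum>k. \<Sum>j. ennreal ((1/2) ^ k) * ennreal ((1/2) ^ j))"
    by (intro suminf_le summableI allI) (use en2 in \<open>simp add: ennreal_mult[symmetric] ennreal_leI del: ennreal_power\<close>)
  also have "\<dots> = ennreal (\<Sum>k. (1/2) ^ k) * ennreal (\<Sum>k. (1/2) ^ k)" unfolding ennreal_suminf_cmult ennreal_suminf_multc g ..
  also have "\<dots> < \<infinity>" by (simp add: ennreal_mult_less_top)
  finally have E: "mutual_energy \<alpha> \<xi> \<xi> < \<infinity>" .
  have sp: "space \<xi> = UNIV" using sets_eq_imp_space_eq[OF s] by simp
  \<comment> \<open>A potential that is infinite everywhere would give a nonzero measure infinite
    energy.\<close>
  have "\<exists>x. potential \<alpha> \<xi> x < \<infinity>"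
  proof (rule ccontr)
    assume "\<not> ?thesis"
    then have "potential \<alpha> \<xi> x = \<infinity>" for x by (metis infinity_ennreal_def less_top)
    then have "mutual_energy \<alpha> \<xi> \<xi> = \<infinity> * emeasure \<xi> UNIV" by (simp add: mutual_energy_potential sp)
    moreover have "emeasure \<xi> UNIV \<noteq> 0" using emeasure_mono[of A1 UNIV \<xi>] mass s by auto
    ultimately show False using E by (simp add: ennreal_top_mult)
  qed
  then have radon: "radon_measure \<alpha> \<xi>"
    unfolding radon_measure_def using s compact_emeasure_finite_energy[OF s E] by simp
  have "emeasure \<xi> (- A1) = 0" using A1 m(5) by (simp add: emb)
  then have "\<xi> \<in> constraints \<alpha> A1"
    using radon E mass AE_in_iff[OF s A1] by (simp add: constraints_def finite_energy_pos_def carried_by_def)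
  then show thesis by (rule that[OF _ mass \<mu> en le])
qed

theorem infinite_constraint_not_solvable:
  assumes A: "closed (- D)" and q: "0 < q" "q < 1" and thin: "\<not> thin_at_infinity \<alpha> q (- D)"
    and A1: "A1 \<in> sets borel" and sub: "A1 \<subseteq> D" and cap: "inner_cap \<alpha> (A1 :: 'a set) = \<infinity>"
    and nn: "nonneg_signed \<zeta>" and fII: "field_case_II \<alpha> D \<zeta> f"
  shows "\<exists>\<xi> \<in> constraints \<alpha> A1. emeasure \<xi> A1 = \<infinity> \<and> min_weighted_energy \<alpha> A1 (- D) \<xi> f = 0 \<and> \<not> solvable \<alpha> A1 (- D) \<xi> f"
proof -
  note F = field_case_II_properties[OF A q thin fII]
  have Ab: "- D \<in> sets borel" using A by simp
  have dis: "A1 \<inter> - D = {}" using sub by auto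
  have f: "field_vanishing_on (- D) f" unfolding field_vanishing_on_def using F(1,2) by simp
  have "potential \<alpha> (snd \<zeta>) x = 0" for x
  proof -
    have "AE y in snd \<zeta>. riesz_kernel \<alpha> x y = 0" by (rule emeasure_0_AE) (use nn in \<open>simp add: nonneg_signed_def\<close>)
    then have "potential \<alpha> (snd \<zeta>) x = (\<integral>\<^sup>+y. 0 \<partial>snd \<zeta>)" unfolding potential_def by (rule nn_integral_cong_AE)
    then show ?thesis by simp
  qed
  \<comment> \<open>For \<zeta> >= 0 the bound on the negative part is an integral of the zero
    potential; this is the almost everywhere nonnegativity of the field.\<close>
  then have neg: "neg_part f \<gamma> = 0" if "energy_on UNIV \<gamma>" for \<gamma>
    using F(4)[OF that] by (simp add: mutual_energy_potential)
  let ?a = "fst \<zeta>"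
  obtain \<xi> \<mu> where \<xi>: "\<xi> \<in> constraints \<alpha> A1" "emeasure \<xi> A1 = \<infinity>"
    and \<mu>: "\<And>k. energy_on A1 (\<mu> k)" "\<And>k. emeasure (\<mu> k) UNIV = 1" "\<And>k. en (\<mu> k) (\<mu> k) \<le> ((1/2) ^ k)\<^sup>2"
    and le: "\<And>k B. B \<in> sets borel \<Longrightarrow> emeasure (\<mu> k) B \<le> emeasure \<xi> B"
    by (rule constraint_of_infinite_mass[OF A1 cap]) (rule that)
  note m = energy_onD[OF \<mu>(1)]
  have nonneg: "0 \<le> weighted_energy \<alpha> f \<gamma>" "en (fst \<gamma>) (fst \<gamma>) + en (snd \<gamma>) (snd \<gamma>) - 2 * en (fst \<gamma>) (snd \<gamma>) \<le> weighted_energy \<alpha> f \<gamma>"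
    if \<gamma>: "\<gamma> \<in> admissible \<alpha> A1 (- D) \<xi> f" for \<gamma>
  proof -
    note d = admissibleD[OF A1 Ab f \<gamma>]
    show 1: "en (fst \<gamma>) (fst \<gamma>) + en (snd \<gamma>) (snd \<gamma>) - 2 * en (fst \<gamma>) (snd \<gamma>) \<le> weighted_energy \<alpha> f \<gamma>"
      unfolding d(7) pair_energy_def neg[OF energy_on_UNIV[OF d(1)]] by simp
    show "0 \<le> weighted_energy \<alpha> f \<gamma>"
      using en_diff_nonneg[OF energy_onD(4)[OF d(1)] energy_onD(4)[OF d(5)]] 1 by (rule order_trans)
  qed
  have low: "0 \<le> min_weighted_energy \<alpha> A1 (- D) \<xi> f"
    unfolding min_weighted_energy_def by (rule INF_greatest) (simp add: nonneg)
  \<comment> \<open>The first term bounds the energy of \<open>\<mu> k\<close> minus its sweep, a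
    projection; the second is twice the field integral, estimated by Cauchy-Schwarz with
    \<zeta>.\<close>
  define e where "e k = ((1/2) ^ k)\<^sup>2 + 2 * ((1/2) ^ k * sqrt (en ?a ?a))" for k :: nat
  have up: "min_weighted_energy \<alpha> A1 (- D) \<xi> f \<le> ereal (e k)" for k
  proof -
    note \<mu>U = energy_on_UNIV[OF \<mu>(1)]
    obtain \<nu> where sw: "swept (- D) (\<mu> k) \<nu>" using swept_exists[OF A q thin \<mu>U] by metis
    have P: "pos_part f (\<mu> k) \<le> ennreal (en (\<mu> k) ?a)" using F(3)[OF \<mu>U, of k] by (simp add: ennreal_en[OF m(4) F(5)])
    have Pf: "pos_part f (\<mu> k) < \<infinity>" by (rule le_less_trans[OF P]) simp
    have mem: "(\<mu> k, \<nu>) \<in> admissible \<alpha> A1 (- D) \<xi> f"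
      by (rule admissibleI[OF A1 Ab dis f \<mu>(1,2) le Pf _ sweptD(1)[OF sw]]) (use neg[OF \<mu>U] sweptD(2)[OF sw] \<mu>(2) in auto)
    have "enn2real (pos_part f (\<mu> k)) \<le> en (\<mu> k) ?a" by (rule enn2real_leI[OF _ P]) simp
    also have "\<dots> \<le> (1/2) ^ k * sqrt (en ?a ?a)"
    proof -
      have "en (\<mu> k) ?a \<le> sqrt (en (\<mu> k) (\<mu> k) * en ?a ?a)" by (rule real_le_rsqrt[OF en_Cauchy_Schwarz[OF m(4) F(5)]])
      also have "\<dots> = sqrt (en (\<mu> k) (\<mu> k)) * sqrt (en ?a ?a)" by (rule real_sqrt_mult)
      also have "\<dots> \<le> (1/2) ^ k * sqrt (en ?a ?a)"
        by (intro mult_right_mono real_le_lsqrt \<mu>(3)) auto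
      finally show ?thesis .
    qed
    finally have "en (\<mu> k) (\<mu> k) + en \<nu> \<nu> - 2 * en (\<mu> k) \<nu> + 2 * enn2real (pos_part f (\<mu> k)) \<le> e k"
      using swept_minimal(2)[OF sw \<mu>U sweptD(1)[OF sw]] \<mu>(3)[of k] en_nonneg[of \<nu> \<nu>] unfolding e_def by linarith
    then have "weighted_energy \<alpha> f (\<mu> k, \<nu>) \<le> e k"
      unfolding admissibleD(7)[OF A1 Ab f mem] pair_energy_def fst_conv snd_conv neg[OF \<mu>U] by simp
    then show ?thesis unfolding min_weighted_energy_def by (intro INF_lower2[OF mem]) simp
  qed
  have "e \<longlonglongrightarrow> 0\<^sup>2 + 2 * (0 * sqrt (en ?a ?a))"
    unfolding e_def by (intro tendsto_intros LIMSEQ_power_zero) auto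
  then have "(\<lambda>k. ereal (e k)) \<longlonglongrightarrow> ereal 0" by (intro tendsto_ereal) simp
  then have "min_weighted_energy \<alpha> A1 (- D) \<xi> f \<le> ereal 0" by (rule LIMSEQ_le_const) (use up in blast)
  with low have min: "min_weighted_energy \<alpha> A1 (- D) \<xi> f = 0" by (simp add: zero_ereal_def antisym)
  have "\<not> solvable \<alpha> A1 (- D) \<xi> f"
  proof
    assume "solvable \<alpha> A1 (- D) \<xi> f"
    then obtain \<gamma> where \<gamma>: "\<gamma> \<in> admissible \<alpha> A1 (- D) \<xi> f" and w: "weighted_energy \<alpha> f \<gamma> = 0"
      by (auto simp: solvable_def min)
    note d = admissibleD[OF A1 Ab f \<gamma>]
    \<comment> \<open>Both the energy and the field integral are nonnegative, so the value 0 forces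
      the two components to coincide in energy, although they live on disjoint sets.\<close>
    have "heat_distance (fst \<gamma>) (snd \<gamma>) = 0"
      unfolding heat_distance_energy[OF energy_on_UNIV[OF d(1)] energy_on_UNIV[OF d(5)]]
      using nonneg(2)[OF \<gamma>] w by (simp add: ennreal_neg)
    moreover have "energy_on (- (- D)) (fst \<gamma>)" by (rule energy_on_subset[OF d(1) _ A1]) (use sub in simp)
    moreover have "- D \<noteq> {}" using thin by (auto simp: thin_at_infinity_def)
    ultimately show False using heat_distance_pos[OF A _ _ d(2,5,6)] by blast
  qed
  with \<xi> min show ?thesis by blast
qed

end

theorem theorem6p2:
  fixes \<alpha> q :: real and D A1 A2 :: "'a::euclidean_space set"
  assumes "3 \<le> DIM('a)" and "0 < \<alpha>" and "\<alpha> \<le> 2"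
    and "0 < q" and "q < 1"
    and "open D" and "connected D" and "D \<noteq> {}"
    and "closedin (top_of_set D) A1" and "0 < inner_cap \<alpha> A1"
    and "A2 = - D" and "0 < inner_cap \<alpha> A2"
    and "\<not> thin_at_infinity \<alpha> q A2"
  shows
    "(\<forall>f \<xi>. (field_case_I \<alpha> A2 f \<or> (\<exists>\<zeta>. field_case_II \<alpha> D \<zeta> f)) \<longrightarrow>
        \<xi> \<in> constraints \<alpha> A1 \<longrightarrow> admissible \<alpha> A1 A2 \<xi> f \<noteq> {} \<longrightarrow>
        emeasure \<xi> A1 < \<infinity> \<longrightarrow> solvable \<alpha> A1 A2 \<xi> f) \<and>
     (\<forall>f \<zeta>. inner_cap \<alpha> A1 = \<infinity> \<longrightarrow> nonneg_signed \<zeta> \<longrightarrow> field_case_II \<alpha> D \<zeta> f \<longrightarrow>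
        (\<exists>\<xi> \<in> constraints \<alpha> A1.
           emeasure \<xi> A1 = \<infinity> \<and>
           min_weighted_energy \<alpha> A1 A2 \<xi> f = 0 \<and>
           \<not> solvable \<alpha> A1 A2 \<xi> f))"
proof -
  have dim: "\<alpha> < real DIM('a)" using assms(1,3) by linarith
  obtain C where C: "0 < C" "\<And>x y :: 'a. riesz_kernel \<alpha> x y = (\<integral>\<^sup>+t. ennreal (gauss t (x - y)) \<partial>rtime C \<alpha>)"
    using riesz_kernel_mixture[OF assms(2) dim] by metis
  interpret riesz_space \<alpha> C "TYPE('a)" by unfold_locales (fact assms(1-3) C)+
  have A: "closed (- D)" using assms(6) by (simp add: closed_open)
  have thin: "\<not> thin_at_infinity \<alpha> q (- D)" using assms(11,13) by simp
  obtain T where "closed T" "A1 = D \<inter> T" using assms(9) by (auto simp: closedin_closed)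
  then have A1: "A1 \<in> sets borel" and sub: "A1 \<subseteq> D" using assms(6) by auto
  have solv: "solvable \<alpha> A1 A2 \<xi> f"
    if field: "field_case_I \<alpha> A2 f \<or> (\<exists>\<zeta>. field_case_II \<alpha> D \<zeta> f)" and \<xi>: "\<xi> \<in> constraints \<alpha> A1" "emeasure \<xi> A1 < \<infinity>"
      and ne: "admissible \<alpha> A1 A2 \<xi> f \<noteq> {}" for f \<xi>
  proof -
    have "field_vanishing_on (- D) f \<and> (energy_on UNIV \<xi> \<longrightarrow> neg_part f \<xi> < \<infinity>)"
      using field
    proof
      assume "field_case_I \<alpha> A2 f"
      then show ?thesis
        using field_case_I_properties[of "- D" f] A assms(11) by (simp add: field_vanishing_on_def)
    next
      assume "\<exists>\<zeta>. field_case_II \<alpha> D \<zeta> f"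
      then obtain \<zeta> where "field_case_II \<alpha> D \<zeta> f" by blast
      note F = field_case_II_properties[OF A assms(4,5) thin this]
      have "neg_part f \<xi> < \<infinity>" if "energy_on UNIV \<xi>"
        by (rule le_less_trans[OF F(4)[OF that] mutual_energy_finite[OF energy_onD(4)[OF that] F(6)]])
      then show ?thesis using F(1,2) by (simp add: field_vanishing_on_def)
    qed
    then show ?thesis
      using solvable_of_finite_constraint[OF A assms(4,5) thin A1 _ \<xi>, of f] sub ne assms(11) by auto
  qed
  show ?thesis
    using solv infinite_constraint_not_solvable[OF A assms(4,5) thin A1 sub] assms(11) by blast
qed

end
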